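(* Let $T\in(0,\infty)$, $d,m\in\mathbb{N}$, let $\mu\colon\mathbb{R}^d\to\mathbb{R}^d$ and $\sigma\colon\mathbb{R}^d\to\mathbb{R}^{d\times m}$ be locally Lipschitz continuous functions, let $(\Omega,\mathcal{F},\mathbb{P},(\mathcal{F}_t)_{t\in[0,T]})$ be a stochastic basis, let $W\colon[0,T]\times\Omega\to\mathbb{R}^m$ be a standard $(\mathcal{F}_t)_{t\in[0,T]}$-Brownian motion with continuous sample paths and let $X\colon[0,T]\times\Omega\to\mathbb{R}^d$ be an adapted stochastic process with continuous sample paths satisfying $X_t=X_0+\int_0^t\mu(X_s)\,ds+\int_0^t\sigma(X_s)\,dW_s$ $\mathbb{P}$-a.s. for all $t\in[0,T]$. Let $\rho\in[0,\infty)$, $U\in C^3(\mathbb{R}^d,[0,\infty))$ and $\bar U\in C(\mathbb{R}^d,\mathbb{R})$ satisfy $\mathbb{E}[e^{U(X_0)}]<\infty$, $\inf_{y\in\mathbb{R}^d}\bar U(y)>-\infty$ and $$U'(x)\mu(x)+\tfrac12\operatorname{tr}\big(\sigma(x)\sigma(x)^*(\operatorname{Hess}U)(x)\big)+\tfrac12\|\sigma(x)^*(\nabla U)(x)\|^2+\bar U(x)\le\rho\,U(x)$$ for all $x\in\mathbb{R}^d$. Let $Y^N\colon[0,T]\times\Omega\to\mathbb{R}^d$, $N\in\mathbb{N}$, be mappings satisfying $Y^N_0=X_0$ and $$Y^N_t=Y^N_{nT/N}+\mathbb{1}_{\{\|Y^N_{nT/N}\|\le\exp(|\ln(N/T)|^{1/2})\}}\left[\frac{\mu(Y^N_{nT/N})(t-\frac{nT}{N})+\sigma(Y^N_{nT/N})(W_t-W_{nT/N})}{1+\|\mu(Y^N_{nT/N})(t-\frac{nT}{N})+\sigma(Y^N_{nT/N})(W_t-W_{nT/N})\|^2}\right]$$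 for all $t\in(\frac{nT}{N},\frac{(n+1)T}{N}]$, $n\in\{0,1,\dots,N-1\}$, $N\in\mathbb{N}$. Let $p,c\in[1,\infty)$, let $\tau_N\colon\Omega\to[0,T]$, $N\in\mathbb{N}$, satisfy $\tau_N=\inf\big(\{t\in\{0,\frac TN,\frac{2T}N,\dots,T\}\colon\|Y^N_t\|>\exp(|\ln(N/T)|^{1/2})\}\cup\{T\}\big)$, and assume that for all $x,y\in\mathbb{R}^d$ and all $i\in\{1,2,3\}$: $\|\mu(x)\|+\|\sigma(x)\|_{\mathrm{HS}(\mathbb{R}^m,\mathbb{R}^d)}\le c(1+\|x\|^c)$, $|\bar U(x)-\bar U(y)|\le c(1+\|x\|^c+\|y\|^c)\|x-y\|$, $\|x\|^{1/c}\le c(1+U(x))$ and $\|U^{(i)}(x)\|_{L^{(i)}(\mathbb{R}^d,\mathbb{R})}\le c(1+U(x))^{\max(1-i/p,0)}$. Then for all $r\in(0,\infty)$ it holds that $\lim_{N\to\infty}\sup_{t\in[0,T]}\mathbb{E}[\|X_t-Y^N_t\|^r]=0$, and $$\limsup_{N\to\infty}\sup_{t\in[0,T]}\mathbb{E}\Big[\exp\Big(\tfrac{U(Y^N_t)}{e^{\rho t}}+\int_0^{t\wedge\tau_N}\tfrac{\bar U(Y^N_s)}{e^{\rho s}}\,ds\Big)\Big]\le\mathbb{E}\big[e^{U(X_0)}\big]<\infty$$ and $\sup_{N\in\mathbb{N}}\sup_{t\in[0,T]}\mathbb{E}\Big[\exp\Big(\tfrac{U(Y^N_t)}{e^{\rho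 t}}+\int_0^{t\wedge\tau_N}\tfrac{\bar U(Y^N_s)}{e^{\rho s}}\,ds\Big)\Big]<\infty$.
   Context: $U^{(i)}(x)$ denotes the $i$-th Fréchet derivative of $U$ at $x$, viewed as an $i$-linear map, with operator norm $\|\cdot\|_{L^{(i)}(\mathbb{R}^d,\mathbb{R})}$; $\|\cdot\|_{\mathrm{HS}(\mathbb{R}^m,\mathbb{R}^d)}$ is the Hilbert–Schmidt (Frobenius) norm; $A^*$ is the transpose; $\|\cdot\|$ is the Euclidean norm. *)

theory Defs
  imports "HOL-Probability.Probability"
begin

definition locally_lipschitz :: "('a::metric_space \<Rightarrow> 'b::metric_space) \<Rightarrow> bool" where
  "locally_lipschitz f \<longleftrightarrow> (\<forall>x. \<exists>e>0. \<exists>L. L-lipschitz_on (ball x e) f)"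

definition stochastic_basis :: "'a measure \<Rightarrow> (real \<Rightarrow> 'a measure) \<Rightarrow> real \<Rightarrow> bool" where
  "stochastic_basis M F T \<longleftrightarrow> prob_space M \<and>
     (\<forall>t\<in>{0..T}. space (F t) = space M \<and> sets (F t) \<subseteq> sets M) \<and>
     (\<forall>s t. 0 \<le> s \<and> s \<le> t \<and> t \<le> T \<longrightarrow> sets (F s) \<subseteq> sets (F t))"

definition std_brownian_motion ::
  "'a measure \<Rightarrow> (real \<Rightarrow> 'a measure) \<Rightarrow> real \<Rightarrow> (real \<Rightarrow> 'a \<Rightarrow> real^'m) \<Rightarrow> bool" where
  "std_brownian_motion M F T W \<longleftrightarrow>
     (\<forall>t\<in>{0..T}. W t \<in> borel_measurable (F t)) \<and>
     (\<forall>\<omega>\<in>space M. W 0 \<omega> = 0 \<and> continuous_on {0..T} (\<lambda>t. W t \<omega>)) \<and>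
     (\<forall>s t. 0 \<le> s \<and> s < t \<and> t \<le> T \<longrightarrow>
        prob_space.indep_set M (sets (F s))
          {(\<lambda>\<omega>. W t \<omega> - W s \<omega>) -` A \<inter> space M | A. A \<in> sets borel} \<and>
        prob_space.indep_vars M (\<lambda>_. borel) (\<lambda>i \<omega>. (W t \<omega> - W s \<omega>) $ i) UNIV \<and>
        (\<forall>i. distributed M lborel (\<lambda>\<omega>. (W t \<omega> - W s \<omega>) $ i)
               (\<lambda>x. ennreal (normal_density 0 (sqrt (t - s)) x))))"

text \<open>Convergence in probability (robust w.r.t. measurability: bad sets are covered by
  events of small probability).\<close>
definition conv_in_prob :: "'a measure \<Rightarrow> (nat \<Rightarrow> 'a \<Rightarrow> 'b::metric_space) \<Rightarrow> ('a \<Rightarrow> 'b) \<Rightarrow> bool" where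
  "conv_in_prob M S Z \<longleftrightarrow> (\<forall>\<epsilon>>0. \<forall>\<delta>>0. \<forall>\<^sub>F n in sequentially.
      \<exists>A\<in>sets M. {\<omega>\<in>space M. \<epsilon> < dist (S n \<omega>) (Z \<omega>)} \<subseteq> A \<and> measure M A < \<delta>)"

text \<open>The Ito integral of a continuous adapted integrand H (R^{d x m}-valued) against W over [0,t]:
  I is (a version of) it iff I is the limit in probability of the left-point Riemann sums over
  the uniform partitions of [0,t]. For continuous adapted integrands this coincides with the
  usual Ito integral.\<close>
definition is_ito_integral ::
  "'a measure \<Rightarrow> (real \<Rightarrow> 'a \<Rightarrow> real^'m) \<Rightarrow> (real \<Rightarrow> 'a \<Rightarrow> real^'m^'d) \<Rightarrow> real \<Rightarrow> ('a \<Rightarrow> real^'d) \<Rightarrow> bool" where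
  "is_ito_integral M W H t I \<longleftrightarrow>
     conv_in_prob M
       (\<lambda>n \<omega>. \<Sum>k<n. H (real k * t / real n) \<omega> *v
                  (W (real (Suc k) * t / real n) \<omega> - W (real k * t / real n) \<omega>)) I"

definition sde_solution ::
  "'a measure \<Rightarrow> (real \<Rightarrow> 'a measure) \<Rightarrow> real \<Rightarrow> (real^'d \<Rightarrow> real^'d) \<Rightarrow> (real^'d \<Rightarrow> real^'m^'d)
    \<Rightarrow> (real \<Rightarrow> 'a \<Rightarrow> real^'m) \<Rightarrow> (real \<Rightarrow> 'a \<Rightarrow> real^'d) \<Rightarrow> bool" where
  "sde_solution M F T \<mu> \<sigma> W X \<longleftrightarrow>
     (\<forall>t\<in>{0..T}. X t \<in> borel_measurable (F t)) \<and>
     (\<forall>\<omega>\<in>space M. continuous_on {0..T} (\<lambda>t. X t \<omega>)) \<and>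
     (\<forall>t\<in>{0..T}. is_ito_integral M W (\<lambda>s \<omega>. \<sigma> (X s \<omega>)) t
          (\<lambda>\<omega>. X t \<omega> - X 0 \<omega> - integral {0..t} (\<lambda>s. \<mu> (X s \<omega>))))"

definition grad_of :: "((real^'d) \<Rightarrow>\<^sub>L real) \<Rightarrow> real^'d" where
  "grad_of D = (\<chi> i. blinfun_apply D (axis i 1))"

definition hess_of :: "((real^'d) \<Rightarrow>\<^sub>L ((real^'d) \<Rightarrow>\<^sub>L real)) \<Rightarrow> real^'d^'d" where
  "hess_of D = (\<chi> i j. blinfun_apply (blinfun_apply D (axis i 1)) (axis j 1))"

end

theory Submission
  imports Defs
begin

text \<open>
  Within one step, Taylor expansion of \<open>U\<close> up to third order turns the exponent of the Lyapunov
  functional into a part linear in the Brownian increment, a part of the order of the step size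
  \<open>h = T/N\<close> and a remainder of order \<open>h\<^bsup>3/2\<^esup>\<close>. In the conditional expectation of the exponential, the
  square of the linear part produces exactly the term with the squared gradient, so that the
  Lyapunov inequality makes the contribution of order \<open>h\<close> nonpositive. The cutoff
  \<open>exp (sqrt \<bar>ln (N/T)\<bar>)\<close> grows more slowly than every power of \<open>N\<close>, so the constants of the expansion
  cost only an arbitrarily small power of \<open>N\<close>. Each step thus multiplies the expectation by at most
  \<open>1 + K h\<^bsup>5/4\<^esup>\<close>, and the product over all steps tends to \<open>1\<close>.

  These exponential moments and the associated maximal inequality bound all moments of the scheme
  and the probability that it leaves a large ball. On the event that both \<open>X\<close> and the scheme stay in such a ball, the coefficients are
  Lipschitz, and comparing the scheme with Riemann sums of the Ito integral through a discrete
  Gronwall inequality gives convergence in probability; the moment bounds pass to \<open>X\<close> and upgrade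
  this to convergence in every \<open>L\<^sup>r\<close>.
\<close>

section \<open>Analytic preliminaries\<close>

text \<open>The limit superior in the claim is bounded by the initial exponential moment with
  constant one. The expansion of a step must therefore keep the coefficients of order
  \<open>h\<close> exactly and may be generous only with the remainder, which has to be summable
  over \<open>N\<close> steps even after multiplication by a power of the cutoff. A second obstacle
  is that the stochastic integral is given only as a limit in probability of Riemann sums, so no
  isometry is available for the integral itself. The comparison is made with finite sums on a
  refinement of the Euler grid, where the isometry is elementary. These sums contain a solution
  whose moments are not known beforehand; hence errors are localised by events that are already
  decided at the beginning of each Euler step. Conditional expectations are avoided: an increment
  independent of \<open>F s\<close> is integrated out with the past frozen, and inequalities between
  conditional expectations are expressed by integrating against indicators of events in
  \<open>F s\<close>.\<close>

lemma norm_matrix_vector_mult_le: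
  fixes A :: "real^'m^'d"
  shows "norm (A *v x) \<le> norm A * norm x"
proof -
  have "norm (A *v x) = L2_set (\<lambda>i. \<bar>(A $ i) \<bullet> x\<bar>) UNIV"
    by (simp add: norm_vec_def matrix_vector_mult_def inner_vec_def)
  also have "\<dots> \<le> L2_set (\<lambda>i. norm (A $ i) * norm x) UNIV"
    by (rule L2_set_mono) (auto simp: Cauchy_Schwarz_ineq2)
  also have "\<dots> = norm A * norm x"
    by (simp add: L2_set_left_distrib norm_vec_def)
  finally show ?thesis .
qed

lemma bounded_bilinear_matrix_vector_mult:
  "bounded_bilinear ((*v) :: real^'m^'d \<Rightarrow> real^'m \<Rightarrow> real^'d)"
proof
  show "\<exists>K. \<forall>(a::real^'m^'d) b. norm (a *v b) \<le> norm a * norm b * K"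
    by (rule exI[of _ 1]) (simp add: norm_matrix_vector_mult_le)
qed (simp_all add: algebra_simps scaleR_matrix_vector_assoc matrix_vector_mult_scaleR)

lemma borel_measurable_matrix_vector_mult [measurable]:
  fixes A :: "'a \<Rightarrow> real^'m^'d"
  assumes [measurable]: "A \<in> borel_measurable N" "x \<in> borel_measurable N"
  shows "(\<lambda>\<omega>. A \<omega> *v x \<omega>) \<in> borel_measurable N"
proof (rule borel_measurable_continuous_Pair[where H = "(*v)"])
  show "continuous_on UNIV (\<lambda>x::(real^'m^'d) \<times> (real^'m). fst x *v snd x)"
    by (intro bounded_bilinear.continuous_on[OF bounded_bilinear_matrix_vector_mult] continuous_intros)
qed fact+

section \<open>Pathwise integrals as limits of Riemann sums\<close>

lemma integral_combine_uniform:
  fixes f :: "real \<Rightarrow> 'b::banach"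
  assumes "0 \<le> \<Delta>" "continuous_on {a..a + real n * \<Delta>} f"
  shows "integral {a..a + real n * \<Delta>} f = (\<Sum>k<n. integral {a + real k * \<Delta>..a + real (Suc k) * \<Delta>} f)"
  using assms(2)
proof (induction n)
  case 0
  then show ?case by simp
next
  case (Suc n)
  have le: "a \<le> a + real n * \<Delta>" "a + real n * \<Delta> \<le> a + real (Suc n) * \<Delta>"
    using assms(1) by (auto simp: algebra_simps)
  have "integral {a..a + real (Suc n) * \<Delta>} f
      = integral {a..a + real n * \<Delta>} f + integral {a + real n * \<Delta>..a + real (Suc n) * \<Delta>} f"
    by (rule Henstock_Kurzweil_Integration.integral_combine[symmetric, OF le])
      (rule integrable_continuous_real[OF Suc.prems])
  moreover have "continuous_on {a..a + real n * \<Delta>} f"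
    using Suc.prems le by (auto intro: continuous_on_subset)
  ultimately show ?case using Suc.IH by simp
qed

text \<open>Riemann sums are the common tool below: they carry measurability over to pathwise
  integrals, replace a Fubini argument, and approximate the drift integral of the SDE.\<close>

lemma riemann_sum_tendsto_integral:
  fixes f :: "real \<Rightarrow> 'b::banach"
  assumes ab: "a \<le> b" and cont: "continuous_on {a..b} f"
  shows "(\<lambda>n. ((b - a) / real n) *\<^sub>R (\<Sum>k<n. f (a + real k * ((b - a) / real n)))) \<longlonglongrightarrow> integral {a..b} f"
proof (rule LIMSEQ_I)
  fix r :: real assume r: "0 < r"
  \<comment> \<open>The summand \<open>+ 1\<close> in the denominator covers the degenerate interval
    \<open>a = b\<close>.\<close>
  define e where "e = r / (2 * (b - a + 1))"
  have e: "0 < e" using r ab by (simp add: e_def)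
  have "uniformly_continuous_on {a..b} f"
    using cont by (intro compact_uniformly_continuous) auto
  then obtain d where d: "d > 0" "\<And>x y. x \<in> {a..b} \<Longrightarrow> y \<in> {a..b} \<Longrightarrow> dist y x < d \<Longrightarrow> dist (f y) (f x) < e"
    using e unfolding uniformly_continuous_on_def by metis
  obtain n0 :: nat where n0: "(b - a) / d < real n0" using reals_Archimedean2 by blast
  have "norm (((b - a) / real n) *\<^sub>R (\<Sum>k<n. f (a + real k * ((b - a) / real n))) - integral {a..b} f) < r"
    if n: "n \<ge> Suc n0" for n
  proof -
    define D where "D = (b - a) / real n"
    have npos: "real n > 0" using n by simp
    have D0: "0 \<le> D" using ab by (simp add: D_def)
    have "(b - a) / d < real n" using n n0 by linarith
    then have Dd: "D < d" using d npos by (simp add: D_def field_simps)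
    have nD: "a + real n * D = b" using npos by (simp add: D_def)
    have c: "integral {a..b} f = (\<Sum>k<n. integral {a + real k * D..a + real (Suc k) * D} f)"
      using integral_combine_uniform[of D a n f] D0 cont nD by simp
    have "norm (D *\<^sub>R f (a + real k * D) - integral {a + real k * D..a + real (Suc k) * D} f) \<le> e * D"
      if k: "k < n" for k
    proof -
      let ?l = "a + real k * D" and ?u = "a + real (Suc k) * D"
      have l: "a \<le> ?l" using D0 by simp
      have lu: "?l \<le> ?u" using D0 by (simp add: algebra_simps)
      have "real (Suc k) * D \<le> real n * D" using k D0 by (intro mult_right_mono) auto
      then have u: "?u \<le> b" using nD by simp
      have ul: "?u - ?l = D" by (simp add: algebra_simps)
      have sub: "{?l..?u} \<subseteq> {a..b}" using l u by auto
      have cf: "continuous_on {?l..?u} f" using cont sub continuous_on_subset by blast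
      have "D *\<^sub>R f ?l - integral {?l..?u} f = integral {?l..?u} (\<lambda>s. f ?l - f s)"
        using integrable_continuous_real[OF cf] lu ul by (subst integral_diff) auto
      also have "norm \<dots> \<le> e * (?u - ?l)"
      proof (rule integral_bound[OF lu])
        show "continuous_on {?l..?u} (\<lambda>s. f ?l - f s)" using cf by (intro continuous_intros)
        fix t assume t: "t \<in> {?l..?u}"
        have "dist ?l t < d" using t ul Dd by (auto simp: dist_real_def)
        moreover have "t \<in> {a..b}" "?l \<in> {a..b}" using t sub l u lu by auto
        ultimately have "dist (f ?l) (f t) < e" using d(2) by blast
        then show "norm (f ?l - f t) \<le> e" by (simp add: dist_norm)
      qed
      finally show ?thesis using ul by simp
    qed
    then have "norm (D *\<^sub>R (\<Sum>k<n. f (a + real k * D)) - integral {a..b} f) \<le> (\<Sum>k<n. e * D)"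
      unfolding c scaleR_sum_right sum_subtractf[symmetric] by (intro order_trans[OF norm_sum] sum_mono) auto
    also have "\<dots> = e * (real n * D)" by simp
    also have "\<dots> = e * (b - a)" using nD by (metis add_diff_cancel_left')
    also have "\<dots> < r"
    proof -
      have "e * (b - a) \<le> e * (b - a + 1)" using e by simp
      also have "\<dots> = r / 2" using ab by (simp add: e_def field_simps)
      finally show ?thesis using r by simp
    qed
    finally show ?thesis by (simp add: D_def)
  qed
  then show "\<exists>no. \<forall>n\<ge>no. norm (((b - a) / real n) *\<^sub>R (\<Sum>k<n. f (a + real k * ((b - a) / real n))) - integral {a..b} f) < r"
    by blast
qed

lemma riemann_point_in_interval:
  fixes a b :: real
  assumes "a \<le> b" "k < n"
  shows "a + real k * ((b - a) / real n) \<in> {a..b}"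
proof -
  have "real k * ((b - a) / real n) \<le> real n * ((b - a) / real n)"
    using assms by (intro mult_right_mono) auto
  then show ?thesis using assms by auto
qed

text \<open>As a limit of Riemann sums the integral inherits measurability from the single times,
  without joint measurability in time and \<omega>. Taking a member of the filtration for
  \<open>N\<close> makes integrals of adapted continuous processes measurable at the right
  endpoint.\<close>

lemma borel_measurable_integral_continuous:
  fixes f :: "real \<Rightarrow> 'a \<Rightarrow> 'b::{banach, second_countable_topology}"
  assumes ab: "a \<le> b"
    and meas: "\<And>s. s \<in> {a..b} \<Longrightarrow> f s \<in> borel_measurable N"
    and cont: "\<And>\<omega>. \<omega> \<in> space N \<Longrightarrow> continuous_on {a..b} (\<lambda>s. f s \<omega>)"
  shows "(\<lambda>\<omega>. integral {a..b} (\<lambda>s. f s \<omega>)) \<in> borel_measurable N"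
proof (rule borel_measurable_LIMSEQ_metric)
  show "(\<lambda>\<omega>. ((b - a) / real n) *\<^sub>R (\<Sum>k<n. f (a + real k * ((b - a) / real n)) \<omega>)) \<in> borel_measurable N" for n
    using meas riemann_point_in_interval[OF ab]
    by (intro borel_measurable_scaleR borel_measurable_const borel_measurable_sum) auto
qed (use riemann_sum_tendsto_integral[OF ab cont] in simp)

text \<open>A substitute for Tonelli's theorem with a weight \<open>g\<close>: Riemann sums satisfy
  the bound term by term, and Fatou's lemma passes to the limit.\<close>

lemma nn_integral_integral_le:
  fixes f :: "real \<Rightarrow> 'a \<Rightarrow> real"
  assumes ab: "a \<le> b"
    and meas: "\<And>s. s \<in> {a..b} \<Longrightarrow> f s \<in> borel_measurable N"
    and cont: "\<And>\<omega>. \<omega> \<in> space N \<Longrightarrow> continuous_on {a..b} (\<lambda>s. f s \<omega>)"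
    and nonneg: "\<And>s \<omega>. s \<in> {a..b} \<Longrightarrow> \<omega> \<in> space N \<Longrightarrow> 0 \<le> f s \<omega>"
    and g: "g \<in> borel_measurable N"
    and bound: "\<And>s. s \<in> {a..b} \<Longrightarrow> (\<integral>\<^sup>+\<omega>. ennreal (g \<omega>) * ennreal (f s \<omega>) \<partial>N) \<le> C"
  shows "(\<integral>\<^sup>+\<omega>. ennreal (g \<omega>) * ennreal (integral {a..b} (\<lambda>s. f s \<omega>)) \<partial>N) \<le> ennreal (b - a) * C"
proof -
  let ?x = "\<lambda>n k. a + real k * ((b - a) / real n)"
  let ?S = "\<lambda>n \<omega>. ((b - a) / real n) *\<^sub>R (\<Sum>k<n. f (?x n k) \<omega>)"
  have pt: "?x n k \<in> {a..b}" if "k < n" for n k using riemann_point_in_interval[OF ab that] .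
  note [measurable] = g
  have mS[measurable]: "?S n \<in> borel_measurable N" for n
    using meas pt by (intro borel_measurable_scaleR borel_measurable_const borel_measurable_sum) auto
  have lim: "(\<lambda>n. ennreal (?S n \<omega>)) \<longlonglongrightarrow> ennreal (integral {a..b} (\<lambda>s. f s \<omega>))" if "\<omega> \<in> space N" for \<omega>
    using riemann_sum_tendsto_integral[OF ab cont[OF that]] by (rule tendsto_ennrealI)
  have le: "(\<integral>\<^sup>+\<omega>. ennreal (g \<omega>) * ennreal (?S n \<omega>) \<partial>N) \<le> ennreal (b - a) * C" for n
  proof -
    have nn: "0 \<le> f (?x n k) \<omega>" if "k < n" "\<omega> \<in> space N" for k \<omega> using nonneg pt that by blast
    have "(\<integral>\<^sup>+\<omega>. ennreal (g \<omega>) * ennreal (?S n \<omega>) \<partial>N)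
        = (\<integral>\<^sup>+\<omega>. (\<Sum>k<n. ennreal ((b - a) / real n) * (ennreal (g \<omega>) * ennreal (f (?x n k) \<omega>))) \<partial>N)"
    proof (rule nn_integral_cong)
      fix \<omega> assume "\<omega> \<in> space N"
      then have "ennreal (?S n \<omega>) = ennreal ((b - a) / real n) * (\<Sum>k<n. ennreal (f (?x n k) \<omega>))"
        using ab sum_ennreal[of "{..<n}" "\<lambda>k. f (?x n k) \<omega>"] nn unfolding real_scaleR_def
        by (subst ennreal_mult') (simp_all del: times_divide_eq_right)
      then show "ennreal (g \<omega>) * ennreal (?S n \<omega>) = (\<Sum>k<n. ennreal ((b - a) / real n) * (ennreal (g \<omega>) * ennreal (f (?x n k) \<omega>)))"
        by (simp add: sum_distrib_left ac_simps)
    qed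
    also have "\<dots> = (\<Sum>k<n. ennreal ((b - a) / real n) * (\<integral>\<^sup>+\<omega>. ennreal (g \<omega>) * ennreal (f (?x n k) \<omega>) \<partial>N))"
      using meas pt by (subst nn_integral_sum) (auto intro!: sum.cong nn_integral_cmult)
    also have "\<dots> \<le> (\<Sum>k<n. ennreal ((b - a) / real n) * C)"
      using bound pt by (intro sum_mono mult_left_mono) auto
    also have "\<dots> = ennreal (real n * ((b - a) / real n)) * C"
      using ab by (subst ennreal_mult') (auto simp: ac_simps ennreal_of_nat_eq_real_of_nat)
    also have "\<dots> \<le> ennreal (b - a) * C"
      using ab by (intro mult_right_mono ennreal_leI) auto
    finally show ?thesis .
  qed
  have "(\<integral>\<^sup>+\<omega>. ennreal (g \<omega>) * ennreal (integral {a..b} (\<lambda>s. f s \<omega>)) \<partial>N) \<le> (\<integral>\<^sup>+\<omega>. liminf (\<lambda>n. ennreal (g \<omega>) * ennreal (?S n \<omega>)) \<partial>N)"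
  proof (rule nn_integral_mono)
    fix \<omega> assume w: "\<omega> \<in> space N"
    have "(\<lambda>n. ennreal (g \<omega>) * ennreal (?S n \<omega>)) \<longlonglongrightarrow> ennreal (g \<omega>) * ennreal (integral {a..b} (\<lambda>s. f s \<omega>))"
      using lim[OF w] by (intro ennreal_tendsto_cmult) auto
    from lim_imp_Liminf[OF _ this]
    show "ennreal (g \<omega>) * ennreal (integral {a..b} (\<lambda>s. f s \<omega>)) \<le> liminf (\<lambda>n. ennreal (g \<omega>) * ennreal (?S n \<omega>))" by simp
  qed
  also have "\<dots> \<le> liminf (\<lambda>n. \<integral>\<^sup>+\<omega>. ennreal (g \<omega>) * ennreal (?S n \<omega>) \<partial>N)"
    by (rule nn_integral_liminf) (rule borel_measurable_times_ennreal[OF measurable_compose[OF g measurable_ennreal] measurable_compose[OF mS measurable_ennreal]])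
  also have "\<dots> \<le> liminf (\<lambda>n. ennreal (b - a) * C)"
    using le by (intro Liminf_mono) auto
  finally show ?thesis by (simp add: Liminf_const)
qed


section \<open>Lipschitz and growth estimates\<close>

text \<open>A dummy time parameter brings the notion into the form used for differential equations,
  where local Lipschitz continuity is known to become global on compact sets.\<close>

lemma locally_lipschitz_imp_local_lipschitz:
  fixes f :: "'a::metric_space \<Rightarrow> 'b::metric_space"
  assumes "locally_lipschitz f"
  shows "local_lipschitz (UNIV :: real set) UNIV (\<lambda>t. f)"
proof (rule local_lipschitzI)
  fix t :: real and x :: 'a
  obtain e L where e: "e > 0" "L-lipschitz_on (ball x e) f"
    using assms unfolding locally_lipschitz_def by blast
  then have "L-lipschitz_on (cball x (e/2) \<inter> UNIV) f" by (auto intro: lipschitz_on_subset)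
  then show "\<exists>u>0. \<exists>L. \<forall>t\<in>cball t u \<inter> UNIV. L-lipschitz_on (cball x u \<inter> UNIV) f"
    using e by (intro exI[of _ "e/2"]) auto
qed

lemma locally_lipschitz_continuous_on:
  assumes "locally_lipschitz f"
  shows "continuous_on UNIV f"
  using local_lipschitz_continuous_on[OF locally_lipschitz_imp_local_lipschitz[OF assms], of 0] by simp

lemma locally_lipschitz_on_compact:
  fixes f :: "'a::metric_space \<Rightarrow> 'b::metric_space"
  assumes "locally_lipschitz f" "compact K"
  obtains L where "L-lipschitz_on K f"
proof -
  have "local_lipschitz {0::real} K (\<lambda>t. f)"
    using locally_lipschitz_imp_local_lipschitz[OF assms(1)] by (rule local_lipschitz_subset) auto
  then obtain L where "\<And>t. t \<in> {0::real} \<Longrightarrow> L-lipschitz_on K f"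
    using local_lipschitz_compact_implies_lipschitz[of "{0::real}" K "\<lambda>t. f"] assms(2) by auto
  then show thesis using that by auto
qed

lemma discrete_gronwall:
  fixes e :: "nat \<Rightarrow> real"
  assumes "0 \<le> a" "0 \<le> b"
    and "\<And>j. j \<le> n \<Longrightarrow> e j \<le> a + b * (\<Sum>k<j. e k)"
    and "j \<le> n"
  shows "e j \<le> a * exp (b * real j)"
proof -
  \<comment> \<open>The induction runs over the majorant rather than over \<open>e j\<close> itself,
    because the majorant grows by a factor of at most \<open>1 + b\<close> per index.\<close>
  have *: "a + b * (\<Sum>k<j. e k) \<le> a * (1 + b) ^ j" if "j \<le> n" for j
    using that
  proof (induction j)
    case (Suc j)
    have "a + b * (\<Sum>k<Suc j. e k) = (a + b * (\<Sum>k<j. e k)) + b * e j" by (simp add: algebra_simps)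
    also have "\<dots> \<le> (1 + b) * (a + b * (\<Sum>k<j. e k))"
      using mult_left_mono[OF assms(3)[of j] assms(2)] Suc.prems by (simp add: algebra_simps)
    also have "\<dots> \<le> (1 + b) * (a * (1 + b) ^ j)"
      using Suc assms by (intro mult_left_mono) auto
    finally show ?case by (simp add: mult_ac)
  qed simp
  have "(1 + b) ^ j \<le> exp b ^ j" using assms(2) by (intro power_mono) auto
  also have "\<dots> = exp (b * real j)" by (simp add: exp_of_nat_mult[symmetric] mult.commute)
  finally show ?thesis
    using *[OF assms(4)] assms(3)[OF assms(4)] assms(1) by (meson mult_left_mono order_trans)
qed

text \<open>With \<open>s = sqrt \<bar>ln h\<bar>\<close> the left side is the exponential of
  \<open>a * s + \<epsilon> * ln h\<close>. Young's inequality bounds \<open>a * s\<close> by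
  \<open>a\<^sup>2 / (4 * \<epsilon>) + \<epsilon> * s\<^sup>2\<close>; the last term cancels
  against \<open>\<epsilon> * ln h\<close> when \<open>h\<close> is at most 1, and otherwise costs a
  power of \<open>T\<close>. This is how a small power of \<open>h\<close> pays for any power of the
  cutoff.\<close>

lemma exp_sqrt_abs_ln_powr_le:
  fixes a \<epsilon> h T :: real
  assumes "0 < \<epsilon>" "0 < h" "h \<le> T" "1 \<le> T"
  shows "exp (sqrt \<bar>ln h\<bar>) powr a * h powr \<epsilon> \<le> exp (a\<^sup>2 / (4 * \<epsilon>)) * T powr (2 * \<epsilon>)"
proof -
  define s where "s = sqrt \<bar>ln h\<bar>"
  have s2: "s\<^sup>2 = \<bar>ln h\<bar>" by (simp add: s_def)
  have "0 \<le> (a - 2 * \<epsilon> * s)\<^sup>2" by simp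
  then have "a * s \<le> a\<^sup>2 / (4 * \<epsilon>) + \<epsilon> * s\<^sup>2"
    using assms by (simp add: field_simps power2_eq_square)
  moreover have "\<bar>ln h\<bar> + ln h \<le> 2 * ln T" using assms ln_mono[of h T] ln_ge_zero[of T] by linarith
  then have "\<epsilon> * \<bar>ln h\<bar> + \<epsilon> * ln h \<le> 2 * \<epsilon> * ln T"
    using mult_left_mono[of "\<bar>ln h\<bar> + ln h" "2 * ln T" \<epsilon>] assms by (simp add: algebra_simps)
  ultimately have "a * s + \<epsilon> * ln h \<le> a\<^sup>2 / (4 * \<epsilon>) + 2 * \<epsilon> * ln T" using s2 by simp
  then have "exp (a * s + \<epsilon> * ln h) \<le> exp (a\<^sup>2 / (4 * \<epsilon>) + 2 * \<epsilon> * ln T)" by simp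
  then show ?thesis using assms by (simp add: powr_def exp_add s_def mult_ac)
qed

text \<open>The bound on the gradient says that \<open>(1 + U)\<^bsup>1/p\<^esup>\<close> is Lipschitz continuous.\<close>

lemma polynomial_growth_of_gradient_bound:
  fixes U :: "'a::real_normed_vector \<Rightarrow> real" and U1 :: "'a \<Rightarrow> ('a \<Rightarrow>\<^sub>L real)"
  assumes U0: "\<And>x. 0 \<le> U x"
    and der: "\<And>x. (U has_derivative blinfun_apply (U1 x)) (at x)"
    and p: "1 \<le> p" and c: "0 \<le> c"
    and bd: "\<And>x. norm (U1 x) \<le> c * (1 + U x) powr (1 - 1 / p)"
  shows "1 + U x \<le> ((1 + U 0) powr (1 / p) + c * norm x) powr p"
proof -
  define V where "V = (\<lambda>x. (1 + U x) powr (1 / p))"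
  have pos: "0 < 1 + U x" for x using U0[of x] by linarith
  have V': "(V has_derivative (\<lambda>v. (1 / p) * (1 + U x) powr (1 / p - 1) * blinfun_apply (U1 x) v)) (at x)" for x
  proof -
    have "((\<lambda>x. 1 + U x) has_derivative blinfun_apply (U1 x)) (at x)"
      using has_derivative_add[OF has_derivative_const[of 1] der[of x]] by simp
    from has_derivative_powr[OF this has_derivative_const[of "1/p"] pos]
    show ?thesis unfolding V_def
      by (rule has_derivative_eq_rhs) (use pos[of x] in \<open>auto simp: fun_eq_iff powr_diff field_simps\<close>)
  qed
  have "onorm (\<lambda>v. (1 / p) * (1 + U y) powr (1 / p - 1) * blinfun_apply (U1 y) v) \<le> c" for y
  proof (rule onorm_bound[OF c])
    fix v
    have "norm ((1 / p) * (1 + U y) powr (1 / p - 1) * blinfun_apply (U1 y) v)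
        \<le> (1 / p) * (1 + U y) powr (1 / p - 1) * (c * (1 + U y) powr (1 - 1 / p) * norm v)"
      using p norm_blinfun[of "U1 y" v] mult_right_mono[OF bd[of y], of "norm v"]
      by (auto simp: abs_mult intro!: mult_left_mono divide_right_mono)
    also have "\<dots> = (1 / p) * (c * norm v)"
      using pos[of y] powr_add[of "1 + U y" "1/p - 1" "1 - 1/p"] by (simp add: mult_ac)
    also have "\<dots> \<le> 1 * (c * norm v)" using p c by (intro mult_right_mono) auto
    finally show "norm ((1 / p) * (1 + U y) powr (1 / p - 1) * blinfun_apply (U1 y) v) \<le> c * norm v" by simp
  qed
  then have "norm (V x - V 0) \<le> c * norm (x - 0)"
    by (intro differentiable_bound[of UNIV V]) (auto intro: V')
  then have "V x \<le> V 0 + c * norm x" by simp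
  then have "V x powr p \<le> (V 0 + c * norm x) powr p" using p by (intro powr_mono2) (auto simp: V_def)
  moreover have "V x powr p = 1 + U x" using p pos[of x] by (simp add: V_def powr_powr)
  ultimately show ?thesis by (simp add: V_def)
qed

section \<open>Gaussian and exponential estimates\<close>

text \<open>Completing the square: the factor \<open>exp (l * x)\<close> shifts the mean of the
  normal density to \<open>l * \<sigma>\<^sup>2\<close> and leaves a constant in front.\<close>

lemma nn_integral_normal_exp:
  assumes s: "0 < \<sigma>"
  shows "(\<integral>\<^sup>+x. ennreal (normal_density 0 \<sigma> x) * ennreal (exp (l * x)) \<partial>lborel) = ennreal (exp (l\<^sup>2 * \<sigma>\<^sup>2 / 2))"
proof -
  have eq: "normal_density 0 \<sigma> x * exp (l * x) = exp (l\<^sup>2 * \<sigma>\<^sup>2 / 2) * normal_density (l * \<sigma>\<^sup>2) \<sigma> x" for x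
  proof -
    have "- x\<^sup>2 / (2 * \<sigma>\<^sup>2) + l * x = l\<^sup>2 * \<sigma>\<^sup>2 / 2 + (- (x - l * \<sigma>\<^sup>2)\<^sup>2 / (2 * \<sigma>\<^sup>2))"
      using s by (simp add: field_simps power2_eq_square)
    then have "exp (- x\<^sup>2 / (2 * \<sigma>\<^sup>2)) * exp (l * x) = exp (l\<^sup>2 * \<sigma>\<^sup>2 / 2) * exp (- (x - l * \<sigma>\<^sup>2)\<^sup>2 / (2 * \<sigma>\<^sup>2))"
      by (simp only: exp_add[symmetric])
    then show ?thesis unfolding normal_density_def by simp
  qed
  have "(\<integral>\<^sup>+x. ennreal (normal_density 0 \<sigma> x) * ennreal (exp (l * x)) \<partial>lborel)
      = (\<integral>\<^sup>+x. ennreal (exp (l\<^sup>2 * \<sigma>\<^sup>2 / 2)) * ennreal (normal_density (l * \<sigma>\<^sup>2) \<sigma> x) \<partial>lborel)"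
    by (simp add: ennreal_mult[symmetric] eq)
  also have "\<dots> = ennreal (exp (l\<^sup>2 * \<sigma>\<^sup>2 / 2))"
    using s by (simp add: nn_integral_cmult nn_integral_eq_integral)
  finally show ?thesis .
qed

text \<open>One term of the exponential series is at most the whole series. This trades powers for
  exponentials in the moment bounds.\<close>

lemma power_le_fact_exp:
  fixes x :: real
  assumes "0 \<le> x"
  shows "x ^ k \<le> fact k * exp x"
proof -
  have "(\<Sum>n\<in>{k}. inverse (fact n) * x ^ n) \<le> (\<Sum>n. inverse (fact n) * x ^ n)"
    using assms by (intro sum_le_suminf summable_exp) auto
  then have "inverse (fact k) * x ^ k \<le> exp x" by (simp add: exp_def scaleR_conv_of_real divide_inverse mult.commute)
  then show ?thesis by (simp add: field_simps)
qed

text \<open>The largest coordinate controls the norm. This reduces exponential moments of the norm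
  of an increment to those of its one-dimensional Gaussian coordinates.\<close>

lemma norm_le_card_mult_component:
  fixes z :: "real^'m"
  obtains i where "norm z \<le> real CARD('m) * \<bar>z $ i\<bar>"
proof -
  obtain i where "\<bar>z $ i\<bar> = Max (range (\<lambda>j. \<bar>z $ j\<bar>))"
    using Max_in[of "range (\<lambda>j. \<bar>z $ j\<bar>)"] by (metis finite_class.finite_UNIV finite_imageI imageE image_is_empty UNIV_not_empty)
  then have "\<bar>z $ j\<bar> \<le> \<bar>z $ i\<bar>" for j by simp
  then have "(\<Sum>j\<in>UNIV. \<bar>z $ j\<bar>) \<le> (\<Sum>j\<in>(UNIV::'m set). \<bar>z $ i\<bar>)" by (intro sum_mono) auto
  then show thesis using that[of i] norm_le_l1_cart[of z] by simp
qed

section \<open>Brownian increments\<close>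

locale filtered_brownian_motion = prob_space M for M :: "'a measure" +
  fixes F :: "real \<Rightarrow> 'a measure" and T :: real and W :: "real \<Rightarrow> 'a \<Rightarrow> real^'m"
  assumes basis: "stochastic_basis M F T"
    and BM: "std_brownian_motion M F T W"
begin

lemma space_F: "t \<in> {0..T} \<Longrightarrow> space (F t) = space M"
  using basis by (auto simp: stochastic_basis_def)

lemma sets_F_subset: "t \<in> {0..T} \<Longrightarrow> sets (F t) \<subseteq> sets M"
  using basis by (auto simp: stochastic_basis_def)

lemma sets_F_mono: "0 \<le> s \<Longrightarrow> s \<le> t \<Longrightarrow> t \<le> T \<Longrightarrow> sets (F s) \<subseteq> sets (F t)"
  using basis by (auto simp: stochastic_basis_def)

lemma measurable_F_mono:
  assumes "0 \<le> s" "s \<le> t" "t \<le> T" "f \<in> measurable (F s) N"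
  shows "f \<in> measurable (F t) N"
  using assms sets_F_mono[of s t] space_F[of s] space_F[of t] by (auto simp: measurable_def)

lemma measurable_F_M:
  assumes "t \<in> {0..T}" "f \<in> measurable (F t) N"
  shows "f \<in> measurable M N"
  using assms sets_F_subset[of t] space_F[of t] by (auto simp: measurable_def)

lemma W_measurable_F: "t \<in> {0..T} \<Longrightarrow> W t \<in> borel_measurable (F t)"
  using BM by (auto simp: std_brownian_motion_def)

lemma W_continuous: "\<omega> \<in> space M \<Longrightarrow> continuous_on {0..T} (\<lambda>t. W t \<omega>)"
  using BM by (auto simp: std_brownian_motion_def)

abbreviation incr :: "real \<Rightarrow> real \<Rightarrow> 'a \<Rightarrow> real^'m" where
  "incr s t \<omega> \<equiv> W t \<omega> - W s \<omega>"

lemma incr_measurable_F: "0 \<le> s \<Longrightarrow> s \<le> t \<Longrightarrow> t \<le> T \<Longrightarrow> incr s t \<in> borel_measurable (F t)"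
  using W_measurable_F[of t] measurable_F_mono[of s t "W s" borel] W_measurable_F[of s]
  by (intro borel_measurable_diff) auto

lemma incr_measurable: "0 \<le> s \<Longrightarrow> s \<le> t \<Longrightarrow> t \<le> T \<Longrightarrow> incr s t \<in> borel_measurable M"
  using incr_measurable_F[of s t] by (intro measurable_F_M[of t]) auto

section \<open>Independence of increments from the past\<close>

lemma prob_Int_incr:
  assumes "0 \<le> s" "s < t" "t \<le> T" "A \<in> sets (F s)" "B \<in> sets borel"
  shows "prob (A \<inter> (incr s t -` B \<inter> space M)) = prob A * prob (incr s t -` B \<inter> space M)"
proof -
  have "indep_set (sets (F s)) {incr s t -` A \<inter> space M | A. A \<in> sets borel}"
    using BM assms by (auto simp: std_brownian_motion_def)
  then show ?thesis using assms(4,5) unfolding indep_sets2_eq by blast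
qed

lemma indep_var_incr:
  fixes f :: "'a \<Rightarrow> real" and g :: "real^'m \<Rightarrow> real"
  assumes st: "0 \<le> s" "s < t" "t \<le> T"
    and f: "f \<in> borel_measurable (F s)" and g: "g \<in> borel_measurable borel"
  shows "indep_var borel f borel (\<lambda>\<omega>. g (incr s t \<omega>))"
proof -
  have s: "s \<in> {0..T}" using st by auto
  have Z: "incr s t \<in> borel_measurable M" using st by (intro incr_measurable) auto
  have fM: "f \<in> borel_measurable M" using measurable_F_M[OF s f] .
  have gM: "(\<lambda>\<omega>. g (incr s t \<omega>)) \<in> borel_measurable M" using measurable_compose[OF Z g] .
  \<comment> \<open>Independence of random variables is formulated with generated sigma-algebras;
    stability under intersection allows it to be checked on the preimages alone.\<close>
  have stable: "Int_stable {h -` A \<inter> space M | A. A \<in> sets borel}" for h :: "'a \<Rightarrow> real"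
  proof (safe intro!: Int_stableI)
    fix A B :: "real set" assume "A \<in> sets borel" "B \<in> sets borel"
    then show "\<exists>C. (h -` A \<inter> space M) \<inter> (h -` B \<inter> space M) = h -` C \<inter> space M \<and> C \<in> sets borel"
      by (intro exI[of _ "A \<inter> B"]) auto
  qed
  have "indep_set {f -` A \<inter> space M | A. A \<in> sets borel} {(\<lambda>\<omega>. g (incr s t \<omega>)) -` A \<inter> space M | A. A \<in> sets borel}"
    unfolding indep_sets2_eq
  proof (intro conjI ballI)
    fix a b assume "a \<in> {f -` A \<inter> space M | A. A \<in> sets borel}" "b \<in> {(\<lambda>\<omega>. g (incr s t \<omega>)) -` A \<inter> space M | A. A \<in> sets borel}"
    then obtain A B where AB: "a = f -` A \<inter> space M" "A \<in> sets borel" "b = (\<lambda>\<omega>. g (incr s t \<omega>)) -` B \<inter> space M" "B \<in> sets borel"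
      by auto
    have "a \<in> sets (F s)" using measurable_sets[OF f AB(2)] AB(1) space_F[OF s] by simp
    moreover have "g -` B \<in> sets borel" using measurable_sets[OF g AB(4)] by simp
    moreover have "b = incr s t -` (g -` B) \<inter> space M" using AB by auto
    ultimately show "prob (a \<inter> b) = prob a * prob b" using prob_Int_incr[OF st, of a "g -` B"] by simp
  qed (use fM gM in \<open>auto intro: measurable_sets\<close>)
  then show ?thesis
    unfolding indep_var_eq using indep_set_sigma_sets[OF _ stable stable] fM gM by blast
qed

text \<open>Independence makes the joint law of \<omega>, seen through \<open>F s\<close>, and of
  the increment a product measure, so the increment can be replaced by an independent copy while the
  past stays fixed. This takes the place of conditional expectation given
  \<open>F s\<close>.\<close>

lemma nn_integral_freeze:
  assumes st: "0 \<le> s" "s < t" "t \<le> T"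
    and f: "f \<in> borel_measurable (F s \<Otimes>\<^sub>M borel)"
  shows "(\<integral>\<^sup>+\<omega>. f (\<omega>, incr s t \<omega>) \<partial>M) = (\<integral>\<^sup>+\<omega>. \<integral>\<^sup>+\<omega>'. f (\<omega>, incr s t \<omega>') \<partial>M \<partial>M)"
proof -
  have s: "s \<in> {0..T}" using st by auto
  \<comment> \<open>\<open>?S\<close> is \<open>M\<close> restricted to the sigma-algebra
    \<open>F s\<close>, obtained by transporting \<open>M\<close> along the identity; the point
    \<omega> itself thus acts as the random variable that carries the past.\<close>
  let ?S = "distr M (F s) (\<lambda>\<omega>. \<omega>)" and ?D = "distr M borel (incr s t)"
  let ?J = "distr M (F s \<Otimes>\<^sub>M borel) (\<lambda>\<omega>. (\<omega>, incr s t \<omega>))"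
  have X[measurable]: "(\<lambda>\<omega>. \<omega>) \<in> measurable M (F s)" using measurable_F_M[OF s measurable_ident] by (simp add: id_def)
  have Z[measurable]: "incr s t \<in> borel_measurable M" using st by (intro incr_measurable) auto
  have XZ[measurable]: "(\<lambda>\<omega>. (\<omega>, incr s t \<omega>)) \<in> measurable M (F s \<Otimes>\<^sub>M borel)" by measurable
  note [measurable] = f
  interpret S: prob_space ?S by (rule prob_space_distr) (rule X)
  interpret D: prob_space ?D by (rule prob_space_distr) (rule Z)
  have sec: "(\<lambda>z. f (\<omega>, z)) \<in> borel_measurable borel" if "\<omega> \<in> space M" for \<omega>
    using that space_F[OF s] f by (intro measurable_Pair2[of f "F s"]) auto
  have prod: "?S \<Otimes>\<^sub>M ?D = ?J"
  proof (rule pair_measure_eqI)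
    show "sigma_finite_measure ?S" ..
    show "sigma_finite_measure ?D" ..
    fix A B assume A: "A \<in> sets ?S" and B: "B \<in> sets ?D"
    have A': "A \<in> sets M" "A \<subseteq> space M" using A sets_F_subset[OF s] sets.sets_into_space by auto
    have "emeasure ?J (A \<times> B) = emeasure M ((\<lambda>\<omega>. (\<omega>, incr s t \<omega>)) -` (A \<times> B) \<inter> space M)"
      using A B by (intro emeasure_distr[OF XZ]) auto
    also have "(\<lambda>\<omega>. (\<omega>, incr s t \<omega>)) -` (A \<times> B) \<inter> space M = A \<inter> (incr s t -` B \<inter> space M)" by auto
    also have "emeasure M \<dots> = emeasure M A * emeasure M (incr s t -` B \<inter> space M)"
      using prob_Int_incr[OF st, of A B] A B by (simp add: emeasure_eq_measure ennreal_mult)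
    also have "\<dots> = emeasure ?S A * emeasure ?D B"
      using A B A' X Z by (simp add: emeasure_distr Int_absorb2)
    finally show "emeasure ?S A * emeasure ?D B = emeasure ?J (A \<times> B)" by simp
  qed simp
  have "(\<integral>\<^sup>+\<omega>. f (\<omega>, incr s t \<omega>) \<partial>M) = (\<integral>\<^sup>+x. f x \<partial>?J)"
    by (subst nn_integral_distr) auto
  also have "\<dots> = (\<integral>\<^sup>+x. f x \<partial>(?S \<Otimes>\<^sub>M ?D))" unfolding prod ..
  also have "\<dots> = (\<integral>\<^sup>+\<omega>. \<integral>\<^sup>+z. f (\<omega>, z) \<partial>?D \<partial>?S)"
    by (subst D.nn_integral_fst[symmetric]) auto
  also have "\<dots> = (\<integral>\<^sup>+\<omega>. \<integral>\<^sup>+z. f (\<omega>, z) \<partial>?D \<partial>M)"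
    by (subst nn_integral_distr) (auto intro!: D.borel_measurable_nn_integral)
  also have "\<dots> = (\<integral>\<^sup>+\<omega>. \<integral>\<^sup>+\<omega>'. f (\<omega>, incr s t \<omega>') \<partial>M \<partial>M)"
    using sec by (intro nn_integral_cong, subst nn_integral_distr) auto
  finally show ?thesis .
qed

lemma nn_integral_mult_incr:
  assumes st: "0 \<le> s" "s < t" "t \<le> T"
    and [measurable]: "f \<in> borel_measurable (F s)" "g \<in> borel_measurable borel"
  shows "(\<integral>\<^sup>+\<omega>. f \<omega> * g (incr s t \<omega>) \<partial>M) = (\<integral>\<^sup>+\<omega>. f \<omega> \<partial>M) * (\<integral>\<^sup>+\<omega>. g (incr s t \<omega>) \<partial>M)"
proof -
  have s: "s \<in> {0..T}" using st by auto
  have Z[measurable]: "incr s t \<in> borel_measurable M" using st by (intro incr_measurable) auto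
  have [measurable]: "f \<in> borel_measurable M" using s by (rule measurable_F_M) measurable
  have "(\<integral>\<^sup>+\<omega>. f \<omega> * g (incr s t \<omega>) \<partial>M) = (\<integral>\<^sup>+\<omega>. \<integral>\<^sup>+\<omega>'. f \<omega> * g (incr s t \<omega>') \<partial>M \<partial>M)"
    using nn_integral_freeze[OF st, of "\<lambda>(\<omega>, z). f \<omega> * g z"] by simp
  also have "\<dots> = (\<integral>\<^sup>+\<omega>. f \<omega> * (\<integral>\<^sup>+\<omega>'. g (incr s t \<omega>') \<partial>M) \<partial>M)"
    by (intro nn_integral_cong nn_integral_cmult) measurable
  also have "\<dots> = (\<integral>\<^sup>+\<omega>. f \<omega> \<partial>M) * (\<integral>\<^sup>+\<omega>. g (incr s t \<omega>) \<partial>M)"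
    by (rule nn_integral_multc) measurable
  finally show ?thesis .
qed

section \<open>Moments of increments\<close>

lemma incr_distributed:
  assumes "0 \<le> s" "s < t" "t \<le> T"
  shows "distributed M lborel (\<lambda>\<omega>. incr s t \<omega> $ i) (\<lambda>x. ennreal (normal_density 0 (sqrt (t - s)) x))"
  using BM assms by (auto simp: std_brownian_motion_def)

lemma incr_component_measurable:
  assumes "0 \<le> s" "s \<le> t" "t \<le> T"
  shows "(\<lambda>\<omega>. incr s t \<omega> $ i) \<in> borel_measurable M"
  using measurable_compose[OF incr_measurable[OF assms], of "\<lambda>x. x $ i"] by simp

lemma incr_integrable:
  assumes "0 \<le> s" "s < t" "t \<le> T"
  shows "integrable M (\<lambda>\<omega>. incr s t \<omega> $ i)" "integrable M (\<lambda>\<omega>. (incr s t \<omega> $ i)\<^sup>2)"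
proof -
  have pos: "0 < sqrt (t - s)" using assms by simp
  show "integrable M (\<lambda>\<omega>. incr s t \<omega> $ i)"
    using integrable_normal_moment[OF pos, of 0 1]
      distributed_integrable[OF incr_distributed[OF assms, of i], of "\<lambda>x. x"] by simp
  show "integrable M (\<lambda>\<omega>. (incr s t \<omega> $ i)\<^sup>2)"
    using integrable_normal_moment[OF pos, of 0 2]
      distributed_integrable[OF incr_distributed[OF assms, of i], of "\<lambda>x. x\<^sup>2"] by simp
qed

lemma expectation_incr:
  assumes "0 \<le> s" "s < t" "t \<le> T"
  shows "expectation (\<lambda>\<omega>. incr s t \<omega> $ i) = 0"
  using normal_distributed_expectation[OF _ incr_distributed[OF assms, of i]] assms by simp

lemma expectation_incr_square:
  assumes "0 \<le> s" "s < t" "t \<le> T"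
  shows "expectation (\<lambda>\<omega>. (incr s t \<omega> $ i)\<^sup>2) = t - s"
  using normal_distributed_variance[OF _ incr_distributed[OF assms, of i]] assms expectation_incr[OF assms, of i]
  by simp

lemma incr_product:
  assumes st: "0 \<le> s" "s < t" "t \<le> T" and ij: "i \<noteq> j"
  shows "integrable M (\<lambda>\<omega>. incr s t \<omega> $ i * incr s t \<omega> $ j)"
    and "expectation (\<lambda>\<omega>. incr s t \<omega> $ i * incr s t \<omega> $ j) = 0"
proof -
  have "indep_vars (\<lambda>_. borel) (\<lambda>i \<omega>. incr s t \<omega> $ i) UNIV"
    using BM st by (auto simp: std_brownian_motion_def)
  \<comment> \<open>The sum over the singleton \<open>{j}\<close> turns joint independence of the
    coordinates into independence of two of them.\<close>
  then have *: "indep_var borel (\<lambda>\<omega>. incr s t \<omega> $ i) borel (\<lambda>\<omega>. incr s t \<omega> $ j)"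
    using indep_vars_sum[of "{j}" i "\<lambda>i \<omega>. incr s t \<omega> $ i"] ij indep_vars_subset[of _ _ UNIV "{i, j}"] by auto
  show "integrable M (\<lambda>\<omega>. incr s t \<omega> $ i * incr s t \<omega> $ j)"
    by (rule indep_var_integrable[OF * incr_integrable(1)[OF st] incr_integrable(1)[OF st]])
  show "expectation (\<lambda>\<omega>. incr s t \<omega> $ i * incr s t \<omega> $ j) = 0"
    using indep_var_lebesgue_integral[OF * incr_integrable(1)[OF st] incr_integrable(1)[OF st]]
      expectation_incr[OF st] by simp
qed

lemma nn_integral_incr_norm_square:
  assumes st: "0 \<le> s" "s \<le> t" "t \<le> T"
  shows "(\<integral>\<^sup>+\<omega>. ennreal ((norm (incr s t \<omega>))\<^sup>2) \<partial>M) = ennreal (real CARD('m) * (t - s))"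
proof (cases "s = t")
  case False
  then have st': "s < t" using st by simp
  have eq: "(norm (incr s t \<omega>))\<^sup>2 = (\<Sum>i\<in>UNIV. (incr s t \<omega> $ i)\<^sup>2)" for \<omega>
    by (simp add: norm_vec_def L2_set_def sum_nonneg)
  have "(\<integral>\<^sup>+\<omega>. ennreal ((norm (incr s t \<omega>))\<^sup>2) \<partial>M) = ennreal (expectation (\<lambda>\<omega>. (norm (incr s t \<omega>))\<^sup>2))"
    unfolding eq using incr_integrable(2)[OF st(1) st' st(3)]
    by (intro nn_integral_eq_integral Bochner_Integration.integrable_sum AE_I2 sum_nonneg) simp_all
  also have "expectation (\<lambda>\<omega>. (norm (incr s t \<omega>))\<^sup>2) = (\<Sum>i\<in>(UNIV::'m set). t - s)"
    unfolding eq using expectation_incr_square[OF st(1) st' st(3)] incr_integrable(2)[OF st(1) st' st(3)]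
    by (subst Bochner_Integration.integral_sum) simp_all
  finally show ?thesis by simp
qed simp

text \<open>The norm is at most \<open>CARD('m)\<close> times one coordinate, and the exponential of
  an absolute value is at most the sum of two exponentials. Summing over all coordinates removes the
  dependence of the largest one on \<omega>; this explains the factors \<open>2\<close> and
  \<open>CARD('m)\<close>. The case \<open>s = t\<close> is separate because an empty increment has
  no normal density.\<close>

lemma nn_integral_exp_norm_incr:
  assumes st: "0 \<le> s" "s \<le> t" "t \<le> T" and l: "0 \<le> l"
  shows "(\<integral>\<^sup>+\<omega>. ennreal (exp (l * norm (incr s t \<omega>))) \<partial>M)
    \<le> ennreal (2 * real CARD('m) * exp ((l * real CARD('m))\<^sup>2 * (t - s) / 2))"
proof (cases "s = t")
  case True
  have "1 \<le> real CARD('m)" by (simp add: Suc_le_eq)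
  then have "ennreal 1 \<le> ennreal (2 * real CARD('m))" by (intro ennreal_leI) linarith
  moreover have "(\<integral>\<^sup>+\<omega>. ennreal (exp (l * norm (incr s t \<omega>))) \<partial>M) = ennreal 1"
    using True by (simp add: emeasure_space_1)
  ultimately show ?thesis using True by simp
next
  case False
  then have st': "s < t" using st by simp
  let ?m = "real CARD('m)"
  have exp_abs: "exp (a * \<bar>z\<bar>) \<le> exp (a * z) + exp ((- a) * z)" for a z :: real
    by (cases "z \<ge> 0") auto
  have m[measurable]: "(\<lambda>\<omega>. incr s t \<omega> $ i) \<in> borel_measurable M" for i
    using incr_component_measurable st by auto
  have one: "(\<integral>\<^sup>+\<omega>. ennreal (exp (c * incr s t \<omega> $ i)) \<partial>M) = ennreal (exp (c\<^sup>2 * (t - s) / 2))" for c i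
    using distributed_nn_integral[OF incr_distributed[OF st(1) st' st(3), of i], of "\<lambda>x. ennreal (exp (c * x))"]
      nn_integral_normal_exp[of "sqrt (t - s)" c] st' by simp
  have "(\<integral>\<^sup>+\<omega>. ennreal (exp (l * norm (incr s t \<omega>))) \<partial>M)
     \<le> (\<integral>\<^sup>+\<omega>. (\<Sum>i\<in>UNIV. ennreal (exp ((l * ?m) * incr s t \<omega> $ i)) + ennreal (exp ((- (l * ?m)) * incr s t \<omega> $ i))) \<partial>M)"
  proof (rule nn_integral_mono)
    fix \<omega>
    obtain i where i: "norm (incr s t \<omega>) \<le> ?m * \<bar>incr s t \<omega> $ i\<bar>" by (rule norm_le_card_mult_component)
    let ?z = "incr s t \<omega> $ i"
    have "l * norm (incr s t \<omega>) \<le> l * (?m * \<bar>?z\<bar>)" using i l by (rule mult_left_mono)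
    then have "exp (l * norm (incr s t \<omega>)) \<le> exp (l * ?m * \<bar>?z\<bar>)" by simp
    also have "\<dots> \<le> exp ((l * ?m) * ?z) + exp ((- (l * ?m)) * ?z)" by (rule exp_abs)
    finally have "ennreal (exp (l * norm (incr s t \<omega>)))
      \<le> ennreal (exp ((l * ?m) * ?z)) + ennreal (exp ((- (l * ?m)) * ?z))"
      by (metis ennreal_leI ennreal_plus exp_ge_zero)
    also have "\<dots> \<le> (\<Sum>i\<in>UNIV. ennreal (exp ((l * ?m) * incr s t \<omega> $ i)) + ennreal (exp ((- (l * ?m)) * incr s t \<omega> $ i)))"
      by (rule member_le_sum[of i UNIV]) auto
    finally show "ennreal (exp (l * norm (incr s t \<omega>)))
      \<le> (\<Sum>i\<in>UNIV. ennreal (exp ((l * ?m) * incr s t \<omega> $ i)) + ennreal (exp ((- (l * ?m)) * incr s t \<omega> $ i)))" .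
  qed
  also have "\<dots> = (\<Sum>i\<in>(UNIV::'m set). ennreal (exp ((l * ?m)\<^sup>2 * (t - s) / 2)) + ennreal (exp ((- (l * ?m))\<^sup>2 * (t - s) / 2)))"
    by (subst nn_integral_sum, measurable, subst nn_integral_add, measurable, subst one, subst one, rule refl)
  also have "\<dots> = ennreal (2 * ?m * exp ((l * ?m)\<^sup>2 * (t - s) / 2))"
    by (simp add: ennreal_mult ennreal_of_nat_eq_real_of_nat flip: mult_2) (simp add: ac_simps)
  finally show ?thesis .
qed

text \<open>Brownian scaling: measured in units of \<open>sqrt h\<close>, the quantity
  \<open>sqrt h + norm (incr s t \<omega>)\<close> has all moments bounded, even with an exponential
  weight as long as its rate \<open>l\<close> is at most of order \<open>1 / sqrt h\<close>. The
  exponent \<open>k\<close> thus counts half powers of the step size.\<close>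

lemma nn_integral_incr_power_exp:
  fixes K :: real and k :: nat
  obtains C where "0 < C" "\<And>s t h l. 0 \<le> s \<Longrightarrow> s \<le> t \<Longrightarrow> t \<le> T \<Longrightarrow> t - s \<le> h \<Longrightarrow> 0 < h \<Longrightarrow> 0 \<le> l \<Longrightarrow> l * sqrt h \<le> K \<Longrightarrow>
    (\<integral>\<^sup>+\<omega>. ennreal ((sqrt h + norm (incr s t \<omega>)) ^ k * exp (l * (sqrt h + norm (incr s t \<omega>)))) \<partial>M) \<le> ennreal (C * sqrt h ^ k)"
proof -
  let ?m = "real CARD('m)"
  define C where "C = fact k * exp (K + 1) * (2 * ?m * exp (((K + 1) * ?m)\<^sup>2 / 2))"
  have "(\<integral>\<^sup>+\<omega>. ennreal ((sqrt h + norm (incr s t \<omega>)) ^ k * exp (l * (sqrt h + norm (incr s t \<omega>)))) \<partial>M) \<le> ennreal (C * sqrt h ^ k)"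
    if *: "0 \<le> s" "s \<le> t" "t \<le> T" "t - s \<le> h" "0 < h" "0 \<le> l" "l * sqrt h \<le> K" for s t h l
  proof -
    \<comment> \<open>The power is absorbed by \<open>exp (w / sqrt h)\<close>, which raises the
      exponential rate to \<open>q\<close>. Since \<open>q * sqrt h\<close> is at most
      \<open>K + 1\<close>, the Gaussian bound does not depend on \<open>h\<close>.\<close>
    define q where "q = l + 1 / sqrt h"
    have q: "0 \<le> q" using * by (simp add: q_def)
    have qh: "q * sqrt h = l * sqrt h + 1" using * by (simp add: q_def field_simps)
    have [measurable]: "incr s t \<in> borel_measurable M" using incr_measurable * by auto
    have "(\<integral>\<^sup>+\<omega>. ennreal ((sqrt h + norm (incr s t \<omega>)) ^ k * exp (l * (sqrt h + norm (incr s t \<omega>)))) \<partial>M)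
       \<le> (\<integral>\<^sup>+\<omega>. ennreal (fact k * sqrt h ^ k * exp (K + 1)) * ennreal (exp (q * norm (incr s t \<omega>))) \<partial>M)"
    proof (rule nn_integral_mono)
      fix \<omega>
      let ?w = "sqrt h + norm (incr s t \<omega>)"
      have "(?w / sqrt h) ^ k \<le> fact k * exp (?w / sqrt h)" using * by (intro power_le_fact_exp) auto
      then have "?w ^ k \<le> fact k * exp (?w / sqrt h) * sqrt h ^ k"
        using * by (simp add: power_divide pos_divide_le_eq)
      then have "?w ^ k * exp (l * ?w) \<le> fact k * exp (?w / sqrt h) * sqrt h ^ k * exp (l * ?w)"
        by (rule mult_right_mono) simp
      also have "\<dots> = fact k * sqrt h ^ k * exp (q * sqrt h + q * norm (incr s t \<omega>))"
        by (simp add: q_def exp_add[symmetric] algebra_simps add_divide_distrib)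
      also have "\<dots> \<le> fact k * sqrt h ^ k * exp (K + 1 + q * norm (incr s t \<omega>))"
        using qh * by (intro mult_left_mono) auto
      finally show "ennreal (?w ^ k * exp (l * ?w)) \<le> ennreal (fact k * sqrt h ^ k * exp (K + 1)) * ennreal (exp (q * norm (incr s t \<omega>)))"
        using * by (subst ennreal_mult[symmetric]) (auto intro!: ennreal_leI simp: exp_add mult_ac)
    qed
    also have "\<dots> = ennreal (fact k * sqrt h ^ k * exp (K + 1)) * (\<integral>\<^sup>+\<omega>. ennreal (exp (q * norm (incr s t \<omega>))) \<partial>M)"
      by (rule nn_integral_cmult) measurable
    also have "\<dots> \<le> ennreal (fact k * sqrt h ^ k * exp (K + 1)) * ennreal (2 * ?m * exp (((K + 1) * ?m)\<^sup>2 / 2))"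
    proof (intro mult_left_mono order_trans[OF nn_integral_exp_norm_incr[OF *(1-3) q]] ennreal_leI)
      have "(q * ?m)\<^sup>2 * (t - s) \<le> (q * ?m)\<^sup>2 * (sqrt h)\<^sup>2" using * by (intro mult_left_mono) auto
      also have "\<dots> = ((q * sqrt h) * ?m)\<^sup>2" by (simp add: power_mult_distrib)
      also have "\<dots> \<le> ((K + 1) * ?m)\<^sup>2" using qh * q by (intro power_mono mult_right_mono) auto
      finally show "exp ((q * ?m)\<^sup>2 * (t - s) / 2) \<le> exp (((K + 1) * ?m)\<^sup>2 / 2)" by simp
    qed auto
    also have "\<dots> = ennreal (C * sqrt h ^ k)"
      using * by (subst ennreal_mult[symmetric]) (auto simp: C_def mult_ac)
    finally show ?thesis .
  qed
  moreover have "0 < C" by (simp add: C_def)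
  ultimately show thesis using that by blast
qed

text \<open>Only the upper bound in the discrete Ito isometry is needed, whence the crude factor \<open>CARD('m)\<close>.\<close>

lemma discrete_ito_isometry:
  fixes b :: "nat \<Rightarrow> 'a \<Rightarrow> real^'m^'d"
  assumes g: "0 < g" and n: "real n * g \<le> T"
    and meas: "\<And>i. i < n \<Longrightarrow> b i \<in> borel_measurable (F (real i * g))"
    and bdd: "\<And>i \<omega>. i < n \<Longrightarrow> \<omega> \<in> space M \<Longrightarrow> norm (b i \<omega>) \<le> B"
  shows "integrable M (\<lambda>\<omega>. (norm (\<Sum>i<n. b i \<omega> *v incr (real i * g) (real (Suc i) * g) \<omega>))\<^sup>2)"
    and "expectation (\<lambda>\<omega>. (norm (\<Sum>i<n. b i \<omega> *v incr (real i * g) (real (Suc i) * g) \<omega>))\<^sup>2)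
      \<le> real CARD('m) * g * (\<Sum>i<n. expectation (\<lambda>\<omega>. (norm (b i \<omega>))\<^sup>2))"
proof -
  let ?D = "\<lambda>i. incr (real i * g) (real (Suc i) * g)"
  let ?S = "\<lambda>k \<omega>. \<Sum>i<k. b i \<omega> *v ?D i \<omega>"
  let ?m = "real CARD('m)"
  \<comment> \<open>Adaptedness of the partial sum is carried through the induction, because it
    makes the coefficients of the next cross term independent of the next increment.\<close>
  have "integrable M (\<lambda>\<omega>. (norm (?S k \<omega>))\<^sup>2) \<and> ?S k \<in> borel_measurable (F (real k * g)) \<and>
      expectation (\<lambda>\<omega>. (norm (?S k \<omega>))\<^sup>2) \<le> ?m * g * (\<Sum>i<k. expectation (\<lambda>\<omega>. (norm (b i \<omega>))\<^sup>2))" if "k \<le> n" for k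
    using that
  proof (induction k)
    case (Suc k)
    let ?s = "real k * g" and ?t = "real (Suc k) * g"
    have "real (Suc k) * g \<le> real n * g" using Suc.prems g by (intro mult_right_mono) auto
    then have st: "0 \<le> ?s" "?s < ?t" "?t \<le> T" and st': "?s \<le> ?t" "?s \<in> {0..T}" "?t \<in> {0..T}"
      using g n by (auto simp: algebra_simps)
    have IH: "integrable M (\<lambda>\<omega>. (norm (?S k \<omega>))\<^sup>2)" "?S k \<in> borel_measurable (F ?s)"
      "expectation (\<lambda>\<omega>. (norm (?S k \<omega>))\<^sup>2) \<le> ?m * g * (\<Sum>i<k. expectation (\<lambda>\<omega>. (norm (b i \<omega>))\<^sup>2))"
      using Suc by auto
    have bF: "b k \<in> borel_measurable (F ?s)" and bB: "\<And>\<omega>. \<omega> \<in> space M \<Longrightarrow> norm (b k \<omega>) \<le> B"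
      using meas bdd Suc.prems by auto
    have mS: "?S (Suc k) \<in> borel_measurable (F ?t)"
    proof -
      have "?S k \<in> borel_measurable (F ?t)" "b k \<in> borel_measurable (F ?t)"
        by (rule measurable_F_mono[OF st(1) st'(1) st(3)], fact IH bF)+
      moreover have "?D k \<in> borel_measurable (F ?t)" using st st' by (intro incr_measurable_F) auto
      ultimately show ?thesis
        unfolding sum.lessThan_Suc by (intro borel_measurable_add borel_measurable_matrix_vector_mult)
    qed
    have bM[measurable]: "b k \<in> borel_measurable M" and SM[measurable]: "?S k \<in> borel_measurable M"
      by (rule measurable_F_M[OF st'(2)], fact bF IH)+
    have DM[measurable]: "?D k \<in> borel_measurable M" using st by (intro incr_measurable) auto
    have ib: "integrable M (\<lambda>\<omega>. (norm (b k \<omega>))\<^sup>2)"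
      by (rule integrable_const_bound[of _ "B\<^sup>2"]) (use bB in \<open>auto intro!: AE_I2 power_mono\<close>)
    \<comment> \<open>\<open>\<xi> l\<close> is the coefficient of the \<open>l\<close>-th
      coordinate of the increment in the inner product of the old sum with the new summand. It is
      known at the left endpoint, so each cross term has expectation zero.\<close>
    define \<xi> where "\<xi> l \<omega> = (\<Sum>r\<in>UNIV. ?S k \<omega> $ r * b k \<omega> $ r $ l)" for l \<omega>
    have \<xi>F: "\<xi> l \<in> borel_measurable (F ?s)" for l
    proof -
      have "(\<lambda>\<omega>. ?S k \<omega> $ r) \<in> borel_measurable (F ?s)" for r
        using measurable_compose[OF IH(2), of "\<lambda>x. x $ r"] by simp
      moreover have "(\<lambda>\<omega>. b k \<omega> $ r $ l) \<in> borel_measurable (F ?s)" for r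
        using measurable_compose[OF bF, of "\<lambda>x. x $ r $ l"]
        by (simp add: borel_measurable_continuous_onI continuous_intros)
      ultimately show ?thesis unfolding \<xi>_def by (intro borel_measurable_sum borel_measurable_times)
    qed
    have \<xi>int: "integrable M (\<xi> l)" for l
    proof (rule Bochner_Integration.integrable_bound)
      show "integrable M (\<lambda>\<omega>. \<bar>B\<bar> * (real CARD('d) * (1 + (norm (?S k \<omega>))\<^sup>2)))" using IH(1) by auto
      show "\<xi> l \<in> borel_measurable M" using measurable_F_M[OF st'(2) \<xi>F] .
      show "AE \<omega> in M. norm (\<xi> l \<omega>) \<le> norm (\<bar>B\<bar> * (real CARD('d) * (1 + (norm (?S k \<omega>))\<^sup>2)))"
      proof (rule AE_I2)
        fix \<omega> assume w: "\<omega> \<in> space M"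
        have "\<bar>?S k \<omega> $ r * b k \<omega> $ r $ l\<bar> \<le> (1 + (norm (?S k \<omega>))\<^sup>2) * \<bar>B\<bar>" for r
        proof -
          have "\<bar>?S k \<omega> $ r\<bar> \<le> norm (?S k \<omega>)" by (rule component_le_norm_cart)
          also have "\<dots> \<le> 1 + (norm (?S k \<omega>))\<^sup>2"
            using zero_le_power2[of "norm (?S k \<omega>) - 1"] unfolding power2_diff
            by (smt (verit) norm_ge_zero one_power2 mult_cancel_left1)
          finally have 1: "\<bar>?S k \<omega> $ r\<bar> \<le> 1 + (norm (?S k \<omega>))\<^sup>2" .
          have "\<bar>b k \<omega> $ r $ l\<bar> \<le> norm (b k \<omega> $ r)" by (rule component_le_norm_cart)
          also have "\<dots> \<le> norm (b k \<omega>)" by (rule Finite_Cartesian_Product.norm_nth_le)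
          also have "\<dots> \<le> \<bar>B\<bar>" using bB[OF w] by simp
          finally show ?thesis using 1 unfolding abs_mult by (intro mult_mono) auto
        qed
        then have "\<bar>\<xi> l \<omega>\<bar> \<le> (\<Sum>r\<in>(UNIV::'d set). (1 + (norm (?S k \<omega>))\<^sup>2) * \<bar>B\<bar>)"
          unfolding \<xi>_def by (intro order_trans[OF sum_abs] sum_mono)
        also have "\<dots> = norm (\<bar>B\<bar> * (real CARD('d) * (1 + (norm (?S k \<omega>))\<^sup>2)))" by (simp add: abs_mult)
        finally show "norm (\<xi> l \<omega>) \<le> norm (\<bar>B\<bar> * (real CARD('d) * (1 + (norm (?S k \<omega>))\<^sup>2)))" by simp
      qed
    qed
    have ind: "indep_var borel (\<xi> l) borel (\<lambda>\<omega>. ?D k \<omega> $ l)" for l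
      using indep_var_incr[OF st \<xi>F[of l], of "\<lambda>x. x $ l"] by simp
    have cross_int: "integrable M (\<lambda>\<omega>. \<xi> l \<omega> * ?D k \<omega> $ l)" for l
      using indep_var_integrable[OF ind \<xi>int incr_integrable(1)[OF st]] by simp
    have cross: "expectation (\<lambda>\<omega>. \<xi> l \<omega> * ?D k \<omega> $ l) = 0" for l
      using indep_var_lebesgue_integral[OF ind \<xi>int incr_integrable(1)[OF st]] expectation_incr[OF st] by simp
    have inner: "?S k \<omega> \<bullet> (b k \<omega> *v ?D k \<omega>) = (\<Sum>l\<in>UNIV. \<xi> l \<omega> * ?D k \<omega> $ l)" for \<omega>
      unfolding \<xi>_def inner_vec_def matrix_vector_mult_def inner_real_def vec_lambda_beta
        sum_distrib_left sum_distrib_right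
      by (subst sum.swap) (simp only: mult.assoc)
    have sq: "(norm (?S (Suc k) \<omega>))\<^sup>2 = (norm (?S k \<omega>))\<^sup>2 + 2 * (\<Sum>l\<in>UNIV. \<xi> l \<omega> * ?D k \<omega> $ l)
        + (norm (b k \<omega> *v ?D k \<omega>))\<^sup>2" for \<omega>
      unfolding sum.lessThan_Suc power2_norm_eq_inner inner[symmetric]
      by (simp add: inner_add_left inner_add_right inner_commute)
    have last: "(\<integral>\<^sup>+\<omega>. ennreal ((norm (b k \<omega> *v ?D k \<omega>))\<^sup>2) \<partial>M) \<le> ennreal (?m * g * expectation (\<lambda>\<omega>. (norm (b k \<omega>))\<^sup>2))"
    proof -
      have "(\<integral>\<^sup>+\<omega>. ennreal ((norm (b k \<omega> *v ?D k \<omega>))\<^sup>2) \<partial>M)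
        \<le> (\<integral>\<^sup>+\<omega>. ennreal ((norm (b k \<omega>))\<^sup>2) * ennreal ((norm (?D k \<omega>))\<^sup>2) \<partial>M)"
        by (intro nn_integral_mono, subst ennreal_mult[symmetric])
          (auto intro!: ennreal_leI power_mono norm_matrix_vector_mult_le simp flip: power_mult_distrib)
      also have "\<dots> = (\<integral>\<^sup>+\<omega>. ennreal ((norm (b k \<omega>))\<^sup>2) \<partial>M) * (\<integral>\<^sup>+\<omega>. ennreal ((norm (?D k \<omega>))\<^sup>2) \<partial>M)"
        by (rule nn_integral_mult_incr[OF st, of "\<lambda>\<omega>. ennreal ((norm (b k \<omega>))\<^sup>2)" "\<lambda>z. ennreal ((norm z)\<^sup>2)"])
          (use bF in \<open>measurable\<close>)
      also have "(\<integral>\<^sup>+\<omega>. ennreal ((norm (?D k \<omega>))\<^sup>2) \<partial>M) = ennreal (?m * g)"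
        using nn_integral_incr_norm_square[OF st(1) st'(1) st(3)] by (simp add: algebra_simps)
      also have "(\<integral>\<^sup>+\<omega>. ennreal ((norm (b k \<omega>))\<^sup>2) \<partial>M) = ennreal (expectation (\<lambda>\<omega>. (norm (b k \<omega>))\<^sup>2))"
        using ib by (intro nn_integral_eq_integral) auto
      finally show ?thesis using g by (simp add: ennreal_mult mult_ac)
    qed
    have ilast: "integrable M (\<lambda>\<omega>. (norm (b k \<omega> *v ?D k \<omega>))\<^sup>2)"
    proof (rule integrableI_nonneg)
      show "(\<lambda>\<omega>. (norm (b k \<omega> *v ?D k \<omega>))\<^sup>2) \<in> borel_measurable M" by measurable
      show "(\<integral>\<^sup>+\<omega>. ennreal ((norm (b k \<omega> *v ?D k \<omega>))\<^sup>2) \<partial>M) < \<infinity>"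
        using le_less_trans[OF last] by simp
    qed simp
    have elast: "expectation (\<lambda>\<omega>. (norm (b k \<omega> *v ?D k \<omega>))\<^sup>2) \<le> ?m * g * expectation (\<lambda>\<omega>. (norm (b k \<omega>))\<^sup>2)"
      using last g unfolding nn_integral_eq_integral[OF ilast AE_I2[OF zero_le_power2]]
      by (subst (asm) ennreal_le_iff) (auto intro!: mult_nonneg_nonneg)
    have "integrable M (\<lambda>\<omega>. (norm (?S (Suc k) \<omega>))\<^sup>2)"
      unfolding sq using IH(1) cross_int ilast by auto
    moreover have "expectation (\<lambda>\<omega>. (norm (?S (Suc k) \<omega>))\<^sup>2)
       = expectation (\<lambda>\<omega>. (norm (?S k \<omega>))\<^sup>2) + 2 * (\<Sum>l\<in>UNIV. expectation (\<lambda>\<omega>. \<xi> l \<omega> * ?D k \<omega> $ l))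
        + expectation (\<lambda>\<omega>. (norm (b k \<omega> *v ?D k \<omega>))\<^sup>2)"
      unfolding sq using IH(1) cross_int ilast by simp
    moreover have "\<dots> \<le> ?m * g * (\<Sum>i<Suc k. expectation (\<lambda>\<omega>. (norm (b i \<omega>))\<^sup>2))"
      using elast IH(3) cross by (simp add: algebra_simps)
    ultimately show ?case using mS by simp
  qed simp
  from this[of n] show "integrable M (\<lambda>\<omega>. (norm (?S n \<omega>))\<^sup>2)"
    "expectation (\<lambda>\<omega>. (norm (?S n \<omega>))\<^sup>2) \<le> ?m * g * (\<Sum>i<n. expectation (\<lambda>\<omega>. (norm (b i \<omega>))\<^sup>2))" by auto
qed

end

section \<open>Expansion of one tamed step\<close>

definition tamed :: "'a::real_normed_vector \<Rightarrow> 'a" where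
  "tamed v = (1 / (1 + (norm v)\<^sup>2)) *\<^sub>R v"

lemma norm_tamed: "norm (tamed v) = norm v / (1 + (norm v)\<^sup>2)"
  by (simp add: tamed_def abs_of_nonneg)

lemma norm_tamed_le: "norm (tamed v) \<le> norm v"
  unfolding norm_tamed by (simp add: divide_le_eq mult_le_cancel_left1 add_pos_nonneg)

text \<open>The maximum is attained at \<open>norm v = 1\<close>. This bound is the origin of the
  radius \<open>1 / 2\<close> in all local estimates of the derivatives of \<open>U\<close>.\<close>

lemma norm_tamed_le_half: "norm (tamed v) \<le> 1 / 2"
proof -
  have "0 \<le> (norm v - 1)\<^sup>2" by simp
  then have "2 * norm v \<le> 1 + (norm v)\<^sup>2" by (simp add: power2_eq_square algebra_simps)
  then show ?thesis unfolding norm_tamed by (simp add: divide_le_eq add_pos_nonneg)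
qed

lemma norm_tamed_diff: "norm (tamed v - v) = norm v ^ 3 / (1 + (norm v)\<^sup>2)"
proof -
  have pos: "0 < 1 + (norm v)\<^sup>2" by (simp add: add_pos_nonneg)
  have "tamed v - v = (1 / (1 + (norm v)\<^sup>2) - 1) *\<^sub>R v" by (simp add: tamed_def scaleR_left_diff_distrib)
  also have "1 / (1 + (norm v)\<^sup>2) - 1 = - ((norm v)\<^sup>2 / (1 + (norm v)\<^sup>2))"
    using pos by (simp add: field_simps)
  finally show ?thesis using pos by (simp add: power2_eq_square power3_eq_cube abs_of_nonneg)
qed

lemma norm_tamed_diff_le_cube: "norm (tamed v - v) \<le> norm v ^ 3"
  unfolding norm_tamed_diff by (simp add: divide_le_eq mult_le_cancel_left1 add_pos_nonneg)

lemma norm_tamed_diff_le_square: "norm (tamed v - v) \<le> (norm v)\<^sup>2"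
proof -
  have "0 \<le> (norm v)\<^sup>2 * (1 + (norm v)\<^sup>2 - norm v)"
    by (smt (verit) mult_nonneg_nonneg zero_le_power2 norm_tamed_le_half power2_diff one_power2 mult_cancel_left1)
  then show ?thesis unfolding norm_tamed_diff
    by (simp add: divide_le_eq add_pos_nonneg power2_eq_square power3_eq_cube algebra_simps)
qed

lemma continuous_on_tamed: "continuous_on S tamed"
  unfolding tamed_def by (intro continuous_intros) (metis add_pos_nonneg less_irrefl zero_le_power2 zero_less_one)

lemma borel_measurable_tamed [measurable]: "tamed \<in> borel_measurable borel"
  by (rule borel_measurable_continuous_onI[OF continuous_on_tamed])

section \<open>Taylor estimates\<close>

text \<open>Maclaurin's formula for \<open>U\<close> along the segment from \<open>x\<close> to
  \<open>x + v\<close>, which stays in the ball of radius \<open>norm v\<close> where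
  \<open>U3\<close> is controlled. The coefficient \<open>1/6\<close> of the remainder is enlarged
  to \<open>1\<close>.\<close>

lemma taylor_third_order:
  fixes U :: "'a::real_normed_vector \<Rightarrow> real"
    and U1 :: "'a \<Rightarrow> ('a \<Rightarrow>\<^sub>L real)" and U2 :: "'a \<Rightarrow> ('a \<Rightarrow>\<^sub>L ('a \<Rightarrow>\<^sub>L real))"
    and U3 :: "'a \<Rightarrow> ('a \<Rightarrow>\<^sub>L ('a \<Rightarrow>\<^sub>L ('a \<Rightarrow>\<^sub>L real)))"
  assumes d1: "\<And>x. (U has_derivative blinfun_apply (U1 x)) (at x)"
    and d2: "\<And>x. (U1 has_derivative blinfun_apply (U2 x)) (at x)"
    and d3: "\<And>x. (U2 has_derivative blinfun_apply (U3 x)) (at x)"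
    and bd: "\<And>y. norm (y - x) \<le> norm v \<Longrightarrow> norm (U3 y) \<le> K"
  shows "\<bar>U (x + v) - U x - U1 x v - U2 x v v / 2\<bar> \<le> K * norm v ^ 3"
proof -
  define diff where "diff m = (\<lambda>r. if m = 0 then U (x + r *\<^sub>R v) else if m = 1 then U1 (x + r *\<^sub>R v) v
     else if m = 2 then U2 (x + r *\<^sub>R v) v v else U3 (x + r *\<^sub>R v) v v v)" for m :: nat
  have line: "((\<lambda>r. x + r *\<^sub>R v) has_derivative (\<lambda>h. h *\<^sub>R v)) (at r)" for r :: real
    by (auto intro!: derivative_eq_intros)
  have D0: "DERIV (\<lambda>r. U (x + r *\<^sub>R v)) r :> U1 (x + r *\<^sub>R v) v" for r
    unfolding has_field_derivative_def
    by (rule has_derivative_eq_rhs[OF has_derivative_compose[OF line d1]]) (auto simp: blinfun.scaleR_right fun_eq_iff)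
  have D1: "DERIV (\<lambda>r. U1 (x + r *\<^sub>R v) v) r :> U2 (x + r *\<^sub>R v) v v" for r
    unfolding has_field_derivative_def
    by (rule has_derivative_eq_rhs[OF bounded_linear.has_derivative[OF blinfun.bounded_linear_left[of v] has_derivative_compose[OF line d2]]])
      (auto simp: blinfun.scaleR_right blinfun.scaleR_left fun_eq_iff)
  have D2: "DERIV (\<lambda>r. U2 (x + r *\<^sub>R v) v v) r :> U3 (x + r *\<^sub>R v) v v v" for r
    unfolding has_field_derivative_def
    by (rule has_derivative_eq_rhs[OF bounded_linear.has_derivative[OF
          bounded_linear_compose[OF blinfun.bounded_linear_left[of v] blinfun.bounded_linear_left[of v]]
          has_derivative_compose[OF line d3]]])
      (auto simp: blinfun.scaleR_right blinfun.scaleR_left fun_eq_iff)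
  have "\<exists>t>0. t < 1 \<and> U (x + 1 *\<^sub>R v) = (\<Sum>m<3. diff m 0 / fact m * 1 ^ m) + diff 3 t / fact 3 * 1 ^ 3"
  proof (rule Maclaurin[of 1 3 diff "\<lambda>r. U (x + r *\<^sub>R v)"])
    show "\<forall>m t. m < 3 \<and> 0 \<le> t \<and> t \<le> 1 \<longrightarrow> DERIV (diff m) t :> diff (Suc m) t"
    proof (intro allI impI)
      fix m t assume "m < (3::nat) \<and> 0 \<le> t \<and> t \<le> (1::real)"
      then have "m = 0 \<or> m = 1 \<or> m = 2" by auto
      then show "DERIV (diff m) t :> diff (Suc m) t" using D0 D1 D2 by (auto simp: diff_def)
    qed
  qed (auto simp: diff_def)
  then obtain t where t: "0 < t" "t < 1"
    "U (x + v) = U x + U1 x v + U2 x v v / 2 + U3 (x + t *\<^sub>R v) v v v / 6"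
    by (auto simp: diff_def eval_nat_numeral)
  have "norm ((x + t *\<^sub>R v) - x) \<le> norm v" using t by (simp add: mult_left_le_one_le)
  then have K: "norm (U3 (x + t *\<^sub>R v)) \<le> K" by (rule bd)
  let ?A = "U3 (x + t *\<^sub>R v)"
  have "\<bar>?A v v v\<bar> \<le> norm (?A v v) * norm v" using norm_blinfun[of "?A v v" v] by simp
  also have "\<dots> \<le> (norm (?A v) * norm v) * norm v" by (intro mult_right_mono norm_blinfun) simp
  also have "\<dots> \<le> ((norm ?A * norm v) * norm v) * norm v" by (intro mult_right_mono norm_blinfun) simp_all
  also have "\<dots> \<le> K * norm v * norm v * norm v" using K by (intro mult_right_mono) auto
  finally have "\<bar>U3 (x + t *\<^sub>R v) v v v\<bar> \<le> K * norm v ^ 3" by (simp add: power3_eq_cube mult_ac)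
  moreover have "0 \<le> K * norm v ^ 3" using order_trans[OF norm_ge_zero K] by (intro mult_nonneg_nonneg) auto
  ultimately show ?thesis using t(3) by auto
qed

text \<open>The quadratic term keeps its coefficient \<open>1 / 2\<close>, because its expectation
  has to match the squared gradient in the Lyapunov inequality; the coefficient of the cubic term is
  irrelevant.\<close>

lemma exp_le_taylor_two:
  fixes a :: real
  shows "exp a \<le> 1 + a + a\<^sup>2 / 2 + \<bar>a\<bar> ^ 3 * exp \<bar>a\<bar>"
proof -
  obtain t where t: "\<bar>t\<bar> \<le> \<bar>a\<bar>" "exp a = (\<Sum>m<3. a ^ m / fact m) + exp t / fact 3 * a ^ 3"
    using Maclaurin_exp_le[of a 3] by blast
  have "exp t / fact 3 * a ^ 3 \<le> \<bar>exp t / fact 3 * a ^ 3\<bar>" by (rule abs_ge_self)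
  also have "\<dots> = exp t / 6 * \<bar>a\<bar> ^ 3" by (simp add: abs_mult power_abs eval_nat_numeral)
  also have "\<dots> \<le> exp \<bar>a\<bar> * \<bar>a\<bar> ^ 3"
  proof (rule mult_right_mono)
    have "exp t \<le> exp \<bar>a\<bar>" using t(1) by simp
    then show "exp t / 6 \<le> exp \<bar>a\<bar>" using exp_ge_zero[of t] by linarith
  qed simp
  finally show ?thesis using t(2) by (simp add: eval_nat_numeral power2_eq_square mult.commute)
qed

text \<open>The second estimate isolates the first-order loss of the discount factor, which supplies
  the term \<open>- \<rho> * U x\<close> needed to match the right side of the Lyapunov
  inequality.\<close>

lemma exp_discount_le:
  fixes \<rho> s u :: real
  assumes "0 \<le> \<rho>" "0 \<le> s" "0 \<le> u"
  shows "\<bar>exp (- \<rho> * (s + u)) - exp (- \<rho> * s)\<bar> \<le> \<rho> * u"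
    and "\<bar>exp (- \<rho> * (s + u)) - exp (- \<rho> * s) + \<rho> * u * exp (- \<rho> * s)\<bar> \<le> (\<rho> * u)\<^sup>2"
proof -
  have s1: "0 \<le> exp (- \<rho> * s)" "exp (- \<rho> * s) \<le> 1" using assms by auto
  have q: "0 \<le> \<rho> * u" using assms by simp
  have e: "exp (- \<rho> * (s + u)) = exp (- \<rho> * s) * exp (- (\<rho> * u))"
    by (simp add: exp_add[symmetric] algebra_simps)
  have l1: "1 - \<rho> * u \<le> exp (- (\<rho> * u))" using exp_ge_add_one_self[of "- (\<rho> * u)"] by simp
  have l2: "exp (- (\<rho> * u)) \<le> 1" using q by simp
  have "exp (- (\<rho> * u)) * (1 + \<rho> * u) \<le> exp (- (\<rho> * u)) * exp (\<rho> * u)"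
    using exp_ge_add_one_self[of "\<rho> * u"] by (intro mult_left_mono) auto
  \<comment> \<open>This is the bound of \<open>exp (- q)\<close> by \<open>1 / (1 + q)\<close> for
    \<open>q = \<rho> * u\<close>, multiplied out; inserting the lower bound \<open>1 - q\<close>
    once more gives the quadratic error.\<close>
  then have l3: "exp (- (\<rho> * u)) + exp (- (\<rho> * u)) * (\<rho> * u) \<le> 1" by (simp add: exp_minus distrib_left)
  have "(1 - \<rho> * u) * (\<rho> * u) \<le> exp (- (\<rho> * u)) * (\<rho> * u)" using l1 q by (rule mult_right_mono)
  then have l4: "exp (- (\<rho> * u)) - 1 + \<rho> * u \<le> (\<rho> * u)\<^sup>2" using l3 by (simp add: power2_eq_square algebra_simps)
  have "\<bar>exp (- (\<rho> * u)) - 1\<bar> \<le> \<rho> * u" using l1 l2 by linarith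
  then have "exp (- \<rho> * s) * \<bar>exp (- (\<rho> * u)) - 1\<bar> \<le> 1 * (\<rho> * u)" using s1 by (intro mult_mono) auto
  moreover have "\<bar>exp (- \<rho> * (s + u)) - exp (- \<rho> * s)\<bar> = exp (- \<rho> * s) * \<bar>exp (- (\<rho> * u)) - 1\<bar>"
    unfolding e using s1(1) by (subst abs_of_nonneg[OF s1(1), symmetric], subst abs_mult[symmetric]) (simp add: algebra_simps)
  ultimately show "\<bar>exp (- \<rho> * (s + u)) - exp (- \<rho> * s)\<bar> \<le> \<rho> * u" by (simp only: mult_1)
  have "\<bar>exp (- (\<rho> * u)) - 1 + \<rho> * u\<bar> \<le> (\<rho> * u)\<^sup>2" using l1 l4 by linarith
  then have "exp (- \<rho> * s) * \<bar>exp (- (\<rho> * u)) - 1 + \<rho> * u\<bar> \<le> 1 * (\<rho> * u)\<^sup>2" using s1 by (intro mult_mono) auto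
  moreover have "\<bar>exp (- \<rho> * (s + u)) - exp (- \<rho> * s) + \<rho> * u * exp (- \<rho> * s)\<bar>
     = exp (- \<rho> * s) * \<bar>exp (- (\<rho> * u)) - 1 + \<rho> * u\<bar>"
    unfolding e using s1(1) by (subst abs_of_nonneg[OF s1(1), symmetric], subst abs_mult[symmetric]) (simp add: algebra_simps)
  ultimately show "\<bar>exp (- \<rho> * (s + u)) - exp (- \<rho> * s) + \<rho> * u * exp (- \<rho> * s)\<bar> \<le> (\<rho> * u)\<^sup>2" by (simp only: mult_1)
qed

lemma abs_mult_le_mult:
  fixes a b A B :: real
  shows "\<bar>a\<bar> \<le> A \<Longrightarrow> \<bar>b\<bar> \<le> B \<Longrightarrow> \<bar>a * b\<bar> \<le> A * B"
  unfolding abs_mult by (rule mult_mono) auto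

text \<open>\<open>\<Lambda>\<close> dominates all the data of the problem near the current state \<open>x\<close>; all remainders
  are measured in powers of the scale \<open>w = sqrt h + norm z\<close> of a Brownian increment.\<close>

locale one_step =
  fixes U :: "real^'d \<Rightarrow> real"
    and U1 :: "real^'d \<Rightarrow> ((real^'d) \<Rightarrow>\<^sub>L real)" and U2 :: "real^'d \<Rightarrow> ((real^'d) \<Rightarrow>\<^sub>L ((real^'d) \<Rightarrow>\<^sub>L real))"
    and U3 :: "real^'d \<Rightarrow> ((real^'d) \<Rightarrow>\<^sub>L ((real^'d) \<Rightarrow>\<^sub>L ((real^'d) \<Rightarrow>\<^sub>L real)))"
    and x b :: "real^'d" and S :: "real^'m^'d" and \<rho> \<Lambda> h s u Ub :: real
  assumes d1: "\<And>x. (U has_derivative blinfun_apply (U1 x)) (at x)"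
    and d2: "\<And>x. (U1 has_derivative blinfun_apply (U2 x)) (at x)"
    and d3: "\<And>x. (U2 has_derivative blinfun_apply (U3 x)) (at x)"
    and \<Lambda>1: "1 \<le> \<Lambda>" and h\<Lambda>: "sqrt h \<le> \<Lambda>" and \<rho>: "0 \<le> \<rho>" "\<rho> \<le> \<Lambda>"
    and s: "0 \<le> s" and u: "0 \<le> u" "u \<le> h"
    and U_bd: "\<bar>U x\<bar> \<le> \<Lambda>" and b_bd: "norm b \<le> \<Lambda>" and S_bd: "norm S \<le> \<Lambda>" and Ub_bd: "\<bar>Ub\<bar> \<le> \<Lambda>"
    and U1_bd: "\<And>y. norm (y - x) \<le> 1 / 2 \<Longrightarrow> norm (U1 y) \<le> \<Lambda>"
    and U2_bd: "\<And>y. norm (y - x) \<le> 1 / 2 \<Longrightarrow> norm (U2 y) \<le> \<Lambda>"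
    and U3_bd: "\<And>y. norm (y - x) \<le> 1 / 2 \<Longrightarrow> norm (U3 y) \<le> \<Lambda>"
begin

definition "wscale (z::real^'m) = sqrt h + norm z"
definition "drift z = u *\<^sub>R b + S *v z"
definition "e0 = exp (- \<rho> * s)"
definition "e1 = exp (- \<rho> * (s + u))"
text \<open>The change of the Lyapunov exponent over a time \<open>u\<close> when the integral of
  the discounted \<open>Ubar\<close> is replaced by its left-endpoint value; the error of that
  replacement is treated separately. \<open>lin\<close> and \<open>quad\<close> are its parts of
  first and second order in the scale \<open>wscale z\<close>.\<close>

definition "growth z = e1 * U (x + tamed (drift z)) - e0 * U x + u * e0 * Ub"
definition "lin z = e0 * U1 x (S *v z)"
definition "quad z = e0 * (u * U1 x b + U2 x (S *v z) (S *v z) / 2 - \<rho> * u * U x + u * Ub)"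

lemma h0: "0 \<le> h" using u by simp

lemma wscale_nonneg: "0 \<le> wscale z" and norm_le_wscale: "norm z \<le> wscale z" and sqrt_le_wscale: "sqrt h \<le> wscale z"
  using h0 by (auto simp: wscale_def)

text \<open>A time of order \<open>h\<close> counts as two powers of the scale. Where only one power
  is wanted, the other factor \<open>sqrt h\<close> is paid for by \<Lambda>.\<close>

lemma u_le_wscale: "u \<le> (wscale z)\<^sup>2" "u \<le> \<Lambda> * wscale z"
proof -
  have "u \<le> (sqrt h)\<^sup>2" using u h0 by simp
  also have "\<dots> \<le> (wscale z)\<^sup>2" using sqrt_le_wscale h0 by (intro power_mono) auto
  finally show "u \<le> (wscale z)\<^sup>2" .
  have "u \<le> sqrt h * sqrt h" using u h0 by simp
  also have "\<dots> \<le> \<Lambda> * wscale z" using sqrt_le_wscale h\<Lambda> h0 \<Lambda>1 by (intro mult_mono) auto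
  finally show "u \<le> \<Lambda> * wscale z" .
qed

lemma abs_u: "\<bar>u\<bar> \<le> (wscale z)\<^sup>2" "\<bar>u\<bar> \<le> \<Lambda> * wscale z" and abs_\<rho>: "\<bar>\<rho>\<bar> \<le> \<Lambda>"
  using u_le_wscale u \<rho> by auto

lemma abs_e0: "\<bar>e0\<bar> \<le> 1" and e0_nonneg: "0 \<le> e0" and e0_le: "e0 \<le> 1" and abs_e1: "\<bar>e1\<bar> \<le> 1"
  using \<rho> s u by (auto simp: mult_nonneg_nonneg e0_def e1_def)

lemma discount_diff: "\<bar>e1 - e0\<bar> \<le> \<rho> * u" "\<bar>e1 - e0 + \<rho> * u * e0\<bar> \<le> (\<rho> * u)\<^sup>2"
  using exp_discount_le[OF \<rho>(1) s u(1)] by (simp_all add: e0_def e1_def)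

lemma \<rho>u_le: "\<rho> * u \<le> \<Lambda>\<^sup>2 * wscale z" "\<rho> * u \<le> \<Lambda> * (wscale z)\<^sup>2"
proof -
  have "\<rho> * u \<le> \<Lambda> * (\<Lambda> * wscale z)" using \<rho> u u_le_wscale \<Lambda>1 by (intro mult_mono) auto
  then show "\<rho> * u \<le> \<Lambda>\<^sup>2 * wscale z" by (simp add: power2_eq_square mult_ac)
  show "\<rho> * u \<le> \<Lambda> * (wscale z)\<^sup>2" using \<rho> u u_le_wscale \<Lambda>1 by (intro mult_mono) auto
qed

lemma norm_S_le: "norm (S *v z) \<le> \<Lambda> * wscale z"
  using norm_matrix_vector_mult_le[of S z] mult_mono[OF S_bd norm_le_wscale[of z]] \<Lambda>1 by simp

text \<open>Since \<Lambda> is at least 1, all powers of it in a remainder may be raised to the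
  largest one; only their finite number matters later.\<close>

lemma \<Lambda>_power: "k \<le> l \<Longrightarrow> \<Lambda> ^ k \<le> \<Lambda> ^ l" using \<Lambda>1 by (rule power_increasing[rotated])

lemma \<Lambda>_power_mult: "k \<le> l \<Longrightarrow> 0 \<le> r \<Longrightarrow> \<Lambda> ^ k * r \<le> \<Lambda> ^ l * r" by (intro mult_right_mono \<Lambda>_power)

lemma norm_drift_le: "norm (drift z) \<le> 2 * \<Lambda>\<^sup>2 * wscale z"
proof -
  have "norm (drift z) \<le> u * norm b + norm (S *v z)"
    unfolding drift_def using norm_triangle_ineq[of "u *\<^sub>R b" "S *v z"] u by simp
  moreover have "u * norm b \<le> (\<Lambda> * wscale z) * \<Lambda>"
    using u_le_wscale[of z] b_bd \<Lambda>1 u wscale_nonneg[of z] by (intro mult_mono) auto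
  moreover have "\<Lambda> * wscale z \<le> \<Lambda>\<^sup>2 * wscale z"
    using \<Lambda>_power_mult[of 1 2, OF _ wscale_nonneg[of z]] by simp
  ultimately show ?thesis using norm_S_le[of z] by (simp add: power2_eq_square mult_ac)
qed

lemma norm_U1_x: "norm (U1 x) \<le> \<Lambda>" and norm_U2_x: "norm (U2 x) \<le> \<Lambda>"
  using U1_bd[of x] U2_bd[of x] by auto

lemma U1_x_le: "norm v \<le> r \<Longrightarrow> \<bar>U1 x v\<bar> \<le> \<Lambda> * r"
  using norm_blinfun[of "U1 x" v] mult_mono[OF norm_U1_x _ _ norm_ge_zero[of v], of r] \<Lambda>1 by fastforce

lemma U2_x_le: "norm v \<le> r \<Longrightarrow> norm v' \<le> r' \<Longrightarrow> \<bar>U2 x v v'\<bar> \<le> \<Lambda> * r * r'"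
proof -
  assume r: "norm v \<le> r" "norm v' \<le> r'"
  then have r0: "0 \<le> r" "0 \<le> r'" using norm_ge_zero order_trans by blast+
  have "\<bar>U2 x v v'\<bar> \<le> norm (U2 x v) * norm v'" using norm_blinfun[of "U2 x v" v'] by simp
  also have "\<dots> \<le> (norm (U2 x) * norm v) * norm v'" using norm_blinfun[of "U2 x" v] by (rule mult_right_mono) simp
  also have "\<dots> \<le> (\<Lambda> * r) * r'" using norm_U2_x r r0 \<Lambda>1 by (intro mult_mono) auto
  finally show ?thesis .
qed

lemma U_increment_le: "norm v \<le> 1 / 2 \<Longrightarrow> \<bar>U (x + v) - U x\<bar> \<le> \<Lambda> * norm v"
proof -
  assume v: "norm v \<le> 1 / 2"
  have "norm (U (x + v) - U x) \<le> \<Lambda> * norm ((x + v) - x)"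
  proof (rule differentiable_bound[of "cball x (1/2)" U "\<lambda>y. blinfun_apply (U1 y)"])
    show "(U has_derivative blinfun_apply (U1 y)) (at y within cball x (1/2))" for y
      using d1 by (rule has_derivative_at_withinI)
    show "onorm (blinfun_apply (U1 y)) \<le> \<Lambda>" if "y \<in> cball x (1/2)" for y
      using U1_bd[of y] that by (simp add: norm_blinfun.rep_eq[symmetric] dist_norm norm_minus_commute)
  qed (use v in \<open>auto simp: dist_norm\<close>)
  then show ?thesis by simp
qed

text \<open>A crude first-order bound suffices for the exponent of the exponential remainder and for
  its cubic factor.\<close>

lemma growth_le: "\<bar>growth z\<bar> \<le> 5 * \<Lambda> ^ 3 * wscale z"
proof -
  let ?w = "wscale z" and ?p = "tamed (drift z)"
  have p: "norm ?p \<le> 2 * \<Lambda>\<^sup>2 * ?w" using norm_tamed_le norm_drift_le order_trans by blast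
  have "\<bar>U (x + ?p) - U x\<bar> \<le> \<Lambda> * (2 * \<Lambda>\<^sup>2 * ?w)"
    using U_increment_le[OF norm_tamed_le_half, of "drift z"] mult_left_mono[OF p, of \<Lambda>] \<Lambda>1 by linarith
  then have 1: "\<bar>e1 * (U (x + ?p) - U x)\<bar> \<le> 1 * (\<Lambda> * (2 * \<Lambda>\<^sup>2 * ?w))" by (intro abs_mult_le_mult abs_e1)
  have 2: "\<bar>(e1 - e0) * U x\<bar> \<le> (\<Lambda>\<^sup>2 * ?w) * \<Lambda>"
    by (intro abs_mult_le_mult U_bd order_trans[OF discount_diff(1) \<rho>u_le(1)])
  have 3: "\<bar>u * e0 * Ub\<bar> \<le> (\<Lambda> * ?w) * 1 * \<Lambda>" by (intro abs_mult_le_mult abs_u abs_e0 Ub_bd)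
  have "growth z = e1 * (U (x + ?p) - U x) + (e1 - e0) * U x + u * e0 * Ub" by (simp add: growth_def algebra_simps)
  then have "\<bar>growth z\<bar> \<le> 3 * (\<Lambda> ^ 3 * ?w) + \<Lambda>\<^sup>2 * ?w"
    using 1 2 3 by (simp add: power3_eq_cube power2_eq_square mult_ac)
  moreover have "\<Lambda>\<^sup>2 * ?w \<le> \<Lambda> ^ 3 * ?w" by (intro \<Lambda>_power_mult wscale_nonneg) simp
  moreover have "0 \<le> \<Lambda> ^ 3 * ?w" using \<Lambda>1 wscale_nonneg by simp
  ultimately show ?thesis by linarith
qed

lemma lin_le: "\<bar>lin z\<bar> \<le> \<Lambda>\<^sup>2 * wscale z"
  using abs_mult_le_mult[OF abs_e0 U1_x_le[OF norm_S_le[of z]]] by (simp add: power2_eq_square mult_ac lin_def)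

lemma quad_le: "\<bar>quad z\<bar> \<le> 5 * \<Lambda> ^ 3 * (wscale z)\<^sup>2"
proof -
  let ?w = "wscale z"
  have 1: "\<bar>u * U1 x b\<bar> \<le> ?w\<^sup>2 * (\<Lambda> * \<Lambda>)" by (intro abs_mult_le_mult abs_u U1_x_le b_bd)
  have 2: "\<bar>U2 x (S *v z) (S *v z)\<bar> \<le> \<Lambda> * (\<Lambda> * ?w) * (\<Lambda> * ?w)" by (intro U2_x_le norm_S_le)
  have 3: "\<bar>\<rho> * u * U x\<bar> \<le> \<Lambda> * ?w\<^sup>2 * \<Lambda>" by (intro abs_mult_le_mult abs_u abs_\<rho> U_bd)
  have 4: "\<bar>u * Ub\<bar> \<le> ?w\<^sup>2 * \<Lambda>" by (intro abs_mult_le_mult abs_u Ub_bd)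
  have "\<bar>u * U1 x b + U2 x (S *v z) (S *v z) / 2 - \<rho> * u * U x + u * Ub\<bar>
      \<le> 2 * (\<Lambda>\<^sup>2 * ?w\<^sup>2) + \<Lambda> ^ 3 * ?w\<^sup>2 + \<Lambda> ^ 1 * ?w\<^sup>2"
    using 1 2 3 4 by (simp add: power2_eq_square power3_eq_cube mult_ac)
  moreover have "\<Lambda>\<^sup>2 * ?w\<^sup>2 \<le> \<Lambda> ^ 3 * ?w\<^sup>2" "\<Lambda> ^ 1 * ?w\<^sup>2 \<le> \<Lambda> ^ 3 * ?w\<^sup>2" by (intro \<Lambda>_power_mult; simp)+
  ultimately have "\<bar>u * U1 x b + U2 x (S *v z) (S *v z) / 2 - \<rho> * u * U x + u * Ub\<bar> \<le> 4 * (\<Lambda> ^ 3 * ?w\<^sup>2)"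
    by linarith
  moreover have "0 \<le> \<Lambda> ^ 3 * ?w\<^sup>2" using \<Lambda>1 by simp
  ultimately have "\<bar>u * U1 x b + U2 x (S *v z) (S *v z) / 2 - \<rho> * u * U x + u * Ub\<bar> \<le> 5 * \<Lambda> ^ 3 * ?w\<^sup>2"
    by linarith
  from abs_mult_le_mult[OF abs_e0 this] show ?thesis by (simp add: quad_def)
qed

text \<open>The difference is a sum of five pieces, each of third order: the Taylor remainder of
  \<open>U\<close>, the change of the discount factor in front of the derivatives, the taming error
  inside the first derivative, the replacement of the tamed increment by \<open>S *v z\<close>
  inside the second derivative, and the second-order error of the discount factor.\<close>

lemma growth_expansion: "\<bar>growth z - lin z - quad z\<bar> \<le> 60 * \<Lambda> ^ 7 * wscale z ^ 3"
proof -
  let ?w = "wscale z"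
  define v where "v = drift z"
  define p where "p = tamed v"
  define y where "y = S *v z"
  have w: "0 \<le> ?w" by (rule wscale_nonneg)
  have v: "norm v \<le> 2 * \<Lambda>\<^sup>2 * ?w" unfolding v_def by (rule norm_drift_le)
  have p: "norm p \<le> 2 * \<Lambda>\<^sup>2 * ?w" "norm p \<le> 1 / 2"
    unfolding p_def using norm_tamed_le[of v] v norm_tamed_le_half[of v] by auto
  have y: "norm y \<le> 2 * \<Lambda>\<^sup>2 * ?w"
    using norm_S_le[of z] \<Lambda>_power_mult[of 1 2, OF _ w] mult_nonneg_nonneg[OF _ w, of "\<Lambda>\<^sup>2"]
    unfolding y_def by auto
  have pv3: "norm (p - v) \<le> 8 * \<Lambda> ^ 6 * ?w ^ 3"
    using norm_tamed_diff_le_cube[of v] power_mono[OF v norm_ge_zero, of 3]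
    by (simp add: p_def power_mult_distrib flip: power_mult)
  have pv2: "norm (p - v) \<le> 4 * \<Lambda> ^ 4 * ?w\<^sup>2"
    using norm_tamed_diff_le_square[of v] power_mono[OF v norm_ge_zero, of 2]
    by (simp add: p_def power_mult_distrib flip: power_mult)
  have py: "norm (p - y) \<le> 5 * \<Lambda> ^ 4 * ?w\<^sup>2"
  proof -
    have "norm (p - y) \<le> norm (p - v) + norm (u *\<^sub>R b)"
      using norm_triangle_ineq[of "p - v" "u *\<^sub>R b"] by (simp add: v_def drift_def y_def)
    moreover have "norm (u *\<^sub>R b) \<le> ?w\<^sup>2 * \<Lambda>"
      using mult_mono[OF u_le_wscale(1)[of z] b_bd] u by simp
    moreover have "\<Lambda> ^ 1 * ?w\<^sup>2 \<le> \<Lambda> ^ 4 * ?w\<^sup>2" by (intro \<Lambda>_power_mult) auto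
    ultimately show ?thesis using pv2 by (simp add: mult_ac)
  qed
  define R where "R = U (x + p) - U x - U1 x p - U2 x p p / 2"
  have "\<bar>R\<bar> \<le> \<Lambda> * norm p ^ 3"
    unfolding R_def by (rule taylor_third_order[OF d1 d2 d3]) (use U3_bd p(2) in auto)
  also have "\<dots> \<le> \<Lambda> * (2 * \<Lambda>\<^sup>2 * ?w) ^ 3" using p \<Lambda>1 by (intro mult_left_mono power_mono) auto
  finally have "\<bar>e1 * R\<bar> \<le> 1 * (\<Lambda> * (2 * \<Lambda>\<^sup>2 * ?w) ^ 3)" by (intro abs_mult_le_mult abs_e1)
  moreover have "\<Lambda> * (2 * \<Lambda>\<^sup>2 * ?w) ^ 3 = 8 * \<Lambda> ^ 7 * ?w ^ 3"
    by (simp add: power_mult_distrib power_Suc[symmetric] mult.assoc del: power_Suc flip: power_mult)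
  ultimately have t1: "\<bar>e1 * R\<bar> \<le> 8 * (\<Lambda> ^ 7 * ?w ^ 3)" by simp
  \<comment> \<open>The discount difference already has order two, so the bracket needs only order
    one; in the second derivative one factor \<open>p\<close> is therefore bounded by
    \<open>1 / 2\<close>.\<close>
  have t2: "\<bar>(e1 - e0) * (U1 x p + U2 x p p / 2)\<bar> \<le> 4 * (\<Lambda> ^ 7 * ?w ^ 3)"
  proof -
    have "\<bar>U1 x p\<bar> \<le> \<Lambda> * (2 * \<Lambda>\<^sup>2 * ?w)" by (rule U1_x_le) (rule p)
    moreover have "\<bar>U2 x p p\<bar> \<le> \<Lambda> * (2 * \<Lambda>\<^sup>2 * ?w) * (1 / 2)" by (rule U2_x_le) (rule p)+
    ultimately have "\<bar>U1 x p + U2 x p p / 2\<bar> \<le> 4 * (\<Lambda> ^ 3 * ?w)"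
      by (simp add: power2_eq_square power3_eq_cube mult_ac)
    then have "\<bar>(e1 - e0) * (U1 x p + U2 x p p / 2)\<bar> \<le> (\<Lambda> * ?w\<^sup>2) * (4 * (\<Lambda> ^ 3 * ?w))"
      by (intro abs_mult_le_mult order_trans[OF discount_diff(1) \<rho>u_le(2)])
    also have "\<dots> = 4 * (\<Lambda> ^ 4 * ?w ^ 3)" by (simp add: eval_nat_numeral mult_ac)
    also have "\<dots> \<le> 4 * (\<Lambda> ^ 7 * ?w ^ 3)" using w by (intro mult_left_mono \<Lambda>_power_mult) auto
    finally show ?thesis .
  qed
  have "\<bar>e0 * U1 x (p - v)\<bar> \<le> 1 * (\<Lambda> * (8 * \<Lambda> ^ 6 * ?w ^ 3))"
    by (intro abs_mult_le_mult abs_e0 U1_x_le pv3)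
  then have t3: "\<bar>e0 * U1 x (p - v)\<bar> \<le> 8 * (\<Lambda> ^ 7 * ?w ^ 3)" by (simp add: eval_nat_numeral mult_ac)
  have t4: "\<bar>e0 * ((U2 x (p - y) p + U2 x y (p - y)) / 2)\<bar> \<le> 20 * (\<Lambda> ^ 7 * ?w ^ 3)"
  proof -
    have "\<bar>U2 x (p - y) p\<bar> \<le> \<Lambda> * (5 * \<Lambda> ^ 4 * ?w\<^sup>2) * (2 * \<Lambda>\<^sup>2 * ?w)" by (intro U2_x_le py p)
    moreover have "\<bar>U2 x y (p - y)\<bar> \<le> \<Lambda> * (2 * \<Lambda>\<^sup>2 * ?w) * (5 * \<Lambda> ^ 4 * ?w\<^sup>2)" by (intro U2_x_le py y)
    ultimately have "\<bar>(U2 x (p - y) p + U2 x y (p - y)) / 2\<bar> \<le> 20 * (\<Lambda> ^ 7 * ?w ^ 3)"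
      by (simp add: eval_nat_numeral mult_ac)
    from abs_mult_le_mult[OF abs_e0 this] show ?thesis by simp
  qed
  have t5: "\<bar>(e1 - e0 + \<rho> * u * e0) * U x\<bar> \<le> 1 * (\<Lambda> ^ 7 * ?w ^ 3)"
  proof -
    have "(\<rho> * u)\<^sup>2 \<le> (\<Lambda>\<^sup>2 * ?w) * (\<Lambda> * ?w\<^sup>2)"
      unfolding power2_eq_square[of "\<rho> * u"] by (rule mult_mono[OF \<rho>u_le]) (use \<rho> u w \<Lambda>1 in auto)
    then have "\<bar>(e1 - e0 + \<rho> * u * e0) * U x\<bar> \<le> ((\<Lambda>\<^sup>2 * ?w) * (\<Lambda> * ?w\<^sup>2)) * \<Lambda>"
      by (intro abs_mult_le_mult U_bd order_trans[OF discount_diff(2)])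
    also have "\<dots> = \<Lambda> ^ 4 * ?w ^ 3" by (simp add: eval_nat_numeral mult_ac)
    also have "\<dots> \<le> \<Lambda> ^ 7 * ?w ^ 3" using w by (intro \<Lambda>_power_mult) auto
    finally show ?thesis by simp
  qed
  have U1v: "U1 x v = u * U1 x b + U1 x y" by (simp add: v_def drift_def y_def blinfun.add_right blinfun.scaleR_right)
  have U2y: "U2 x p p - U2 x y y = U2 x (p - y) p + U2 x y (p - y)"
    by (simp add: blinfun.diff_right blinfun.diff_left)
  have U1p: "U1 x (p - v) = U1 x p - U1 x v" by (simp add: blinfun.diff_right)
  have Uxp: "U (x + p) = R + U x + U1 x p + U2 x p p / 2" by (simp add: R_def)
  have "growth z - lin z - quad z = e1 * R + (e1 - e0) * (U1 x p + U2 x p p / 2) + e0 * U1 x (p - v)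
      + e0 * ((U2 x (p - y) p + U2 x y (p - y)) / 2) + (e1 - e0 + \<rho> * u * e0) * U x"
    unfolding growth_def lin_def quad_def v_def[symmetric] p_def[symmetric] y_def[symmetric] U2y[symmetric] U1p U1v Uxp
    by (simp add: field_simps)
  then have "\<bar>growth z - lin z - quad z\<bar> \<le> 8 * (\<Lambda> ^ 7 * ?w ^ 3) + 4 * (\<Lambda> ^ 7 * ?w ^ 3) + 8 * (\<Lambda> ^ 7 * ?w ^ 3)
     + 20 * (\<Lambda> ^ 7 * ?w ^ 3) + 1 * (\<Lambda> ^ 7 * ?w ^ 3)"
    using t1 t2 t3 t4 t5 by linarith
  moreover have "0 \<le> \<Lambda> ^ 7 * ?w ^ 3" using w \<Lambda>1 by simp
  ultimately show ?thesis by simp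
qed

text \<open>Second-order expansion of the exponential, with the square of \<open>growth\<close>
  replaced by that of \<open>lin\<close>. The cubic remainder carries \<open>\<Lambda> ^ 7\<close>
  and gets multiplied by a first-order factor with \<open>\<Lambda> ^ 3\<close>, hence the power
  ten. The number 600 covers \<open>60 + (360 + 30) / 2 + 125\<close>.\<close>

lemma exp_growth_le:
  "exp (growth z) \<le> 1 + lin z + quad z + (lin z)\<^sup>2 / 2 + 600 * \<Lambda> ^ 10 * (wscale z ^ 3 * exp (5 * \<Lambda> ^ 3 * wscale z))"
proof -
  let ?w = "wscale z"
  let ?e = "exp (5 * \<Lambda> ^ 3 * ?w)"
  let ?r = "growth z - lin z - quad z"
  have w: "0 \<le> ?w" by (rule wscale_nonneg)
  have w3: "0 \<le> ?w ^ 3" using w by simp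
  have e1: "1 \<le> ?e" using w \<Lambda>1 by simp
  \<comment> \<open>A product of a third-order and a first-order quantity has order four; the
    surplus factor \<open>?w\<close> is absorbed by the exponential so that order three
    remains.\<close>
  have ew: "?w \<le> ?e"
  proof -
    have "1 * ?w \<le> 5 * \<Lambda> ^ 3 * ?w" using w one_le_power[OF \<Lambda>1, of 3] by (intro mult_right_mono) linarith+
    then show ?thesis using exp_ge_add_one_self[of "5 * \<Lambda> ^ 3 * ?w"] by linarith
  qed
  have r: "\<bar>?r\<bar> \<le> 60 * (\<Lambda> ^ 7 * ?w ^ 3)" using growth_expansion[of z] by simp
  have r': "60 * (\<Lambda> ^ 7 * ?w ^ 3) \<le> 60 * (\<Lambda> ^ 10 * (?w ^ 3 * ?e))"
  proof -
    have "\<Lambda> ^ 7 * (?w ^ 3 * 1) \<le> \<Lambda> ^ 10 * (?w ^ 3 * ?e)"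
      using w3 e1 \<Lambda>1 by (intro mult_mono \<Lambda>_power mult_left_mono) auto
    then show ?thesis by simp
  qed
  \<comment> \<open>Factoring the difference of squares shows at once that it is of third order: the
    first factor has order two and the second order one.\<close>
  have sq: "(growth z)\<^sup>2 - (lin z)\<^sup>2 = (?r + quad z) * (growth z + lin z)" by (simp add: power2_eq_square algebra_simps)
  have l: "\<bar>growth z + lin z\<bar> \<le> 6 * \<Lambda> ^ 3 * ?w"
    using growth_le[of z] lin_le[of z] \<Lambda>_power_mult[of 2 3, OF _ w] by simp
  have rl: "\<bar>?r * (growth z + lin z)\<bar> \<le> 360 * (\<Lambda> ^ 10 * (?w ^ 3 * ?e))"
  proof -
    have "\<bar>?r * (growth z + lin z)\<bar> \<le> (60 * (\<Lambda> ^ 7 * ?w ^ 3)) * (6 * \<Lambda> ^ 3 * ?w)"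
      by (rule abs_mult_le_mult[OF r l])
    also have "\<dots> = 360 * (\<Lambda> ^ 10 * (?w ^ 3 * ?w))" by (simp add: eval_nat_numeral mult_ac)
    also have "\<dots> \<le> 360 * (\<Lambda> ^ 10 * (?w ^ 3 * ?e))"
      using ew w3 \<Lambda>1 by (intro mult_left_mono) auto
    finally show ?thesis .
  qed
  have ql: "\<bar>quad z * (growth z + lin z)\<bar> \<le> 30 * (\<Lambda> ^ 10 * (?w ^ 3 * ?e))"
  proof -
    have "\<bar>quad z * (growth z + lin z)\<bar> \<le> (5 * \<Lambda> ^ 3 * ?w\<^sup>2) * (6 * \<Lambda> ^ 3 * ?w)"
      by (rule abs_mult_le_mult[OF quad_le l])
    also have "\<dots> = 30 * (\<Lambda> ^ 6 * (?w ^ 3 * 1))" by (simp add: eval_nat_numeral mult_ac)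
    also have "\<dots> \<le> 30 * (\<Lambda> ^ 10 * (?w ^ 3 * ?e))"
      using w3 e1 \<Lambda>1 by (intro mult_left_mono mult_mono \<Lambda>_power) auto
    finally show ?thesis .
  qed
  have "\<bar>growth z\<bar> ^ 3 * exp \<bar>growth z\<bar> \<le> (5 * \<Lambda> ^ 3 * ?w) ^ 3 * ?e"
    using growth_le[of z] w \<Lambda>1 by (intro mult_mono power_mono) auto
  also have "\<dots> = 125 * (\<Lambda> ^ 9 * (?w ^ 3 * ?e))" by (simp add: power_mult_distrib mult_ac flip: power_mult)
  also have "\<dots> \<le> 125 * (\<Lambda> ^ 10 * (?w ^ 3 * ?e))" using w3 by (intro mult_left_mono \<Lambda>_power_mult) auto
  finally have cub: "\<bar>growth z\<bar> ^ 3 * exp \<bar>growth z\<bar> \<le> 125 * (\<Lambda> ^ 10 * (?w ^ 3 * ?e))" .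
  have g2: "(growth z)\<^sup>2 = (lin z)\<^sup>2 + ?r * (growth z + lin z) + quad z * (growth z + lin z)"
    using sq by (simp add: algebra_simps)
  have pos: "0 \<le> \<Lambda> ^ 10 * (?w ^ 3 * ?e)" using w3 \<Lambda>1 by simp
  have "exp (growth z) \<le> 1 + growth z + (growth z)\<^sup>2 / 2 + \<bar>growth z\<bar> ^ 3 * exp \<bar>growth z\<bar>" by (rule exp_le_taylor_two)
  moreover have "growth z = lin z + quad z + ?r" by simp
  moreover have "?r \<le> 60 * (\<Lambda> ^ 10 * (?w ^ 3 * ?e))" using abs_le_D1[OF r] r' by (rule order_trans)
  moreover note g2 abs_le_D1[OF rl] abs_le_D1[OF ql] cub pos
  moreover have "e \<le> 1 + g + g2 / 2 + C \<Longrightarrow> g = l + q + r \<Longrightarrow> r \<le> 60 * A \<Longrightarrow> g2 = l2 + P + Q \<Longrightarrow> P \<le> 360 * A \<Longrightarrow>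
      Q \<le> 30 * A \<Longrightarrow> C \<le> 125 * A \<Longrightarrow> 0 \<le> A \<Longrightarrow> e \<le> 1 + l + q + l2 / 2 + 600 * A"
    for e g g2 C l q r A P Q l2 :: real by linarith
  ultimately have "exp (growth z) \<le> 1 + lin z + quad z + (lin z)\<^sup>2 / 2 + 600 * (\<Lambda> ^ 10 * (?w ^ 3 * ?e))" by blast
  then show ?thesis by (simp only: mult.assoc)
qed

lemma exp_two_growth_le: "exp (2 * growth z) \<le> exp (10 * \<Lambda> ^ 3 * wscale z)"
proof -
  have "growth z \<le> 5 * \<Lambda> ^ 3 * wscale z" by (rule order_trans[OF abs_ge_self growth_le])
  then have "2 * growth z \<le> 10 * \<Lambda> ^ 3 * wscale z" by linarith
  then show ?thesis by simp
qed

end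

section \<open>Gradient and Hessian in coordinates\<close>

lemma grad_of_inner: "blinfun_apply D v = grad_of D \<bullet> v" for D :: "(real^'d) \<Rightarrow>\<^sub>L real"
proof -
  have "blinfun_apply D v = blinfun_apply D (\<Sum>i\<in>UNIV. (v $ i) *\<^sub>R axis i 1)"
    using basis_expansion[of v] by (simp add: scalar_mult_eq_scaleR)
  then show ?thesis
    by (simp add: blinfun.sum_right blinfun.scaleR_right grad_of_def inner_vec_def mult.commute)
qed

lemma hess_of_apply:
  fixes D :: "(real^'d) \<Rightarrow>\<^sub>L ((real^'d) \<Rightarrow>\<^sub>L real)"
  shows "blinfun_apply (blinfun_apply D v) w = (\<Sum>k\<in>UNIV. \<Sum>l\<in>UNIV. v $ k * w $ l * hess_of D $ k $ l)"
proof -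
  have "blinfun_apply (blinfun_apply D v) w
      = blinfun_apply (blinfun_apply D (\<Sum>i\<in>UNIV. (v $ i) *\<^sub>R axis i 1)) (\<Sum>i\<in>UNIV. (w $ i) *\<^sub>R axis i 1)"
    using basis_expansion[of v] basis_expansion[of w] by (simp add: scalar_mult_eq_scaleR)
  then show ?thesis
    by (simp add: blinfun.sum_right blinfun.sum_left blinfun.scaleR_right blinfun.scaleR_left hess_of_def sum_distrib_left mult_ac)
      (rule sum.swap)
qed

lemma matrix_vector_mult_columns:
  fixes A :: "real^'m^'d"
  shows "A *v z = (\<Sum>i\<in>UNIV. (z $ i) *\<^sub>R column i A)"
  by (simp add: matrix_mult_sum scalar_mult_eq_scaleR)

text \<open>Second derivatives along the columns of \<open>S\<close> are what the expectation of the
  quadratic form in a Brownian increment produces; this identity recognises them as the trace in the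
  Lyapunov inequality.\<close>

lemma trace_hess_of:
  fixes D :: "(real^'d) \<Rightarrow>\<^sub>L ((real^'d) \<Rightarrow>\<^sub>L real)" and S :: "real^'m^'d"
  shows "trace (S ** transpose S ** hess_of D) = (\<Sum>i\<in>UNIV. blinfun_apply (blinfun_apply D (column i S)) (column i S))"
proof -
  have "trace (S ** transpose S ** hess_of D)
      = (\<Sum>k\<in>UNIV. \<Sum>l\<in>UNIV. \<Sum>i\<in>UNIV. S $ k $ i * S $ l $ i * hess_of D $ l $ k)"
    by (simp add: trace_def matrix_matrix_mult_def transpose_def sum_distrib_right)
  also have "\<dots> = (\<Sum>k\<in>UNIV. \<Sum>i\<in>UNIV. \<Sum>l\<in>UNIV. S $ k $ i * S $ l $ i * hess_of D $ l $ k)"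
    by (rule sum.cong[OF refl]) (rule sum.swap)
  also have "\<dots> = (\<Sum>i\<in>UNIV. \<Sum>k\<in>UNIV. \<Sum>l\<in>UNIV. S $ k $ i * S $ l $ i * hess_of D $ l $ k)"
    by (rule sum.swap)
  also have "\<dots> = (\<Sum>i\<in>UNIV. blinfun_apply (blinfun_apply D (column i S)) (column i S))"
    unfolding hess_of_apply column_def by (subst (2) sum.swap) (simp add: mult_ac)
  finally show ?thesis .
qed

text \<open>The counterpart for the squared gradient, which arises as the variance of the linear
  part: each column of \<open>S\<close> contributes the square of a directional derivative.\<close>

lemma norm_transpose_grad:
  fixes D :: "(real^'d) \<Rightarrow>\<^sub>L real" and S :: "real^'m^'d"
  shows "(norm (transpose S *v grad_of D))\<^sup>2 = (\<Sum>i\<in>UNIV. (blinfun_apply D (column i S))\<^sup>2)"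
proof -
  have "(transpose S *v grad_of D) $ i = blinfun_apply D (column i S)" for i
    by (simp add: grad_of_inner matrix_vector_mult_def transpose_def column_def inner_vec_def mult.commute)
  then show ?thesis by (simp add: norm_vec_def L2_set_def sum_nonneg)
qed

section \<open>Expectation of the exponential over one step\<close>

context filtered_brownian_motion
begin

lemma expectation_quadratic_form:
  assumes st: "0 \<le> s" "s < t" "t \<le> T"
  shows "integrable M (\<lambda>\<omega>. \<Sum>i\<in>UNIV. \<Sum>j\<in>UNIV. Q i j * (incr s t \<omega> $ i * incr s t \<omega> $ j))"
    and "expectation (\<lambda>\<omega>. \<Sum>i\<in>UNIV. \<Sum>j\<in>UNIV. Q i j * (incr s t \<omega> $ i * incr s t \<omega> $ j)) = (t - s) * (\<Sum>i\<in>UNIV. Q i i)"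
proof -
  have int: "integrable M (\<lambda>\<omega>. incr s t \<omega> $ i * incr s t \<omega> $ j)" for i j
    using incr_product(1)[OF st, of i j] incr_integrable(2)[OF st, of i] by (cases "i = j") (simp_all add: power2_eq_square)
  have ex: "expectation (\<lambda>\<omega>. incr s t \<omega> $ i * incr s t \<omega> $ j) = (if i = j then t - s else 0)" for i j
    using incr_product(2)[OF st, of i j] expectation_incr_square[OF st, of j] by (cases "i = j") (simp_all add: power2_eq_square)
  show "integrable M (\<lambda>\<omega>. \<Sum>i\<in>UNIV. \<Sum>j\<in>UNIV. Q i j * (incr s t \<omega> $ i * incr s t \<omega> $ j))"
    by (intro Bochner_Integration.integrable_sum integrable_mult_right int)
  have "expectation (\<lambda>\<omega>. \<Sum>i\<in>UNIV. \<Sum>j\<in>UNIV. Q i j * (incr s t \<omega> $ i * incr s t \<omega> $ j))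
     = (\<Sum>i\<in>UNIV. \<Sum>j\<in>UNIV. Q i j * (if i = j then t - s else 0))"
    unfolding ex[symmetric] using int
    by (subst Bochner_Integration.integral_sum, intro Bochner_Integration.integrable_sum integrable_mult_right int)
      (intro sum.cong refl, subst Bochner_Integration.integral_sum, intro integrable_mult_right int, simp only: integral_mult_right_zero)
  also have "\<dots> = (t - s) * (\<Sum>i\<in>UNIV. Q i i)"
    by (simp add: if_distrib[of "(*) _"] sum_distrib_left mult.commute cong: if_cong)
  finally show "expectation (\<lambda>\<omega>. \<Sum>i\<in>UNIV. \<Sum>j\<in>UNIV. Q i j * (incr s t \<omega> $ i * incr s t \<omega> $ j)) = (t - s) * (\<Sum>i\<in>UNIV. Q i i)" .
qed

text \<open>The linear part has mean zero, and the expectations of \<open>quad\<close> and of half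
  the square of \<open>lin\<close> add up to \<open>e0 * u\<close> times the Lyapunov expression,
  the squared gradient carrying one more factor \<open>e0\<close>. That sum is nonpositive, so
  beyond the leading \<open>1\<close> only the third-order remainder survives.\<close>

lemma nn_integral_exp_growth_le:
  fixes x b :: "real^'d" and S :: "real^'m^'d"
  assumes os: "one_step U U1 U2 U3 x b S \<rho> \<Lambda> h s u Ub"
    and su: "0 < u" "s + u \<le> T"
    and lyap: "blinfun_apply (U1 x) b + (1/2) * trace (S ** transpose S ** hess_of (U2 x))
        + (1/2) * (norm (transpose S *v grad_of (U1 x)))\<^sup>2 + Ub \<le> \<rho> * U x"
    and C: "0 \<le> C" "(\<integral>\<^sup>+\<omega>. ennreal ((sqrt h + norm (incr s (s + u) \<omega>)) ^ 3 * exp (5 * \<Lambda> ^ 3 * (sqrt h + norm (incr s (s + u) \<omega>)))) \<partial>M) \<le> ennreal C"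
  shows "(\<integral>\<^sup>+\<omega>. ennreal (exp (one_step.growth U x b S \<rho> s u Ub (incr s (s + u) \<omega>))) \<partial>M) \<le> ennreal (1 + 600 * \<Lambda> ^ 10 * C)"
proof -
  interpret one_step U U1 U2 U3 x b S \<rho> \<Lambda> h s u Ub by (rule os)
  have st: "0 \<le> s" "s < s + u" "s + u \<le> T" using s su by auto
  let ?Z = "incr s (s + u)"
  let ?c = "\<lambda>i. column i S"
  let ?R = "\<lambda>\<omega>. wscale (?Z \<omega>) ^ 3 * exp (5 * \<Lambda> ^ 3 * wscale (?Z \<omega>))"
  define l where "l i = U1 x (?c i)" for i
  define q where "q i j = U2 x (?c i) (?c j)" for i j
  define k where "k = e0 * (u * U1 x b - \<rho> * u * U x + u * Ub)"
  have [measurable]: "?Z \<in> borel_measurable M" using st by (intro incr_measurable) auto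
  have lin_eq: "lin z = (\<Sum>i\<in>UNIV. e0 * l i * z $ i)" for z
    by (simp add: lin_def matrix_vector_mult_columns blinfun.sum_right blinfun.scaleR_right l_def sum_distrib_left mult_ac)
  have quad_eq: "quad z = k + (\<Sum>i\<in>UNIV. \<Sum>j\<in>UNIV. e0 / 2 * q i j * (z $ i * z $ j))" for z
  proof -
    have "U2 x (S *v z) (S *v z) = (\<Sum>i\<in>UNIV. \<Sum>j\<in>UNIV. q i j * (z $ i * z $ j))"
      unfolding matrix_vector_mult_columns
      by (subst sum.swap) (simp add: blinfun.sum_right blinfun.sum_left blinfun.scaleR_right
        blinfun.scaleR_left q_def sum_distrib_left mult_ac)
    then show ?thesis
      by (simp add: quad_def k_def sum_distrib_left sum_divide_distrib algebra_simps)
  qed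
  have sq_eq: "(lin z)\<^sup>2 / 2 = (\<Sum>i\<in>UNIV. \<Sum>j\<in>UNIV. e0\<^sup>2 / 2 * l i * l j * (z $ i * z $ j))" for z
    unfolding lin_eq power2_eq_square sum_product sum_divide_distrib by (intro sum.cong refl) simp
  note qf1 = expectation_quadratic_form[OF st, of "\<lambda>i j. e0 / 2 * q i j"]
    and qf2 = expectation_quadratic_form[OF st, of "\<lambda>i j. e0\<^sup>2 / 2 * l i * l j"]
  have ilin: "integrable M (\<lambda>\<omega>. lin (?Z \<omega>))"
    unfolding lin_eq by (intro Bochner_Integration.integrable_sum integrable_mult_right incr_integrable st)
  have elin: "expectation (\<lambda>\<omega>. lin (?Z \<omega>)) = 0"
    unfolding lin_eq using expectation_incr[OF st] incr_integrable(1)[OF st]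
    by (subst Bochner_Integration.integral_sum) simp_all
  have iquad: "integrable M (\<lambda>\<omega>. quad (?Z \<omega>))" unfolding quad_eq using qf1(1) by auto
  have isq: "integrable M (\<lambda>\<omega>. (lin (?Z \<omega>))\<^sup>2 / 2)" unfolding sq_eq by (rule qf2(1))
  have "expectation (\<lambda>\<omega>. quad (?Z \<omega>)) = k + u * (\<Sum>i\<in>UNIV. e0 / 2 * q i i)"
    unfolding quad_eq using qf1 by (simp add: prob_space)
  moreover have "expectation (\<lambda>\<omega>. (lin (?Z \<omega>))\<^sup>2 / 2) = u * (\<Sum>i\<in>UNIV. e0\<^sup>2 / 2 * l i * l i)"
    unfolding sq_eq using qf2(2) by simp
  ultimately have "expectation (\<lambda>\<omega>. quad (?Z \<omega>)) + expectation (\<lambda>\<omega>. (lin (?Z \<omega>))\<^sup>2 / 2)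
     = e0 * u * (U1 x b - \<rho> * U x + Ub + (1/2) * (\<Sum>i\<in>UNIV. q i i) + e0 * ((1/2) * (\<Sum>i\<in>UNIV. (l i)\<^sup>2)))"
  proof -
    have "(\<Sum>i\<in>UNIV. e0 / 2 * q i i) = e0 / 2 * (\<Sum>i\<in>UNIV. q i i)" by (simp only: sum_distrib_left)
    moreover have "(\<Sum>i\<in>UNIV. e0\<^sup>2 / 2 * l i * l i) = e0\<^sup>2 / 2 * (\<Sum>i\<in>UNIV. (l i)\<^sup>2)"
      by (simp only: sum_distrib_left power2_eq_square mult.assoc)
    moreover note \<open>expectation (\<lambda>\<omega>. quad (?Z \<omega>)) = _\<close> \<open>expectation (\<lambda>\<omega>. (lin (?Z \<omega>))\<^sup>2 / 2) = _\<close>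
    ultimately show ?thesis unfolding k_def by (simp only:) (simp add: algebra_simps power2_eq_square)
  qed
  also have "\<dots> \<le> 0"
  proof (rule mult_nonneg_nonpos)
    \<comment> \<open>The square of the linear part is discounted twice; since \<open>e0\<close> is
      at most 1, the surplus discount only helps.\<close>
    have "e0 * ((1/2) * (\<Sum>i\<in>UNIV. (l i)\<^sup>2)) \<le> 1 * ((1/2) * (\<Sum>i\<in>UNIV. (l i)\<^sup>2))"
      using e0_le by (intro mult_right_mono mult_nonneg_nonneg sum_nonneg) auto
    then show "U1 x b - \<rho> * U x + Ub + (1/2) * (\<Sum>i\<in>UNIV. q i i) + e0 * ((1/2) * (\<Sum>i\<in>UNIV. (l i)\<^sup>2)) \<le> 0"
      using lyap unfolding trace_hess_of norm_transpose_grad l_def[symmetric] q_def[symmetric] by linarith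
  qed (use e0_nonneg u in auto)
  finally have neg: "expectation (\<lambda>\<omega>. quad (?Z \<omega>)) + expectation (\<lambda>\<omega>. (lin (?Z \<omega>))\<^sup>2 / 2) \<le> 0" .
  have R0: "0 \<le> ?R \<omega>" for \<omega> using wscale_nonneg by simp
  have mR: "?R \<in> borel_measurable M" unfolding wscale_def by measurable
  have nR: "(\<integral>\<^sup>+\<omega>. ennreal (?R \<omega>) \<partial>M) \<le> ennreal C" using C(2) by (simp add: wscale_def)
  have iR: "integrable M ?R" using le_less_trans[OF nR] mR R0 by (intro integrableI_nonneg) auto
  have eR: "expectation ?R \<le> C"
    using nR C(1) R0 by (subst (asm) nn_integral_eq_integral[OF iR]) (auto simp: ennreal_le_iff)
  let ?G = "\<lambda>\<omega>. 1 + lin (?Z \<omega>) + quad (?Z \<omega>) + (lin (?Z \<omega>))\<^sup>2 / 2 + 600 * \<Lambda> ^ 10 * ?R \<omega>"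
  have le: "exp (growth (?Z \<omega>)) \<le> ?G \<omega>" for \<omega> by (rule exp_growth_le)
  have iG: "integrable M ?G"
    by (intro Bochner_Integration.integrable_add integrable_const ilin iquad isq integrable_mult_right iR)
  have "(\<integral>\<^sup>+\<omega>. ennreal (exp (growth (?Z \<omega>))) \<partial>M) \<le> (\<integral>\<^sup>+\<omega>. ennreal (?G \<omega>) \<partial>M)"
    using le by (intro nn_integral_mono ennreal_leI)
  also have "\<dots> = ennreal (expectation ?G)"
    by (rule nn_integral_eq_integral[OF iG]) (use le exp_ge_zero order_trans in blast)
  also have "expectation ?G = 1 + expectation (\<lambda>\<omega>. lin (?Z \<omega>)) + expectation (\<lambda>\<omega>. quad (?Z \<omega>))
      + expectation (\<lambda>\<omega>. (lin (?Z \<omega>))\<^sup>2 / 2) + 600 * \<Lambda> ^ 10 * expectation ?R"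
    using ilin iquad isq iR by (simp add: prob_space)
  also have "\<dots> \<le> 1 + 600 * \<Lambda> ^ 10 * C"
  proof -
    have "600 * \<Lambda> ^ 10 * expectation ?R \<le> 600 * \<Lambda> ^ 10 * C" using eR \<Lambda>1 by (intro mult_left_mono) auto
    then show ?thesis using elin neg by linarith
  qed
  finally show ?thesis by (simp add: ennreal_leI)
qed

lemma nn_integral_exp_two_growth_le:
  fixes x b :: "real^'d" and S :: "real^'m^'d"
  assumes os: "one_step U U1 U2 U3 x b S \<rho> \<Lambda> h s u Ub"
    and C: "(\<integral>\<^sup>+\<omega>. ennreal (exp (10 * \<Lambda> ^ 3 * (sqrt h + norm (incr s (s + u) \<omega>)))) \<partial>M) \<le> ennreal C"
  shows "(\<integral>\<^sup>+\<omega>. ennreal (exp (2 * one_step.growth U x b S \<rho> s u Ub (incr s (s + u) \<omega>))) \<partial>M) \<le> ennreal C"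
proof -
  interpret one_step U U1 U2 U3 x b S \<rho> \<Lambda> h s u Ub by (rule os)
  have "(\<integral>\<^sup>+\<omega>. ennreal (exp (2 * growth (incr s (s + u) \<omega>))) \<partial>M)
     \<le> (\<integral>\<^sup>+\<omega>. ennreal (exp (10 * \<Lambda> ^ 3 * (sqrt h + norm (incr s (s + u) \<omega>)))) \<partial>M)"
    using exp_two_growth_le unfolding wscale_def by (intro nn_integral_mono ennreal_leI)
  then show ?thesis using C by (rule order_trans)
qed

end

section \<open>Exponential moments of the scheme\<close>

text \<open>Exponential moments concern the scheme alone, so its initial value is a separate
  parameter \<open>X0\<close>; the solution of the SDE joins in
  \<open>tamed_euler_sde\<close>.\<close>

locale tamed_euler_scheme = filtered_brownian_motion M F T W
  for M :: "'a measure" and F T and W :: "real \<Rightarrow> 'a \<Rightarrow> real^'m" +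
  fixes \<mu> :: "real^'d \<Rightarrow> real^'d" and \<sigma> :: "real^'d \<Rightarrow> real^'m^'d"
    and \<rho> :: real and U Ubar :: "real^'d \<Rightarrow> real"
    and U1 :: "real^'d \<Rightarrow> ((real^'d) \<Rightarrow>\<^sub>L real)"
    and U2 :: "real^'d \<Rightarrow> ((real^'d) \<Rightarrow>\<^sub>L ((real^'d) \<Rightarrow>\<^sub>L real))"
    and U3 :: "real^'d \<Rightarrow> ((real^'d) \<Rightarrow>\<^sub>L ((real^'d) \<Rightarrow>\<^sub>L ((real^'d) \<Rightarrow>\<^sub>L real)))"
    and Y :: "nat \<Rightarrow> real \<Rightarrow> 'a \<Rightarrow> real^'d" and \<tau> :: "nat \<Rightarrow> 'a \<Rightarrow> real"
    and p c :: real and X0 :: "'a \<Rightarrow> real^'d"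
  assumes T_pos: "0 < T"
    and mu_loclip: "locally_lipschitz \<mu>" and sigma_loclip: "locally_lipschitz \<sigma>"
    and rho: "0 \<le> \<rho>"
    and U_nonneg: "\<And>x. 0 \<le> U x"
    and U1_deriv: "\<And>x. (U has_derivative blinfun_apply (U1 x)) (at x)"
    and U2_deriv: "\<And>x. (U1 has_derivative blinfun_apply (U2 x)) (at x)"
    and U3_deriv: "\<And>x. (U2 has_derivative blinfun_apply (U3 x)) (at x)"
    and Ubar_cont: "continuous_on UNIV Ubar"
    and X0_measurable: "X0 \<in> borel_measurable (F 0)"
    and exp_U_X0: "(\<integral>\<^sup>+ \<omega>. ennreal (exp (U (X0 \<omega>))) \<partial>M) < \<infinity>"
    and Ubar_bdd: "bdd_below (range Ubar)"
    and Lyap: "\<And>x. blinfun_apply (U1 x) (\<mu> x)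
                 + (1/2) * trace (\<sigma> x ** transpose (\<sigma> x) ** hess_of (U2 x))
                 + (1/2) * (norm (transpose (\<sigma> x) *v grad_of (U1 x)))\<^sup>2
                 + Ubar x \<le> \<rho> * U x"
    and Y_init: "\<And>N \<omega>. N \<ge> 1 \<Longrightarrow> \<omega> \<in> space M \<Longrightarrow> Y N 0 \<omega> = X0 \<omega>"
    and Y_step: "\<And>N n t \<omega>. N \<ge> 1 \<Longrightarrow> n < N \<Longrightarrow> \<omega> \<in> space M \<Longrightarrow>
        real n * T / real N < t \<Longrightarrow> t \<le> real (Suc n) * T / real N \<Longrightarrow>
        Y N t \<omega> = Y N (real n * T / real N) \<omega> +
          (if norm (Y N (real n * T / real N) \<omega>) \<le> exp (sqrt \<bar>ln (real N / T)\<bar>)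
           then (1 / (1 + (norm ((t - real n * T / real N) *\<^sub>R \<mu> (Y N (real n * T / real N) \<omega>)
                    + \<sigma> (Y N (real n * T / real N) \<omega>) *v (W t \<omega> - W (real n * T / real N) \<omega>)))\<^sup>2))
                *\<^sub>R ((t - real n * T / real N) *\<^sub>R \<mu> (Y N (real n * T / real N) \<omega>)
                    + \<sigma> (Y N (real n * T / real N) \<omega>) *v (W t \<omega> - W (real n * T / real N) \<omega>))
           else 0)"
    and p_ge: "1 \<le> p" and c_ge: "1 \<le> c"
    and tau_def: "\<And>N \<omega>. N \<ge> 1 \<Longrightarrow> \<omega> \<in> space M \<Longrightarrow>
        \<tau> N \<omega> = Inf ({t \<in> (\<lambda>k. real k * T / real N) ` {0..N}.
                         exp (sqrt \<bar>ln (real N / T)\<bar>) < norm (Y N t \<omega>)} \<union> {T})"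
    and growth: "\<And>x. norm (\<mu> x) + norm (\<sigma> x) \<le> c * (1 + norm x powr c)"
    and Ubar_lip: "\<And>x y. \<bar>Ubar x - Ubar y\<bar> \<le> c * (1 + norm x powr c + norm y powr c) * norm (x - y)"
    and U_coerc: "\<And>x. norm x powr (1 / c) \<le> c * (1 + U x)"
    and U1_bd: "\<And>x. norm (U1 x) \<le> c * (1 + U x) powr max (1 - 1 / p) 0"
    and U2_bd: "\<And>x. norm (U2 x) \<le> c * (1 + U x) powr max (1 - 2 / p) 0"
    and U3_bd: "\<And>x. norm (U3 x) \<le> c * (1 + U x) powr max (1 - 3 / p) 0"
begin

section \<open>Grid, adaptedness and the stopping time\<close>

definition grid :: "nat \<Rightarrow> nat \<Rightarrow> real" where
  "grid N k = real k * T / real N"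

definition cutoff :: "nat \<Rightarrow> real" where
  "cutoff N = exp (sqrt \<bar>ln (real N / T)\<bar>)"

definition lyap_exponent :: "nat \<Rightarrow> real \<Rightarrow> 'a \<Rightarrow> real" where
  "lyap_exponent N t \<omega> = U (Y N t \<omega>) / exp (\<rho> * t)
     + integral {0..min t (\<tau> N \<omega>)} (\<lambda>s. Ubar (Y N s \<omega>) / exp (\<rho> * s))"

lemma mu_continuous: "continuous_on UNIV \<mu>" and sigma_continuous: "continuous_on UNIV \<sigma>"
  using mu_loclip sigma_loclip by (auto intro: locally_lipschitz_continuous_on)

lemma U_continuous: "continuous_on UNIV U"
  using has_derivative_continuous[OF U1_deriv] by (simp add: continuous_on_eq_continuous_at)

lemma coefficients_measurable [measurable]:
  "\<mu> \<in> borel_measurable borel" "\<sigma> \<in> borel_measurable borel" "U \<in> borel_measurable borel" "Ubar \<in> borel_measurable borel"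
  using mu_continuous sigma_continuous U_continuous Ubar_cont by (auto intro: borel_measurable_continuous_onI)

lemma grid_0 [simp]: "grid N 0 = 0" by (simp add: grid_def)

lemma grid_N [simp]: "N \<ge> 1 \<Longrightarrow> grid N N = T" by (simp add: grid_def)

lemma grid_mono: "i \<le> j \<Longrightarrow> grid N i \<le> grid N j"
  using T_pos by (auto simp: grid_def intro!: divide_right_mono mult_right_mono)

lemma grid_nonneg: "0 \<le> grid N k"
  using T_pos by (simp add: grid_def)

lemma grid_mem: "N \<ge> 1 \<Longrightarrow> k \<le> N \<Longrightarrow> grid N k \<in> {0..T}"
  using grid_mono[of k N N] grid_nonneg[of N k] by auto

lemma grid_Suc: "grid N (Suc k) = grid N k + T / real N"
  by (simp add: grid_def add_divide_distrib distrib_right)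

lemma grid_less: "N \<ge> 1 \<Longrightarrow> grid N k < grid N (Suc k)"
  using T_pos by (simp only: grid_Suc) simp

lemma grid_cell:
  assumes "N \<ge> 1" "t \<in> {0..T}"
  obtains k where "k < N" "grid N k \<le> t" "t \<le> grid N (Suc k)"
proof (cases "t = 0")
  case True
  then show ?thesis using that[of 0] assms grid_nonneg[of N 1] by auto
next
  case False
  define r where "r = t * real N / T"
  have r: "0 < r" "r \<le> real N" using False assms T_pos by (auto simp: r_def field_simps)
  \<comment> \<open>Ceiling minus one, not floor: the cells of the recursion are open on the left,
    and \<open>t = T\<close> has to fall into the last one.\<close>
  define k where "k = nat (\<lceil>r\<rceil> - 1)"
  have "0 < \<lceil>r\<rceil>" using r by simp
  then have k: "real k = of_int \<lceil>r\<rceil> - 1" by (simp add: k_def)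
  have *: "real k < r" "r \<le> real (Suc k)" using k by linarith+
  then have "k < N" using r by linarith
  moreover have "grid N k \<le> t" using * T_pos assms by (simp add: r_def grid_def field_simps)
  moreover have "t \<le> grid N (Suc k)" using * T_pos assms by (simp add: r_def grid_def field_simps)
  ultimately show ?thesis by (rule that)
qed

text \<open>At the left endpoint the increment is \<open>tamed 0 = 0\<close>, so the recursion
  extends to the closed cell. This also lets neighbouring cells be glued in the proof of
  continuity.\<close>

lemma Y_step':
  assumes N: "N \<ge> 1" "k < N" and w: "\<omega> \<in> space M" and t: "grid N k \<le> t" "t \<le> grid N (Suc k)"
  shows "Y N t \<omega> = Y N (grid N k) \<omega> + (if norm (Y N (grid N k) \<omega>) \<le> cutoff N
      then tamed ((t - grid N k) *\<^sub>R \<mu> (Y N (grid N k) \<omega>) + \<sigma> (Y N (grid N k) \<omega>) *v incr (grid N k) t \<omega>) else 0)"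
proof (cases "t = grid N k")
  case True
  then show ?thesis by (simp add: tamed_def)
next
  case False
  then show ?thesis using Y_step[OF N w, of t] t by (simp add: tamed_def cutoff_def grid_def)
qed

lemma Y_measurable_step:
  assumes N: "N \<ge> 1" "k < N" and t: "grid N k \<le> t" "t \<le> grid N (Suc k)"
    and m: "Y N (grid N k) \<in> borel_measurable (F (grid N k))"
  shows "Y N t \<in> borel_measurable (F t)"
proof -
  have g: "grid N k \<in> {0..T}" "grid N (Suc k) \<in> {0..T}" using grid_mem[of N k] grid_mem[of N "Suc k"] N by auto
  then have tT: "t \<in> {0..T}" using t by auto
  have [measurable]: "Y N (grid N k) \<in> borel_measurable (F t)"
    using measurable_F_mono[OF _ t(1) _ m] g tT by auto
  have [measurable]: "incr (grid N k) t \<in> borel_measurable (F t)"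
    using g tT t by (intro incr_measurable_F) auto
  have "(\<lambda>\<omega>. Y N (grid N k) \<omega> + (if norm (Y N (grid N k) \<omega>) \<le> cutoff N
      then tamed ((t - grid N k) *\<^sub>R \<mu> (Y N (grid N k) \<omega>) + \<sigma> (Y N (grid N k) \<omega>) *v incr (grid N k) t \<omega>) else 0))
    \<in> borel_measurable (F t)" by measurable
  then show ?thesis
    using Y_step'[OF N _ t] space_F[OF tT] by (subst measurable_cong) auto
qed

lemma Y_grid_measurable: "N \<ge> 1 \<Longrightarrow> k \<le> N \<Longrightarrow> Y N (grid N k) \<in> borel_measurable (F (grid N k))"
proof (induction k)
  case 0
  then have "Y N 0 \<in> borel_measurable (F 0)"
    using X0_measurable Y_init space_F[of 0] T_pos by (subst measurable_cong[of _ _ X0]) auto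
  then show ?case by simp
next
  case (Suc k)
  then show ?case using Y_measurable_step[of N k "grid N (Suc k)"] grid_less[of N k] by simp
qed

lemma Y_measurable: "N \<ge> 1 \<Longrightarrow> t \<in> {0..T} \<Longrightarrow> Y N t \<in> borel_measurable (F t)"
proof -
  assume *: "N \<ge> 1" "t \<in> {0..T}"
  obtain k where k: "k < N" "grid N k \<le> t" "t \<le> grid N (Suc k)" by (rule grid_cell[OF *])
  show ?thesis by (rule Y_measurable_step[OF *(1) k Y_grid_measurable[OF *(1)]]) (use k in simp)
qed

lemma Y_measurable_M: "N \<ge> 1 \<Longrightarrow> t \<in> {0..T} \<Longrightarrow> Y N t \<in> borel_measurable M"
  using Y_measurable measurable_F_M by blast

lemma Y_continuous_cell:
  assumes N: "N \<ge> 1" "k < N" and w: "\<omega> \<in> space M"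
  shows "continuous_on {grid N k..grid N (Suc k)} (\<lambda>t. Y N t \<omega>)"
proof -
  have "{grid N k..grid N (Suc k)} \<subseteq> {0..T}" using grid_mem[of N k] grid_mem[of N "Suc k"] N by auto
  then have W: "continuous_on {grid N k..grid N (Suc k)} (\<lambda>t. W t \<omega>)"
    using W_continuous[OF w] continuous_on_subset by blast
  have "continuous_on {grid N k..grid N (Suc k)} (\<lambda>t. Y N (grid N k) \<omega> + (if norm (Y N (grid N k) \<omega>) \<le> cutoff N
      then tamed ((t - grid N k) *\<^sub>R \<mu> (Y N (grid N k) \<omega>) + \<sigma> (Y N (grid N k) \<omega>) *v incr (grid N k) t \<omega>) else 0))"
    by (cases "norm (Y N (grid N k) \<omega>) \<le> cutoff N")
      (auto intro!: continuous_intros W continuous_on_compose2[OF continuous_on_tamed[of UNIV]]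
        bounded_bilinear.continuous_on[OF bounded_bilinear_matrix_vector_mult])
  then show ?thesis
    by (rule continuous_on_eq) (rule Y_step'[OF N w, symmetric], auto)
qed

lemma Y_continuous:
  assumes N: "N \<ge> 1" and w: "\<omega> \<in> space M"
  shows "continuous_on {0..T} (\<lambda>t. Y N t \<omega>)"
proof -
  have "continuous_on {0..grid N k} (\<lambda>t. Y N t \<omega>)" if "k \<le> N" for k
    using that
  proof (induction k)
    case (Suc k)
    have "{0..grid N (Suc k)} = {0..grid N k} \<union> {grid N k..grid N (Suc k)}"
      using grid_nonneg[of N k] grid_mono[of k "Suc k" N] by auto
    then show ?case
      using continuous_on_closed_Un[OF _ _ Suc.IH Y_continuous_cell[OF N _ w, of k]] Suc.prems by simp
  qed simp
  from this[of N] show ?thesis using N by simp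
qed

text \<open>Exceeding the cutoff at a grid point is absorbing: the indicator vanishes in that step,
  the state stays the same, and hence the indicator vanishes in all later steps.\<close>

lemma Y_frozen:
  assumes N: "N \<ge> 1" "k \<le> N" and w: "\<omega> \<in> space M" and big: "cutoff N < norm (Y N (grid N k) \<omega>)"
    and t: "grid N k \<le> t" "t \<le> T"
  shows "Y N t \<omega> = Y N (grid N k) \<omega>"
proof -
  have *: "Y N (grid N j) \<omega> = Y N (grid N k) \<omega>" if "k \<le> j" "j \<le> N" for j
    using that
  proof (induction j rule: dec_induct)
    case (step j)
    then have eq: "Y N (grid N j) \<omega> = Y N (grid N k) \<omega>" by simp
    show ?case
      using Y_step'[OF N(1) _ w grid_mono[of j "Suc j" N] order_refl] step.prems eq big by simp
  qed simp
  show ?thesis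
  proof (cases "t = grid N k")
    case False
    obtain j where j: "j < N" "grid N j \<le> t" "t \<le> grid N (Suc j)"
      using grid_cell[OF N(1), of t] t grid_mem[OF N] by auto
    have "k \<le> j"
    proof (rule ccontr)
      assume "\<not> k \<le> j"
      then have "grid N (Suc j) \<le> grid N k" by (intro grid_mono) simp
      then show False using j t False by simp
    qed
    then have eq: "Y N (grid N j) \<omega> = Y N (grid N k) \<omega>" using *[of j] j(1) by simp
    then show ?thesis using Y_step'[OF N(1) j(1) w j(2,3)] big by simp
  qed simp
qed

text \<open>By absorption a state within the cutoff at index \<open>k\<close> cannot have exceeded
  it earlier, so \<tau> is at least the next grid point. The last two claims thus replace
  comparisons with \<tau> by a condition on the current state.\<close>

lemma tau_bounds:
  assumes N: "N \<ge> 1" and w: "\<omega> \<in> space M"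
  shows "0 \<le> \<tau> N \<omega>" "\<tau> N \<omega> \<le> T"
    and "k \<le> N \<Longrightarrow> cutoff N < norm (Y N (grid N k) \<omega>) \<Longrightarrow> \<tau> N \<omega> \<le> grid N k"
    and "k < N \<Longrightarrow> norm (Y N (grid N k) \<omega>) \<le> cutoff N \<Longrightarrow> grid N (Suc k) \<le> \<tau> N \<omega>"
proof -
  define S where "S = {t \<in> grid N ` {0..N}. cutoff N < norm (Y N t \<omega>)} \<union> {T}"
  have tau: "\<tau> N \<omega> = Inf S" using tau_def[OF N w] by (simp add: S_def cutoff_def grid_def[abs_def])
  have fin: "bdd_below S" and ne: "S \<noteq> {}" by (auto simp: S_def)
  have S0: "0 \<le> x" if "x \<in> S" for x using that T_pos grid_nonneg by (auto simp: S_def)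
  show "0 \<le> \<tau> N \<omega>" unfolding tau by (rule cInf_greatest[OF ne S0])
  show "\<tau> N \<omega> \<le> T" unfolding tau by (rule cInf_lower[OF _ fin]) (simp add: S_def)
  show "\<tau> N \<omega> \<le> grid N k" if "k \<le> N" "cutoff N < norm (Y N (grid N k) \<omega>)"
    unfolding tau by (rule cInf_lower[OF _ fin]) (use that in \<open>auto simp: S_def\<close>)
  show "grid N (Suc k) \<le> \<tau> N \<omega>" if k: "k < N" "norm (Y N (grid N k) \<omega>) \<le> cutoff N"
    unfolding tau
  proof (rule cInf_greatest[OF ne])
    fix x assume "x \<in> S"
    then consider "x = T" | j where "j \<le> N" "x = grid N j" "cutoff N < norm (Y N (grid N j) \<omega>)"
      by (auto simp: S_def)
    then show "grid N (Suc k) \<le> x"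
    proof cases
      case 1
      then show ?thesis using grid_mem[of N "Suc k"] N k by simp
    next
      case (2 j)
      have "\<not> j \<le> k"
      proof
        assume "j \<le> k"
        then have "Y N (grid N k) \<omega> = Y N (grid N j) \<omega>"
          using Y_frozen[OF N 2(1) w 2(3) grid_mono[of j k N]] grid_mem[of N k] N k by auto
        then show False using 2(3) k(2) by simp
      qed
      then show ?thesis using 2(2) grid_mono[of "Suc k" j N] by simp
    qed
  qed
qed

lemma discounted_Ubar_continuous:
  assumes N: "N \<ge> 1" and w: "\<omega> \<in> space M"
  shows "continuous_on {0..T} (\<lambda>s. Ubar (Y N s \<omega>) / exp (\<rho> * s))"
  by (intro continuous_intros continuous_on_compose2[OF Ubar_cont Y_continuous[OF N w]]) auto

text \<open>Once stopped, neither the state nor the integral moves, while the discount grows and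
  \<open>U\<close> is nonnegative.\<close>

lemma lyap_exponent_step_stopped:
  assumes N: "N \<ge> 1" "k < N" and w: "\<omega> \<in> space M" and t: "grid N k \<le> t" "t \<le> grid N (Suc k)"
    and big: "cutoff N < norm (Y N (grid N k) \<omega>)"
  shows "lyap_exponent N t \<omega> \<le> lyap_exponent N (grid N k) \<omega>"
proof -
  have "t \<le> T" using t(2) grid_mem[of N "Suc k"] N by simp
  then have Yt: "Y N t \<omega> = Y N (grid N k) \<omega>" using Y_frozen[OF N(1) _ w big t(1)] N by simp
  have tau: "\<tau> N \<omega> \<le> grid N k" using tau_bounds(3)[OF N(1) w _ big] N by simp
  have "U (Y N (grid N k) \<omega>) / exp (\<rho> * t) \<le> U (Y N (grid N k) \<omega>) / exp (\<rho> * grid N k)"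
    using t rho U_nonneg by (intro divide_left_mono) (auto intro!: mult_left_mono)
  then show ?thesis using tau t by (simp add: lyap_exponent_def Yt min_absorb2)
qed

lemma lyap_exponent_step_running:
  assumes N: "N \<ge> 1" "k < N" and w: "\<omega> \<in> space M" and t: "grid N k \<le> t" "t \<le> grid N (Suc k)"
    and small: "norm (Y N (grid N k) \<omega>) \<le> cutoff N"
  shows "lyap_exponent N t \<omega> = lyap_exponent N (grid N k) \<omega> + U (Y N t \<omega>) / exp (\<rho> * t)
     - U (Y N (grid N k) \<omega>) / exp (\<rho> * grid N k) + integral {grid N k..t} (\<lambda>s. Ubar (Y N s \<omega>) / exp (\<rho> * s))"
proof -
  have tT: "t \<le> T" using t(2) grid_mem[of N "Suc k"] N by simp
  have tau: "grid N (Suc k) \<le> \<tau> N \<omega>" using tau_bounds(4)[OF N(1) w N(2) small] .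
  have "integral {0..t} (\<lambda>s. Ubar (Y N s \<omega>) / exp (\<rho> * s))
      = integral {0..grid N k} (\<lambda>s. Ubar (Y N s \<omega>) / exp (\<rho> * s)) + integral {grid N k..t} (\<lambda>s. Ubar (Y N s \<omega>) / exp (\<rho> * s))"
    using grid_mem[of N k] N t tT discounted_Ubar_continuous[OF N(1) w]
    by (intro Henstock_Kurzweil_Integration.integral_combine[symmetric] integrable_continuous_real)
      (auto intro: continuous_on_subset)
  moreover have "min t (\<tau> N \<omega>) = t" "min (grid N k) (\<tau> N \<omega>) = grid N k" using tau t by auto
  ultimately show ?thesis by (simp add: lyap_exponent_def)
qed

text \<open>Passing from grid point to grid point and distinguishing whether the step is stopped
  removes the random upper limit of the integral.\<close>

lemma lyap_exponent_measurable:
  assumes N: "N \<ge> 1" "k \<le> N"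
  shows "lyap_exponent N (grid N k) \<in> borel_measurable (F (grid N k))"
  using N(2)
proof (induction k)
  case 0
  have "(\<lambda>\<omega>. U (X0 \<omega>)) \<in> borel_measurable (F 0)" using X0_measurable by measurable
  moreover have "lyap_exponent N 0 \<omega> = U (X0 \<omega>)" if "\<omega> \<in> space M" for \<omega>
    using tau_bounds(1)[OF N(1) that] Y_init[OF N(1) that] by (simp add: lyap_exponent_def min_absorb1)
  ultimately have "lyap_exponent N 0 \<in> borel_measurable (F 0)"
    using space_F[of 0] T_pos by (subst measurable_cong[of _ _ "\<lambda>\<omega>. U (X0 \<omega>)"]) auto
  then show ?case by simp
next
  case (Suc k)
  let ?s = "grid N k" and ?t = "grid N (Suc k)"
  have k: "k < N" using Suc.prems by simp
  have st: "0 \<le> ?s" "?s \<le> ?t" "?t \<le> T" using grid_mem[of N k] grid_mem[of N "Suc k"] grid_less[of N k] N k by auto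
  let ?J = "\<lambda>\<omega>. integral {?s..?t} (\<lambda>s. Ubar (Y N s \<omega>) / exp (\<rho> * s))"
  have Ym: "Y N r \<in> borel_measurable (F ?t)" if "r \<in> {?s..?t}" for r
    by (rule measurable_F_mono[OF _ _ _ Y_measurable[OF N(1)]]) (use that st in auto)
  have J[measurable]: "?J \<in> borel_measurable (F ?t)"
  proof (rule borel_measurable_integral_continuous[OF st(2)])
    show "(\<lambda>\<omega>. Ubar (Y N r \<omega>) / exp (\<rho> * r)) \<in> borel_measurable (F ?t)" if "r \<in> {?s..?t}" for r
      using Ym[OF that] by measurable
    show "continuous_on {?s..?t} (\<lambda>s. Ubar (Y N s \<omega>) / exp (\<rho> * s))" if "\<omega> \<in> space (F ?t)" for \<omega>
      using discounted_Ubar_continuous[OF N(1), of \<omega>] that space_F[of ?t] st by (auto intro: continuous_on_subset)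
  qed
  have [measurable]: "Y N ?s \<in> borel_measurable (F ?t)" "Y N ?t \<in> borel_measurable (F ?t)" using Ym st by auto
  have [measurable]: "lyap_exponent N ?s \<in> borel_measurable (F ?t)"
    using measurable_F_mono[OF st] Suc by simp
  have "(\<lambda>\<omega>. if norm (Y N ?s \<omega>) \<le> cutoff N then lyap_exponent N ?s \<omega> + U (Y N ?t \<omega>) / exp (\<rho> * ?t)
     - U (Y N ?s \<omega>) / exp (\<rho> * ?s) + ?J \<omega>
     else lyap_exponent N ?s \<omega> + U (Y N ?t \<omega>) / exp (\<rho> * ?t) - U (Y N ?s \<omega>) / exp (\<rho> * ?s)) \<in> borel_measurable (F ?t)"
    by measurable
  moreover have "lyap_exponent N ?t \<omega> = (if norm (Y N ?s \<omega>) \<le> cutoff N then lyap_exponent N ?s \<omega> + U (Y N ?t \<omega>) / exp (\<rho> * ?t)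
     - U (Y N ?s \<omega>) / exp (\<rho> * ?s) + ?J \<omega>
     else lyap_exponent N ?s \<omega> + U (Y N ?t \<omega>) / exp (\<rho> * ?t) - U (Y N ?s \<omega>) / exp (\<rho> * ?s))"
    if w: "\<omega> \<in> space M" for \<omega>
  proof (cases "norm (Y N ?s \<omega>) \<le> cutoff N")
    case True
    then show ?thesis using lyap_exponent_step_running[OF N(1) k w st(2) order_refl] by simp
  next
    case False
    then have "\<tau> N \<omega> \<le> ?s" using tau_bounds(3)[OF N(1) w, of k] k by simp
    then show ?thesis using False st by (simp add: lyap_exponent_def min_absorb2)
  qed
  ultimately show ?case using space_F[of ?t] st by (subst measurable_cong) auto
qed


section \<open>Bounds within the cutoff\<close>

lemma cutoff_ge_1: "1 \<le> cutoff N"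
  by (simp add: cutoff_def)

text \<open>The general estimate with \<epsilon> = \<open>1/4\<close>, applied to
  \<open>h = T / real N\<close>, whose logarithm differs from that of \<open>real N / T\<close> only
  in sign. The maximum with 1 meets the requirement that the upper bound for \<open>h\<close> be at
  least 1.\<close>

lemma cutoff_powr_le:
  assumes N: "N \<ge> 1"
  shows "cutoff N powr a * (T / real N) powr (1/4) \<le> exp (a\<^sup>2) * (max 1 T) powr (1/2)"
proof -
  have h: "0 < T / real N" "T / real N \<le> max 1 T"
    using N T_pos by (auto simp: divide_le_eq le_max_iff_disj mult_le_cancel_left1)
  have "ln (real N / T) = - ln (T / real N)" using N T_pos by (simp add: ln_div)
  then have "cutoff N = exp (sqrt \<bar>ln (T / real N)\<bar>)" by (simp add: cutoff_def)
  then show ?thesis using exp_sqrt_abs_ln_powr_le[of "1/4" "T / real N" "max 1 T" a] h by simp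
qed

lemma cutoff_powr_mono: "a \<le> b \<Longrightarrow> cutoff N powr a \<le> cutoff N powr b"
  using cutoff_ge_1 by (intro powr_mono) auto

lemma one_plus_U_powr_le: "e \<le> 1 \<Longrightarrow> (1 + U x) powr e \<le> 1 + U x"
  using powr_mono[of e 1 "1 + U x"] U_nonneg[of x] by simp

lemma derivative_bounds:
  "norm (U1 x) \<le> c * (1 + U x)" "norm (U2 x) \<le> c * (1 + U x)" "norm (U3 x) \<le> c * (1 + U x)"
proof -
  have e: "max (1 - i / p) 0 \<le> 1" if "0 \<le> i" for i using that p_ge by simp
  have *: "c * (1 + U x) powr max (1 - i / p) 0 \<le> c * (1 + U x)" if "0 \<le> i" for i
    using c_ge e[OF that] by (intro mult_left_mono one_plus_U_powr_le) auto
  show "norm (U1 x) \<le> c * (1 + U x)" "norm (U2 x) \<le> c * (1 + U x)" "norm (U3 x) \<le> c * (1 + U x)"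
    using order_trans[OF U1_bd *] order_trans[OF U2_bd *] order_trans[OF U3_bd *] by auto
qed

text \<open>Here the exponent \<open>1 - 1 / p\<close> of the first derivative pays off:
  \<open>U\<close> grows at most polynomially, so on the ball given by the cutoff it is bounded by a
  power of the cutoff.\<close>

lemma U_growth: "1 + U x \<le> ((1 + U 0) powr (1 / p) + c * norm x) powr p"
proof (rule polynomial_growth_of_gradient_bound[OF U_nonneg U1_deriv p_ge])
  have "max (1 - 1 / p) 0 = 1 - 1 / p" using p_ge by simp
  then show "norm (U1 y) \<le> c * (1 + U y) powr (1 - 1 / p)" for y using U1_bd[of y] by simp
qed (use c_ge in simp)

text \<open>Provides the constant \<Lambda> of a single step as a sequence in \<open>N\<close>.
  Derivatives are controlled in a neighbourhood of radius \<open>1/2\<close> because a tamed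
  increment is no longer than that. The last conclusion states the price: every power of
  \<open>Lam N\<close> is bounded by a multiple of \<open>h\<close> to the power
  \<open>- 1/4\<close>.\<close>

lemma local_bounds:
  obtains Lam :: "nat \<Rightarrow> real" where
    "\<And>N. N \<ge> 1 \<Longrightarrow> 1 \<le> Lam N" "\<And>N. N \<ge> 1 \<Longrightarrow> sqrt T \<le> Lam N" "\<And>N. N \<ge> 1 \<Longrightarrow> \<rho> \<le> Lam N"
    "\<And>N x. N \<ge> 1 \<Longrightarrow> norm x \<le> cutoff N \<Longrightarrow> \<bar>U x\<bar> \<le> Lam N"
    "\<And>N x. N \<ge> 1 \<Longrightarrow> norm x \<le> cutoff N \<Longrightarrow> norm (\<mu> x) \<le> Lam N"
    "\<And>N x. N \<ge> 1 \<Longrightarrow> norm x \<le> cutoff N \<Longrightarrow> norm (\<sigma> x) \<le> Lam N"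
    "\<And>N x. N \<ge> 1 \<Longrightarrow> norm x \<le> cutoff N \<Longrightarrow> \<bar>Ubar x\<bar> \<le> Lam N"
    "\<And>N x y. N \<ge> 1 \<Longrightarrow> norm x \<le> cutoff N \<Longrightarrow> norm (y - x) \<le> 1/2 \<Longrightarrow> norm (U1 y) \<le> Lam N"
    "\<And>N x y. N \<ge> 1 \<Longrightarrow> norm x \<le> cutoff N \<Longrightarrow> norm (y - x) \<le> 1/2 \<Longrightarrow> norm (U2 y) \<le> Lam N"
    "\<And>N x y. N \<ge> 1 \<Longrightarrow> norm x \<le> cutoff N \<Longrightarrow> norm (y - x) \<le> 1/2 \<Longrightarrow> norm (U3 y) \<le> Lam N"
    "\<And>N x y. N \<ge> 1 \<Longrightarrow> norm x \<le> cutoff N \<Longrightarrow> norm (y - x) \<le> 1/2 \<Longrightarrow> \<bar>Ubar y - Ubar x\<bar> \<le> Lam N * norm (y - x)"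
    "\<And>n. \<exists>C. \<forall>N\<ge>1. Lam N ^ n * (T / real N) powr (1/4) \<le> C"
proof -
  \<comment> \<open>\<open>A\<close> is the constant in the bound of \<open>1 + U\<close> on the
    ball of radius \<open>2 * cutoff N\<close>. The exponent \<open>q\<close> exceeds
    \<open>p\<close> (for \<open>U\<close> and its derivatives), \<open>c\<close> (for the
    coefficients) and \<open>c + 1\<close> (for \<open>Ubar\<close>); \<open>K0\<close> is the sum
    of all prefactors that occur.\<close>
  define A where "A = ((1 + U 0) powr (1 / p) + 2 * c) powr p"
  define q where "q = p + c + 1"
  define K0 where "K0 = (1 + sqrt T + \<rho>) + A + c * A + 2 * c + (\<bar>Ubar 0\<bar> + 2 * c) + c * (2 + 2 powr c)"
  define Lam where "Lam N = K0 * cutoff N powr q" for N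
  have A0: "0 \<le> A" by (simp add: A_def)
  have c0: "0 \<le> c" using c_ge by simp
  have "0 \<le> c * A" "0 \<le> c * (2 + 2 powr c)" "0 \<le> sqrt T" using A0 c0 T_pos by auto
  then have K: "1 + sqrt T + \<rho> \<le> K0" "A \<le> K0" "c * A \<le> K0" "2 * c \<le> K0" "\<bar>Ubar 0\<bar> + 2 * c \<le> K0"
    "c * (2 + 2 powr c) \<le> K0" "0 \<le> K0"
    unfolding K0_def using A0 c0 rho abs_ge_zero[of "Ubar 0"] by linarith+
  note nn = A0 c0 K
  have LamI: "r \<le> Lam N" if "r \<le> k * cutoff N powr a" "a \<le> q" "0 \<le> k" "k \<le> K0" for r k a N
  proof -
    have "k * cutoff N powr a \<le> K0 * cutoff N powr q"
      using that by (intro mult_mono cutoff_powr_mono) auto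
    then show ?thesis using that by (simp add: Lam_def)
  qed
  have q0: "0 \<le> q" "p \<le> q" "c \<le> q" "c + 1 \<le> q" using p_ge c_ge by (auto simp: q_def)
  have U_le: "1 + U y \<le> A * cutoff N powr p" if "norm y \<le> 2 * cutoff N" for y N
  proof -
    have "(1 + U 0) powr (1 / p) * 1 \<le> (1 + U 0) powr (1 / p) * cutoff N"
      using cutoff_ge_1 by (intro mult_left_mono) auto
    then have "(1 + U 0) powr (1 / p) + c * norm y \<le> ((1 + U 0) powr (1 / p) + 2 * c) * cutoff N"
      using mult_left_mono[OF that c0] by (simp add: algebra_simps)
    then have "((1 + U 0) powr (1 / p) + c * norm y) powr p \<le> (((1 + U 0) powr (1 / p) + 2 * c) * cutoff N) powr p"
      using p_ge c0 by (intro powr_mono2) auto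
    also have "\<dots> = A * cutoff N powr p"
      using c0 cutoff_ge_1[of N] by (simp add: A_def powr_mult)
    finally show ?thesis using U_growth[of y] by linarith
  qed
  \<comment> \<open>The cutoff is at least 1, so a displacement of \<open>1/2\<close> at most
    doubles the radius.\<close>
  have near: "norm y \<le> 2 * cutoff N" if "norm x \<le> cutoff N" "norm (y - x) \<le> 1/2" for x y :: "real^'d" and N
    using that cutoff_ge_1[of N] norm_triangle_ineq[of "y - x" x] by simp
  have cA: "c * (1 + U y) \<le> Lam N" if "norm y \<le> 2 * cutoff N" for y N
    using mult_left_mono[OF U_le[OF that] c0] nn q0 by (intro LamI[of _ "c * A" N p]) (auto simp: mult.assoc)
  have powc: "norm x powr c \<le> cutoff N powr c" if "norm x \<le> cutoff N" for x :: "real^'d" and N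
    using that c0 by (intro powr_mono2) auto
  have one: "1 \<le> cutoff N powr a" if "0 \<le> a" for N a using cutoff_ge_1 that by (rule ge_one_powr_ge_zero)
  have gr: "norm (\<mu> x) + norm (\<sigma> x) \<le> Lam N" if "norm x \<le> cutoff N" for x N
  proof (rule LamI[of _ "2 * c" N c])
    have "c * (1 + norm x powr c) \<le> c * (2 * cutoff N powr c)"
      using powc[OF that] one[of c N] c0 by (intro mult_left_mono) auto
    then show "norm (\<mu> x) + norm (\<sigma> x) \<le> 2 * c * cutoff N powr c" using growth[of x] by simp
  qed (use nn q0 in \<open>auto\<close>)
  have const: "r \<le> Lam N" if "0 \<le> r" "r \<le> 1 + sqrt T + \<rho>" for r N
    using that nn q0 mult_left_mono[OF one[of q N] that(1)] by (intro LamI[of _ r N q]) auto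
  have Ub: "\<bar>Ubar x\<bar> \<le> Lam N" if x: "norm x \<le> cutoff N" for x N
  proof (rule LamI[of _ "\<bar>Ubar 0\<bar> + 2 * c" N "c + 1"])
    have "\<bar>Ubar x\<bar> \<le> \<bar>Ubar 0\<bar> + c * (1 + norm x powr c) * norm x"
      using Ubar_lip[of x 0] c_ge by simp
    also have "c * (1 + norm x powr c) * norm x \<le> c * (2 * cutoff N powr c) * cutoff N"
      using powc[OF x] one[of c N] c0 x cutoff_ge_1[of N] by (intro mult_mono) auto
    also have "\<dots> = 2 * c * cutoff N powr (c + 1)"
      using cutoff_ge_1[of N] by (simp add: powr_add)
    also have "\<bar>Ubar 0\<bar> \<le> \<bar>Ubar 0\<bar> * cutoff N powr (c + 1)"
      using one[of "c + 1" N] c0 by (simp add: mult_le_cancel_left1)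
    finally show "\<bar>Ubar x\<bar> \<le> (\<bar>Ubar 0\<bar> + 2 * c) * cutoff N powr (c + 1)" by (simp add: distrib_right)
  qed (use nn q0 in \<open>auto\<close>)
  have Lip: "\<bar>Ubar y - Ubar x\<bar> \<le> Lam N * norm (y - x)" if x: "norm x \<le> cutoff N" and y: "norm (y - x) \<le> 1/2" for x y N
  proof -
    have "norm y powr c \<le> (2 * cutoff N) powr c" using near[OF x y] c0 by (intro powr_mono2) auto
    also have "\<dots> = 2 powr c * cutoff N powr c" using cutoff_ge_1[of N] by (simp add: powr_mult)
    finally have "c * (1 + norm y powr c + norm x powr c) \<le> c * ((2 + 2 powr c) * cutoff N powr c)"
      using powc[OF x] one[of c N] c0 by (intro mult_left_mono) (auto simp: distrib_right)
    then have "c * (1 + norm y powr c + norm x powr c) \<le> Lam N"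
      using nn q0 by (intro LamI[of _ "c * (2 + 2 powr c)" N c]) (auto simp: mult.assoc)
    then have "c * (1 + norm y powr c + norm x powr c) * norm (y - x) \<le> Lam N * norm (y - x)"
      by (rule mult_right_mono) simp
    then show ?thesis using Ubar_lip[of y x] by linarith
  qed
  have pow: "\<exists>C. \<forall>N\<ge>1. Lam N ^ n * (T / real N) powr (1/4) \<le> C" for n
  proof (intro exI allI impI)
    fix N :: nat assume N: "1 \<le> N"
    have "(cutoff N powr q) ^ n = cutoff N powr (q * real n)"
      using cutoff_ge_1[of N] by (simp add: powr_powr[symmetric] powr_realpow)
    then have "Lam N ^ n * (T / real N) powr (1/4) = K0 ^ n * (cutoff N powr (q * real n) * (T / real N) powr (1/4))"
      by (simp add: Lam_def power_mult_distrib)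
    also have "\<dots> \<le> K0 ^ n * (exp ((q * real n)\<^sup>2) * (max 1 T) powr (1/2))"
      using K by (intro mult_left_mono cutoff_powr_le[OF N]) auto
    finally show "Lam N ^ n * (T / real N) powr (1/4) \<le> K0 ^ n * (exp ((q * real n)\<^sup>2) * (max 1 T) powr (1/2))" .
  qed
  show thesis
  proof (rule that[of Lam])
    show "\<bar>U x\<bar> \<le> Lam N" if "norm x \<le> cutoff N" for N x
    proof (rule LamI[of _ A N p])
      show "\<bar>U x\<bar> \<le> A * cutoff N powr p" using U_le[of x N] U_nonneg[of x] that cutoff_ge_1[of N] by simp
    qed (use nn q0 in \<open>auto\<close>)
    show "norm (\<mu> x) \<le> Lam N" "norm (\<sigma> x) \<le> Lam N" if "norm x \<le> cutoff N" for N x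
      using gr[OF that] norm_ge_zero[of "\<mu> x"] norm_ge_zero[of "\<sigma> x"] by linarith+
    show "norm (U1 y) \<le> Lam N" "norm (U2 y) \<le> Lam N" "norm (U3 y) \<le> Lam N"
      if "norm x \<le> cutoff N" "norm (y - x) \<le> 1/2" for N x y
      using derivative_bounds[of y] cA[OF near[OF that]] by linarith+
      have "0 \<le> sqrt T" using T_pos by simp
    then show "1 \<le> Lam N" "sqrt T \<le> Lam N" "\<rho> \<le> Lam N" for N using rho by (auto intro!: const)
  qed (use Ub Lip pow in auto)
qed

end

lemma exp_le_one_plus_abs:
  fixes b K :: real
  assumes "\<bar>b\<bar> \<le> K"
  shows "exp b \<le> 1 + exp K * \<bar>b\<bar>"
proof -
  obtain t where t: "\<bar>t\<bar> \<le> \<bar>b\<bar>" "exp b = (\<Sum>m<1. b ^ m / fact m) + exp t / fact 1 * b ^ 1"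
    using Maclaurin_exp_le[of b 1] by blast
  have "exp t * b \<le> exp t * \<bar>b\<bar>" by (intro mult_left_mono) auto
  also have "\<dots> \<le> exp K * \<bar>b\<bar>" using t(1) assms by (intro mult_right_mono) auto
  finally show ?thesis using t(2) by simp
qed

lemma (in filtered_brownian_motion) nn_integral_mult_incr_le:
  assumes st: "0 \<le> s" "s \<le> t" "t \<le> T"
    and f[measurable]: "f \<in> borel_measurable (F s)" and g[measurable]: "g \<in> borel_measurable borel"
    and C: "(\<integral>\<^sup>+\<omega>. g (incr s t \<omega>) \<partial>M) \<le> C"
  shows "(\<integral>\<^sup>+\<omega>. f \<omega> * g (incr s t \<omega>) \<partial>M) \<le> C * (\<integral>\<^sup>+\<omega>. f \<omega> \<partial>M)"
proof (cases "s = t")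
  case True
  have "f \<in> borel_measurable M" by (rule measurable_F_M[OF _ f]) (use st in auto)
  then have "(\<integral>\<^sup>+\<omega>. f \<omega> * g (incr s t \<omega>) \<partial>M) = (\<integral>\<^sup>+\<omega>. f \<omega> \<partial>M) * g 0"
    using True by (simp add: nn_integral_multc)
  moreover have "g 0 \<le> C" using C True by (simp add: emeasure_space_1)
  ultimately show ?thesis by (simp add: mult.commute mult_right_mono)
next
  case False
  then have "(\<integral>\<^sup>+\<omega>. f \<omega> * g (incr s t \<omega>) \<partial>M) = (\<integral>\<^sup>+\<omega>. f \<omega> \<partial>M) * (\<integral>\<^sup>+\<omega>. g (incr s t \<omega>) \<partial>M)"
    using st by (intro nn_integral_mult_incr f g) auto
  also have "\<dots> \<le> (\<integral>\<^sup>+\<omega>. f \<omega> \<partial>M) * C" using C by (rule mult_left_mono) simp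
  finally show ?thesis by (simp add: mult.commute)
qed

context tamed_euler_scheme
begin

section \<open>One step of the Lyapunov exponent\<close>

text \<open>\<open>growth\<close> of the one-step locale with the state as an explicit argument, so
  that joint measurability in state and increment can be stated.\<close>

definition step_growth :: "real \<Rightarrow> real \<Rightarrow> real^'d \<Rightarrow> real^'m \<Rightarrow> real" where
  "step_growth s u x z = exp (- \<rho> * (s + u)) * U (x + tamed (u *\<^sub>R \<mu> x + \<sigma> x *v z))
     - exp (- \<rho> * s) * U x + u * exp (- \<rho> * s) * Ubar x"

lemma step_growth_eq:
  assumes "one_step U U1 U2 U3 x (\<mu> x) (\<sigma> x) \<rho> \<Lambda> h s u (Ubar x)"
  shows "one_step.growth U x (\<mu> x) (\<sigma> x) \<rho> s u (Ubar x) = step_growth s u x"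
proof -
  interpret one_step U U1 U2 U3 x "\<mu> x" "\<sigma> x" \<rho> \<Lambda> h s u "Ubar x" by (rule assms)
  show ?thesis by (simp add: fun_eq_iff growth_def drift_def e0_def e1_def step_growth_def)
qed

abbreviation running :: "nat \<Rightarrow> nat \<Rightarrow> 'a set" where
  "running N k \<equiv> {\<omega> \<in> space M. norm (Y N (grid N k) \<omega>) \<le> cutoff N}"

lemma running_sets: "N \<ge> 1 \<Longrightarrow> k \<le> N \<Longrightarrow> running N k \<in> sets (F (grid N k))"
proof -
  assume *: "N \<ge> 1" "k \<le> N"
  note [measurable] = Y_grid_measurable[OF *]
  have "{\<omega> \<in> space (F (grid N k)). norm (Y N (grid N k) \<omega>) \<le> cutoff N} \<in> sets (F (grid N k))" by measurable
  then show ?thesis using space_F[OF grid_mem[OF *]] by simp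
qed

text \<open>\<open>B\<close> is the error of freezing the integrand at the left endpoint of the
  step. The first bound is small, of order \<open>h\<close> to the power \<open>3/2\<close> in the
  mean. The second is deterministic; it makes the exponential of \<open>B\<close> comparable to
  \<open>1\<close> plus a multiple of the absolute value of \<open>B\<close>.\<close>

lemma Ubar_increment_bound:
  assumes N: "N \<ge> 1" "k < N" and w: "\<omega> \<in> running N k" and t: "grid N k \<le> t" "t \<le> grid N (Suc k)"
    and os: "\<And>u. 0 \<le> u \<Longrightarrow> u \<le> T / real N \<Longrightarrow> one_step U U1 U2 U3 (Y N (grid N k) \<omega>) (\<mu> (Y N (grid N k) \<omega>)) (\<sigma> (Y N (grid N k) \<omega>)) \<rho> \<Lambda> (T / real N) (grid N k) u (Ubar (Y N (grid N k) \<omega>))"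
    and lip: "\<And>y. norm (y - Y N (grid N k) \<omega>) \<le> 1/2 \<Longrightarrow> \<bar>Ubar y - Ubar (Y N (grid N k) \<omega>)\<bar> \<le> \<Lambda> * norm (y - Y N (grid N k) \<omega>)"
  defines "B \<equiv> integral {grid N k..t} (\<lambda>r. Ubar (Y N r \<omega>) / exp (\<rho> * r)) - (t - grid N k) * exp (- \<rho> * grid N k) * Ubar (Y N (grid N k) \<omega>)"
  shows "\<bar>B\<bar> \<le> 3 * \<Lambda> ^ 3 * integral {grid N k..t} (\<lambda>r. sqrt (T / real N) + norm (incr (grid N k) r \<omega>))"
    and "\<bar>B\<bar> \<le> (T / real N) * (\<Lambda> + \<Lambda>\<^sup>2 * (T / real N))"
proof -
  let ?s = "grid N k" and ?h = "T / real N"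
  let ?x = "Y N ?s \<omega>"
  have wM: "\<omega> \<in> space M" and small: "norm ?x \<le> cutoff N" using w by auto
  have h0: "0 < ?h" using N T_pos by simp
  have tT: "{?s..t} \<subseteq> {0..T}" using t grid_mem[of N k] grid_mem[of N "Suc k"] N by auto
  have \<Lambda>1: "1 \<le> \<Lambda>" using one_step.\<Lambda>1[OF os[of 0]] h0 by simp
  have pt: "\<bar>Ubar (Y N r \<omega>) / exp (\<rho> * r) - exp (- \<rho> * ?s) * Ubar ?x\<bar> \<le> \<Lambda> * norm (Y N r \<omega> - ?x) + \<rho> * (r - ?s) * \<Lambda>"
    and inc: "norm (Y N r \<omega> - ?x) \<le> 1/2" "norm (Y N r \<omega> - ?x) \<le> 2 * \<Lambda>\<^sup>2 * (sqrt ?h + norm (incr ?s r \<omega>))"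
    if r: "r \<in> {?s..t}" for r
  proof -
    have u: "0 \<le> r - ?s" "r - ?s \<le> ?h" using r t grid_Suc[of N k] by auto
    interpret one_step U U1 U2 U3 ?x "\<mu> ?x" "\<sigma> ?x" \<rho> \<Lambda> ?h ?s "r - ?s" "Ubar ?x" by (rule os[OF u])
    have Y: "Y N r \<omega> - ?x = tamed (drift (incr ?s r \<omega>))"
      using Y_step'[OF N wM, of r] r t small by (simp add: drift_def)
    show 1: "norm (Y N r \<omega> - ?x) \<le> 1/2" unfolding Y by (rule norm_tamed_le_half)
    show "norm (Y N r \<omega> - ?x) \<le> 2 * \<Lambda>\<^sup>2 * (sqrt ?h + norm (incr ?s r \<omega>))"
      unfolding Y using order_trans[OF norm_tamed_le norm_drift_le[of "incr ?s r \<omega>"]] by (simp add: wscale_def)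
    have e: "Ubar (Y N r \<omega>) / exp (\<rho> * r) - exp (- \<rho> * ?s) * Ubar ?x = e1 * (Ubar (Y N r \<omega>) - Ubar ?x) + (e1 - e0) * Ubar ?x"
      by (simp add: e1_def e0_def exp_minus divide_inverse algebra_simps)
    have "\<bar>e1 * (Ubar (Y N r \<omega>) - Ubar ?x)\<bar> \<le> 1 * (\<Lambda> * norm (Y N r \<omega> - ?x))"
      by (intro abs_mult_le_mult abs_e1 lip 1)
    moreover have "\<bar>(e1 - e0) * Ubar ?x\<bar> \<le> (\<rho> * (r - ?s)) * \<Lambda>"
      by (intro abs_mult_le_mult Ub_bd discount_diff)
    ultimately show "\<bar>Ubar (Y N r \<omega>) / exp (\<rho> * r) - exp (- \<rho> * ?s) * Ubar ?x\<bar> \<le> \<Lambda> * norm (Y N r \<omega> - ?x) + \<rho> * (r - ?s) * \<Lambda>"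
      unfolding e by linarith
  qed
  interpret one_step U U1 U2 U3 ?x "\<mu> ?x" "\<sigma> ?x" \<rho> \<Lambda> ?h ?s 0 "Ubar ?x" by (rule os) (use h0 in auto)
  have cont: "continuous_on {?s..t} (\<lambda>r. Ubar (Y N r \<omega>) / exp (\<rho> * r))"
    using discounted_Ubar_continuous[OF N(1) wM] tT continuous_on_subset by blast
  have W: "continuous_on {?s..t} (\<lambda>r. W r \<omega>)" using W_continuous[OF wM] tT continuous_on_subset by blast
  have B: "B = integral {?s..t} (\<lambda>r. Ubar (Y N r \<omega>) / exp (\<rho> * r) - exp (- \<rho> * ?s) * Ubar ?x)"
    unfolding B_def using integrable_continuous_real[OF cont] t by (subst integral_diff) auto
  have "norm B \<le> integral {?s..t} (\<lambda>r. 3 * \<Lambda> ^ 3 * (sqrt ?h + norm (incr ?s r \<omega>)))"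
    unfolding B
  proof (rule integral_norm_bound_integral)
    show "(\<lambda>r. Ubar (Y N r \<omega>) / exp (\<rho> * r) - exp (- \<rho> * ?s) * Ubar ?x) integrable_on {?s..t}"
      by (intro integrable_continuous_real continuous_intros cont)
    show "(\<lambda>r. 3 * \<Lambda> ^ 3 * (sqrt ?h + norm (incr ?s r \<omega>))) integrable_on {?s..t}"
      by (intro integrable_continuous_real continuous_intros W)
    fix r assume r: "r \<in> {?s..t}"
    let ?w = "sqrt ?h + norm (incr ?s r \<omega>)"
    have "\<rho> * (r - ?s) * \<Lambda> \<le> \<Lambda> * ?h * \<Lambda>"
      using r t grid_Suc[of N k] \<rho> \<Lambda>1 h0 by (intro mult_right_mono mult_mono) auto
    also have "?h = sqrt ?h * sqrt ?h" using h0 by (simp only: real_sqrt_mult_self abs_of_pos)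
    also have "\<Lambda> * (sqrt ?h * sqrt ?h) * \<Lambda> \<le> \<Lambda> * (\<Lambda> * ?w) * \<Lambda>"
      using \<Lambda>1 h\<Lambda> h0 by (intro mult_right_mono mult_left_mono mult_mono) auto
    finally have 1: "\<rho> * (r - ?s) * \<Lambda> \<le> \<Lambda> ^ 3 * ?w" by (simp add: power3_eq_cube mult_ac)
    have "\<Lambda> * norm (Y N r \<omega> - ?x) \<le> \<Lambda> * (2 * \<Lambda>\<^sup>2 * ?w)" using inc(2)[OF r] \<Lambda>1 by (intro mult_left_mono) auto
    then have "\<Lambda> * norm (Y N r \<omega> - ?x) \<le> 2 * (\<Lambda> ^ 3 * ?w)" by (simp add: power3_eq_cube power2_eq_square mult_ac)
    then show "norm (Ubar (Y N r \<omega>) / exp (\<rho> * r) - exp (- \<rho> * ?s) * Ubar ?x) \<le> 3 * \<Lambda> ^ 3 * ?w"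
      using pt[OF r] 1 by simp
  qed
  then show "\<bar>B\<bar> \<le> 3 * \<Lambda> ^ 3 * integral {?s..t} (\<lambda>r. sqrt ?h + norm (incr ?s r \<omega>))" by simp
  have "norm B \<le> (\<Lambda> + \<Lambda>\<^sup>2 * ?h) * (t - ?s)"
    unfolding B
  proof (rule integral_bound)
    show "continuous_on {?s..t} (\<lambda>r. Ubar (Y N r \<omega>) / exp (\<rho> * r) - exp (- \<rho> * ?s) * Ubar ?x)"
      by (intro continuous_intros cont)
    fix r assume r: "r \<in> {?s..t}"
    have "\<rho> * (r - ?s) * \<Lambda> \<le> \<Lambda> * ?h * \<Lambda>"
      using r t grid_Suc[of N k] \<rho> \<Lambda>1 h0 by (intro mult_right_mono mult_mono) auto
    moreover have "\<Lambda> * norm (Y N r \<omega> - ?x) \<le> \<Lambda> * 1" using inc(1)[OF r] \<Lambda>1 by (intro mult_left_mono) auto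
    ultimately show "norm (Ubar (Y N r \<omega>) / exp (\<rho> * r) - exp (- \<rho> * ?s) * Ubar ?x) \<le> \<Lambda> + \<Lambda>\<^sup>2 * ?h"
      using pt[OF r] by (simp add: power2_eq_square mult_ac)
  qed (use t in auto)
  also have "\<dots> \<le> (\<Lambda> + \<Lambda>\<^sup>2 * ?h) * ?h"
  proof (rule mult_left_mono)
    show "t - ?s \<le> ?h" using t grid_Suc[of N k] by simp
    show "0 \<le> \<Lambda> + \<Lambda>\<^sup>2 * ?h" using \<Lambda>1 h0 by (intro add_nonneg_nonneg mult_nonneg_nonneg) auto
  qed
  finally show "\<bar>B\<bar> \<le> ?h * (\<Lambda> + \<Lambda>\<^sup>2 * ?h)" by (simp add: mult.commute)
qed

lemma step_growth_measurable:
  assumes s: "s \<in> {0..T}" and x: "x \<in> borel_measurable (F s)"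
  shows "(\<lambda>q. step_growth s u (x (fst q)) (snd q)) \<in> borel_measurable (F s \<Otimes>\<^sub>M borel)"
proof -
  note [measurable] = x
  show ?thesis
    unfolding step_growth_def by measurable
qed

text \<open>A pathwise estimate that separates two correlated quantities: the endpoint of the
  increment inside \<open>step_growth\<close> and its whole path inside the freezing error.
  Afterwards each can be integrated on its own.\<close>

lemma lyap_exponent_step_bound:
  assumes N: "N \<ge> 1" "k < N" and w: "\<omega> \<in> running N k" and t: "grid N k \<le> t" "t \<le> grid N (Suc k)"
    and B: "\<bar>integral {grid N k..t} (\<lambda>r. Ubar (Y N r \<omega>) / exp (\<rho> * r)) - (t - grid N k) * exp (- \<rho> * grid N k) * Ubar (Y N (grid N k) \<omega>)\<bar>
       \<le> L * integral {grid N k..t} (\<lambda>r. sqrt h + norm (incr (grid N k) r \<omega>))"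
      "\<bar>integral {grid N k..t} (\<lambda>r. Ubar (Y N r \<omega>) / exp (\<rho> * r)) - (t - grid N k) * exp (- \<rho> * grid N k) * Ubar (Y N (grid N k) \<omega>)\<bar> \<le> K"
    and h: "0 < h" "t - grid N k \<le> h" and L: "0 \<le> L"
  shows "exp (lyap_exponent N t \<omega>) \<le> exp (lyap_exponent N (grid N k) \<omega>) *
     (exp (step_growth (grid N k) (t - grid N k) (Y N (grid N k) \<omega>) (incr (grid N k) t \<omega>))
      + exp K * L * (h * sqrt h * exp (2 * step_growth (grid N k) (t - grid N k) (Y N (grid N k) \<omega>) (incr (grid N k) t \<omega>))
         + integral {grid N k..t} (\<lambda>r. (sqrt h + norm (incr (grid N k) r \<omega>))\<^sup>2) / sqrt h))"
proof -
  let ?s = "grid N k"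
  let ?x = "Y N ?s \<omega>"
  define g where "g = step_growth ?s (t - ?s) ?x (incr ?s t \<omega>)"
  define b where "b = integral {?s..t} (\<lambda>r. Ubar (Y N r \<omega>) / exp (\<rho> * r)) - (t - ?s) * exp (- \<rho> * ?s) * Ubar ?x"
  let ?w = "\<lambda>r. sqrt h + norm (incr ?s r \<omega>)"
  have wM: "\<omega> \<in> space M" and small: "norm ?x \<le> cutoff N" using w by auto
  have tT: "{?s..t} \<subseteq> {0..T}" using t grid_mem[of N k] grid_mem[of N "Suc k"] N by auto
  have W: "continuous_on {?s..t} (\<lambda>r. W r \<omega>)" using W_continuous[OF wM] tT continuous_on_subset by blast
  have Yt: "Y N t \<omega> = ?x + tamed ((t - ?s) *\<^sub>R \<mu> ?x + \<sigma> ?x *v incr ?s t \<omega>)"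
    using Y_step'[OF N wM t] small by simp
  have Q: "lyap_exponent N t \<omega> = lyap_exponent N ?s \<omega> + g + b"
    unfolding lyap_exponent_step_running[OF N wM t small] g_def b_def step_growth_def Yt
    by (simp add: exp_minus divide_inverse mult_ac)
  have "exp g * integral {?s..t} ?w = integral {?s..t} (\<lambda>r. exp g * ?w r)" by simp
  \<comment> \<open>Young's inequality with weight \<open>sqrt h\<close>: since \<open>?w\<close>
    has order \<open>sqrt h\<close>, both summands have that same order in expectation, and
    integration over the step gives \<open>h * sqrt h\<close>.\<close>
  also have "\<dots> \<le> integral {?s..t} (\<lambda>r. sqrt h * exp (2 * g) + (?w r)\<^sup>2 / sqrt h)"
  proof (rule integral_le)
    show "(\<lambda>r. exp g * ?w r) integrable_on {?s..t}"
      by (intro integrable_continuous_real continuous_intros W)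
    show "(\<lambda>r. sqrt h * exp (2 * g) + (?w r)\<^sup>2 / sqrt h) integrable_on {?s..t}"
      by (intro integrable_continuous_real continuous_intros W) (use h in auto)
    fix r assume "r \<in> {?s..t}"
    have q: "0 < sqrt h" using h by simp
    have "0 \<le> (sqrt h * exp g - ?w r)\<^sup>2" by simp
    then have "2 * (sqrt h * exp g) * ?w r \<le> (sqrt h * exp g)\<^sup>2 + (?w r)\<^sup>2" by (simp add: power2_diff)
    moreover have "0 \<le> (sqrt h * exp g) * ?w r" using h by simp
    ultimately have "(sqrt h * exp g) * ?w r \<le> (sqrt h * exp g)\<^sup>2 + (?w r)\<^sup>2" by linarith
    also have "\<dots> = sqrt h * (sqrt h * exp (2 * g) + (?w r)\<^sup>2 / sqrt h)"
    proof -
      have "(sqrt h * exp g)\<^sup>2 = sqrt h * (sqrt h * exp (2 * g))" by (simp add: exp_double power2_eq_square)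
      moreover have "(?w r)\<^sup>2 = sqrt h * ((?w r)\<^sup>2 / sqrt h)" using q by simp
      ultimately show ?thesis by (simp only: distrib_left)
    qed
    finally show "exp g * ?w r \<le> sqrt h * exp (2 * g) + (?w r)\<^sup>2 / sqrt h"
      using q by (simp only: mult.assoc mult_le_cancel_left_pos)
  qed
  also have "\<dots> = (t - ?s) * (sqrt h * exp (2 * g)) + integral {?s..t} (\<lambda>r. (?w r)\<^sup>2) / sqrt h"
  proof -
    have "(\<lambda>r. (?w r)\<^sup>2) integrable_on {?s..t}" by (intro integrable_continuous_real continuous_intros W)
    then show ?thesis using t by (subst integral_add) (auto intro: integrable_on_divide)
  qed
  also have "(t - ?s) * (sqrt h * exp (2 * g)) \<le> h * (sqrt h * exp (2 * g))" using h by (intro mult_right_mono) auto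
  finally have J: "exp g * integral {?s..t} ?w \<le> h * sqrt h * exp (2 * g) + integral {?s..t} (\<lambda>r. (?w r)\<^sup>2) / sqrt h" by simp
  have "exp b \<le> 1 + exp K * \<bar>b\<bar>" using B(2) unfolding b_def by (rule exp_le_one_plus_abs)
  also have "\<dots> \<le> 1 + exp K * (L * integral {?s..t} ?w)" using B(1) unfolding b_def by (intro add_left_mono mult_left_mono) auto
  finally have "exp g * exp b \<le> exp g * (1 + exp K * (L * integral {?s..t} ?w))" by (rule mult_left_mono) simp
  also have "\<dots> = exp g + exp K * L * (exp g * integral {?s..t} ?w)" by (simp add: algebra_simps)
  also have "\<dots> \<le> exp g + exp K * L * (h * sqrt h * exp (2 * g) + integral {?s..t} (\<lambda>r. (?w r)\<^sup>2) / sqrt h)"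
    using J L by (intro add_left_mono mult_left_mono) auto
  finally have "exp g * exp b \<le> exp g + exp K * L * (h * sqrt h * exp (2 * g) + integral {?s..t} (\<lambda>r. (?w r)\<^sup>2) / sqrt h)" .
  then have "exp (lyap_exponent N ?s \<omega>) * (exp g * exp b) \<le> exp (lyap_exponent N ?s \<omega>) *
     (exp g + exp K * L * (h * sqrt h * exp (2 * g) + integral {?s..t} (\<lambda>r. (?w r)\<^sup>2) / sqrt h))"
    by (rule mult_left_mono) simp
  then show ?thesis by (simp add: Q exp_add g_def mult.assoc)
qed

text \<open>The remainder of a step is a power of \<open>Lam N\<close> times \<open>h\<close> to the
  power \<open>3/2\<close>; a factor \<open>h\<close> to the power \<open>1/4\<close> pays for
  \<open>Lam N\<close> and leaves the exponent \<open>5/4\<close>. The event \<open>A\<close> in the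
  past makes this a conditional statement, which the maximal inequality needs.\<close>

lemma lyap_exponent_step_expectation:
  obtains K where "0 \<le> K"
    "\<And>N k t A. N \<ge> 1 \<Longrightarrow> k < N \<Longrightarrow> grid N k \<le> t \<Longrightarrow> t \<le> grid N (Suc k) \<Longrightarrow> A \<in> sets (F (grid N k)) \<Longrightarrow>
      (\<integral>\<^sup>+\<omega>. ennreal (exp (lyap_exponent N t \<omega>) * indicator A \<omega>) \<partial>M)
      \<le> ennreal (1 + K * (T / real N) powr (5/4)) * (\<integral>\<^sup>+\<omega>. ennreal (exp (lyap_exponent N (grid N k) \<omega>) * indicator A \<omega>) \<partial>M)"
proof -
  obtain Lam :: "nat \<Rightarrow> real" where Lam:
    "\<And>N. N \<ge> 1 \<Longrightarrow> 1 \<le> Lam N" "\<And>N. N \<ge> 1 \<Longrightarrow> sqrt T \<le> Lam N" "\<And>N. N \<ge> 1 \<Longrightarrow> \<rho> \<le> Lam N"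
    "\<And>N x. N \<ge> 1 \<Longrightarrow> norm x \<le> cutoff N \<Longrightarrow> \<bar>U x\<bar> \<le> Lam N"
    "\<And>N x. N \<ge> 1 \<Longrightarrow> norm x \<le> cutoff N \<Longrightarrow> norm (\<mu> x) \<le> Lam N"
    "\<And>N x. N \<ge> 1 \<Longrightarrow> norm x \<le> cutoff N \<Longrightarrow> norm (\<sigma> x) \<le> Lam N"
    "\<And>N x. N \<ge> 1 \<Longrightarrow> norm x \<le> cutoff N \<Longrightarrow> \<bar>Ubar x\<bar> \<le> Lam N"
    "\<And>N x y. N \<ge> 1 \<Longrightarrow> norm x \<le> cutoff N \<Longrightarrow> norm (y - x) \<le> 1/2 \<Longrightarrow> norm (U1 y) \<le> Lam N"
    "\<And>N x y. N \<ge> 1 \<Longrightarrow> norm x \<le> cutoff N \<Longrightarrow> norm (y - x) \<le> 1/2 \<Longrightarrow> norm (U2 y) \<le> Lam N"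
    "\<And>N x y. N \<ge> 1 \<Longrightarrow> norm x \<le> cutoff N \<Longrightarrow> norm (y - x) \<le> 1/2 \<Longrightarrow> norm (U3 y) \<le> Lam N"
    "\<And>N x y. N \<ge> 1 \<Longrightarrow> norm x \<le> cutoff N \<Longrightarrow> norm (y - x) \<le> 1/2 \<Longrightarrow> \<bar>Ubar y - Ubar x\<bar> \<le> Lam N * norm (y - x)"
    and Lam_pow: "\<And>n. \<exists>C. \<forall>N\<ge>1. Lam N ^ n * (T / real N) powr (1/4) \<le> C"
    using local_bounds by blast
  obtain D3 where D3: "\<And>N. N \<ge> 1 \<Longrightarrow> Lam N ^ 3 * (T / real N) powr (1/4) \<le> D3" using Lam_pow[of 3] by blast
  obtain D10 where D10: "\<And>N. N \<ge> 1 \<Longrightarrow> Lam N ^ 10 * (T / real N) powr (1/4) \<le> D10" using Lam_pow[of 10] by blast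
  have h0: "0 < T / real N" and hT: "T / real N \<le> T" if "N \<ge> 1" for N
    using that T_pos by (auto simp: divide_le_eq mult_le_cancel_left1)
  have q0: "0 < (T / real N) powr (1/4)" "(T / real N) powr (1/4) \<le> T powr (1/4)" if "N \<ge> 1" for N
    using that h0[OF that] hT[OF that] by (auto intro!: powr_mono2)
  have sqrt_q: "sqrt (T / real N) = (T / real N) powr (1/4) * (T / real N) powr (1/4)" if "N \<ge> 1" for N
    using h0[OF that] by (simp add: powr_half_sqrt[symmetric] powr_add[symmetric])
  have D0: "0 \<le> D3" "0 \<le> D10"
    using order_trans[OF _ D3[of 1]] order_trans[OF _ D10[of 1]] Lam(1)[of 1] by auto
  have h_split: "T / real N * sqrt (T / real N) = (T / real N) powr (1/4) * (T / real N) powr (5/4)" if "N \<ge> 1" for N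
  proof -
    have "x * sqrt x = x powr (1/4) * x powr (5/4)" if "0 < x" for x :: real
      using that by (simp add: powr_half_sqrt[symmetric] powr_add[symmetric] powr_mult_base)
    then show ?thesis using h0[OF that] by blast
  qed
  \<comment> \<open>Bound for \<open>l * sqrt h\<close> with the exponential rates
    \<open>5 * Lam N ^ 3\<close> and \<open>10 * Lam N ^ 3\<close>. Half of \<open>sqrt h\<close>
    pays for the third power of \<open>Lam N\<close>; the other half is at most a power of
    \<open>T\<close>.\<close>
  define K1 where "K1 = 10 * (D3 * T powr (1/4))"
  have l_bound: "10 * Lam N ^ 3 * sqrt (T / real N) \<le> K1" if "N \<ge> 1" for N
  proof -
    have "(Lam N ^ 3 * (T / real N) powr (1/4)) * (T / real N) powr (1/4) \<le> D3 * T powr (1/4)"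
      using D3[OF that] q0[OF that] D0 by (intro mult_mono) auto
    then show ?thesis by (simp add: sqrt_q[OF that] K1_def mult_ac)
  qed
  \<comment> \<open>Three moment constants: \<open>C3\<close> for the cubic remainder,
    \<open>C0\<close> for the doubled exponential, and \<open>C2\<close> for the square that comes
    from Young's inequality.\<close>
  obtain C3 where C3: "0 < C3" "\<And>s t h l. 0 \<le> s \<Longrightarrow> s \<le> t \<Longrightarrow> t \<le> T \<Longrightarrow> t - s \<le> h \<Longrightarrow> 0 < h \<Longrightarrow> 0 \<le> l \<Longrightarrow> l * sqrt h \<le> K1 \<Longrightarrow>
    (\<integral>\<^sup>+\<omega>. ennreal ((sqrt h + norm (incr s t \<omega>)) ^ 3 * exp (l * (sqrt h + norm (incr s t \<omega>)))) \<partial>M) \<le> ennreal (C3 * sqrt h ^ 3)"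
    using nn_integral_incr_power_exp[of K1 3] by blast
  obtain C0 where C0: "0 < C0" "\<And>s t h l. 0 \<le> s \<Longrightarrow> s \<le> t \<Longrightarrow> t \<le> T \<Longrightarrow> t - s \<le> h \<Longrightarrow> 0 < h \<Longrightarrow> 0 \<le> l \<Longrightarrow> l * sqrt h \<le> K1 \<Longrightarrow>
    (\<integral>\<^sup>+\<omega>. ennreal ((sqrt h + norm (incr s t \<omega>)) ^ 0 * exp (l * (sqrt h + norm (incr s t \<omega>)))) \<partial>M) \<le> ennreal (C0 * sqrt h ^ 0)"
    using nn_integral_incr_power_exp[of K1 0] by blast
  obtain C2 where C2: "0 < C2" "\<And>s t h l. 0 \<le> s \<Longrightarrow> s \<le> t \<Longrightarrow> t \<le> T \<Longrightarrow> t - s \<le> h \<Longrightarrow> 0 < h \<Longrightarrow> 0 \<le> l \<Longrightarrow> l * sqrt h \<le> 0 \<Longrightarrow>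
    (\<integral>\<^sup>+\<omega>. ennreal ((sqrt h + norm (incr s t \<omega>)) ^ 2 * exp (l * (sqrt h + norm (incr s t \<omega>)))) \<partial>M) \<le> ennreal (C2 * sqrt h ^ 2)"
    using nn_integral_incr_power_exp[of 0 2] by blast
  \<comment> \<open>Uniform version of the deterministic bound for the freezing error, obtained from
    \<open>Lam N * sqrt h\<close> being at most \<open>K1\<close>.\<close>
  define KB where "KB = K1 * sqrt T + K1 * K1 * sqrt T * sqrt T"
  define K where "K = 600 * D10 * C3 + exp KB * (3 * (D3 * (C0 + C2)))"
  have K0: "0 \<le> K" using D0 C0(1) C2(1) C3(1) by (simp add: K_def)
  have main: "(\<integral>\<^sup>+\<omega>. ennreal (exp (lyap_exponent N t \<omega>) * indicator A \<omega>) \<partial>M)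
      \<le> ennreal (1 + K * (T / real N) powr (5/4)) * (\<integral>\<^sup>+\<omega>. ennreal (exp (lyap_exponent N (grid N k) \<omega>) * indicator A \<omega>) \<partial>M)"
    if N: "N \<ge> 1" "k < N" and t: "grid N k \<le> t" "t \<le> grid N (Suc k)" and A: "A \<in> sets (F (grid N k))" for N k t A
  proof (cases "t = grid N k")
    case True
    have "1 * (\<integral>\<^sup>+\<omega>. ennreal (exp (lyap_exponent N (grid N k) \<omega>) * indicator A \<omega>) \<partial>M)
       \<le> ennreal (1 + K * (T / real N) powr (5/4)) * (\<integral>\<^sup>+\<omega>. ennreal (exp (lyap_exponent N (grid N k) \<omega>) * indicator A \<omega>) \<partial>M)"
      using K0 by (intro mult_right_mono) (auto simp flip: ennreal_1 intro!: ennreal_leI)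
    then show ?thesis using True by simp
  next
    case False
    let ?s = "grid N k" and ?h = "T / real N" and ?L = "Lam N"
    define u where "u = t - ?s"
    have u: "0 < u" "u \<le> ?h" and tu: "t = ?s + u" using False t grid_Suc[of N k] by (auto simp: u_def)
    have sT: "?s \<in> {0..T}" and tT: "t \<in> {0..T}" using grid_mem[of N k] grid_mem[of N "Suc k"] N t by auto
    have st: "0 \<le> ?s" "?s < t" "t \<le> T" using sT tT u tu by auto
    have h: "0 < ?h" by (rule h0[OF N(1)])
    have sqrth: "sqrt ?h \<le> ?L" using Lam(2)[OF N(1)] hT[OF N(1)] real_sqrt_le_mono order_trans by blast
    have os: "one_step U U1 U2 U3 x (\<mu> x) (\<sigma> x) \<rho> ?L ?h ?s u' (Ubar x)"
      if "norm x \<le> cutoff N" "0 \<le> u'" "u' \<le> ?h" for x u'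
      by (unfold_locales) (use Lam[OF N(1)] that sqrth rho sT U1_deriv U2_deriv U3_deriv in auto)
    have \<Lambda>: "1 \<le> ?L" by (rule Lam(1)[OF N(1)])
    let ?Q = "lyap_exponent N ?s"
    let ?x = "\<lambda>\<omega>. Y N ?s \<omega>"
    let ?g = "\<lambda>\<omega>. step_growth ?s u (?x \<omega>) (incr ?s t \<omega>)"
    let ?G = "running N k"
    \<comment> \<open>\<open>f\<close> and \<open>f'\<close> split the current value on
      \<open>A\<close> according to whether the scheme still runs. Both are known at time
      \<open>?s\<close>, and the expansion is available only on the running part.\<close>
    define f where "f \<omega> = exp (?Q \<omega>) * indicator (A \<inter> ?G) \<omega>" for \<omega>
    define f' where "f' \<omega> = exp (?Q \<omega>) * indicator (A - ?G) \<omega>" for \<omega>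
    let ?J = "\<lambda>\<omega>. integral {?s..t} (\<lambda>r. (sqrt ?h + norm (incr ?s r \<omega>))\<^sup>2)"
    define L3 where "L3 = exp KB * (3 * ?L ^ 3)"
    have L3: "0 \<le> L3" using \<Lambda> by (simp add: L3_def)
    have GF: "?G \<in> sets (F ?s)" using running_sets[OF N(1), of k] N by simp
    have QF[measurable]: "?Q \<in> borel_measurable (F ?s)" using lyap_exponent_measurable[OF N(1), of k] N by simp
    have xF[measurable]: "?x \<in> borel_measurable (F ?s)" using Y_grid_measurable[OF N(1), of k] N by simp
    have [measurable]: "A \<in> sets (F ?s)" "?G \<in> sets (F ?s)" by fact+
    have fF[measurable]: "f \<in> borel_measurable (F ?s)" unfolding f_def by measurable
    have f'F: "f' \<in> borel_measurable (F ?s)" unfolding f'_def by measurable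
    have fM: "f \<in> borel_measurable M" and f'M: "f' \<in> borel_measurable M"
      by (rule measurable_F_M[OF sT], fact fF f'F)+
    have f0: "0 \<le> f \<omega>" "0 \<le> f' \<omega>" for \<omega> by (auto simp: f_def f'_def)
    have gF: "(\<lambda>q. step_growth ?s u (?x (fst q)) (snd q)) \<in> borel_measurable (F ?s \<Otimes>\<^sub>M borel)"
      by (rule step_growth_measurable[OF sT xF])
    have gM: "?g \<in> borel_measurable M"
    proof -
      have "(\<lambda>\<omega>. (\<omega>, incr ?s t \<omega>)) \<in> measurable M (F ?s \<Otimes>\<^sub>M borel)"
        using incr_measurable[of ?s t] st measurable_F_M[OF sT measurable_ident] by (auto simp: id_def)
      from measurable_compose[OF this gF] show ?thesis by simp
    qed
    have W_cont: "continuous_on {?s..t} (\<lambda>r. W r \<omega>)" if "\<omega> \<in> space M" for \<omega>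
      by (rule continuous_on_subset[OF W_continuous[OF that]]) (use sT tT in auto)
    have JM: "?J \<in> borel_measurable M"
    proof (rule borel_measurable_integral_continuous)
      fix r assume "r \<in> {?s..t}"
      then have [measurable]: "incr ?s r \<in> borel_measurable M" using st by (intro incr_measurable) auto
      show "(\<lambda>\<omega>. (sqrt ?h + norm (incr ?s r \<omega>))\<^sup>2) \<in> borel_measurable M" by measurable
    next
      show "continuous_on {?s..t} (\<lambda>r. (sqrt ?h + norm (incr ?s r \<omega>))\<^sup>2)" if "\<omega> \<in> space M" for \<omega>
        by (intro continuous_intros W_cont that)
    qed (use st in auto)
    have KB: "?h * (?L + ?L\<^sup>2 * ?h) \<le> KB"
    proof -
      have "?L ^ 1 \<le> ?L ^ 3" using \<Lambda> by (intro power_increasing) auto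
      then have "?L * sqrt ?h \<le> ?L ^ 3 * sqrt ?h" using h by (intro mult_right_mono) auto
      moreover have "0 \<le> ?L ^ 3 * sqrt ?h" using \<Lambda> h by (intro mult_nonneg_nonneg) auto
      ultimately have 1: "?L * sqrt ?h \<le> K1" using l_bound[OF N(1)] unfolding mult.assoc by linarith
      have sT': "sqrt ?h \<le> sqrt T" using hT[OF N(1)] by simp
      have 0: "0 \<le> ?L * sqrt ?h" "0 \<le> sqrt ?h" using \<Lambda> h by auto
      have "?h * (?L + ?L\<^sup>2 * ?h) = (sqrt ?h * sqrt ?h) * (?L + ?L\<^sup>2 * (sqrt ?h * sqrt ?h))"
        using h by (simp only: real_sqrt_mult_self abs_of_pos)
      also have "\<dots> = (?L * sqrt ?h) * sqrt ?h + (?L * sqrt ?h) * (?L * sqrt ?h) * sqrt ?h * sqrt ?h"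
        by (simp add: power2_eq_square algebra_simps)
      also have "\<dots> \<le> K1 * sqrt T + K1 * K1 * sqrt T * sqrt T"
        using 1 sT' 0 by (intro add_mono mult_mono) (auto intro!: mult_nonneg_nonneg order_trans[OF 0(1) 1])
      finally show ?thesis by (simp add: KB_def)
    qed
    have pt: "ennreal (exp (lyap_exponent N t \<omega>) * indicator A \<omega>) \<le> ennreal (f' \<omega>) + (ennreal (f \<omega>) * ennreal (exp (?g \<omega>))
        + (ennreal (L3 * (?h * sqrt ?h)) * (ennreal (f \<omega>) * ennreal (exp (2 * ?g \<omega>)))
        + ennreal (L3 / sqrt ?h) * (ennreal (f \<omega>) * ennreal (?J \<omega>))))" if wM: "\<omega> \<in> space M" for \<omega>
    proof -
      have J0: "0 \<le> ?J \<omega>"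
        by (intro integral_nonneg integrable_continuous_real continuous_intros W_cont wM) auto
      have "exp (lyap_exponent N t \<omega>) * indicator A \<omega> \<le> f' \<omega> + (f \<omega> * exp (?g \<omega>)
        + ((L3 * (?h * sqrt ?h)) * (f \<omega> * exp (2 * ?g \<omega>)) + (L3 / sqrt ?h) * (f \<omega> * ?J \<omega>)))"
      proof (cases "\<omega> \<in> A")
        case inA: True
        show ?thesis
        proof (cases "\<omega> \<in> ?G")
          case True
          then have small: "norm (?x \<omega>) \<le> cutoff N" by simp
          note bnd = Ubar_increment_bound[OF N True t os[OF small] Lam(11)[OF N(1) small]]
          have "exp (lyap_exponent N t \<omega>) \<le> exp (?Q \<omega>) * (exp (?g \<omega>)
              + exp KB * (3 * ?L ^ 3) * (?h * sqrt ?h * exp (2 * ?g \<omega>) + ?J \<omega> / sqrt ?h))"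
            unfolding u_def using bnd order_trans[OF _ KB] h u \<Lambda>
            by (intro lyap_exponent_step_bound[OF N True t]) (auto simp: u_def)
          then show ?thesis using inA True by (simp add: f_def f'_def L3_def algebra_simps)
        next
          case False
          then have "cutoff N < norm (?x \<omega>)" using wM by simp
          then have "lyap_exponent N t \<omega> \<le> ?Q \<omega>" by (rule lyap_exponent_step_stopped[OF N wM t])
          then show ?thesis using inA False by (simp add: f_def f'_def)
        qed
      next
        case False
        then show ?thesis by (simp add: f_def f'_def)
      qed
      note real_bound = this
      have conv: "ennreal a \<le> ennreal a' + (ennreal b * ennreal e + (ennreal c1 * (ennreal b * ennreal e') + ennreal c2 * (ennreal b * ennreal j)))"
        if "a \<le> a' + (b * e + (c1 * (b * e') + c2 * (b * j)))" "0 \<le> a'" "0 \<le> b" "0 \<le> e" "0 \<le> e'" "0 \<le> j" "0 \<le> c1" "0 \<le> c2"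
        for a a' b e e' j c1 c2 :: real
      proof -
        have "ennreal a \<le> ennreal (a' + (b * e + (c1 * (b * e') + c2 * (b * j))))" using that(1) by (rule ennreal_leI)
        then show ?thesis using that(2-) by (simp add: ennreal_mult)
      qed
      have "0 \<le> L3 * (?h * sqrt ?h)" "0 \<le> L3 / sqrt ?h"
        by (rule mult_nonneg_nonneg[OF L3 mult_nonneg_nonneg[OF less_imp_le[OF h] real_sqrt_ge_zero[OF less_imp_le[OF h]]]],
          rule divide_nonneg_nonneg[OF L3 real_sqrt_ge_zero[OF less_imp_le[OF h]]])
      then show ?thesis by (intro conv[OF real_bound] f0 exp_ge_zero J0)
    qed
    have sgM: "(\<lambda>\<omega>'. step_growth ?s u x (incr ?s t \<omega>')) \<in> borel_measurable M" for x
    proof -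
      have [measurable]: "incr ?s t \<in> borel_measurable M" using st by (intro incr_measurable) auto
      show ?thesis unfolding step_growth_def by measurable
    qed
    have nn_cmult_le: "(\<integral>\<^sup>+\<omega>'. a * g \<omega>' \<partial>M) \<le> C * a"
      if "g \<in> borel_measurable M" "(\<integral>\<^sup>+\<omega>'. g \<omega>' \<partial>M) \<le> C" for a C :: ennreal and g
      using that by (simp add: nn_integral_cmult mult.commute[of C] mult_left_mono)
    \<comment> \<open>With the past frozen the state is a constant within the cutoff, so the
      one-step expectation applies; elsewhere the weight \<open>f\<close> vanishes.\<close>
    have I1: "(\<integral>\<^sup>+\<omega>. ennreal (f \<omega>) * ennreal (exp (?g \<omega>)) \<partial>M) \<le> ennreal (1 + 600 * ?L ^ 10 * (C3 * sqrt ?h ^ 3)) * (\<integral>\<^sup>+\<omega>. ennreal (f \<omega>) \<partial>M)"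
    proof -
      have "(\<integral>\<^sup>+\<omega>. ennreal (f \<omega>) * ennreal (exp (?g \<omega>)) \<partial>M)
        = (\<integral>\<^sup>+\<omega>. \<integral>\<^sup>+\<omega>'. ennreal (f \<omega>) * ennreal (exp (step_growth ?s u (?x \<omega>) (incr ?s t \<omega>'))) \<partial>M \<partial>M)"
        using nn_integral_freeze[OF st, of "\<lambda>q. ennreal (f (fst q)) * ennreal (exp (step_growth ?s u (?x (fst q)) (snd q)))"] gF
        by simp
      also have "\<dots> \<le> (\<integral>\<^sup>+\<omega>. ennreal (1 + 600 * ?L ^ 10 * (C3 * sqrt ?h ^ 3)) * ennreal (f \<omega>) \<partial>M)"
      proof (rule nn_integral_mono)
        fix \<omega> assume wM: "\<omega> \<in> space M"
        show "(\<integral>\<^sup>+\<omega>'. ennreal (f \<omega>) * ennreal (exp (step_growth ?s u (?x \<omega>) (incr ?s t \<omega>'))) \<partial>M)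
          \<le> ennreal (1 + 600 * ?L ^ 10 * (C3 * sqrt ?h ^ 3)) * ennreal (f \<omega>)"
        proof (cases "\<omega> \<in> ?G")
          case True
          then have small: "norm (?x \<omega>) \<le> cutoff N" by simp
          note o = os[OF small less_imp_le[OF u(1)] u(2)]
          have "(\<integral>\<^sup>+\<omega>'. ennreal (exp (step_growth ?s u (?x \<omega>) (incr ?s t \<omega>'))) \<partial>M) \<le> ennreal (1 + 600 * ?L ^ 10 * (C3 * sqrt ?h ^ 3))"
          proof -
            have 5: "5 * ?L ^ 3 * sqrt ?h \<le> K1"
            proof -
              have "0 \<le> ?L ^ 3 * sqrt ?h" using \<Lambda> h by (intro mult_nonneg_nonneg) auto
              then show ?thesis using l_bound[OF N(1)] unfolding mult.assoc by linarith
            qed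
            show ?thesis
              using nn_integral_exp_growth_le[OF o u(1) _ Lyap, of "C3 * sqrt ?h ^ 3"] C3(2)[of ?s t ?h "5 * ?L ^ 3"] C3(1) 5 st u h \<Lambda>
              unfolding step_growth_eq[OF o] tu[symmetric] by (simp add: tu)
          qed
          then show ?thesis by (intro nn_cmult_le measurable_compose[OF sgM]) measurable
        next
          case False
          then show ?thesis by (simp add: f_def)
        qed
      qed
      also have "\<dots> = ennreal (1 + 600 * ?L ^ 10 * (C3 * sqrt ?h ^ 3)) * (\<integral>\<^sup>+\<omega>. ennreal (f \<omega>) \<partial>M)"
        using fM by (intro nn_integral_cmult) auto
      finally show ?thesis .
    qed
    have I2: "(\<integral>\<^sup>+\<omega>. ennreal (f \<omega>) * ennreal (exp (2 * ?g \<omega>)) \<partial>M) \<le> ennreal C0 * (\<integral>\<^sup>+\<omega>. ennreal (f \<omega>) \<partial>M)"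
    proof -
      have "(\<integral>\<^sup>+\<omega>. ennreal (f \<omega>) * ennreal (exp (2 * ?g \<omega>)) \<partial>M)
        = (\<integral>\<^sup>+\<omega>. \<integral>\<^sup>+\<omega>'. ennreal (f \<omega>) * ennreal (exp (2 * step_growth ?s u (?x \<omega>) (incr ?s t \<omega>'))) \<partial>M \<partial>M)"
        using nn_integral_freeze[OF st, of "\<lambda>q. ennreal (f (fst q)) * ennreal (exp (2 * step_growth ?s u (?x (fst q)) (snd q)))"] gF
        by simp
      also have "\<dots> \<le> (\<integral>\<^sup>+\<omega>. ennreal C0 * ennreal (f \<omega>) \<partial>M)"
      proof (rule nn_integral_mono)
        fix \<omega> assume wM: "\<omega> \<in> space M"
        show "(\<integral>\<^sup>+\<omega>'. ennreal (f \<omega>) * ennreal (exp (2 * step_growth ?s u (?x \<omega>) (incr ?s t \<omega>'))) \<partial>M) \<le> ennreal C0 * ennreal (f \<omega>)"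
        proof (cases "\<omega> \<in> ?G")
          case True
          then have small: "norm (?x \<omega>) \<le> cutoff N" by simp
          note o = os[OF small less_imp_le[OF u(1)] u(2)]
          have "(\<integral>\<^sup>+\<omega>'. ennreal (exp (2 * step_growth ?s u (?x \<omega>) (incr ?s t \<omega>'))) \<partial>M) \<le> ennreal C0"
            using nn_integral_exp_two_growth_le[OF o, of C0] C0(2)[of ?s t ?h "10 * ?L ^ 3"] l_bound[OF N(1)] st u h \<Lambda>
            unfolding step_growth_eq[OF o] tu[symmetric] by (simp add: tu)
          then show ?thesis by (intro nn_cmult_le measurable_compose[OF sgM]) measurable
        next
          case False
          then show ?thesis by (simp add: f_def)
        qed
      qed
      also have "\<dots> = ennreal C0 * (\<integral>\<^sup>+\<omega>. ennreal (f \<omega>) \<partial>M)"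
        using fM by (intro nn_integral_cmult) auto
      finally show ?thesis .
    qed
    \<comment> \<open>At each intermediate time the increment since \<open>?s\<close> is still
      independent of \<open>f\<close>. The resulting order \<open>h * h\<close> becomes
      \<open>h * sqrt h\<close> after the division by \<open>sqrt h\<close> from Young's
      inequality.\<close>
    have I3: "(\<integral>\<^sup>+\<omega>. ennreal (f \<omega>) * ennreal (?J \<omega>) \<partial>M) \<le> ennreal (?h * (C2 * ?h)) * (\<integral>\<^sup>+\<omega>. ennreal (f \<omega>) \<partial>M)"
    proof -
      have "(\<integral>\<^sup>+\<omega>. ennreal (f \<omega>) * ennreal (?J \<omega>) \<partial>M) \<le> ennreal (t - ?s) * (ennreal (C2 * ?h) * (\<integral>\<^sup>+\<omega>. ennreal (f \<omega>) \<partial>M))"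
      proof (rule nn_integral_integral_le[OF less_imp_le[OF st(2)] _ _ _ fM])
        fix r assume r: "r \<in> {?s..t}"
        then have [measurable]: "incr ?s r \<in> borel_measurable M" using st by (intro incr_measurable) auto
        show "(\<lambda>\<omega>. (sqrt ?h + norm (incr ?s r \<omega>))\<^sup>2) \<in> borel_measurable M" by measurable
        show "(\<integral>\<^sup>+\<omega>. ennreal (f \<omega>) * ennreal ((sqrt ?h + norm (incr ?s r \<omega>))\<^sup>2) \<partial>M) \<le> ennreal (C2 * ?h) * (\<integral>\<^sup>+\<omega>. ennreal (f \<omega>) \<partial>M)"
        proof (rule nn_integral_mult_incr_le[where s="?s" and t=r and f="\<lambda>\<omega>. ennreal (f \<omega>)" and g="\<lambda>z. ennreal ((sqrt ?h + norm z)\<^sup>2)"])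
          show "(\<integral>\<^sup>+\<omega>. ennreal ((sqrt ?h + norm (incr ?s r \<omega>))\<^sup>2) \<partial>M) \<le> ennreal (C2 * ?h)"
            using C2(2)[of ?s r ?h 0] r st h u by (simp add: u_def)
        qed (use r st fF in auto)
      next
        show "continuous_on {?s..t} (\<lambda>r. (sqrt ?h + norm (incr ?s r \<omega>))\<^sup>2)" if "\<omega> \<in> space M" for \<omega>
          by (intro continuous_intros W_cont that)
      qed auto
      also have "\<dots> \<le> ennreal ?h * (ennreal (C2 * ?h) * (\<integral>\<^sup>+\<omega>. ennreal (f \<omega>) \<partial>M))"
        using u by (intro mult_right_mono ennreal_leI) (auto simp: u_def)
      finally show ?thesis by (simp only: ennreal_mult'[OF less_imp_le[OF h]] mult.assoc)
    qed
    let ?I = "\<integral>\<^sup>+\<omega>. ennreal (f \<omega>) \<partial>M" and ?I' = "\<integral>\<^sup>+\<omega>. ennreal (f' \<omega>) \<partial>M"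
    \<comment> \<open>The total factor on the running part: \<open>1\<close>, the third-order
      remainder, and the two contributions of the freezing error.\<close>
    define \<alpha> where "\<alpha> = (1 + 600 * ?L ^ 10 * (C3 * sqrt ?h ^ 3)) + (L3 * (?h * sqrt ?h) * C0 + L3 / sqrt ?h * (?h * (C2 * ?h)))"
    note [measurable] = fM f'M gM JM
    have "(\<integral>\<^sup>+\<omega>. ennreal (exp (lyap_exponent N t \<omega>) * indicator A \<omega>) \<partial>M)
       \<le> (\<integral>\<^sup>+\<omega>. ennreal (f' \<omega>) + (ennreal (f \<omega>) * ennreal (exp (?g \<omega>))
        + (ennreal (L3 * (?h * sqrt ?h)) * (ennreal (f \<omega>) * ennreal (exp (2 * ?g \<omega>)))
        + ennreal (L3 / sqrt ?h) * (ennreal (f \<omega>) * ennreal (?J \<omega>)))) \<partial>M)"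
      using pt by (rule nn_integral_mono)
    also have "\<dots> = ?I' + ((\<integral>\<^sup>+\<omega>. ennreal (f \<omega>) * ennreal (exp (?g \<omega>)) \<partial>M)
        + (ennreal (L3 * (?h * sqrt ?h)) * (\<integral>\<^sup>+\<omega>. ennreal (f \<omega>) * ennreal (exp (2 * ?g \<omega>)) \<partial>M)
        + ennreal (L3 / sqrt ?h) * (\<integral>\<^sup>+\<omega>. ennreal (f \<omega>) * ennreal (?J \<omega>) \<partial>M)))"
    proof -
      have m1: "(\<lambda>\<omega>. ennreal (f' \<omega>)) \<in> borel_measurable M" by measurable
      have m2: "(\<lambda>\<omega>. ennreal (f \<omega>) * ennreal (exp (?g \<omega>))) \<in> borel_measurable M" by measurable
      have m3: "(\<lambda>\<omega>. ennreal (f \<omega>) * ennreal (exp (2 * ?g \<omega>))) \<in> borel_measurable M" by measurable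
      have m4: "(\<lambda>\<omega>. ennreal (f \<omega>) * ennreal (?J \<omega>)) \<in> borel_measurable M" by measurable
      show ?thesis
        unfolding nn_integral_cmult[OF m3, symmetric] nn_integral_cmult[OF m4, symmetric]
        by (subst nn_integral_add[symmetric], (intro borel_measurable_times_ennreal borel_measurable_const m1 m2 m3 m4 borel_measurable_add)+)+ (rule refl)
    qed
    also have "\<dots> \<le> ?I' + (ennreal (1 + 600 * ?L ^ 10 * (C3 * sqrt ?h ^ 3)) * ?I
        + (ennreal (L3 * (?h * sqrt ?h)) * (ennreal C0 * ?I) + ennreal (L3 / sqrt ?h) * (ennreal (?h * (C2 * ?h)) * ?I)))"
      by (intro add_mono order_refl mult_left_mono I1 I2 I3) auto
    also have "\<dots> = ?I' + ennreal \<alpha> * ?I"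
    proof -
      note h' = less_imp_le[OF h] and sq' = real_sqrt_ge_zero[OF less_imp_le[OF h]]
      have hs: "0 \<le> L3 * (?h * sqrt ?h)" by (rule mult_nonneg_nonneg[OF L3 mult_nonneg_nonneg[OF h' sq']])
      have "0 \<le> 1 + 600 * ?L ^ 10 * (C3 * sqrt ?h ^ 3)" using \<Lambda> C3(1) sq' by simp
      moreover have "0 \<le> L3 * (?h * sqrt ?h) * C0" by (rule mult_nonneg_nonneg[OF hs less_imp_le[OF C0(1)]])
      moreover have "0 \<le> L3 / sqrt ?h * (?h * (C2 * ?h))"
        by (rule mult_nonneg_nonneg[OF divide_nonneg_nonneg[OF L3 sq'] mult_nonneg_nonneg[OF h' mult_nonneg_nonneg[OF less_imp_le[OF C2(1)] h']]])
      ultimately have n: "0 \<le> 1 + 600 * ?L ^ 10 * (C3 * sqrt ?h ^ 3)" "0 \<le> L3 * (?h * sqrt ?h) * C0" "0 \<le> L3 / sqrt ?h * (?h * (C2 * ?h))" .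
      have "ennreal (L3 * (?h * sqrt ?h)) * (ennreal C0 * ?I) = ennreal (L3 * (?h * sqrt ?h) * C0) * ?I"
        by (simp only: ennreal_mult'[OF hs] mult.assoc[of "ennreal _"])
      moreover have "ennreal (L3 / sqrt ?h) * (ennreal (?h * (C2 * ?h)) * ?I) = ennreal (L3 / sqrt ?h * (?h * (C2 * ?h))) * ?I"
      proof -
        show ?thesis by (simp only: ennreal_mult'[OF divide_nonneg_nonneg[OF L3 sq']] mult.assoc[of "ennreal _"])
      qed
      ultimately show ?thesis
        unfolding \<alpha>_def using n by (simp only: ennreal_plus add_nonneg_nonneg distrib_right)
    qed
    also have "\<dots> \<le> ennreal (1 + K * ?h powr (5/4)) * (?I' + ?I)"
    proof -
      have sq: "sqrt ?h ^ 3 = ?h * sqrt ?h" "?h * ?h / sqrt ?h = ?h * sqrt ?h"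
      proof -
        have "sqrt x ^ 3 = x * sqrt x \<and> x * x / sqrt x = x * sqrt x" if "0 < x" for x :: real
          using that real_div_sqrt[of x] by (simp add: power3_eq_cube flip: times_divide_eq_right)
        then show "sqrt ?h ^ 3 = ?h * sqrt ?h" "?h * ?h / sqrt ?h = ?h * sqrt ?h" using h by blast+
      qed
      \<comment> \<open>The exponent \<open>3/2\<close> is split into \<open>1/4 + 5/4\<close>; the
        first share absorbs the powers of \<open>Lam N\<close>.\<close>
      have l10: "?L ^ 10 * (?h * sqrt ?h) \<le> D10 * ?h powr (5/4)" and l3: "?L ^ 3 * (?h * sqrt ?h) \<le> D3 * ?h powr (5/4)"
        unfolding h_split[OF N(1)] mult.assoc[symmetric] using D10[OF N(1)] D3[OF N(1)] by (intro mult_right_mono; simp)+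
      have "\<alpha> = 1 + 600 * C3 * (?L ^ 10 * (?h * sqrt ?h)) + exp KB * (3 * (C0 + C2)) * (?L ^ 3 * (?h * sqrt ?h))"
      proof -
        define r where "r = ?h * sqrt ?h"
        have "L3 / x * (y * (C2 * y)) = L3 * C2 * (y * y / x)" for x y by simp
        then have "\<alpha> = (1 + 600 * ?L ^ 10 * (C3 * r)) + (L3 * r * C0 + L3 * C2 * r)" unfolding \<alpha>_def r_def sq(1) by (simp only: sq(2))
        then show ?thesis unfolding r_def[symmetric] L3_def by (simp add: algebra_simps)
      qed
      also have "\<dots> \<le> 1 + 600 * C3 * (D10 * ?h powr (5/4)) + exp KB * (3 * (C0 + C2)) * (D3 * ?h powr (5/4))"
        using l10 l3 C3(1) C0(1) C2(1) by (intro add_mono order_refl mult_left_mono) auto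
      also have "\<dots> = 1 + K * ?h powr (5/4)" by (simp add: K_def algebra_simps)
      finally have a: "\<alpha> \<le> 1 + K * ?h powr (5/4)" .
      \<comment> \<open>On the stopped part the exponent does not increase, so the same factor,
        being at least 1, may be applied to both parts.\<close>
      have "ennreal 1 * ?I' \<le> ennreal (1 + K * ?h powr (5/4)) * ?I'" using K0 by (intro mult_right_mono ennreal_leI) auto
      moreover have "ennreal \<alpha> * ?I \<le> ennreal (1 + K * ?h powr (5/4)) * ?I" using a by (intro mult_right_mono ennreal_leI) auto
      ultimately show ?thesis unfolding distrib_left by (simp only: ennreal_1 mult_1 add_mono)
    qed
    also have "?I' + ?I = (\<integral>\<^sup>+\<omega>. ennreal (exp (?Q \<omega>) * indicator A \<omega>) \<partial>M)"
    proof -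
      have "?I' + ?I = (\<integral>\<^sup>+\<omega>. ennreal (f' \<omega>) + ennreal (f \<omega>) \<partial>M)"
        by (rule nn_integral_add[symmetric]) measurable
      also have "\<dots> = (\<integral>\<^sup>+\<omega>. ennreal (exp (?Q \<omega>) * indicator A \<omega>) \<partial>M)"
        by (rule nn_integral_cong) (auto simp: f_def f'_def indicator_def)
      finally show ?thesis .
    qed
    finally show ?thesis .
  qed
  show thesis by (rule that[OF K0 main])
qed


section \<open>Exponential moments and the maximal inequality\<close>

abbreviation E0 :: ennreal where "E0 \<equiv> \<integral>\<^sup>+\<omega>. ennreal (exp (U (X0 \<omega>))) \<partial>M"

lemma lyap_exponent_measurable_M:
  assumes "N \<ge> 1" "k \<le> N"
  shows "lyap_exponent N (grid N k) \<in> borel_measurable M"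
  using measurable_F_M[OF grid_mem[OF assms] lyap_exponent_measurable[OF assms]] .

lemma lyap_exponent_0: "N \<ge> 1 \<Longrightarrow> \<omega> \<in> space M \<Longrightarrow> lyap_exponent N 0 \<omega> = U (X0 \<omega>)"
  using tau_bounds(1)[of N \<omega>] Y_init[of N \<omega>] by (simp add: lyap_exponent_def min_absorb1)

text \<open>Compounding at most \<open>N\<close> factors turns \<open>h\<close> to the power
  \<open>5/4\<close> into \<open>T\<close> times \<open>h\<close> to the power \<open>1/4\<close>,
  because \<open>real N * h = T\<close>.\<close>

lemma compound_growth_le:
  assumes "N \<ge> 1" "0 \<le> K" "k \<le> N"
  shows "(1 + K * (T / real N) powr (5/4)) ^ k \<le> exp (K * T * (T / real N) powr (1/4))"
proof -
  let ?h = "T / real N"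
  have h: "0 < ?h" using assms T_pos by simp
  have "(1 + K * ?h powr (5/4)) ^ k \<le> (1 + K * ?h powr (5/4)) ^ N"
    using assms by (intro power_increasing) auto
  also have "\<dots> \<le> exp (K * ?h powr (5/4)) ^ N"
    using assms(2) by (intro power_mono) auto
  also have "\<dots> = exp (real N * (K * ?h powr (5/4)))" by (simp add: exp_of_nat_mult)
  also have "real N * (K * ?h powr (5/4)) = K * T * ?h powr (1/4)"
  proof -
    have "x powr (5/4) = x * x powr (1/4)" if "0 < x" for x :: real
      using that by (simp add: powr_mult_base)
    then have "real N * (K * ?h powr (5/4)) = K * (real N * ?h) * ?h powr (1/4)" using h by simp
    then show ?thesis using assms by simp
  qed
  finally show ?thesis .
qed

text \<open>Up to factors whose product tends to 1, the exponential of the exponent is a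
  supermartingale on the grid. The second bound is Doob's maximal inequality for it, and the factors
  are kept explicit in \<open>N\<close> for the sake of the limit superior.\<close>

lemma exp_lyap_exponent_bounds:
  obtains K where "0 \<le> K"
    "\<And>N t. N \<ge> 1 \<Longrightarrow> t \<in> {0..T} \<Longrightarrow>
      (\<integral>\<^sup>+\<omega>. ennreal (exp (lyap_exponent N t \<omega>)) \<partial>M) \<le> ennreal (exp (K * (T / real N) powr (1/4))) * E0"
    "\<And>N l. N \<ge> 1 \<Longrightarrow> 0 \<le> l \<Longrightarrow>
      ennreal l * emeasure M {\<omega> \<in> space M. \<exists>k\<le>N. l \<le> exp (lyap_exponent N (grid N k) \<omega>)} \<le> ennreal (exp (K * (T / real N) powr (1/4))) * E0"
proof -
  obtain K where K: "0 \<le> K" and step: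
    "\<And>N k t A. N \<ge> 1 \<Longrightarrow> k < N \<Longrightarrow> grid N k \<le> t \<Longrightarrow> t \<le> grid N (Suc k) \<Longrightarrow> A \<in> sets (F (grid N k)) \<Longrightarrow>
      (\<integral>\<^sup>+\<omega>. ennreal (exp (lyap_exponent N t \<omega>) * indicator A \<omega>) \<partial>M)
      \<le> ennreal (1 + K * (T / real N) powr (5/4)) * (\<integral>\<^sup>+\<omega>. ennreal (exp (lyap_exponent N (grid N k) \<omega>) * indicator A \<omega>) \<partial>M)"
    using lyap_exponent_step_expectation by blast
  let ?q = "\<lambda>N. 1 + K * (T / real N) powr (5/4)"
  have q: "1 \<le> ?q N" for N using K by simp
  have stepM: "(\<integral>\<^sup>+\<omega>. ennreal (exp (lyap_exponent N t \<omega>)) \<partial>M) \<le> ennreal (?q N) * (\<integral>\<^sup>+\<omega>. ennreal (exp (lyap_exponent N (grid N k) \<omega>)) \<partial>M)"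
    if "N \<ge> 1" "k < N" "grid N k \<le> t" "t \<le> grid N (Suc k)" for N k t
  proof -
    have s: "space (F (grid N k)) = space M" using space_F[OF grid_mem[of N k]] that by simp
    have "(\<integral>\<^sup>+\<omega>. ennreal (exp (lyap_exponent N s \<omega>)) \<partial>M) = (\<integral>\<^sup>+\<omega>. ennreal (exp (lyap_exponent N s \<omega>) * indicator (space M) \<omega>) \<partial>M)" for s
      by (rule nn_integral_cong) auto
    then show ?thesis using step[OF that, of "space M"] sets.top[of "F (grid N k)"] s by simp
  qed
  have E00: "(\<integral>\<^sup>+\<omega>. ennreal (exp (lyap_exponent N (grid N 0) \<omega>)) \<partial>M) = E0" if "N \<ge> 1" for N
    using lyap_exponent_0[OF that] by (intro nn_integral_cong) simp
  have grid_bound: "(\<integral>\<^sup>+\<omega>. ennreal (exp (lyap_exponent N (grid N k) \<omega>)) \<partial>M) \<le> ennreal (?q N ^ k) * E0" if "N \<ge> 1" "k \<le> N" for N k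
    using that(2)
  proof (induction k)
    case 0
    then show ?case using E00[OF that(1)] by simp
  next
    case (Suc k)
    have "(\<integral>\<^sup>+\<omega>. ennreal (exp (lyap_exponent N (grid N (Suc k)) \<omega>)) \<partial>M) \<le> ennreal (?q N) * (\<integral>\<^sup>+\<omega>. ennreal (exp (lyap_exponent N (grid N k) \<omega>)) \<partial>M)"
      using stepM[OF that(1), of k "grid N (Suc k)"] Suc.prems grid_less[OF that(1), of k] by simp
    also have "\<dots> \<le> ennreal (?q N) * (ennreal (?q N ^ k) * E0)" using Suc by (intro mult_left_mono) auto
    also have "\<dots> = ennreal (?q N ^ Suc k) * E0"
      using q[of N] unfolding power_Suc by (subst ennreal_mult) (simp_all add: mult.assoc)
    finally show ?case .
  qed
  have all: "(\<integral>\<^sup>+\<omega>. ennreal (exp (lyap_exponent N t \<omega>)) \<partial>M) \<le> ennreal (exp (K * T * (T / real N) powr (1/4))) * E0"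
    if N: "N \<ge> 1" and t: "t \<in> {0..T}" for N t
  proof -
    obtain k where k: "k < N" "grid N k \<le> t" "t \<le> grid N (Suc k)" by (rule grid_cell[OF N t])
    have "(\<integral>\<^sup>+\<omega>. ennreal (exp (lyap_exponent N t \<omega>)) \<partial>M) \<le> ennreal (?q N) * (\<integral>\<^sup>+\<omega>. ennreal (exp (lyap_exponent N (grid N k) \<omega>)) \<partial>M)"
      by (rule stepM[OF N k])
    also have "\<dots> \<le> ennreal (?q N) * (ennreal (?q N ^ k) * E0)" using grid_bound[OF N, of k] k by (intro mult_left_mono) auto
    also have "\<dots> = ennreal (?q N ^ Suc k) * E0"
      using q[of N] unfolding power_Suc by (subst ennreal_mult) (simp_all add: mult.assoc)
    also have "\<dots> \<le> ennreal (exp (K * T * (T / real N) powr (1/4))) * E0"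
      using compound_growth_le[OF N K, of "Suc k"] k by (intro mult_right_mono ennreal_leI) auto
    finally show ?thesis .
  qed
  have max: "ennreal l * emeasure M {\<omega> \<in> space M. \<exists>k\<le>N. l \<le> exp (lyap_exponent N (grid N k) \<omega>)} \<le> ennreal (exp (K * T * (T / real N) powr (1/4))) * E0"
    if N: "N \<ge> 1" and l: "0 \<le> l" for N l
  proof -
    let ?V = "\<lambda>k \<omega>. exp (lyap_exponent N (grid N k) \<omega>)"
    \<comment> \<open>No crossing of the level \<open>l\<close> up to index \<open>k\<close>. The
      induction below bounds the expectation of the process stopped at its first crossing, where its
      value is counted as \<open>l\<close>.\<close>
    define A where "A k = {\<omega> \<in> space M. \<forall>i\<le>k. ?V i \<omega> < l}" for k
    have AF: "A k \<in> sets (F (grid N k))" if k: "k \<le> N" for k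
    proof -
      have s: "space M = space (F (grid N k))" using space_F[OF grid_mem[OF N k]] by simp
      have m: "lyap_exponent N (grid N i) \<in> borel_measurable (F (grid N k))" if "i \<le> k" for i
        using that k by (intro measurable_F_mono[OF grid_nonneg grid_mono _ lyap_exponent_measurable[OF N]]) (use grid_mem[OF N k] in auto)
      have "{\<omega> \<in> space (F (grid N k)). \<forall>i\<in>{..k}. ?V i \<omega> < l} \<in> sets (F (grid N k))"
        by (intro sets.sets_Collect_finite_All') (use m in \<open>auto intro!: borel_measurable_less borel_measurable_const measurable_compose[OF m borel_measurable_exp]\<close>)
      moreover have "A k = {\<omega> \<in> space (F (grid N k)). \<forall>i\<in>{..k}. ?V i \<omega> < l}"
        unfolding A_def s[symmetric] by auto
      ultimately show ?thesis by (simp only:)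
    qed
    have AM[measurable]: "A k \<in> sets M" if "k \<le> N" for k using AF[OF that] sets_F_subset[OF grid_mem[OF N that]] by blast
    have Vm: "lyap_exponent N (grid N k) \<in> borel_measurable M" if "k \<le> N" for k by (rule lyap_exponent_measurable_M[OF N that])
    have split: "(\<integral>\<^sup>+\<omega>. ennreal (exp (g \<omega>) * indicator B \<omega>) \<partial>M) + ennreal l * emeasure M (space M - B)
        = (\<integral>\<^sup>+\<omega>. ennreal (exp (g \<omega>) * indicator B \<omega>) + ennreal l * indicator (space M - B) \<omega> \<partial>M)"
      if [measurable]: "g \<in> borel_measurable M" "B \<in> sets M" for g B
      by (subst nn_integral_add) (auto simp: nn_integral_cmult_indicator)
    have ind: "(\<integral>\<^sup>+\<omega>. ennreal (?V k \<omega> * indicator (A k) \<omega>) \<partial>M) + ennreal l * emeasure M (space M - A k) \<le> ennreal (?q N ^ k) * E0" if "k \<le> N" for k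
      using that
    proof (induction k)
      case 0
      have "(\<integral>\<^sup>+\<omega>. ennreal (?V 0 \<omega> * indicator (A 0) \<omega>) \<partial>M) + ennreal l * emeasure M (space M - A 0)
        = (\<integral>\<^sup>+\<omega>. ennreal (?V 0 \<omega> * indicator (A 0) \<omega>) + ennreal l * indicator (space M - A 0) \<omega> \<partial>M)"
        by (rule split[OF Vm[OF 0] AM[OF 0]])
      also have "\<dots> \<le> (\<integral>\<^sup>+\<omega>. ennreal (?V 0 \<omega>) \<partial>M)"
        by (rule nn_integral_mono) (auto simp: A_def indicator_def intro!: ennreal_leI)
      finally show ?case using E00[OF N] by simp
    next
      case (Suc k)
      then have k: "k < N" "k \<le> N" by auto
      have "(\<integral>\<^sup>+\<omega>. ennreal (?V (Suc k) \<omega> * indicator (A (Suc k)) \<omega>) \<partial>M) + ennreal l * emeasure M (space M - A (Suc k))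
        = (\<integral>\<^sup>+\<omega>. ennreal (?V (Suc k) \<omega> * indicator (A (Suc k)) \<omega>) + ennreal l * indicator (space M - A (Suc k)) \<omega> \<partial>M)"
        by (rule split[OF Vm[OF Suc.prems] AM[OF Suc.prems]])
      \<comment> \<open>On \<open>A k\<close> without \<open>A (Suc k)\<close> the new value is at
        least \<open>l\<close>, so replacing \<open>l\<close> by it can only increase the integrand;
        what remains involves \<open>A k\<close>, an event known one step earlier.\<close>
      also have "\<dots> \<le> (\<integral>\<^sup>+\<omega>. ennreal (?V (Suc k) \<omega> * indicator (A k) \<omega>) + ennreal l * indicator (space M - A k) \<omega> \<partial>M)"
        by (rule nn_integral_mono) (auto simp: A_def indicator_def le_Suc_eq intro!: ennreal_leI)
      also have "\<dots> = (\<integral>\<^sup>+\<omega>. ennreal (?V (Suc k) \<omega> * indicator (A k) \<omega>) \<partial>M) + ennreal l * emeasure M (space M - A k)"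
        by (rule split[symmetric, OF Vm[OF Suc.prems] AM[OF k(2)]])
      also have "\<dots> \<le> ennreal (?q N) * (\<integral>\<^sup>+\<omega>. ennreal (?V k \<omega> * indicator (A k) \<omega>) \<partial>M) + ennreal (?q N) * (ennreal l * emeasure M (space M - A k))"
      proof (rule add_mono)
        show "(\<integral>\<^sup>+\<omega>. ennreal (?V (Suc k) \<omega> * indicator (A k) \<omega>) \<partial>M) \<le> ennreal (?q N) * (\<integral>\<^sup>+\<omega>. ennreal (?V k \<omega> * indicator (A k) \<omega>) \<partial>M)"
          by (rule step[OF N k(1) _ order_refl AF[OF k(2)]]) (use grid_less[OF N, of k] in simp)
        have "1 * (ennreal l * emeasure M (space M - A k)) \<le> ennreal (?q N) * (ennreal l * emeasure M (space M - A k))"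
          using q[of N] ennreal_leI[of 1 "?q N"] by (intro mult_right_mono) auto
        then show "ennreal l * emeasure M (space M - A k) \<le> ennreal (?q N) * (ennreal l * emeasure M (space M - A k))" by simp
      qed
      also have "\<dots> \<le> ennreal (?q N) * (ennreal (?q N ^ k) * E0)"
        unfolding distrib_left[symmetric] using Suc.IH[OF k(2)] by (intro mult_left_mono) auto
      also have "\<dots> = ennreal (?q N ^ Suc k) * E0"
        using q[of N] unfolding power_Suc by (subst ennreal_mult) (simp_all add: mult.assoc)
      finally show ?case .
    qed
    have eq: "{\<omega> \<in> space M. \<exists>k\<le>N. l \<le> ?V k \<omega>} = space M - A N" by (auto simp: A_def not_less)
    have "ennreal l * emeasure M {\<omega> \<in> space M. \<exists>k\<le>N. l \<le> ?V k \<omega>} \<le> ennreal (?q N ^ N) * E0"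
      unfolding eq by (rule order_trans[OF add_increasing[OF zero_le order_refl] ind[OF order_refl]])
    also have "\<dots> \<le> ennreal (exp (K * T * (T / real N) powr (1/4))) * E0"
      using compound_growth_le[OF N K, of N] by (intro mult_right_mono ennreal_leI) auto
    finally show ?thesis .
  qed
  show thesis
    by (rule that[of "K * T", OF _ all max]) (use K T_pos in auto)
qed


section \<open>Moments and tails of the scheme\<close>

text \<open>Since \<open>Ubar\<close> is bounded below, the integral costs only a constant, and a
  bound on the exponent becomes a bound on \<open>U\<close> along the scheme.\<close>

lemma lyap_exponent_ge:
  obtains b where "0 \<le> b"
    "\<And>N t \<omega>. N \<ge> 1 \<Longrightarrow> t \<in> {0..T} \<Longrightarrow> \<omega> \<in> space M \<Longrightarrow> exp (- \<rho> * T) * U (Y N t \<omega>) - b * T \<le> lyap_exponent N t \<omega>"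
proof -
  obtain l where l: "\<And>x. l \<le> Ubar x" using Ubar_bdd unfolding bdd_below_def by auto
  \<comment> \<open>Nonnegativity of \<open>b\<close> keeps the lower bound valid after division by
    \<open>exp (\<rho> * s)\<close> and after extending the interval to length
    \<open>T\<close>.\<close>
  define b where "b = max 0 (- l)"
  have b: "0 \<le> b" "\<And>x. - b \<le> Ubar x" using l by (auto simp: b_def) (metis le_minus_iff max.coboundedI2 neg_le_iff_le minus_minus)
  have "exp (- \<rho> * T) * U (Y N t \<omega>) - b * T \<le> lyap_exponent N t \<omega>"
    if N: "N \<ge> 1" and t: "t \<in> {0..T}" and w: "\<omega> \<in> space M" for N t \<omega>
  proof -
    let ?m = "min t (\<tau> N \<omega>)"
    have m: "0 \<le> ?m" "?m \<le> T" using tau_bounds(1)[OF N w] t by auto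
    have "integral {0..?m} (\<lambda>s. - b) \<le> integral {0..?m} (\<lambda>s. Ubar (Y N s \<omega>) / exp (\<rho> * s))"
    proof (rule integral_le)
      show "(\<lambda>s. Ubar (Y N s \<omega>) / exp (\<rho> * s)) integrable_on {0..?m}"
        by (rule integrable_continuous_real, rule continuous_on_subset[OF discounted_Ubar_continuous[OF N w]]) (use m in auto)
      fix s assume s: "s \<in> {0..?m}"
      have e: "1 \<le> exp (\<rho> * s)" using s rho by simp
      have "- b \<le> - b / exp (\<rho> * s)" using e b(1) by (simp add: field_simps mult_le_cancel_left1)
      also have "\<dots> \<le> Ubar (Y N s \<omega>) / exp (\<rho> * s)" using b(2) by (intro divide_right_mono) auto
      finally show "- b \<le> Ubar (Y N s \<omega>) / exp (\<rho> * s)" .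
    qed auto
    moreover have "- (b * T) \<le> integral {0..?m} (\<lambda>s. - b)" using m mult_right_mono[OF m(2) b(1)] by (simp add: mult.commute)
    moreover have "exp (- \<rho> * T) * U (Y N t \<omega>) \<le> U (Y N t \<omega>) / exp (\<rho> * t)"
    proof -
      have "exp (- \<rho> * T) \<le> exp (- (\<rho> * t))" using t rho by (simp add: mult_left_mono)
      then have "exp (- \<rho> * T) * U (Y N t \<omega>) \<le> exp (- (\<rho> * t)) * U (Y N t \<omega>)" using U_nonneg by (rule mult_right_mono)
      then show ?thesis by (simp add: exp_minus divide_inverse mult.commute)
    qed
    ultimately show ?thesis by (simp add: lyap_exponent_def)
  qed
  then show thesis using that b(1) by blast
qed

text \<open>Coercivity makes \<open>norm x\<close> at most a power of \<open>1 + U x\<close>, and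
  the exponential dominates every power. The rate \<open>exp (- \<rho> * T)\<close> is the part of
  \<open>U\<close> that survives discounting up to time \<open>T\<close>.\<close>

lemma norm_powr_le_exp_U:
  assumes q: "0 \<le> q"
  obtains C where "0 \<le> C" "\<And>x. norm x powr q \<le> C * exp (exp (- \<rho> * T) * U x)"
proof -
  define \<theta> where "\<theta> = exp (- \<rho> * T)"
  have \<theta>: "0 < \<theta>" by (simp add: \<theta>_def)
  \<comment> \<open>Coercivity controls the power \<open>1 / c\<close> of the norm, so the
    \<open>q\<close>-th power needs exponent \<open>c * q\<close>, rounded up to an integer. The
    summand \<open>1\<close> in \<open>C\<close> handles \<open>norm x < 1\<close>.\<close>
  obtain n :: nat where n: "c * q \<le> real n" using real_arch_simple by blast
  define C where "C = 1 + (c / \<theta>) ^ n * (fact n * exp \<theta>)"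
  have C0: "0 \<le> C" using \<theta> c_ge by (simp add: C_def)
  have "norm x powr q \<le> C * exp (\<theta> * U x)" for x
  proof (cases "1 \<le> norm x")
    case False
    have "1 \<le> exp (\<theta> * U x)" using \<theta> U_nonneg[of x] by simp
    moreover have "1 \<le> C" using \<theta> c_ge by (simp add: C_def)
    ultimately have "1 \<le> C * exp (\<theta> * U x)" using mult_mono[of 1 C 1 "exp (\<theta> * U x)"] by simp
    moreover have "norm x powr q \<le> 1 powr q" using False q by (intro powr_mono2) auto
    ultimately show ?thesis by simp
  next
    case True
    have base: "1 \<le> c * (1 + U x)" using c_ge U_nonneg[of x] mult_mono[of 1 c 1 "1 + U x"] by simp
    have "norm x powr q = (norm x powr (1 / c)) powr (c * q)" using c_ge by (simp add: powr_powr)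
    also have "\<dots> \<le> (c * (1 + U x)) powr (c * q)" using U_coerc[of x] c_ge q by (intro powr_mono2) auto
    also have "\<dots> \<le> (c * (1 + U x)) powr (real n)" using base n by (intro powr_mono) auto
    also have "\<dots> = (c / \<theta>) ^ n * (\<theta> * (1 + U x)) ^ n"
      using base \<theta> by (simp add: powr_realpow power_mult_distrib[symmetric])
    also have "\<dots> \<le> (c / \<theta>) ^ n * (fact n * exp (\<theta> * (1 + U x)))"
      using \<theta> U_nonneg[of x] c_ge by (intro mult_left_mono power_le_fact_exp) auto
    also have "\<dots> = ((c / \<theta>) ^ n * (fact n * exp \<theta>)) * exp (\<theta> * U x)" by (simp add: distrib_left exp_add)
    also have "\<dots> \<le> C * exp (\<theta> * U x)" by (intro mult_right_mono) (auto simp: C_def)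
    finally show ?thesis .
  qed
  then show thesis using that[OF C0] by (simp add: \<theta>_def)
qed

lemma exp_lyap_exponent_uniform_bound:
  obtains B where "0 \<le> B"
    "\<And>N t. N \<ge> 1 \<Longrightarrow> t \<in> {0..T} \<Longrightarrow> (\<integral>\<^sup>+\<omega>. ennreal (exp (lyap_exponent N t \<omega>)) \<partial>M) \<le> ennreal B"
    "\<And>N l. N \<ge> 1 \<Longrightarrow> 0 \<le> l \<Longrightarrow>
      ennreal l * emeasure M {\<omega> \<in> space M. \<exists>k\<le>N. l \<le> exp (lyap_exponent N (grid N k) \<omega>)} \<le> ennreal B"
proof -
  obtain K where K: "0 \<le> K"
    "\<And>N t. N \<ge> 1 \<Longrightarrow> t \<in> {0..T} \<Longrightarrow>
      (\<integral>\<^sup>+\<omega>. ennreal (exp (lyap_exponent N t \<omega>)) \<partial>M) \<le> ennreal (exp (K * (T / real N) powr (1/4))) * E0"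
    "\<And>N l. N \<ge> 1 \<Longrightarrow> 0 \<le> l \<Longrightarrow>
      ennreal l * emeasure M {\<omega> \<in> space M. \<exists>k\<le>N. l \<le> exp (lyap_exponent N (grid N k) \<omega>)} \<le> ennreal (exp (K * (T / real N) powr (1/4))) * E0"
    by (rule exp_lyap_exponent_bounds, rule that)
  define B where "B = exp (K * T powr (1/4)) * enn2real E0"
  have E0: "E0 = ennreal (enn2real E0)" using exp_U_X0 by (simp add: less_top)
  have "ennreal (exp (K * (T / real N) powr (1/4))) * E0 \<le> ennreal B" if "N \<ge> 1" for N
  proof -
    have "T / real N \<le> T" using that T_pos by (simp add: divide_le_eq mult_le_cancel_left1)
    then have "K * (T / real N) powr (1/4) \<le> K * T powr (1/4)"
      using T_pos K(1) by (intro mult_left_mono powr_mono2) auto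
    then have "ennreal (exp (K * (T / real N) powr (1/4))) * E0 \<le> ennreal (exp (K * T powr (1/4))) * E0"
      by (intro mult_right_mono ennreal_leI) auto
    also have "\<dots> = ennreal B" by (subst E0) (simp add: B_def ennreal_mult)
    finally show ?thesis .
  qed
  then show thesis
    by (intro that[of B]) (auto simp: B_def intro: order_trans[OF K(2)] order_trans[OF K(3)])
qed

lemma Y_moment_bound:
  assumes q: "0 \<le> q"
  obtains C where "0 \<le> C"
    "\<And>N t. N \<ge> 1 \<Longrightarrow> t \<in> {0..T} \<Longrightarrow> (\<integral>\<^sup>+\<omega>. ennreal (norm (Y N t \<omega>) powr q) \<partial>M) \<le> ennreal C"
proof -
  obtain B where B: "0 \<le> B"
    "\<And>N t. N \<ge> 1 \<Longrightarrow> t \<in> {0..T} \<Longrightarrow> (\<integral>\<^sup>+\<omega>. ennreal (exp (lyap_exponent N t \<omega>)) \<partial>M) \<le> ennreal B"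
    "\<And>N l. N \<ge> 1 \<Longrightarrow> 0 \<le> l \<Longrightarrow>
      ennreal l * emeasure M {\<omega> \<in> space M. \<exists>k\<le>N. l \<le> exp (lyap_exponent N (grid N k) \<omega>)} \<le> ennreal B"
    by (rule exp_lyap_exponent_uniform_bound, rule that)
  obtain C where C: "0 \<le> C" "\<And>x. norm x powr q \<le> C * exp (exp (- \<rho> * T) * U x)" using norm_powr_le_exp_U[OF q] by blast
  obtain b where b: "0 \<le> b"
    "\<And>N t \<omega>. N \<ge> 1 \<Longrightarrow> t \<in> {0..T} \<Longrightarrow> \<omega> \<in> space M \<Longrightarrow> exp (- \<rho> * T) * U (Y N t \<omega>) - b * T \<le> lyap_exponent N t \<omega>"
    by (rule lyap_exponent_ge, rule that)
  have "(\<integral>\<^sup>+\<omega>. ennreal (norm (Y N t \<omega>) powr q) \<partial>M) \<le> ennreal (C * exp (b * T) * B)"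
    if N: "N \<ge> 1" and t: "t \<in> {0..T}" for N t
  proof -
    let ?g = "\<lambda>\<omega>. exp (exp (- \<rho> * T) * U (Y N t \<omega>) - b * T)"
    note [measurable] = Y_measurable_M[OF N t]
    have "(\<integral>\<^sup>+\<omega>. ennreal (norm (Y N t \<omega>) powr q) \<partial>M) \<le> (\<integral>\<^sup>+\<omega>. ennreal (C * exp (b * T)) * ennreal (?g \<omega>) \<partial>M)"
    proof (rule nn_integral_mono)
      fix \<omega>
      have "norm (Y N t \<omega>) powr q \<le> C * exp (b * T) * ?g \<omega>"
        using C(2)[of "Y N t \<omega>"] by (simp add: exp_diff)
      then show "ennreal (norm (Y N t \<omega>) powr q) \<le> ennreal (C * exp (b * T)) * ennreal (?g \<omega>)"
        using C(1) by (subst ennreal_mult[symmetric]) (auto intro: ennreal_leI)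
    qed
    also have "\<dots> = ennreal (C * exp (b * T)) * (\<integral>\<^sup>+\<omega>. ennreal (?g \<omega>) \<partial>M)"
      by (rule nn_integral_cmult) measurable
    also have "\<dots> \<le> ennreal (C * exp (b * T)) * (\<integral>\<^sup>+\<omega>. ennreal (exp (lyap_exponent N t \<omega>)) \<partial>M)"
      by (intro mult_left_mono nn_integral_mono ennreal_leI) (simp_all add: b(2)[OF N t, simplified])
    also have "\<dots> \<le> ennreal (C * exp (b * T)) * ennreal B" using B(2)[OF N t] by (rule mult_left_mono) simp
    also have "\<dots> = ennreal (C * exp (b * T) * B)" using B(1) C(1) by (subst ennreal_mult) auto
    finally show ?thesis .
  qed
  then show thesis using that[of "C * exp (b * T) * B"] B(1) C(1) by simp
qed

lemma Y_uniform_tail: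
  assumes "0 < \<epsilon>"
  obtains R where "1 \<le> R"
    "\<And>N. N \<ge> 1 \<Longrightarrow> emeasure M {\<omega> \<in> space M. \<exists>k\<le>N. R < norm (Y N (grid N k) \<omega>)} \<le> ennreal \<epsilon>"
proof -
  obtain B where B: "0 \<le> B"
    "\<And>N t. N \<ge> 1 \<Longrightarrow> t \<in> {0..T} \<Longrightarrow> (\<integral>\<^sup>+\<omega>. ennreal (exp (lyap_exponent N t \<omega>)) \<partial>M) \<le> ennreal B"
    "\<And>N l. N \<ge> 1 \<Longrightarrow> 0 \<le> l \<Longrightarrow>
      ennreal l * emeasure M {\<omega> \<in> space M. \<exists>k\<le>N. l \<le> exp (lyap_exponent N (grid N k) \<omega>)} \<le> ennreal B"
    by (rule exp_lyap_exponent_uniform_bound, rule that)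
  obtain b where b: "0 \<le> b"
    "\<And>N t \<omega>. N \<ge> 1 \<Longrightarrow> t \<in> {0..T} \<Longrightarrow> \<omega> \<in> space M \<Longrightarrow> exp (- \<rho> * T) * U (Y N t \<omega>) - b * T \<le> lyap_exponent N t \<omega>"
    by (rule lyap_exponent_ge, rule that)
  define \<theta> where "\<theta> = exp (- \<rho> * T)"
  \<comment> \<open>The maximal inequality gives probability at most \<open>B / l\<close>, hence at
    most \<epsilon>. \<open>Z\<close> is the size of \<open>U\<close> that forces the exponential
    above level \<open>l\<close>, and \<open>R\<close> is the radius beyond which coercivity makes
    \<open>U\<close> at least \<open>Z\<close>.\<close>
  define l where "l = 1 + B / \<epsilon>"
  define Z where "Z = (ln l + b * T) / \<theta>"
  define R where "R = (c * (1 + Z)) powr c"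
  have \<theta>: "0 < \<theta>" by (simp add: \<theta>_def)
  have l: "1 \<le> l" "B \<le> l * \<epsilon>" using B(1) assms by (auto simp: l_def field_simps)
  have Z: "0 \<le> Z" using \<theta> b(1) T_pos l by (auto simp: Z_def)
  have base: "1 \<le> c * (1 + Z)" using c_ge Z mult_mono[of 1 c 1 "1 + Z"] by simp
  then have R1: "1 \<le> R" using c_ge by (simp add: R_def ge_one_powr_ge_zero)
  have "emeasure M {\<omega> \<in> space M. \<exists>k\<le>N. R < norm (Y N (grid N k) \<omega>)} \<le> ennreal \<epsilon>" if N: "N \<ge> 1" for N
  proof -
    let ?A = "{\<omega> \<in> space M. \<exists>k\<le>N. l \<le> exp (lyap_exponent N (grid N k) \<omega>)}"
    have "{\<omega> \<in> space M. \<exists>k\<le>N. R < norm (Y N (grid N k) \<omega>)} \<subseteq> ?A"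
    proof safe
      fix \<omega> k assume w: "\<omega> \<in> space M" and k: "k \<le> N" "R < norm (Y N (grid N k) \<omega>)"
      let ?y = "Y N (grid N k) \<omega>"
      have "c * (1 + Z) = R powr (1 / c)" using base c_ge by (simp add: R_def powr_powr)
      also have "\<dots> \<le> norm ?y powr (1 / c)" using k(2) R1 c_ge by (intro powr_mono2) auto
      also have "\<dots> \<le> c * (1 + U ?y)" by (rule U_coerc)
      finally have "Z \<le> U ?y" using c_ge by simp
      then have "ln l + b * T \<le> \<theta> * U ?y" using \<theta> by (simp add: Z_def field_simps)
      then have "ln l \<le> lyap_exponent N (grid N k) \<omega>"
        using b(2)[OF N grid_mem[OF N k(1)] w] by (simp add: \<theta>_def)
      then have "exp (ln l) \<le> exp (lyap_exponent N (grid N k) \<omega>)" by simp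
      then show "\<exists>k\<le>N. l \<le> exp (lyap_exponent N (grid N k) \<omega>)" using k(1) l by auto
    qed
    moreover have A: "?A \<in> sets M"
    proof -
      have "{\<omega> \<in> space M. \<exists>k\<in>{..N}. l \<le> exp (lyap_exponent N (grid N k) \<omega>)} \<in> sets M"
        by (rule sets.sets_Collect_finite_Ex) (use lyap_exponent_measurable_M[OF N] in \<open>auto intro!: borel_measurable_le measurable_compose[OF _ borel_measurable_exp]\<close>)
      then show ?thesis by (simp only: Bex_def atMost_iff)
    qed
    ultimately have "emeasure M {\<omega> \<in> space M. \<exists>k\<le>N. R < norm (Y N (grid N k) \<omega>)} \<le> emeasure M ?A" by (rule emeasure_mono)
    also have "\<dots> \<le> ennreal \<epsilon>"
    proof -
      have "ennreal (l * measure M ?A) \<le> ennreal B"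
        using B(3)[OF N, of l] l by (simp add: emeasure_eq_measure ennreal_mult)
      then have "l * measure M ?A \<le> B" using B(1) by (simp add: ennreal_le_iff)
      then have "l * measure M ?A \<le> l * \<epsilon>" using l(2) by (rule order_trans)
      then have "measure M ?A \<le> \<epsilon>" using l by simp
      then show ?thesis by (simp add: emeasure_eq_measure ennreal_leI)
    qed
    finally show ?thesis .
  qed
  then show thesis using that[OF R1] by blast
qed

text \<open>The factor in front of \<open>E0\<close> is the exponential of a multiple of
  \<open>h\<close> to the power \<open>1/4\<close> and tends to 1. Finiteness of \<open>E0\<close>
  allows the limit to be taken inside the product.\<close>

lemma limsup_exp_lyap_exponent:
  "limsup (\<lambda>N. SUP t\<in>{0..T}. \<integral>\<^sup>+\<omega>. ennreal (exp (lyap_exponent N t \<omega>)) \<partial>M) \<le> E0"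
proof -
  obtain K where K: "0 \<le> K"
    "\<And>N t. N \<ge> 1 \<Longrightarrow> t \<in> {0..T} \<Longrightarrow>
      (\<integral>\<^sup>+\<omega>. ennreal (exp (lyap_exponent N t \<omega>)) \<partial>M) \<le> ennreal (exp (K * (T / real N) powr (1/4))) * E0"
    "\<And>N l. N \<ge> 1 \<Longrightarrow> 0 \<le> l \<Longrightarrow>
      ennreal l * emeasure M {\<omega> \<in> space M. \<exists>k\<le>N. l \<le> exp (lyap_exponent N (grid N k) \<omega>)} \<le> ennreal (exp (K * (T / real N) powr (1/4))) * E0"
    by (rule exp_lyap_exponent_bounds, rule that)
  let ?g = "\<lambda>N. exp (K * (T / real N) powr (1/4))"
  have "limsup (\<lambda>N. SUP t\<in>{0..T}. \<integral>\<^sup>+\<omega>. ennreal (exp (lyap_exponent N t \<omega>)) \<partial>M) \<le> limsup (\<lambda>N. E0 * ennreal (?g N))"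
    by (rule Limsup_mono, rule eventually_sequentiallyI[of 1]) (auto intro!: SUP_least K(2) simp: mult.commute[of E0])
  also have "\<dots> = E0 * ennreal (exp (K * 0))"
  proof (rule lim_imp_Limsup)
    have "(\<lambda>N. T / real N) \<longlonglongrightarrow> 0" by (rule lim_const_over_n)
    then have "(\<lambda>N. (T / real N) powr (1/4)) \<longlonglongrightarrow> 0"
      by (rule tendsto_zero_powrI[OF _ tendsto_const]) (use T_pos in auto)
    then have "?g \<longlonglongrightarrow> exp (K * 0)" by (intro tendsto_intros)
    then show "(\<lambda>N. E0 * ennreal (?g N)) \<longlonglongrightarrow> E0 * ennreal (exp (K * 0))"
      using exp_U_X0 by (intro ennreal_tendsto_cmult tendsto_ennrealI) auto
  qed simp
  finally show ?thesis by simp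
qed

lemma SUP_exp_lyap_exponent_finite:
  "(SUP N\<in>{1..}. SUP t\<in>{0..T}. \<integral>\<^sup>+\<omega>. ennreal (exp (lyap_exponent N t \<omega>)) \<partial>M) < \<infinity>"
proof -
  obtain B where B: "0 \<le> B"
    "\<And>N t. N \<ge> 1 \<Longrightarrow> t \<in> {0..T} \<Longrightarrow> (\<integral>\<^sup>+\<omega>. ennreal (exp (lyap_exponent N t \<omega>)) \<partial>M) \<le> ennreal B"
    "\<And>N l. N \<ge> 1 \<Longrightarrow> 0 \<le> l \<Longrightarrow>
      ennreal l * emeasure M {\<omega> \<in> space M. \<exists>k\<le>N. l \<le> exp (lyap_exponent N (grid N k) \<omega>)} \<le> ennreal B"
    by (rule exp_lyap_exponent_uniform_bound, rule that)
  have "(SUP N\<in>{1..}. SUP t\<in>{0..T}. \<integral>\<^sup>+\<omega>. ennreal (exp (lyap_exponent N t \<omega>)) \<partial>M) \<le> ennreal B"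
    by (intro SUP_least B(2)) auto
  then show ?thesis by (rule le_less_trans) simp
qed

end

section \<open>Convergence in probability\<close>

lemma fraction_floor:
  fixes s t :: real
  assumes "0 \<le> s" "s \<le> t"
  defines "a n \<equiv> nat \<lfloor>real n * (s / t)\<rfloor>"
  shows "a n \<le> n" and "(\<lambda>n. t * (real (a n) / real n)) \<longlonglongrightarrow> s"
proof -
  have r: "0 \<le> s / t" "s / t \<le> 1" using assms by (auto simp: divide_le_eq)
  have a: "real (a n) = of_int \<lfloor>real n * (s / t)\<rfloor>" for n
  proof -
    have "0 \<le> real n * (s / t)" using r by (intro mult_nonneg_nonneg) auto
    then show ?thesis unfolding a_def by (intro of_nat_nat) (simp only: zero_le_floor)
  qed
  have "real (a n) \<le> real n * (s / t)" for n unfolding a by linarith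
  also have "real n * (s / t) \<le> real n * 1" for n using r by (intro mult_left_mono) auto
  finally show "a n \<le> n" for n by simp
  have b: "\<bar>real (a n) / real n - s / t\<bar> \<le> 1 / real n" if "n \<ge> 1" for n
  proof -
    have "\<bar>real (a n) - real n * (s / t)\<bar> \<le> 1" unfolding a by linarith
    then have "\<bar>real (a n) - real n * (s / t)\<bar> / real n \<le> 1 / real n" by (rule divide_right_mono) simp
    also have "\<bar>real (a n) - real n * (s / t)\<bar> / real n = \<bar>real (a n) / real n - s / t\<bar>"
    proof -
      have "(real (a n) - real n * (s / t)) / real n = real (a n) / real n - s / t"
        using that by (simp add: diff_divide_distrib)
      then show ?thesis by (metis abs_divide abs_of_nat)
    qed
    finally show ?thesis .
  qed
  have "(\<lambda>n. real (a n) / real n - s / t) \<longlonglongrightarrow> 0"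
    by (rule tendsto_rabs_zero_cancel, rule tendsto_sandwich[of "\<lambda>_. 0" _ _ "\<lambda>n. 1 / real n"])
      (use b in \<open>auto intro!: eventually_sequentiallyI[of 1] lim_const_over_n\<close>)
  from tendsto_mult[OF tendsto_const LIM_zero_cancel[OF this]]
  have "(\<lambda>n. t * (real (a n) / real n)) \<longlonglongrightarrow> t * (s / t)" .
  \<comment> \<open>For \<open>t = 0\<close> also \<open>s = 0\<close>, and division by zero yields
    zero.\<close>
  moreover have "t * (s / t) = s" using assms by (cases "t = 0") auto
  ultimately show "(\<lambda>n. t * (real (a n) / real n)) \<longlonglongrightarrow> s" by simp
qed

lemma fraction_mem:
  fixes t :: real
  assumes "0 \<le> t" "a \<le> b"
  shows "t * (real a / real b) \<in> {0..t}"
proof -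
  have "real a / real b \<le> 1" using assms by (auto simp: divide_le_eq)
  then show ?thesis using mult_left_mono[of "real a / real b" 1 t] assms by simp
qed

text \<open>By continuity the fractions of \<open>t\<close>, a countable dense set, decide a
  condition on all times. This makes the corresponding events measurable.\<close>

lemma continuous_bounded_iff_fractions:
  fixes f :: "real \<Rightarrow> 'b::real_normed_vector"
  assumes t: "0 \<le> t" and f: "continuous_on {0..t} f"
  shows "(\<forall>s\<in>{0..t}. norm (f s) \<le> R) \<longleftrightarrow> (\<forall>b. \<forall>a\<in>{..b}. norm (f (t * (real a / real b))) \<le> R)"
proof safe
  fix b a :: nat
  assume "\<forall>s\<in>{0..t}. norm (f s) \<le> R" "a \<le> b"
  then show "norm (f (t * (real a / real b))) \<le> R" using fraction_mem[OF t] by blast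
next
  fix s assume *: "\<forall>b. \<forall>a\<in>{..b}. norm (f (t * (real a / real b))) \<le> R" and s: "s \<in> {0..t}"
  let ?u = "\<lambda>n. t * (real (nat \<lfloor>real n * (s / t)\<rfloor>) / real n)"
  have u: "?u \<longlonglongrightarrow> s" "nat \<lfloor>real n * (s / t)\<rfloor> \<le> n" for n using fraction_floor[of s t] s by auto
  have "(\<lambda>n. norm (f (?u n))) \<longlonglongrightarrow> norm (f s)"
    by (intro tendsto_norm continuous_on_tendsto_compose[OF f u(1) s]) (use fraction_mem[OF t] u(2) in auto)
  then show "norm (f s) \<le> R" by (rule LIMSEQ_le_const2) (use * u(2) in auto)
qed

lemma (in finite_measure) measure_decseq_tendsto_0:
  assumes "\<And>n. B n \<in> sets M" "decseq B" "(\<Inter>n. B n) = {}"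
  shows "(\<lambda>n. measure M (B n)) \<longlonglongrightarrow> 0"
proof -
  have "range B \<subseteq> sets M" using assms(1) by blast
  then show ?thesis using finite_Lim_measure_decseq[of B] assms(2,3) by simp
qed

text \<open>The events that some index from \<open>n\<close> on still deviates by more than
  \<epsilon> decrease to the empty set.\<close>

lemma (in finite_measure) pointwise_limit_in_measure:
  fixes f :: "nat \<Rightarrow> 'a \<Rightarrow> 'b::{real_normed_vector, second_countable_topology}"
  assumes [measurable]: "\<And>n. f n \<in> borel_measurable M" "g \<in> borel_measurable M"
    and lim: "\<And>\<omega>. \<omega> \<in> space M \<Longrightarrow> (\<lambda>n. f n \<omega>) \<longlonglongrightarrow> g \<omega>"
    and e: "0 < \<epsilon>" "0 < \<delta>"
  shows "\<forall>\<^sub>F n in sequentially. measure M {\<omega> \<in> space M. \<epsilon> < norm (f n \<omega> - g \<omega>)} < \<delta>"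
proof -
  define B where "B n = {\<omega> \<in> space M. \<exists>k\<ge>n. \<epsilon> < norm (f k \<omega> - g \<omega>)}" for n
  have [measurable]: "B n \<in> sets M" for n unfolding B_def by measurable
  have "decseq B" unfolding B_def by (intro decseq_SucI) (auto intro: Suc_leD)
  moreover have "(\<Inter>n. B n) = {}"
  proof safe
    fix \<omega> assume *: "\<omega> \<in> (\<Inter>n. B n)"
    then have "\<omega> \<in> space M" by (auto simp: B_def)
    from lim[OF this] e obtain n where "\<forall>k\<ge>n. norm (f k \<omega> - g \<omega>) < \<epsilon>" by (auto simp: LIMSEQ_iff)
    then have "\<omega> \<notin> B n" by (auto simp: B_def not_less less_imp_le)
    then show "\<omega> \<in> {}" using * by blast
  qed
  ultimately have "(\<lambda>n. measure M (B n)) \<longlonglongrightarrow> 0"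
    by (intro measure_decseq_tendsto_0) auto
  then have "\<forall>\<^sub>F n in sequentially. measure M (B n) < \<delta>" using e(2) by (rule order_tendstoD)
  then show ?thesis
    by eventually_elim (rule le_less_trans[OF finite_measure_mono], auto simp: B_def)
qed

text \<open>Using fractions of \<open>t\<close> itself, not of \<open>T\<close>, involves no time
  after \<open>t\<close>, so the event belongs to \<open>F t\<close> and can serve as an adapted
  localisation.\<close>

lemma (in filtered_brownian_motion) sup_event_measurable:
  fixes X :: "real \<Rightarrow> 'a \<Rightarrow> 'b::{real_normed_vector, second_countable_topology}"
  assumes t: "t \<in> {0..T}" and X: "\<And>s. s \<in> {0..T} \<Longrightarrow> X s \<in> borel_measurable (F s)"
    and cont: "\<And>\<omega>. \<omega> \<in> space M \<Longrightarrow> continuous_on {0..T} (\<lambda>s. X s \<omega>)"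
  shows "{\<omega> \<in> space M. \<forall>s\<in>{0..t}. norm (X s \<omega>) \<le> R} \<in> sets (F t)"
proof -
  have m: "X (t * (real a / real b)) \<in> borel_measurable (F t)" if "a \<le> b" for a b
    using fraction_mem[of t a b] that t by (intro measurable_F_mono[OF _ _ _ X]) auto
  have "{\<omega> \<in> space (F t). \<forall>b. \<forall>a\<in>{..b}. norm (X (t * (real a / real b)) \<omega>) \<le> R} \<in> sets (F t)"
    by (intro sets.sets_Collect_countable_All sets.sets_Collect_finite_All' borel_measurable_le
        measurable_compose[OF m borel_measurable_norm] borel_measurable_const) auto
  also have "{\<omega> \<in> space (F t). \<forall>b. \<forall>a\<in>{..b}. norm (X (t * (real a / real b)) \<omega>) \<le> R} = {\<omega> \<in> space M. \<forall>s\<in>{0..t}. norm (X s \<omega>) \<le> R}"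
    unfolding space_F[OF t]
  proof (rule Collect_cong, rule conj_cong[OF refl])
    fix \<omega> assume "\<omega> \<in> space M"
    then have "continuous_on {0..t} (\<lambda>s. X s \<omega>)" using continuous_on_subset[OF cont] t by auto
    then show "(\<forall>b. \<forall>a\<in>{..b}. norm (X (t * (real a / real b)) \<omega>) \<le> R) = (\<forall>s\<in>{0..t}. norm (X s \<omega>) \<le> R)"
      using continuous_bounded_iff_fractions[of t "\<lambda>s. X s \<omega>" R] t by auto
  qed
  finally show ?thesis .
qed

text \<open>Each continuous path is bounded on \<open>{0..T}\<close>, so the complements of the
  measurable events \<open>G n\<close> decrease to the empty set. No moment of the process is
  involved.\<close>

lemma (in filtered_brownian_motion) bounded_paths_event:
  fixes X :: "real \<Rightarrow> 'a \<Rightarrow> 'b::{real_normed_vector, second_countable_topology}"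
  assumes T: "0 \<le> T" and X: "\<And>s. s \<in> {0..T} \<Longrightarrow> X s \<in> borel_measurable (F s)"
    and cont: "\<And>\<omega>. \<omega> \<in> space M \<Longrightarrow> continuous_on {0..T} (\<lambda>s. X s \<omega>)"
    and e: "0 < \<epsilon>"
  obtains R where "1 \<le> R" "prob (space M - {\<omega> \<in> space M. \<forall>s\<in>{0..T}. norm (X s \<omega>) \<le> R}) \<le> \<epsilon>"
proof -
  define G where "G n = {\<omega> \<in> space M. \<forall>s\<in>{0..T}. norm (X s \<omega>) \<le> real n}" for n
  have GM: "G n \<in> sets M" for n
    using sup_event_measurable[OF _ X cont, of T "real n"] sets_F_subset[of T] T unfolding G_def by auto
  have "decseq (\<lambda>n. space M - G n)" unfolding G_def by (intro decseq_SucI) (auto intro: order_trans)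
  moreover have "(\<Inter>n. space M - G n) = {}"
  proof safe
    fix \<omega> assume *: "\<omega> \<in> (\<Inter>n. space M - G n)"
    then have w: "\<omega> \<in> space M" by auto
    have "bounded ((\<lambda>s. X s \<omega>) ` {0..T})" by (intro compact_imp_bounded compact_continuous_image cont w) simp
    then obtain K where K: "\<forall>s\<in>{0..T}. norm (X s \<omega>) \<le> K" by (auto simp: bounded_iff)
    obtain n :: nat where "K \<le> real n" using real_arch_simple by blast
    then have "\<omega> \<in> G n" using K w by (auto simp: G_def intro: order_trans)
    then show "\<omega> \<in> {}" using * by blast
  qed
  ultimately have "(\<lambda>n. prob (space M - G n)) \<longlonglongrightarrow> 0"
    by (intro measure_decseq_tendsto_0[of "\<lambda>n. space M - G n"] sets.compl_sets GM)
  then have "\<forall>\<^sub>F n in sequentially. prob (space M - G n) < \<epsilon>" using e by (rule order_tendstoD)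
  then have "\<forall>\<^sub>F n in sequentially. n \<ge> 1 \<and> prob (space M - G n) < \<epsilon>"
    using eventually_ge_at_top[of 1] by eventually_elim simp
  then obtain n where n: "n \<ge> 1" "prob (space M - G n) < \<epsilon>" by (auto dest: eventually_happens)
  show thesis by (rule that[of "real n"]) (use n in \<open>auto simp: G_def\<close>)
qed

text \<open>The same argument with uniform continuity of each path. The event is defined on
  fractions only, to be measurable, and its property is then extended to all times by
  continuity.\<close>

lemma (in filtered_brownian_motion) modulus_event:
  fixes X :: "real \<Rightarrow> 'a \<Rightarrow> 'b::{real_normed_vector, second_countable_topology}"
  assumes T: "0 < T" and X: "\<And>s. s \<in> {0..T} \<Longrightarrow> X s \<in> borel_measurable (F s)"
    and cont: "\<And>\<omega>. \<omega> \<in> space M \<Longrightarrow> continuous_on {0..T} (\<lambda>s. X s \<omega>)"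
    and e: "0 < \<epsilon>" "0 < \<delta>"
  obtains r G where "0 < r" "G \<in> sets M" "prob (space M - G) \<le> \<epsilon>"
    "\<And>\<omega> s t. \<omega> \<in> G \<Longrightarrow> s \<in> {0..T} \<Longrightarrow> t \<in> {0..T} \<Longrightarrow> \<bar>s - t\<bar> < r \<Longrightarrow> norm (X s \<omega> - X t \<omega>) \<le> \<delta>"
proof -
  let ?q = "\<lambda>a b. T * (real a / real b)"
  define G where "G n = {\<omega> \<in> space M. \<forall>b. \<forall>a\<in>{..b}. \<forall>b'. \<forall>a'\<in>{..b'}. \<bar>?q a b - ?q a' b'\<bar> < 1 / real (Suc n) \<longrightarrow>
     norm (X (?q a b) \<omega> - X (?q a' b') \<omega>) \<le> \<delta>}" for n
  have mq: "X (?q a b) \<in> borel_measurable M" if "a \<le> b" for a b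
    using fraction_mem[of T a b] that T by (intro measurable_F_M[OF _ X]) auto
  have GM: "G n \<in> sets M" for n
    unfolding G_def
    by (intro sets.sets_Collect_countable_All sets.sets_Collect_finite_All' sets.sets_Collect_imp borel_measurable_le
        measurable_compose[OF _ borel_measurable_norm] borel_measurable_const borel_measurable_diff mq) auto
  have "decseq (\<lambda>n. space M - G n)"
  proof (rule decseq_SucI)
    fix n
    have "1 / real (Suc (Suc n)) \<le> 1 / real (Suc n)" by (intro divide_left_mono) auto
    then show "space M - G (Suc n) \<subseteq> space M - G n" unfolding G_def by fastforce
  qed
  moreover have "(\<Inter>n. space M - G n) = {}"
  proof safe
    fix \<omega> assume *: "\<omega> \<in> (\<Inter>n. space M - G n)"
    then have w: "\<omega> \<in> space M" by auto
    have "uniformly_continuous_on {0..T} (\<lambda>s. X s \<omega>)" by (intro compact_uniformly_continuous cont w) simp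
    then obtain d where d: "0 < d" "\<And>s t. s \<in> {0..T} \<Longrightarrow> t \<in> {0..T} \<Longrightarrow> dist t s < d \<Longrightarrow> dist (X t \<omega>) (X s \<omega>) < \<delta>"
      using e(2) unfolding uniformly_continuous_on_def by metis
    obtain n where n: "inverse (real (Suc n)) < d" using reals_Archimedean[OF d(1)] by blast
    have "\<omega> \<in> G n"
      unfolding G_def
    proof (safe intro!: w)
      fix b a b' a' :: nat
      assume ab: "a \<le> b" "a' \<le> b'" "\<bar>?q a b - ?q a' b'\<bar> < 1 / real (Suc n)"
      have "dist (?q a b) (?q a' b') < d" using ab n by (simp add: dist_real_def inverse_eq_divide)
      then have "dist (X (?q a b) \<omega>) (X (?q a' b') \<omega>) < \<delta>"
        using fraction_mem[OF less_imp_le[OF T]] ab by (intro d(2))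
      then show "norm (X (?q a b) \<omega> - X (?q a' b') \<omega>) \<le> \<delta>" by (simp add: dist_norm)
    qed
    then show "\<omega> \<in> {}" using * by blast
  qed
  ultimately have "(\<lambda>n. prob (space M - G n)) \<longlonglongrightarrow> 0"
    by (intro measure_decseq_tendsto_0[of "\<lambda>n. space M - G n"] sets.compl_sets GM)
  then have "\<forall>\<^sub>F n in sequentially. prob (space M - G n) < \<epsilon>" using e(1) by (rule order_tendstoD)
  then obtain n where n: "prob (space M - G n) < \<epsilon>" by (auto simp: eventually_sequentially)
  have bound: "norm (X s \<omega> - X t \<omega>) \<le> \<delta>" if w: "\<omega> \<in> G n" and st: "s \<in> {0..T}" "t \<in> {0..T}" "\<bar>s - t\<bar> < 1 / real (Suc n)" for \<omega> s t
  proof -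
    have wM: "\<omega> \<in> space M" using w by (simp add: G_def)
    let ?u = "\<lambda>s k. T * (real (nat \<lfloor>real k * (s / T)\<rfloor>) / real k)"
    have u: "?u s \<longlonglongrightarrow> s" "?u t \<longlonglongrightarrow> t" and le: "nat \<lfloor>real k * (s / T)\<rfloor> \<le> k" "nat \<lfloor>real k * (t / T)\<rfloor> \<le> k" for k
      using fraction_floor[of s T] fraction_floor[of t T] st by auto
    have mem: "?u s k \<in> {0..T}" "?u t k \<in> {0..T}" for k using fraction_mem[OF less_imp_le[OF T]] le by auto
    have "(\<lambda>k. norm (X (?u s k) \<omega> - X (?u t k) \<omega>)) \<longlonglongrightarrow> norm (X s \<omega> - X t \<omega>)"
      by (intro tendsto_norm tendsto_diff continuous_on_tendsto_compose[OF cont[OF wM] u(1) st(1)]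
          continuous_on_tendsto_compose[OF cont[OF wM] u(2) st(2)]) (use mem in auto)
    moreover have "\<forall>\<^sub>F k in sequentially. norm (X (?u s k) \<omega> - X (?u t k) \<omega>) \<le> \<delta>"
    proof -
      \<comment> \<open>The strict inequality for the distance of \<open>s\<close> and
        \<open>t\<close> persists for their approximations, whereas the bound on the values survives
        the limit as a weak inequality.\<close>
      have "(\<lambda>k. \<bar>?u s k - ?u t k\<bar>) \<longlonglongrightarrow> \<bar>s - t\<bar>" by (intro tendsto_rabs tendsto_diff u)
      then have "\<forall>\<^sub>F k in sequentially. \<bar>?u s k - ?u t k\<bar> < 1 / real (Suc n)" using st(3) by (rule order_tendstoD)
      then show ?thesis by eventually_elim (use w le in \<open>auto simp: G_def\<close>)
    qed
    ultimately show ?thesis by (rule tendsto_upperbound) simp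
  qed
  show thesis by (rule that[of "1 / real (Suc n)" "G n"]) (use GM n bound in auto)
qed

lemma norm_add_gt_half:
  fixes x y :: "'a::real_normed_vector"
  assumes "\<epsilon> < norm (x + y)"
  shows "\<epsilon> / 2 < norm x \<or> \<epsilon> / 2 < norm y"
  using assms norm_triangle_ineq[of x y] by linarith

section \<open>Riemann sums of the solution on refined grids\<close>

locale tamed_euler_sde = tamed_euler_scheme M F T W \<mu> \<sigma> \<rho> U Ubar U1 U2 U3 Y \<tau> p c "X 0"
  for M :: "'a measure" and F T and W :: "real \<Rightarrow> 'a \<Rightarrow> real^'m"
    and \<mu> :: "real^'d \<Rightarrow> real^'d" and \<sigma> :: "real^'d \<Rightarrow> real^'m^'d" and \<rho> U Ubar U1 U2 U3 Y \<tau> p c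
    and X :: "real \<Rightarrow> 'a \<Rightarrow> real^'d" +
  assumes SDE: "sde_solution M F T \<mu> \<sigma> W X"
begin

lemma X_adapted: "t \<in> {0..T} \<Longrightarrow> X t \<in> borel_measurable (F t)"
  using SDE by (simp add: sde_solution_def)

lemma X_measurable: "t \<in> {0..T} \<Longrightarrow> X t \<in> borel_measurable M"
  using X_adapted measurable_F_M by blast

lemma X_continuous: "\<omega> \<in> space M \<Longrightarrow> continuous_on {0..T} (\<lambda>t. X t \<omega>)"
  using SDE by (simp add: sde_solution_def)

definition fine_step :: "nat \<Rightarrow> nat \<Rightarrow> real" where
  "fine_step N m = T / (real N * real m)"

text \<open>Each Euler cell is divided into \<open>m\<close> parts, and the sum runs over the first
  \<open>k\<close> cells. One mesh serves all \<open>k\<close>, so that the sums can be compared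
  with the scheme along the whole grid.\<close>

definition fine_sum :: "nat \<Rightarrow> nat \<Rightarrow> nat \<Rightarrow> 'a \<Rightarrow> real^'d" where
  "fine_sum N m k \<omega> = (\<Sum>i<k * m. fine_step N m *\<^sub>R \<mu> (X (real i * fine_step N m) \<omega>)
     + \<sigma> (X (real i * fine_step N m) \<omega>) *v incr (real i * fine_step N m) (real (Suc i) * fine_step N m) \<omega>)"

text \<open>The integrals are approximated along uniform partitions of \<open>{0..grid N k}\<close>.
  With \<open>k * m\<close> pieces such a partition has exactly the mesh
  \<open>fine_step N m\<close>, so one passes to the subsequence of multiples of \<open>k\<close>;
  the drift converges pathwise and the noise by the definition of the Ito integral.\<close>

lemma fine_sum_converges_at:
  assumes N: "N \<ge> 1" "k \<le> N" and e: "0 < \<epsilon>" "0 < \<delta>"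
  shows "\<forall>\<^sub>F m in sequentially. \<exists>A\<in>sets M.
     {\<omega> \<in> space M. \<epsilon> < norm (X (grid N k) \<omega> - X 0 \<omega> - fine_sum N m k \<omega>)} \<subseteq> A \<and> prob A \<le> \<delta>"
proof (cases "k = 0")
  case True
  then show ?thesis using e by (intro always_eventually allI bexI[of _ "{}"]) (auto simp: fine_sum_def)
next
  case False
  let ?t = "grid N k"
  have tT: "?t \<in> {0..T}" by (rule grid_mem[OF N])
  let ?J = "\<lambda>\<omega>. integral {0..?t} (\<lambda>s. \<mu> (X s \<omega>))"
  let ?S = "\<lambda>n \<omega>. \<Sum>i<n. \<sigma> (X (real i * ?t / real n) \<omega>) *v (W (real (Suc i) * ?t / real n) \<omega> - W (real i * ?t / real n) \<omega>)"
  let ?L = "\<lambda>n \<omega>. ((?t - 0) / real n) *\<^sub>R (\<Sum>i<n. \<mu> (X (0 + real i * ((?t - 0) / real n)) \<omega>))"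
  have ito: "\<forall>\<^sub>F n in sequentially. \<exists>A\<in>sets M. {\<omega>\<in>space M. \<epsilon> / 2 < dist (?S n \<omega>) (X ?t \<omega> - X 0 \<omega> - ?J \<omega>)} \<subseteq> A \<and> measure M A < \<delta> / 2"
    using SDE tT e unfolding sde_solution_def is_ito_integral_def conv_in_prob_def by (meson half_gt_zero)
  have Xm: "X s \<in> borel_measurable M" if "s \<in> {0..?t}" for s using X_measurable[of s] that tT by auto
  have cont: "continuous_on {0..?t} (\<lambda>s. \<mu> (X s \<omega>))" if "\<omega> \<in> space M" for \<omega>
    by (rule continuous_on_compose2[OF mu_continuous continuous_on_subset[OF X_continuous[OF that]]]) (use tT in auto)
  have Lm: "?L n \<in> borel_measurable M" for n
  proof (intro borel_measurable_scaleR borel_measurable_const borel_measurable_sum)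
    fix i assume "i \<in> {..<n}"
    then have "0 + real i * ((?t - 0) / real n) \<in> {0..?t}"
      using tT by (intro riemann_point_in_interval) auto
    from Xm[OF this] show "(\<lambda>\<omega>. \<mu> (X (0 + real i * ((?t - 0) / real n)) \<omega>)) \<in> borel_measurable M" by measurable
  qed
  have Jm: "?J \<in> borel_measurable M"
  proof (rule borel_measurable_integral_continuous)
    show "(\<lambda>\<omega>. \<mu> (X s \<omega>)) \<in> borel_measurable M" if "s \<in> {0..?t}" for s using Xm[OF that] by measurable
  qed (use cont tT in auto)
  have leb: "\<forall>\<^sub>F n in sequentially. prob {\<omega> \<in> space M. \<epsilon> / 2 < norm (?L n \<omega> - ?J \<omega>)} < \<delta> / 2"
  proof (rule pointwise_limit_in_measure[OF Lm Jm])
    show "(\<lambda>n. ?L n \<omega>) \<longlonglongrightarrow> ?J \<omega>" if "\<omega> \<in> space M" for \<omega>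
      by (rule riemann_sum_tendsto_integral[OF _ cont[OF that]]) (use tT in auto)
  qed (use e in auto)
  have Bm: "{\<omega> \<in> space M. \<epsilon> / 2 < norm (?L n \<omega> - ?J \<omega>)} \<in> sets M" for n
    by (rule borel_measurable_less[OF borel_measurable_const measurable_compose[OF borel_measurable_diff[OF Lm Jm] borel_measurable_norm]])
  have "filterlim (\<lambda>m. k * m) sequentially sequentially"
    using False by (intro filterlim_subseq) (auto simp: strict_mono_def)
  from eventually_compose_filterlim[OF eventually_conj[OF ito leb] this] eventually_ge_at_top[of 1]
  show ?thesis
  proof eventually_elim
    case (elim m)
    let ?n = "k * m" and ?g = "fine_step N m"
    obtain A where A: "A \<in> sets M" "{\<omega>\<in>space M. \<epsilon> / 2 < dist (?S ?n \<omega>) (X ?t \<omega> - X 0 \<omega> - ?J \<omega>)} \<subseteq> A" "measure M A < \<delta> / 2"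
      using elim by blast
    let ?B = "{\<omega> \<in> space M. \<epsilon> / 2 < norm (?L ?n \<omega> - ?J \<omega>)}"
    have gt: "real i * ?t / real ?n = real i * ?g" "(?t - 0) / real ?n = ?g" for i
      using False elim(2) N by (auto simp: grid_def fine_step_def field_simps)
    have dec: "fine_sum N m k \<omega> = ?L ?n \<omega> + ?S ?n \<omega>" for \<omega>
      unfolding gt fine_sum_def sum.distrib scaleR_sum_right by simp
    have "{\<omega> \<in> space M. \<epsilon> < norm (X ?t \<omega> - X 0 \<omega> - fine_sum N m k \<omega>)} \<subseteq> A \<union> ?B"
    proof safe
      fix \<omega> assume w: "\<omega> \<in> space M" "\<epsilon> < norm (X ?t \<omega> - X 0 \<omega> - fine_sum N m k \<omega>)" "\<omega> \<notin> A" 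
      have eq: "X ?t \<omega> - X 0 \<omega> - fine_sum N m k \<omega> = ((X ?t \<omega> - X 0 \<omega> - ?J \<omega>) - ?S ?n \<omega>) + (?J \<omega> - ?L ?n \<omega>)"
        unfolding dec by simp
      have "\<not> \<epsilon> / 2 < norm ((X ?t \<omega> - X 0 \<omega> - ?J \<omega>) - ?S ?n \<omega>)"
        using A(2) w(1,3) by (auto simp: dist_norm norm_minus_commute)
      then have "\<epsilon> / 2 < norm (?J \<omega> - ?L ?n \<omega>)"
        using norm_add_gt_half[OF w(2)[unfolded eq]] by blast
      then show "\<epsilon> / 2 < norm (?L ?n \<omega> - ?J \<omega>)" by (subst norm_minus_commute)
    qed
    moreover have "prob (A \<union> ?B) \<le> \<delta>"
      using measure_Un_le[OF A(1) Bm[of ?n]] A(3) elim(1) by linarith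
    ultimately show ?case using A(1) Bm[of ?n] by blast
  qed
qed

text \<open>For fixed \<open>N\<close> only finitely many grid points matter, so a single refinement
  \<open>m\<close> works for all of them. Its dependence on \<open>N\<close> is harmless because the
  later estimates are uniform in \<open>m\<close>.\<close>

lemma fine_sum_converges:
  assumes N: "N \<ge> 1" and e: "0 < \<epsilon>" "0 < \<delta>"
  obtains m A where "m \<ge> 1" "\<And>k. k \<le> N \<Longrightarrow> A k \<in> sets M"
    "\<And>k. k \<le> N \<Longrightarrow> {\<omega> \<in> space M. \<epsilon> < norm (X (grid N k) \<omega> - X 0 \<omega> - fine_sum N m k \<omega>)} \<subseteq> A k"
    "\<And>k. k \<le> N \<Longrightarrow> prob (A k) \<le> \<delta>"
proof -
  have "\<forall>\<^sub>F m in sequentially. \<forall>k\<in>{..N}. \<exists>A\<in>sets M.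
     {\<omega> \<in> space M. \<epsilon> < norm (X (grid N k) \<omega> - X 0 \<omega> - fine_sum N m k \<omega>)} \<subseteq> A \<and> prob A \<le> \<delta>"
    using fine_sum_converges_at[OF N _ e] by (intro eventually_ball_finite) auto
  then have "\<forall>\<^sub>F m in sequentially. m \<ge> 1 \<and> (\<forall>k\<in>{..N}. \<exists>A\<in>sets M.
     {\<omega> \<in> space M. \<epsilon> < norm (X (grid N k) \<omega> - X 0 \<omega> - fine_sum N m k \<omega>)} \<subseteq> A \<and> prob A \<le> \<delta>)"
    by (rule eventually_conj[OF eventually_ge_at_top])
  then obtain m where m: "m \<ge> 1" "\<forall>k\<in>{..N}. \<exists>A\<in>sets M.
     {\<omega> \<in> space M. \<epsilon> < norm (X (grid N k) \<omega> - X 0 \<omega> - fine_sum N m k \<omega>)} \<subseteq> A \<and> prob A \<le> \<delta>"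
    by (auto dest: eventually_happens)
  from bchoice[OF m(2)[unfolded Bex_def]] obtain A where "\<forall>k\<in>{..N}. A k \<in> sets M \<and>
     {\<omega> \<in> space M. \<epsilon> < norm (X (grid N k) \<omega> - X 0 \<omega> - fine_sum N m k \<omega>)} \<subseteq> A k \<and> prob (A k) \<le> \<delta>" ..
  then show thesis using m(1) by (intro that[of m A]) auto
qed

text \<open>For \<open>X\<close> all times up to the grid point are included, since its values at
  the refined times enter; for the scheme the grid points suffice. Nothing after
  \<open>grid N k\<close> is involved, so the event may multiply the coefficients of the following
  step.\<close>

definition good :: "nat \<Rightarrow> real \<Rightarrow> nat \<Rightarrow> 'a set" where
  "good N R k = {\<omega> \<in> space M. (\<forall>i\<in>{..k}. norm (Y N (grid N i) \<omega>) \<le> R) \<and> (\<forall>s\<in>{0..grid N k}. norm (X s \<omega>) \<le> R)}"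

lemma good_sets_F: "N \<ge> 1 \<Longrightarrow> k \<le> N \<Longrightarrow> good N R k \<in> sets (F (grid N k))"
proof -
  assume N: "N \<ge> 1" "k \<le> N"
  have m: "Y N (grid N i) \<in> borel_measurable (F (grid N k))" if "i \<le> k" for i
    using that N grid_mem[OF N] by (intro measurable_F_mono[OF grid_nonneg grid_mono _ Y_grid_measurable]) auto
  have "{\<omega> \<in> space (F (grid N k)). \<forall>i\<in>{..k}. norm (Y N (grid N i) \<omega>) \<le> R} \<in> sets (F (grid N k))"
    by (intro sets.sets_Collect_finite_All' borel_measurable_le measurable_compose[OF m borel_measurable_norm] borel_measurable_const) auto
  then have "{\<omega> \<in> space M. \<forall>i\<in>{..k}. norm (Y N (grid N i) \<omega>) \<le> R} \<inter> {\<omega> \<in> space M. \<forall>s\<in>{0..grid N k}. norm (X s \<omega>) \<le> R} \<in> sets (F (grid N k))"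
    using sup_event_measurable[OF grid_mem[OF N] X_adapted X_continuous, of R] space_F[OF grid_mem[OF N]] by auto
  also have "{\<omega> \<in> space M. \<forall>i\<in>{..k}. norm (Y N (grid N i) \<omega>) \<le> R} \<inter> {\<omega> \<in> space M. \<forall>s\<in>{0..grid N k}. norm (X s \<omega>) \<le> R} = good N R k"
    by (auto simp: good_def)
  finally show ?thesis .
qed

lemma good_antimono: "i \<le> j \<Longrightarrow> good N R j \<subseteq> good N R i"
  using grid_mono[of i j N] by (force simp: good_def)

lemma truncated_coefficients:
  assumes R: "0 \<le> R"
  obtains L B where "0 \<le> L" "0 \<le> B"
    "\<And>x y. norm x \<le> R \<Longrightarrow> norm y \<le> R \<Longrightarrow> norm (\<mu> x - \<mu> y) \<le> L * norm (x - y)"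
    "\<And>x y. norm x \<le> R \<Longrightarrow> norm y \<le> R \<Longrightarrow> norm (\<sigma> x - \<sigma> y) \<le> L * norm (x - y)"
    "\<And>x. norm x \<le> R \<Longrightarrow> norm (\<mu> x) \<le> B" "\<And>x. norm x \<le> R \<Longrightarrow> norm (\<sigma> x) \<le> B"
proof -
  obtain L1 where L1: "L1-lipschitz_on (cball 0 R) \<mu>" using locally_lipschitz_on_compact[OF mu_loclip compact_cball] .
  obtain L2 where L2: "L2-lipschitz_on (cball 0 R) \<sigma>" using locally_lipschitz_on_compact[OF sigma_loclip compact_cball] .
  have L: "0 \<le> L1" "0 \<le> L2" using L1 L2 lipschitz_on_nonneg by auto
  let ?B = "c * (1 + R powr c)"
  have bd: "norm (\<mu> x) + norm (\<sigma> x) \<le> ?B" if "norm x \<le> R" for x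
  proof -
    have "c * (1 + norm x powr c) \<le> ?B" using that c_ge by (intro mult_left_mono add_left_mono powr_mono2) auto
    then show ?thesis using growth[of x] by linarith
  qed
  show thesis
  proof (rule that[of "max L1 L2" ?B])
    show "norm (\<mu> x - \<mu> y) \<le> max L1 L2 * norm (x - y)" if "norm x \<le> R" "norm y \<le> R" for x y
      using lipschitz_onD[OF L1, of x y] that mult_right_mono[of L1 "max L1 L2" "norm (x - y)"] by (simp add: dist_norm)
    show "norm (\<sigma> x - \<sigma> y) \<le> max L1 L2 * norm (x - y)" if "norm x \<le> R" "norm y \<le> R" for x y
      using lipschitz_onD[OF L2, of x y] that mult_right_mono[of L2 "max L1 L2" "norm (x - y)"] by (simp add: dist_norm)
    show "norm (\<mu> x) \<le> ?B" "norm (\<sigma> x) \<le> ?B" if "norm x \<le> R" for x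
      using bd[OF that] norm_ge_zero[of "\<mu> x"] norm_ge_zero[of "\<sigma> x"] by linarith+
  qed (use L c_ge in auto)
qed

end

section \<open>The localised error recursion\<close>

lemma norm_add3_square_le:
  fixes x y z :: "'a::real_normed_vector"
  shows "(norm (x + y + z))\<^sup>2 \<le> 3 * ((norm x)\<^sup>2 + (norm y)\<^sup>2 + (norm z)\<^sup>2)"
proof -
  have "norm (x + y + z) \<le> norm x + norm y + norm z" by norm
  then have "(norm (x + y + z))\<^sup>2 \<le> (norm x + norm y + norm z)\<^sup>2" by (intro power_mono) auto
  also have "\<dots> \<le> 3 * ((norm x)\<^sup>2 + (norm y)\<^sup>2 + (norm z)\<^sup>2)"
    using zero_le_power2[of "norm x - norm y"] zero_le_power2[of "norm y - norm z"] zero_le_power2[of "norm x - norm z"]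
    by (simp add: power2_eq_square algebra_simps)
  finally show ?thesis .
qed

lemma norm_sum_square_le:
  fixes f :: "'b \<Rightarrow> 'a::real_normed_vector"
  shows "(norm (sum f I))\<^sup>2 \<le> real (card I) * (\<Sum>i\<in>I. (norm (f i))\<^sup>2)"
proof -
  have "(norm (sum f I))\<^sup>2 \<le> (\<Sum>i\<in>I. norm (f i))\<^sup>2" by (intro power_mono norm_sum) auto
  also have "\<dots> \<le> real (card I) * (\<Sum>i\<in>I. (norm (f i))\<^sup>2)"
    using sum_squared_le_sum_of_squares[of "\<lambda>i. norm (f i)" I] by (simp add: mult.commute)
  finally show ?thesis .
qed

lemma integrable_nn_bound:
  fixes f :: "'a \<Rightarrow> real"
  assumes f: "f \<in> borel_measurable M" "\<And>\<omega>. \<omega> \<in> space M \<Longrightarrow> 0 \<le> f \<omega>"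
    and C: "0 \<le> C" "(\<integral>\<^sup>+\<omega>. ennreal (f \<omega>) \<partial>M) \<le> ennreal C"
  shows "integrable M f" "integral\<^sup>L M f \<le> C"
proof -
  show i: "integrable M f"
    by (rule integrableI_nonneg[OF f(1)]) (use f(2) le_less_trans[OF C(2)] in auto)
  show "integral\<^sup>L M f \<le> C"
    using C nn_integral_eq_integral[OF i] f(2) by (simp add: AE_I2)
qed

lemma sum_blocks:
  fixes f :: "nat \<Rightarrow> 'a::comm_monoid_add"
  shows "(\<Sum>i<j * m. f i) = (\<Sum>k<j. \<Sum>i\<in>{k * m..<k * m + m}. f i)"
proof (induction j)
  case (Suc j)
  have eq: "{..<Suc j * m} = {..<j * m} \<union> {j * m..<j * m + m}" by auto
  have "(\<Sum>i<Suc j * m. f i) = (\<Sum>i<j * m. f i) + (\<Sum>i\<in>{j * m..<j * m + m}. f i)"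
    unfolding eq by (rule sum.union_disjoint) auto
  then show ?case using Suc by (simp only: sum.lessThan_Suc)
qed simp

context tamed_euler_sde
begin

definition increment :: "nat \<Rightarrow> nat \<Rightarrow> 'a \<Rightarrow> real^'d" where
  "increment N k \<omega> = (T / real N) *\<^sub>R \<mu> (Y N (grid N k) \<omega>) + \<sigma> (Y N (grid N k) \<omega>) *v incr (grid N k) (grid N (Suc k)) \<omega>"

text \<open>On the good event the radius \<open>R\<close> lies below the cutoff, so the indicator in
  the scheme never switches off.\<close>

lemma Y_grid_sum:
  assumes N: "N \<ge> 1" "R \<le> cutoff N" "j \<le> N" and w: "\<omega> \<in> good N R j"
  shows "Y N (grid N j) \<omega> = X 0 \<omega> + (\<Sum>k<j. tamed (increment N k \<omega>))"
  using N(3) w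
proof (induction j)
  case 0
  then show ?case using Y_init[OF N(1), of \<omega>] by (simp add: good_def)
next
  case (Suc j)
  have wj: "\<omega> \<in> good N R j" using Suc.prems(2) good_antimono[of j "Suc j" N R] by auto
  have wM: "\<omega> \<in> space M" and small: "norm (Y N (grid N j) \<omega>) \<le> cutoff N"
    using wj N(2) by (auto simp: good_def intro: order_trans)
  have "Y N (grid N (Suc j)) \<omega> = Y N (grid N j) \<omega> + tamed (increment N j \<omega>)"
    using Y_step'[OF N(1) _ wM, of j "grid N (Suc j)"] Suc.prems grid_less[OF N(1), of j] small
    by (simp add: increment_def grid_Suc)
  then show ?case using Suc.IH[OF _ wj] Suc.prems by simp
qed

lemma fine_grid:
  assumes N: "N \<ge> 1" "m \<ge> 1"
  shows "real (k * m) * fine_step N m = grid N k" "real i * fine_step N m \<le> grid N (i div m) + T / real N"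
    "grid N (i div m) \<le> real i * fine_step N m" "i < j * m \<Longrightarrow> real i * fine_step N m \<le> grid N j"
    "i < j * m \<Longrightarrow> i div m < j" "real m * fine_step N m = T / real N"
proof -
  show eq: "real (k * m) * fine_step N m = grid N k" for k using N by (simp add: grid_def fine_step_def)
  have g: "0 \<le> fine_step N m" using T_pos by (simp add: fine_step_def)
  show "grid N (i div m) \<le> real i * fine_step N m"
    unfolding eq[symmetric] using g by (intro mult_right_mono) (simp_all only: of_nat_le_iff div_times_less_eq_dividend)
  have "i \<le> Suc (i div m) * m" using N dividend_less_div_times[of m i] by (simp add: add.commute)
  then have "real i * fine_step N m \<le> real (Suc (i div m) * m) * fine_step N m"
    using g by (intro mult_right_mono) (simp_all only: of_nat_le_iff)
  then show "real i * fine_step N m \<le> grid N (i div m) + T / real N" unfolding eq grid_Suc .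
  show "real i * fine_step N m \<le> grid N j" if "i < j * m"
    unfolding eq[symmetric] using g that by (intro mult_right_mono) (simp_all only: of_nat_le_iff)
  show "i div m < j" if "i < j * m" using that by (simp add: less_mult_imp_div_less)
  show "real m * fine_step N m = T / real N" using N by (simp add: fine_step_def)
qed

text \<open>The coefficients of the scheme are constant within a cell, so its untamed increment
  telescopes into refined increments and can be compared term by term with
  \<open>fine_sum\<close>.\<close>

lemma increment_blocks:
  assumes N: "N \<ge> 1" "m \<ge> 1"
  shows "(\<Sum>i\<in>{k * m..<k * m + m}. fine_step N m *\<^sub>R \<mu> (Y N (grid N (i div m)) \<omega>)
      + \<sigma> (Y N (grid N (i div m)) \<omega>) *v incr (real i * fine_step N m) (real (Suc i) * fine_step N m) \<omega>) = increment N k \<omega>"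
proof -
  let ?g = "fine_step N m" and ?y = "Y N (grid N k) \<omega>"
  have div: "i div m = k" if "i \<in> {k * m..<k * m + m}" for i
    using that N by (auto intro!: div_nat_eqI simp: mult.commute)
  have "(\<Sum>i\<in>{k * m..<k * m + m}. ?g *\<^sub>R \<mu> (Y N (grid N (i div m)) \<omega>)
      + \<sigma> (Y N (grid N (i div m)) \<omega>) *v incr (real i * ?g) (real (Suc i) * ?g) \<omega>)
     = (\<Sum>i\<in>{k * m..<k * m + m}. ?g *\<^sub>R \<mu> ?y + \<sigma> ?y *v (W (real (Suc i) * ?g) \<omega> - W (real i * ?g) \<omega>))"
    by (rule sum.cong[OF refl]) (simp only: div)
  also have "\<dots> = (real m * ?g) *\<^sub>R \<mu> ?y + \<sigma> ?y *v (\<Sum>i\<in>{k * m..<k * m + m}. W (real (Suc i) * ?g) \<omega> - W (real i * ?g) \<omega>)"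
    by (simp add: sum.distrib sum_constant_scaleR linear_sum[OF matrix_vector_mul_linear] del: of_nat_Suc sum_constant)
  also have "(\<Sum>i\<in>{k * m..<k * m + m}. W (real (Suc i) * ?g) \<omega> - W (real i * ?g) \<omega>) = W (real (k * m + m) * ?g) \<omega> - W (real (k * m) * ?g) \<omega>"
    by (rule sum_Suc_diff'[of "k * m" "k * m + m" "\<lambda>i. W (real i * ?g) \<omega>"]) simp
  also have "real (k * m + m) * ?g = grid N (Suc k)"
    using fine_grid(1)[OF N, of "Suc k"] by (simp only: mult_Suc add.commute)
  finally show ?thesis unfolding fine_grid(1,6)[OF N] increment_def .
qed

definition osc_bounded :: "nat \<Rightarrow> real \<Rightarrow> 'a set \<Rightarrow> bool" where
  "osc_bounded N \<delta> G \<longleftrightarrow> (\<forall>\<omega>\<in>G. \<forall>s\<in>{0..T}. \<forall>t\<in>{0..T}. \<bar>s - t\<bar> \<le> T / real N \<longrightarrow> norm (X s \<omega> - X t \<omega>) \<le> \<delta>)"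

text \<open>The sets \<open>A k\<close> are measurable covers of the exceptional events, as in the
  definition of convergence in probability.\<close>

definition fine_sum_close :: "nat \<Rightarrow> nat \<Rightarrow> real \<Rightarrow> real \<Rightarrow> (nat \<Rightarrow> 'a set) \<Rightarrow> bool" where
  "fine_sum_close N m \<delta> \<eta> A \<longleftrightarrow> (\<forall>k\<le>N. A k \<in> sets M \<and> prob (A k) \<le> \<eta> \<and>
     {\<omega> \<in> space M. \<delta> < norm (X (grid N k) \<omega> - X 0 \<omega> - fine_sum N m k \<omega>)} \<subseteq> A k)"

text \<open>\<open>D\<close> arises from the error by projecting \<open>X\<close> onto the ball of radius \<open>R\<close> and multiplying each
  summand by the indicator of \<open>good N R k\<close>, with \<open>k\<close> the coarse step it belongs to; unlike the error, it is
  known to be square integrable.\<close>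

lemma grid_error_bound:
  assumes R: "1 \<le> R"
  obtains K where "0 \<le> K"
    "\<And>N m \<delta> \<eta> G A j. N \<ge> 1 \<Longrightarrow> m \<ge> 1 \<Longrightarrow> R \<le> cutoff N \<Longrightarrow> 0 \<le> \<delta> \<Longrightarrow> 0 \<le> \<eta> \<Longrightarrow> G \<in> sets M \<Longrightarrow> prob (space M - G) \<le> \<eta> \<Longrightarrow>
      osc_bounded N \<delta> G \<Longrightarrow> fine_sum_close N m \<delta> \<eta> A \<Longrightarrow> j \<le> N \<Longrightarrow>
      \<exists>D. D \<in> borel_measurable M \<and> integrable M (\<lambda>\<omega>. (norm (D \<omega> :: real^'d))\<^sup>2) \<and> expectation (\<lambda>\<omega>. (norm (D \<omega>))\<^sup>2) \<le> K * (\<delta>\<^sup>2 + \<eta> + T / real N) \<and>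
        (\<forall>\<omega>\<in>good N R j. X 0 \<omega> + fine_sum N m j \<omega> - Y N (grid N j) \<omega> = D \<omega>)"
proof -
  have R0: "0 \<le> R" using R by simp
  obtain L B where LB: "0 \<le> L" "0 \<le> B"
    "\<And>x y. norm x \<le> R \<Longrightarrow> norm y \<le> R \<Longrightarrow> norm (\<mu> x - \<mu> y) \<le> L * norm (x - y)"
    "\<And>x y. norm x \<le> R \<Longrightarrow> norm y \<le> R \<Longrightarrow> norm (\<sigma> x - \<sigma> y) \<le> L * norm (x - y)"
    "\<And>x. norm x \<le> R \<Longrightarrow> norm (\<mu> x) \<le> B" "\<And>x. norm x \<le> R \<Longrightarrow> norm (\<sigma> x) \<le> B"
    by (rule truncated_coefficients[OF R0], rule that)
  obtain C6 where C6: "0 < C6" "\<And>s t h l. 0 \<le> s \<Longrightarrow> s \<le> t \<Longrightarrow> t \<le> T \<Longrightarrow> t - s \<le> h \<Longrightarrow> 0 < h \<Longrightarrow> 0 \<le> l \<Longrightarrow> l * sqrt h \<le> 0 \<Longrightarrow>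
    (\<integral>\<^sup>+\<omega>. ennreal ((sqrt h + norm (incr s t \<omega>)) ^ 6 * exp (l * (sqrt h + norm (incr s t \<omega>)))) \<partial>M) \<le> ennreal (C6 * sqrt h ^ 6)"
    using nn_integral_incr_power_exp[of 0 6] by blast
  let ?md = "real CARD('m)"
  \<comment> \<open>The taming error is cubic in the increment, so its square needs the sixth moment
    and is of order \<open>h ^ 3\<close>.\<close>
  define Cr where "Cr = (B * (1 + sqrt T)) ^ 6 * C6"
  \<comment> \<open>The factor \<open>3\<close> comes from squaring a sum of three terms,
    \<open>T\<close> from Cauchy-Schwarz for the drift, \<open>?md\<close> from the discrete
    isometry, and \<open>L\<^sup>2\<close> from the Lipschitz bound.\<close>
  define K1 where "K1 = 3 * (T + ?md) * L\<^sup>2"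
  define K where "K = (K1 * T * (6 + 8 * R\<^sup>2) + 3 * Cr * T\<^sup>2) * exp (3 * K1 * T)"
  have nn: "0 \<le> Cr" "0 \<le> K1" using LB C6(1) T_pos by (auto simp: Cr_def K1_def)
  have K: "0 \<le> K" using nn T_pos by (simp add: K_def)
  \<comment> \<open>At refined times inside a cell \<open>X\<close> may leave the ball although the
    good event held at the left endpoint. Projecting keeps the argument in the ball, stays adapted
    and does not increase distances.\<close>
  define \<pi> where "\<pi> = closest_point (cball (0::real^'d) R)"
  have ball: "closed (cball (0::real^'d) R)" "convex (cball (0::real^'d) R)" "cball (0::real^'d) R \<noteq> {}" using R0 by auto
  have \<pi>R: "norm (\<pi> x) \<le> R" for x using closest_point_in_set[OF ball(1,3), of x] by (simp add: \<pi>_def)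
  have \<pi>id: "norm x \<le> R \<Longrightarrow> \<pi> x = x" for x unfolding \<pi>_def by (rule closest_point_self) simp
  have \<pi>lip: "norm (\<pi> x - \<pi> y) \<le> norm (x - y)" for x y
    using closest_point_lipschitz[OF ball(2,1,3), of x y] by (simp add: \<pi>_def dist_norm)
  have [measurable]: "\<pi> \<in> borel_measurable borel"
    unfolding \<pi>_def by (intro borel_measurable_continuous_onI continuous_on_closest_point ball)
  have main: "\<exists>D. D \<in> borel_measurable M \<and> integrable M (\<lambda>\<omega>. (norm (D \<omega> :: real^'d))\<^sup>2) \<and> expectation (\<lambda>\<omega>. (norm (D \<omega>))\<^sup>2) \<le> K * (\<delta>\<^sup>2 + \<eta> + T / real N) \<and>
        (\<forall>\<omega>\<in>good N R j. X 0 \<omega> + fine_sum N m j \<omega> - Y N (grid N j) \<omega> = D \<omega>)"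
    if N: "N \<ge> 1" and m: "m \<ge> 1" and cut: "R \<le> cutoff N" and \<delta>: "0 \<le> \<delta>" and \<eta>: "0 \<le> \<eta>" and G: "G \<in> sets M" "prob (space M - G) \<le> \<eta>"
      and osc: "osc_bounded N \<delta> G" and close: "fine_sum_close N m \<delta> \<eta> A" and j: "j \<le> N" for N m \<delta> \<eta> G A j
  proof -
    note osc = osc[unfolded osc_bounded_def, rule_format]
    have A: "A k \<in> sets M" "{\<omega> \<in> space M. \<delta> < norm (X (grid N k) \<omega> - X 0 \<omega> - fine_sum N m k \<omega>)} \<subseteq> A k" "prob (A k) \<le> \<eta>"
      if "k \<le> N" for k using close that by (auto simp: fine_sum_close_def)
    let ?h = "T / real N" and ?g = "fine_step N m"
    have h: "0 < ?h" and g: "0 < ?g" using N m T_pos by (auto simp: fine_step_def)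
    note fg = fine_grid[OF N m]
    define \<psi> where "\<psi> k \<omega> = indicat_real (good N R k) \<omega>" for k \<omega>
    define y where "y k \<omega> = Y N (grid N k) \<omega>" for k \<omega>
    define x where "x i \<omega> = \<pi> (X (real i * ?g) \<omega>)" for i \<omega>
    define a where "a i \<omega> = \<psi> (i div m) \<omega> *\<^sub>R (\<mu> (x i \<omega>) - \<mu> (y (i div m) \<omega>))" for i \<omega>
    define b where "b i \<omega> = \<psi> (i div m) \<omega> *\<^sub>R (\<sigma> (x i \<omega>) - \<sigma> (y (i div m) \<omega>))" for i \<omega>
    define rr where "rr k \<omega> = \<psi> k \<omega> *\<^sub>R (increment N k \<omega> - tamed (increment N k \<omega>))" for k \<omega>
    let ?dW = "\<lambda>i. incr (real i * ?g) (real (Suc i) * ?g)"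
    \<comment> \<open>\<open>P\<close> is the drift difference, \<open>Q\<close> the martingale
      difference and \<open>Z\<close> the accumulated taming error. The cutoff indicator depends on
      the coarse cell only, so each summand of \<open>Q\<close> is adapted to its refined
      time.\<close>
    define P where "P j \<omega> = (\<Sum>i<j * m. ?g *\<^sub>R a i \<omega>)" for j \<omega>
    define Q where "Q j \<omega> = (\<Sum>i<j * m. b i \<omega> *v ?dW i \<omega>)" for j \<omega>
    define Z where "Z j \<omega> = (\<Sum>k<j. rr k \<omega>)" for j \<omega>
    define D where "D j \<omega> = P j \<omega> + Q j \<omega> + Z j \<omega>" for j \<omega>
    have \<psi>1: "\<psi> k \<omega> = 1" if "\<omega> \<in> good N R j" "k \<le> j" for k j \<omega>
      using good_antimono[OF that(2), of N R] that(1) by (auto simp: \<psi>_def)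
    have repr: "X 0 \<omega> + fine_sum N m j \<omega> - Y N (grid N j) \<omega> = D j \<omega>" if j: "j \<le> N" and w: "\<omega> \<in> good N R j" for j \<omega>
    proof -
      have Xx: "x i \<omega> = X (real i * ?g) \<omega>" if "i < j * m" for i
        unfolding x_def using w fg(4)[OF that] g by (intro \<pi>id) (auto simp: good_def)
      have "P j \<omega> + Q j \<omega> = (\<Sum>i<j * m. (?g *\<^sub>R \<mu> (X (real i * ?g) \<omega>) + \<sigma> (X (real i * ?g) \<omega>) *v ?dW i \<omega>)
         - (?g *\<^sub>R \<mu> (y (i div m) \<omega>) + \<sigma> (y (i div m) \<omega>) *v ?dW i \<omega>))"
        unfolding P_def Q_def sum.distrib[symmetric]
      proof (rule sum.cong[OF refl])
        fix i assume "i \<in> {..<j * m}"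
        then have i: "i < j * m" by simp
        have "\<psi> (i div m) \<omega> = 1" using \<psi>1[OF w] fg(5)[OF i] by simp
        then show "?g *\<^sub>R a i \<omega> + b i \<omega> *v ?dW i \<omega> = (?g *\<^sub>R \<mu> (X (real i * ?g) \<omega>) + \<sigma> (X (real i * ?g) \<omega>) *v ?dW i \<omega>)
         - (?g *\<^sub>R \<mu> (y (i div m) \<omega>) + \<sigma> (y (i div m) \<omega>) *v ?dW i \<omega>)"
          by (simp add: a_def b_def Xx[OF i] scaleR_diff_right matrix_vector_mult_diff_rdistrib del: of_nat_Suc)
      qed
      also have "\<dots> = fine_sum N m j \<omega> - (\<Sum>k<j. increment N k \<omega>)"
        unfolding sum_subtractf fine_sum_def[symmetric] sum_blocks y_def increment_blocks[OF N m] ..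
      finally have PQ: "P j \<omega> + Q j \<omega> = fine_sum N m j \<omega> - (\<Sum>k<j. increment N k \<omega>)" .
      have "Z j \<omega> = (\<Sum>k<j. increment N k \<omega>) - (\<Sum>k<j. tamed (increment N k \<omega>))"
        unfolding Z_def sum_subtractf[symmetric] rr_def using \<psi>1[OF w] by (intro sum.cong) auto
      then show ?thesis unfolding D_def PQ Y_grid_sum[OF N cut j w] by simp
    qed
    have ti: "real i * ?g \<in> {0..T}" "grid N (i div m) \<in> {0..T}" "i div m < N" if "i < j * m" "j \<le> N" for i j
      using fg(4)[OF that(1)] fg(5)[OF that(1)] grid_mem[OF N that(2)] grid_mem[OF N, of "i div m"] g that by auto
    have xF: "x i \<in> borel_measurable (F (real i * ?g))" if "i < j * m" "j \<le> N" for i j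
      using X_adapted[OF ti(1)[OF that]] unfolding x_def by measurable
    have lift: "f \<in> borel_measurable (F (real i * ?g))"
      if "i < j * m" "j \<le> N" "f \<in> borel_measurable (F (grid N (i div m)))" for f :: "'a \<Rightarrow> 'z::topological_space" and i j
      using ti[OF that(1,2)] by (intro measurable_F_mono[OF grid_nonneg fg(3) _ that(3)]) auto
    have \<psi>F: "\<psi> k \<in> borel_measurable (F (grid N k))" if "k \<le> N" for k
      unfolding \<psi>_def using good_sets_F[OF N that] by measurable
    have yF: "y k \<in> borel_measurable (F (grid N k))" if "k \<le> N" for k
      unfolding y_def by (rule Y_grid_measurable[OF N that])
    have aF: "a i \<in> borel_measurable (F (real i * ?g))" and bF: "b i \<in> borel_measurable (F (real i * ?g))"
      if i: "i < j * m" "j \<le> N" for i j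
    proof -
      have k: "i div m \<le> N" using ti(3)[OF i] by simp
      note [measurable] = xF[OF i] lift[OF i \<psi>F[OF k]] lift[OF i yF[OF k]]
      show "a i \<in> borel_measurable (F (real i * ?g))" "b i \<in> borel_measurable (F (real i * ?g))"
        unfolding a_def b_def by measurable
    qed
    have xM: "x i \<in> borel_measurable M" and aM: "a i \<in> borel_measurable M" and bM: "b i \<in> borel_measurable M" if "i < j * m" "j \<le> N" for i j
      by (rule measurable_F_M[OF ti(1)[OF that]], rule xF[OF that] aF[OF that] bF[OF that])+
    have \<psi>M: "\<psi> k \<in> borel_measurable M" and yM: "y k \<in> borel_measurable M" if "k \<le> N" for k
      by (rule measurable_F_M[OF grid_mem[OF N that]], rule \<psi>F[OF that] yF[OF that])+
    have dM: "?dW i \<in> borel_measurable M" if "i < j * m" "j \<le> N" for i j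
    proof (rule incr_measurable)
      have "real (Suc i) * ?g \<le> real (j * m) * ?g" using that g by (intro mult_right_mono) (simp_all only: of_nat_le_iff)
      then show "real (Suc i) * ?g \<le> T" using fg(1)[of j] grid_mem[OF N that(2)] by simp
    qed (use g in \<open>auto intro!: mult_right_mono\<close>)
    have Sk: "Suc k \<le> N \<Longrightarrow> grid N (Suc k) \<le> T" for k using grid_mem[OF N, of "Suc k"] by simp
    have zM: "incr (grid N k) (grid N (Suc k)) \<in> borel_measurable M" if "k < N" for k
      using grid_nonneg[of N k] grid_less[OF N, of k] Sk[of k] that by (intro incr_measurable) auto
    have rrM: "rr k \<in> borel_measurable M" if "k < N" for k
    proof -
      note [measurable] = zM[OF that] \<psi>M[OF less_imp_le[OF that]] Y_measurable_M[OF N grid_mem[OF N less_imp_le[OF that]]]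
      show ?thesis unfolding rr_def increment_def by measurable
    qed
    have PM: "P j \<in> borel_measurable M" and QM: "Q j \<in> borel_measurable M" and ZM: "Z j \<in> borel_measurable M" if "j \<le> N" for j
    proof -
      show "P j \<in> borel_measurable M" unfolding P_def
        using aM[OF _ that] by (intro borel_measurable_sum borel_measurable_scaleR borel_measurable_const) auto
      show "Q j \<in> borel_measurable M" unfolding Q_def
        using bM[OF _ that] dM[OF _ that] by (intro borel_measurable_sum borel_measurable_matrix_vector_mult) auto
      show "Z j \<in> borel_measurable M" unfolding Z_def using that by (intro borel_measurable_sum rrM) auto
    qed
    have DM: "D j \<in> borel_measurable M" if "j \<le> N" for j
      unfolding D_def using PM[OF that] QM[OF that] ZM[OF that] by measurable
    have xR: "norm (x i \<omega>) \<le> R" for i \<omega> unfolding x_def by (rule \<pi>R)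
    have \<psi>01: "\<psi> k \<omega> = 0 \<or> \<psi> k \<omega> = 1 \<and> \<omega> \<in> good N R k \<and> norm (y k \<omega>) \<le> R" for k \<omega>
      by (auto simp: \<psi>_def indicator_def good_def y_def)
    \<comment> \<open>The localised squared distance controls drift and diffusion differences alike;
      being at most \<open>4 * R\<^sup>2\<close>, it is integrable without any knowledge of moments
      of \<open>X\<close>.\<close>
    define v where "v i \<omega> = \<psi> (i div m) \<omega> * (norm (x i \<omega> - y (i div m) \<omega>))\<^sup>2" for i \<omega>
    have v0: "0 \<le> v i \<omega>" for i \<omega> using \<psi>01[of "i div m" \<omega>] by (auto simp: v_def)
    have v4: "v i \<omega> \<le> 4 * R\<^sup>2" for i \<omega>
      using \<psi>01[of "i div m" \<omega>]
    proof (elim disjE conjE)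
      assume p: "\<psi> (i div m) \<omega> = 1" "norm (y (i div m) \<omega>) \<le> R"
      have "norm (x i \<omega> - y (i div m) \<omega>) \<le> 2 * R" using norm_triangle_ineq4[of "x i \<omega>" "y (i div m) \<omega>"] xR[of i \<omega>] p by linarith
      then have "(norm (x i \<omega> - y (i div m) \<omega>))\<^sup>2 \<le> (2 * R)\<^sup>2" by (intro power_mono) auto
      then show ?thesis using p by (simp add: v_def power_mult_distrib)
    qed (simp add: v_def)
    have av: "(norm (a i \<omega>))\<^sup>2 \<le> L\<^sup>2 * v i \<omega>" and bv: "(norm (b i \<omega>))\<^sup>2 \<le> L\<^sup>2 * v i \<omega>" and bB: "norm (b i \<omega>) \<le> 2 * B" for i \<omega>
    proof -
      have "(norm (a i \<omega>))\<^sup>2 \<le> L\<^sup>2 * v i \<omega> \<and> (norm (b i \<omega>))\<^sup>2 \<le> L\<^sup>2 * v i \<omega> \<and> norm (b i \<omega>) \<le> 2 * B"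
        using \<psi>01[of "i div m" \<omega>]
      proof (elim disjE conjE)
        assume p: "\<psi> (i div m) \<omega> = 1" "norm (y (i div m) \<omega>) \<le> R"
        have "norm (a i \<omega>) \<le> L * norm (x i \<omega> - y (i div m) \<omega>)" "norm (b i \<omega>) \<le> L * norm (x i \<omega> - y (i div m) \<omega>)"
          using LB(3,4)[OF xR p(2)] p(1) by (simp_all add: a_def b_def)
        from power_mono[OF this(1) norm_ge_zero, of 2] power_mono[OF this(2) norm_ge_zero, of 2]
        have "(norm (a i \<omega>))\<^sup>2 \<le> L\<^sup>2 * v i \<omega>" "(norm (b i \<omega>))\<^sup>2 \<le> L\<^sup>2 * v i \<omega>"
          using p(1) by (simp_all add: v_def power_mult_distrib)
        moreover have "norm (b i \<omega>) \<le> 2 * B"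
          using norm_triangle_ineq4[of "\<sigma> (x i \<omega>)" "\<sigma> (y (i div m) \<omega>)"] LB(6)[OF xR, of i \<omega>] LB(6)[OF p(2)] p(1) by (simp add: b_def)
        ultimately show ?thesis by blast
      qed (use LB(2) in \<open>simp add: a_def b_def v_def\<close>)
      then show "(norm (a i \<omega>))\<^sup>2 \<le> L\<^sup>2 * v i \<omega>" "(norm (b i \<omega>))\<^sup>2 \<le> L\<^sup>2 * v i \<omega>" "norm (b i \<omega>) \<le> 2 * B" by blast+
    qed
    have vint: "integrable M (v i)" if i: "i < j * m" "j \<le> N" for i j
    proof (rule integrable_const_bound[of _ "4 * R\<^sup>2"])
      note [measurable] = xM[OF i] \<psi>M[OF less_imp_le[OF ti(3)[OF i]]] yM[OF less_imp_le[OF ti(3)[OF i]]]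
      show "v i \<in> borel_measurable M" unfolding v_def by measurable
      show "AE \<omega> in M. norm (v i \<omega>) \<le> 4 * R\<^sup>2" using v0 v4 by (intro AE_I2) simp
    qed
    have rr_int: "integrable M (\<lambda>\<omega>. (norm (rr k \<omega>))\<^sup>2)" and rr_exp: "expectation (\<lambda>\<omega>. (norm (rr k \<omega>))\<^sup>2) \<le> Cr * ?h ^ 3" if k: "k < N" for k
    proof -
      let ?w = "\<lambda>\<omega>. sqrt ?h + norm (incr (grid N k) (grid N (Suc k)) \<omega>)"
      let ?c = "B * (1 + sqrt T)"
      have c0: "0 \<le> ?c" using LB(2) T_pos by simp
      have hT: "sqrt ?h \<le> sqrt T" using N T_pos by (simp add: divide_le_eq mult_le_cancel_left1)
      have pt: "(norm (rr k \<omega>))\<^sup>2 \<le> ?c ^ 6 * ?w \<omega> ^ 6" for \<omega>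
        using \<psi>01[of k \<omega>]
      proof (elim disjE conjE)
        assume "\<psi> k \<omega> = 0"
        then show ?thesis using c0 h by (simp add: rr_def)
      next
        assume p: "\<psi> k \<omega> = 1" "norm (y k \<omega>) \<le> R"
        have w: "sqrt ?h \<le> ?w \<omega>" "norm (incr (grid N k) (grid N (Suc k)) \<omega>) \<le> ?w \<omega>" using h by auto
        have "norm (increment N k \<omega>) \<le> ?h * norm (\<mu> (y k \<omega>)) + norm (\<sigma> (y k \<omega>)) * norm (incr (grid N k) (grid N (Suc k)) \<omega>)"
          unfolding increment_def y_def[symmetric]
          by (intro order_trans[OF norm_triangle_ineq] add_mono norm_matrix_vector_mult_le)
            (simp_all only: norm_scaleR abs_of_pos[OF h] order_refl)
        also have "\<dots> \<le> (sqrt T * ?w \<omega>) * B + B * ?w \<omega>"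
        proof (intro add_mono mult_mono LB(5)[OF p(2)] LB(6)[OF p(2)] w)
          have "sqrt ?h * sqrt ?h \<le> sqrt T * ?w \<omega>" using hT w(1) h T_pos by (intro mult_mono) auto
          then show "?h \<le> sqrt T * ?w \<omega>" by (simp only: real_sqrt_mult_self abs_of_pos[OF h])
        qed (use LB(2) T_pos h in auto)
        also have "\<dots> = ?c * ?w \<omega>" by (simp add: algebra_simps)
        finally have i: "norm (increment N k \<omega>) \<le> ?c * ?w \<omega>" .
        have "norm (rr k \<omega>) \<le> norm (increment N k \<omega>) ^ 3"
          using norm_tamed_diff_le_cube[of "increment N k \<omega>"] p(1) by (simp add: rr_def norm_minus_commute)
        also have "\<dots> \<le> (?c * ?w \<omega>) ^ 3" using i by (intro power_mono) auto
        finally have "(norm (rr k \<omega>))\<^sup>2 \<le> ((?c * ?w \<omega>) ^ 3)\<^sup>2" by (intro power_mono) auto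
        then show ?thesis by (simp add: power_mult_distrib flip: power_mult)
      qed
      have "(\<integral>\<^sup>+\<omega>. ennreal ((norm (rr k \<omega>))\<^sup>2) \<partial>M) \<le> (\<integral>\<^sup>+\<omega>. ennreal (?c ^ 6) * ennreal (?w \<omega> ^ 6) \<partial>M)"
        using pt c0 by (intro nn_integral_mono, subst ennreal_mult[symmetric]) (auto intro!: ennreal_leI simp: h less_imp_le)
      also have "\<dots> = ennreal (?c ^ 6) * (\<integral>\<^sup>+\<omega>. ennreal (?w \<omega> ^ 6) \<partial>M)"
        by (intro nn_integral_cmult measurable_compose[OF zM[OF k], of "\<lambda>z. ennreal ((sqrt ?h + norm z) ^ 6)"]) measurable
      also have "\<dots> \<le> ennreal (?c ^ 6) * ennreal (C6 * sqrt ?h ^ 6)"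
        using C6(2)[of "grid N k" "grid N (Suc k)" ?h 0] grid_nonneg[of N k] grid_less[OF N, of k] Sk[of k] k h
        by (intro mult_left_mono) (auto simp: grid_Suc)
      also have "\<dots> = ennreal (Cr * ?h ^ 3)"
      proof -
        have "sqrt ?h ^ 6 = ?h ^ 3" using h power_mult[of "sqrt ?h" 2 3] by simp
        then show ?thesis using c0 h C6(1) by (subst ennreal_mult[symmetric]) (auto simp: Cr_def mult.assoc)
      qed
      finally have nnb: "(\<integral>\<^sup>+\<omega>. ennreal ((norm (rr k \<omega>))\<^sup>2) \<partial>M) \<le> ennreal (Cr * ?h ^ 3)" .
      have m: "(\<lambda>\<omega>. (norm (rr k \<omega>))\<^sup>2) \<in> borel_measurable M" using rrM[OF k] by measurable
      have "0 \<le> Cr * ?h ^ 3" using nn(1) h by (intro mult_nonneg_nonneg) auto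
      from integrable_nn_bound[OF m _ this nnb]
      show "integrable M (\<lambda>\<omega>. (norm (rr k \<omega>))\<^sup>2)" "expectation (\<lambda>\<omega>. (norm (rr k \<omega>))\<^sup>2) \<le> Cr * ?h ^ 3" by auto
    qed
    have Dsq: "integrable M (\<lambda>\<omega>. (norm (D j \<omega>))\<^sup>2)"
      "expectation (\<lambda>\<omega>. (norm (D j \<omega>))\<^sup>2) \<le> K1 * ?g * (\<Sum>i<j * m. expectation (v i)) + 3 * (real N * (\<Sum>k<j. Cr * ?h ^ 3))"
      if j: "j \<le> N" for j
    proof -
      have jm: "real (j * m) * ?g \<le> T" unfolding fg(1) using grid_mem[OF N j] by simp
      \<comment> \<open>Cauchy-Schwarz over \<open>j * m\<close> terms: the number of terms times
        the mesh is at most \<open>T\<close>, which makes the bound independent of the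
        refinement.\<close>
      have P2: "(norm (P j \<omega>))\<^sup>2 \<le> T * ?g * L\<^sup>2 * (\<Sum>i<j * m. v i \<omega>)" for \<omega>
      proof -
        have "(norm (P j \<omega>))\<^sup>2 \<le> real (j * m) * (\<Sum>i<j * m. (norm (?g *\<^sub>R a i \<omega>))\<^sup>2)"
          unfolding P_def using norm_sum_square_le[of "\<lambda>i. ?g *\<^sub>R a i \<omega>" "{..<j * m}"] by simp
        also have "\<dots> = (real (j * m) * ?g) * ?g * (\<Sum>i<j * m. (norm (a i \<omega>))\<^sup>2)"
          by (simp add: power_mult_distrib sum_distrib_left[symmetric] power2_eq_square[of ?g] mult_ac)
        also have "\<dots> \<le> T * ?g * (\<Sum>i<j * m. L\<^sup>2 * v i \<omega>)"
          using jm g T_pos av by (intro mult_mono sum_mono) (auto intro: sum_nonneg)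
        finally show ?thesis by (simp add: sum_distrib_left mult_ac)
      qed
      have Z2: "(norm (Z j \<omega>))\<^sup>2 \<le> real N * (\<Sum>k<j. (norm (rr k \<omega>))\<^sup>2)" for \<omega>
      proof -
        have "(norm (Z j \<omega>))\<^sup>2 \<le> real j * (\<Sum>k<j. (norm (rr k \<omega>))\<^sup>2)"
          unfolding Z_def using norm_sum_square_le[of "\<lambda>k. rr k \<omega>" "{..<j}"] by simp
        also have "\<dots> \<le> real N * (\<Sum>k<j. (norm (rr k \<omega>))\<^sup>2)" using j by (intro mult_right_mono sum_nonneg) auto
        finally show ?thesis .
      qed
      have iso: "integrable M (\<lambda>\<omega>. (norm (Q j \<omega>))\<^sup>2)"
        "expectation (\<lambda>\<omega>. (norm (Q j \<omega>))\<^sup>2) \<le> ?md * ?g * (\<Sum>i<j * m. expectation (\<lambda>\<omega>. (norm (b i \<omega>))\<^sup>2))"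
        unfolding Q_def using discrete_ito_isometry[OF g jm bF[OF _ j] bB] by auto
      have bint: "integrable M (\<lambda>\<omega>. (norm (b i \<omega>))\<^sup>2)" if "i < j * m" for i
      proof (rule Bochner_Integration.integrable_bound[OF integrable_mult_right[OF vint[OF that j], of "L\<^sup>2"]])
        show "(\<lambda>\<omega>. (norm (b i \<omega>))\<^sup>2) \<in> borel_measurable M" using bM[OF that j] by measurable
      qed (use bv v0 in auto)
      let ?S = "\<lambda>\<omega>. 3 * (T * ?g * L\<^sup>2 * (\<Sum>i<j * m. v i \<omega>) + (norm (Q j \<omega>))\<^sup>2 + real N * (\<Sum>k<j. (norm (rr k \<omega>))\<^sup>2))"
      have DS: "(norm (D j \<omega>))\<^sup>2 \<le> ?S \<omega>" for \<omega>
        unfolding D_def by (rule order_trans[OF norm_add3_square_le mult_left_mono[OF add_mono[OF add_mono[OF P2 order_refl] Z2]]]) simp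
      have iv: "integrable M (\<lambda>\<omega>. \<Sum>i<j * m. v i \<omega>)" by (intro Bochner_Integration.integrable_sum vint[OF _ j]) auto
      have ir: "integrable M (\<lambda>\<omega>. \<Sum>k<j. (norm (rr k \<omega>))\<^sup>2)" by (intro Bochner_Integration.integrable_sum rr_int) (use j in auto)
      have iS: "integrable M ?S"
        by (intro integrable_mult_right Bochner_Integration.integrable_add iv ir iso(1))
      show iD: "integrable M (\<lambda>\<omega>. (norm (D j \<omega>))\<^sup>2)"
      proof (rule Bochner_Integration.integrable_bound[OF iS])
        show "(\<lambda>\<omega>. (norm (D j \<omega>))\<^sup>2) \<in> borel_measurable M" using DM[OF j] by measurable
        show "AE \<omega> in M. norm ((norm (D j \<omega>))\<^sup>2) \<le> norm (?S \<omega>)"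
        proof (rule AE_I2)
          fix \<omega>
          have "norm ((norm (D j \<omega>))\<^sup>2) \<le> ?S \<omega>" using DS[of \<omega>] by simp
          also have "\<dots> \<le> norm (?S \<omega>)" by simp
          finally show "norm ((norm (D j \<omega>))\<^sup>2) \<le> norm (?S \<omega>)" .
        qed
      qed
      have "expectation (\<lambda>\<omega>. (norm (D j \<omega>))\<^sup>2) \<le> expectation ?S"
        by (rule integral_mono[OF iD iS DS])
      also have "\<dots> = 3 * (T * ?g * L\<^sup>2 * (\<Sum>i<j * m. expectation (v i)) + expectation (\<lambda>\<omega>. (norm (Q j \<omega>))\<^sup>2)
          + real N * (\<Sum>k<j. expectation (\<lambda>\<omega>. (norm (rr k \<omega>))\<^sup>2)))"
      proof -
        have "expectation (\<lambda>\<omega>. \<Sum>i<j * m. v i \<omega>) = (\<Sum>i<j * m. expectation (v i))"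
          by (rule Bochner_Integration.integral_sum) (use vint[OF _ j] in auto)
        moreover have "expectation (\<lambda>\<omega>. \<Sum>k<j. (norm (rr k \<omega>))\<^sup>2) = (\<Sum>k<j. expectation (\<lambda>\<omega>. (norm (rr k \<omega>))\<^sup>2))"
          by (rule Bochner_Integration.integral_sum) (use rr_int j in auto)
        ultimately show ?thesis using iv ir iso(1) by simp
      qed
      also have "\<dots> \<le> 3 * (T * ?g * L\<^sup>2 * (\<Sum>i<j * m. expectation (v i)) + ?md * ?g * (\<Sum>i<j * m. L\<^sup>2 * expectation (v i))
          + real N * (\<Sum>k<j. Cr * ?h ^ 3))"
      proof -
        have "expectation (\<lambda>\<omega>. (norm (b i \<omega>))\<^sup>2) \<le> L\<^sup>2 * expectation (v i)" if "i < j * m" for i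
          using integral_mono[OF bint[OF that] integrable_mult_right[OF vint[OF that j], of "L\<^sup>2"]] bv by simp
        then have 1: "?md * ?g * (\<Sum>i<j * m. expectation (\<lambda>\<omega>. (norm (b i \<omega>))\<^sup>2)) \<le> ?md * ?g * (\<Sum>i<j * m. L\<^sup>2 * expectation (v i))"
          using g by (intro mult_left_mono sum_mono) auto
        have 2: "real N * (\<Sum>k<j. expectation (\<lambda>\<omega>. (norm (rr k \<omega>))\<^sup>2)) \<le> real N * (\<Sum>k<j. Cr * ?h ^ 3)"
          using rr_exp j by (intro mult_left_mono sum_mono) auto
        show ?thesis by (intro mult_left_mono add_mono order_refl order_trans[OF iso(2) 1] 2) simp
      qed
      also have "\<dots> = K1 * ?g * (\<Sum>i<j * m. expectation (v i)) + 3 * (real N * (\<Sum>k<j. Cr * ?h ^ 3))"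
        unfolding sum_distrib_left[symmetric] K1_def by (simp add: algebra_simps)
      finally show "expectation (\<lambda>\<omega>. (norm (D j \<omega>))\<^sup>2) \<le> K1 * ?g * (\<Sum>i<j * m. expectation (v i)) + 3 * (real N * (\<Sum>k<j. Cr * ?h ^ 3))" .
    qed
    define e where "e k = expectation (\<lambda>\<omega>. (norm (D k \<omega>))\<^sup>2)" for k
    \<comment> \<open>Two deviations of size \<delta> under a factor three give
      \<open>6 * \<delta>\<^sup>2\<close>; two exceptional events of probability at most \<eta>, on
      which \<open>v\<close> is bounded only by \<open>4 * R\<^sup>2\<close>, give the rest.\<close>
    define \<theta> where "\<theta> = 6 * \<delta>\<^sup>2 + 8 * R\<^sup>2 * \<eta>"
    have \<theta>0: "0 \<le> \<theta>" using \<eta> by (simp add: \<theta>_def)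
    \<comment> \<open>Off the exceptional events the distance splits into the oscillation of
      \<open>X\<close> within the cell, the defect of the Riemann sum at the left grid point, and
      the error \<open>D\<close> there. This feeds the error of an earlier cell back and closes the
      recursion.\<close>
    have v_exp: "expectation (v i) \<le> 3 * e (i div m) + \<theta>" if i: "i < j * m" "j \<le> N" for i j
    proof -
      let ?k = "i div m"
      have k: "?k \<le> N" using ti(3)[OF i] by simp
      let ?V = "\<lambda>\<omega>. 6 * \<delta>\<^sup>2 + 3 * (norm (D ?k \<omega>))\<^sup>2 + 4 * R\<^sup>2 * (indicat_real (space M - G) \<omega> + indicat_real (A ?k) \<omega>)"
      have GA: "space M - G \<in> sets M" "A ?k \<in> sets M" using G(1) A(1)[OF k] by auto
      have "v i \<omega> \<le> ?V \<omega>" if wM: "\<omega> \<in> space M" for \<omega>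
      proof (cases "\<omega> \<in> G \<and> \<omega> \<notin> A ?k")
        case False
        then have "1 \<le> indicat_real (space M - G) \<omega> + indicat_real (A ?k) \<omega>" using wM by (auto simp: indicator_def)
        then have "4 * R\<^sup>2 * 1 \<le> 4 * R\<^sup>2 * (indicat_real (space M - G) \<omega> + indicat_real (A ?k) \<omega>)" by (intro mult_left_mono) auto
        moreover have "0 \<le> 6 * \<delta>\<^sup>2 + 3 * (norm (D ?k \<omega>))\<^sup>2" by simp
        ultimately show ?thesis using v4[of i \<omega>] by linarith
      next
        case True
        have rest: "0 \<le> 4 * R\<^sup>2 * (indicat_real (space M - G) \<omega> + indicat_real (A ?k) \<omega>)" by simp
        show ?thesis using \<psi>01[of ?k \<omega>]
        proof (elim disjE conjE)
          assume "\<psi> ?k \<omega> = 0"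
          then have "v i \<omega> = 0" by (simp add: v_def)
          then show ?thesis using rest by simp
        next
          assume p: "\<psi> ?k \<omega> = 1" "\<omega> \<in> good N R ?k"
          let ?Xk = "X (grid N ?k) \<omega>"
          have "norm ?Xk \<le> R" using p(2) grid_nonneg[of N ?k] by (auto simp: good_def)
          then have "x i \<omega> - ?Xk = \<pi> (X (real i * ?g) \<omega>) - \<pi> ?Xk" by (simp add: x_def \<pi>id)
          then have "norm (x i \<omega> - ?Xk) \<le> norm (X (real i * ?g) \<omega> - ?Xk)" using \<pi>lip by simp
          also have "\<dots> \<le> \<delta>"
            using True fg(2,3)[of i] by (intro osc ti[OF i]) auto
          finally have 1: "(norm (x i \<omega> - ?Xk))\<^sup>2 \<le> \<delta>\<^sup>2" by (intro power_mono) auto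
          have "norm (?Xk - X 0 \<omega> - fine_sum N m ?k \<omega>) \<le> \<delta>" using True A(2)[OF k] wM by (auto simp: not_less)
          then have 2: "(norm (?Xk - X 0 \<omega> - fine_sum N m ?k \<omega>))\<^sup>2 \<le> \<delta>\<^sup>2" by (intro power_mono) auto
          have eq: "x i \<omega> - y ?k \<omega> = (x i \<omega> - ?Xk) + (?Xk - X 0 \<omega> - fine_sum N m ?k \<omega>) + D ?k \<omega>"
            unfolding repr[OF k p(2), symmetric] y_def by simp
          have "(norm (x i \<omega> - y ?k \<omega>))\<^sup>2 \<le> 3 * (\<delta>\<^sup>2 + \<delta>\<^sup>2 + (norm (D ?k \<omega>))\<^sup>2)"
            unfolding eq by (rule order_trans[OF norm_add3_square_le mult_left_mono[OF add_mono[OF add_mono[OF 1 2] order_refl]]]) simp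
          then have "v i \<omega> \<le> 6 * \<delta>\<^sup>2 + 3 * (norm (D ?k \<omega>))\<^sup>2" using p(1) by (simp add: v_def)
          then show ?thesis by (rule add_increasing2[OF rest])
        qed
      qed
      note vV = this
      have ind: "integrable M (indicat_real C)" "expectation (indicat_real C) = prob C" if "C \<in> sets M" for C
        using that by (simp_all add: integrable_real_indicator emeasure_eq_measure)
      note int = Dsq(1)[OF k] ind(1)[OF GA(1)] ind(1)[OF GA(2)]
      have iV: "integrable M ?V"
        by (intro Bochner_Integration.integrable_add integrable_const integrable_mult_right int)
      have "expectation (v i) \<le> expectation ?V"
        by (rule integral_mono_AE[OF vint[OF i] iV AE_I2[OF vV]])
      also have "\<dots> = 6 * \<delta>\<^sup>2 + 3 * e ?k + 4 * R\<^sup>2 * (prob (space M - G) + prob (A ?k))"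
        using int ind(2)[OF GA(1)] ind(2)[OF GA(2)]
        by (simp add: e_def prob_space del: Bochner_Integration.integral_indicator)
      also have "\<dots> \<le> 6 * \<delta>\<^sup>2 + 3 * e ?k + 4 * R\<^sup>2 * (\<eta> + \<eta>)"
        using G(2) A(3)[OF k] by (intro add_left_mono mult_left_mono add_mono) auto
      finally show ?thesis by (simp add: \<theta>_def algebra_simps)
    qed
    \<comment> \<open>The bound for \<open>v i\<close> depends on \<open>i\<close> only through its
      cell, so the sum over refined times collapses to a sum over cells with weight
      \<open>T / real N\<close>, the form required by the Gronwall inequality.\<close>
    have rec: "e j \<le> (K1 * T * \<theta> + 3 * Cr * T\<^sup>2 * ?h) + (3 * K1 * ?h) * (\<Sum>k<j. e k)" if j: "j \<le> N" for j
    proof -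
      have "K1 * ?g * (\<Sum>i<j * m. expectation (v i)) \<le> K1 * ?g * (\<Sum>i<j * m. 3 * e (i div m) + \<theta>)"
        using v_exp[OF _ j] nn(2) g by (intro mult_left_mono sum_mono) auto
      also have "(\<Sum>i<j * m. 3 * e (i div m) + \<theta>) = (\<Sum>k<j. \<Sum>i\<in>{k * m..<k * m + m}. 3 * e k + \<theta>)"
      proof -
        have dv: "i div m = k" if "i \<in> {k * m..<k * m + m}" for i k
          using that m by (auto intro!: div_nat_eqI simp: mult.commute)
        show ?thesis unfolding sum_blocks by (intro sum.cong refl) (simp only: dv)
      qed
      also have "K1 * ?g * \<dots> = K1 * (real m * ?g) * (\<Sum>k<j. 3 * e k + \<theta>)"
        by (simp add: sum_distrib_left mult_ac)
      also have "\<dots> = K1 * (real j * ?h) * \<theta> + (3 * K1 * ?h) * (\<Sum>k<j. e k)"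
      proof -
        have "(\<Sum>k<j. 3 * e k + \<theta>) = 3 * (\<Sum>k<j. e k) + real j * \<theta>" by (simp add: sum.distrib sum_distrib_left)
        then show ?thesis unfolding fg(6) by (simp only:) (simp add: algebra_simps)
      qed
      also have "K1 * (real j * ?h) * \<theta> \<le> K1 * T * \<theta>"
        using grid_mem[OF N j] nn(2) \<theta>0 by (intro mult_right_mono mult_left_mono) (auto simp: grid_def)
      finally have 1: "K1 * ?g * (\<Sum>i<j * m. expectation (v i)) \<le> K1 * T * \<theta> + (3 * K1 * ?h) * (\<Sum>k<j. e k)" by simp
      have "real N * (\<Sum>k<j. Cr * ?h ^ 3) = Cr * ?h * ((real j * ?h) * (real N * ?h))"
        by (simp add: power3_eq_cube mult_ac)
      also have "\<dots> \<le> Cr * ?h * (T * T)"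
        using grid_mem[OF N j] N nn(1) h T_pos by (intro mult_left_mono mult_mono) (auto simp: grid_def)
      finally have "3 * (real N * (\<Sum>k<j. Cr * ?h ^ 3)) \<le> 3 * (Cr * ?h * (T * T))" by (rule mult_left_mono) simp
      also have "\<dots> = 3 * Cr * T\<^sup>2 * ?h" by (simp add: power2_eq_square mult_ac)
      finally have 2: "3 * (real N * (\<Sum>k<j. Cr * ?h ^ 3)) \<le> 3 * Cr * T\<^sup>2 * ?h" .
      show ?thesis using Dsq(2)[OF j] 1 2 unfolding e_def by linarith
    qed
    let ?a = "K1 * T * \<theta> + 3 * Cr * T\<^sup>2 * ?h"
    have a0: "0 \<le> ?a" using nn \<theta>0 T_pos h by (intro add_nonneg_nonneg mult_nonneg_nonneg) auto
    have b0: "0 \<le> 3 * K1 * ?h" by (rule mult_nonneg_nonneg[OF _ less_imp_le[OF h]]) (use nn in simp)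
    have "e j \<le> ?a * exp (3 * K1 * ?h * real j)"
      by (rule discrete_gronwall[OF a0 b0 rec j])
    also have "\<dots> \<le> ?a * exp (3 * K1 * T)"
    proof -
      have "3 * K1 * (real j * ?h) \<le> 3 * K1 * T" using grid_mem[OF N j] nn by (intro mult_left_mono) (auto simp: grid_def)
      then show ?thesis using a0 by (intro mult_left_mono) (auto simp: mult_ac)
    qed
    also have "?a \<le> (K1 * T * (6 + 8 * R\<^sup>2) + 3 * Cr * T\<^sup>2) * (\<delta>\<^sup>2 + \<eta> + ?h)"
    proof -
      have "\<theta> \<le> (6 + 8 * R\<^sup>2) * (\<delta>\<^sup>2 + \<eta> + ?h)"
      proof -
        have "0 \<le> 6 * \<eta> + 8 * R\<^sup>2 * \<delta>\<^sup>2 + (6 + 8 * R\<^sup>2) * ?h" using \<eta> h by (intro add_nonneg_nonneg mult_nonneg_nonneg) auto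
        then show ?thesis unfolding \<theta>_def distrib_left distrib_right by linarith
      qed
      then have "K1 * T * \<theta> \<le> K1 * T * ((6 + 8 * R\<^sup>2) * (\<delta>\<^sup>2 + \<eta> + ?h))" using nn T_pos by (intro mult_left_mono) auto
      moreover have "3 * Cr * T\<^sup>2 * ?h \<le> 3 * Cr * T\<^sup>2 * (\<delta>\<^sup>2 + \<eta> + ?h)" using nn \<eta> by (intro mult_left_mono) auto
      ultimately show ?thesis by (simp only: distrib_right mult.assoc)
    qed
    finally have "e j \<le> K * (\<delta>\<^sup>2 + \<eta> + ?h)" by (simp add: K_def mult_ac)
    then show ?thesis using DM[OF j] Dsq(1)[OF j] repr[OF j] by (intro exI[of _ "D j"]) (simp add: e_def)
  qed
  show thesis by (rule that[OF K main])
qed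

end

section \<open>Convergence in probability at all times\<close>

lemma measure_gt_le_integral:
  fixes f :: "'a \<Rightarrow> real"
  assumes f: "integrable M f" "\<And>\<omega>. \<omega> \<in> space M \<Longrightarrow> 0 \<le> f \<omega>" and a: "0 < a"
    and fin: "finite_measure M" and E: "integral\<^sup>L M f \<le> E"
  shows "measure M {\<omega> \<in> space M. a < f \<omega>} \<le> E / a"
proof -
  interpret finite_measure M by (rule fin)
  let ?S = "{\<omega> \<in> space M. a < f \<omega>}"
  have [measurable]: "f \<in> borel_measurable M" using f(1) by simp
  have S: "?S \<in> sets M" by measurable
  have i: "integrable M (indicat_real ?S)" using S by (simp add: integrable_real_indicator emeasure_eq_measure)
  have "a * measure M ?S = (\<integral>\<omega>. a * indicat_real ?S \<omega> \<partial>M)" using S by simp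
  also have "\<dots> \<le> integral\<^sup>L M f"
    by (rule integral_mono_AE[OF integrable_mult_right[OF i] f(1) AE_I2]) (use f(2) a in \<open>auto simp: indicator_def\<close>)
  finally show ?thesis using E a by (simp add: field_simps)
qed

context tamed_euler_sde
begin

lemma step_tendsto_0: "(\<lambda>N. T / real N) \<longlonglongrightarrow> 0"
  by (rule lim_const_over_n)

text \<open>A fixed localisation radius eventually lies below the cutoff, so for large
  \<open>N\<close> the truncation of the scheme is invisible on the good events.\<close>

lemma cutoff_ge_eventually: "\<forall>\<^sub>F N in sequentially. R \<le> cutoff N"
proof -
  define l where "l = ln (max 1 R)"
  have l: "0 \<le> l" by (simp add: l_def)
  have "\<forall>\<^sub>F N in sequentially. T * exp (l\<^sup>2) \<le> real N"
    using filterlim_real_sequentially unfolding filterlim_at_top by blast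
  then show ?thesis
  proof eventually_elim
    case (elim N)
    then have "exp (l\<^sup>2) \<le> real N / T" using T_pos by (simp add: field_simps)
    then have "ln (exp (l\<^sup>2)) \<le> ln (real N / T)" using less_le_trans[OF exp_gt_zero] by (intro ln_mono) auto
    then have "l\<^sup>2 \<le> \<bar>ln (real N / T)\<bar>" by simp
    then have "l \<le> sqrt \<bar>ln (real N / T)\<bar>" by (rule real_le_rsqrt)
    then have "exp l \<le> cutoff N" by (simp add: cutoff_def)
    then show ?case by (simp add: l_def)
  qed
qed

text \<open>Chebyshev's inequality for the scheme within one cell; it carries the estimate from the
  left grid point to the remaining times of the cell. Bounded coefficients are at hand only on the
  good event.\<close>

lemma Y_increment_prob:
  assumes R: "0 \<le> R"
  obtains C where "0 \<le> C"
    "\<And>N k t \<epsilon>. N \<ge> 1 \<Longrightarrow> k < N \<Longrightarrow> grid N k \<le> t \<Longrightarrow> t \<le> grid N (Suc k) \<Longrightarrow> 0 < \<epsilon> \<Longrightarrow>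
      \<exists>E\<in>sets M. {\<omega> \<in> good N R k. \<epsilon> < norm (Y N t \<omega> - Y N (grid N k) \<omega>)} \<subseteq> E \<and> prob E \<le> C * (T / real N) / \<epsilon>\<^sup>2"
proof -
  obtain L B where LB: "0 \<le> L" "0 \<le> B"
    "\<And>x y. norm x \<le> R \<Longrightarrow> norm y \<le> R \<Longrightarrow> norm (\<mu> x - \<mu> y) \<le> L * norm (x - y)"
    "\<And>x y. norm x \<le> R \<Longrightarrow> norm y \<le> R \<Longrightarrow> norm (\<sigma> x - \<sigma> y) \<le> L * norm (x - y)"
    "\<And>x. norm x \<le> R \<Longrightarrow> norm (\<mu> x) \<le> B" "\<And>x. norm x \<le> R \<Longrightarrow> norm (\<sigma> x) \<le> B"
    by (rule truncated_coefficients[OF R], rule that)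
  let ?md = "real CARD('m)"
  define C where "C = 2 * B\<^sup>2 * (T + ?md)"
  have C: "0 \<le> C" using T_pos by (simp add: C_def)
  have main: "\<exists>E\<in>sets M. {\<omega> \<in> good N R k. \<epsilon> < norm (Y N t \<omega> - Y N (grid N k) \<omega>)} \<subseteq> E \<and> prob E \<le> C * (T / real N) / \<epsilon>\<^sup>2"
    if N: "N \<ge> 1" "k < N" and t: "grid N k \<le> t" "t \<le> grid N (Suc k)" and e: "0 < \<epsilon>" for N k t \<epsilon>
  proof -
    let ?s = "grid N k" and ?h = "T / real N"
    have st: "0 \<le> ?s" "?s \<le> t" "t \<le> T" using grid_nonneg t grid_mem[of N "Suc k"] N by auto
    have u: "0 \<le> t - ?s" "t - ?s \<le> ?h" using t grid_Suc[of N k] by auto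
    have h: "0 < ?h" "?h \<le> T" using N T_pos by (auto simp: divide_le_eq mult_le_cancel_left1)
    have hh: "?h\<^sup>2 \<le> T * ?h" using h by (simp only: power2_eq_square mult_right_mono less_imp_le)
    let ?f = "\<lambda>\<omega>. 2 * B\<^sup>2 * (T * ?h + (norm (incr ?s t \<omega>))\<^sup>2)"
    have iM: "incr ?s t \<in> borel_measurable M" by (rule incr_measurable[OF st])
    have sq: "(\<lambda>\<omega>. (norm (incr ?s t \<omega>))\<^sup>2) \<in> borel_measurable M"
      using measurable_compose[OF iM, of "\<lambda>z. (norm z)\<^sup>2" borel] by simp
    have bd: "(\<integral>\<^sup>+\<omega>. ennreal ((norm (incr ?s t \<omega>))\<^sup>2) \<partial>M) \<le> ennreal (?md * ?h)"
      unfolding nn_integral_incr_norm_square[OF st] using u by (intro ennreal_leI mult_left_mono) auto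
    have md: "0 \<le> ?md * ?h" by (rule mult_nonneg_nonneg) (use h in auto)
    note in2 = integrable_nn_bound[OF sq zero_le_power2 md bd]
    have fi: "integrable M ?f" using in2(1) by simp
    have "expectation ?f = 2 * B\<^sup>2 * (T * ?h + expectation (\<lambda>\<omega>. (norm (incr ?s t \<omega>))\<^sup>2))"
      using in2(1) by (simp add: prob_space)
    also have "\<dots> \<le> 2 * B\<^sup>2 * (T * ?h + ?md * ?h)" using in2(2) by (intro mult_left_mono add_left_mono) auto
    also have "\<dots> = C * ?h" by (simp only: C_def distrib_right mult.assoc)
    finally have fe: "expectation ?f \<le> C * ?h" .
    let ?E = "{\<omega> \<in> space M. \<epsilon>\<^sup>2 < ?f \<omega>}"
    have "0 \<le> T * ?h" by (rule mult_nonneg_nonneg[OF less_imp_le[OF T_pos] less_imp_le[OF h(1)]])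
    then have f0: "0 \<le> ?f \<omega>" for \<omega> by (intro mult_nonneg_nonneg[OF _ add_nonneg_nonneg[OF _ zero_le_power2]]) simp
    have "prob ?E \<le> C * ?h / \<epsilon>\<^sup>2"
      by (rule measure_gt_le_integral[OF fi f0 _ finite_measure_axioms fe]) (use e in simp)
    moreover have "?E \<in> sets M"
      by (rule borel_measurable_less[OF borel_measurable_const borel_measurable_integrable[OF fi]])
    moreover have "{\<omega> \<in> good N R k. \<epsilon> < norm (Y N t \<omega> - Y N ?s \<omega>)} \<subseteq> ?E"
    proof safe
      fix \<omega> assume w: "\<omega> \<in> good N R k" "\<epsilon> < norm (Y N t \<omega> - Y N ?s \<omega>)"
      show wM: "\<omega> \<in> space M" using w by (simp add: good_def)
      let ?y = "Y N ?s \<omega>"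
      have y: "norm ?y \<le> R" using w by (auto simp: good_def)
      have "norm (Y N t \<omega> - ?y) \<le> norm ((t - ?s) *\<^sub>R \<mu> ?y + \<sigma> ?y *v incr ?s t \<omega>)"
        unfolding Y_step'[OF N wM t] by (simp add: norm_tamed_le)
      also have "\<dots> \<le> (t - ?s) * norm (\<mu> ?y) + norm (\<sigma> ?y) * norm (incr ?s t \<omega>)"
        using u by (intro order_trans[OF norm_triangle_ineq] add_mono norm_matrix_vector_mult_le) auto
      also have "\<dots> \<le> ?h * B + B * norm (incr ?s t \<omega>)"
        using LB(5)[OF y] LB(6)[OF y] LB(2) u h by (intro add_mono mult_mono) auto
      also have "\<dots> = B * (?h + norm (incr ?s t \<omega>))" by (simp add: algebra_simps)
      finally have "norm (Y N t \<omega> - ?y) \<le> B * (?h + norm (incr ?s t \<omega>))" .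
      then have "\<epsilon> < B * (?h + norm (incr ?s t \<omega>))" using w(2) by linarith
      then have "\<epsilon>\<^sup>2 < (B * (?h + norm (incr ?s t \<omega>)))\<^sup>2" using e by (intro power_strict_mono) auto
      also have "\<dots> = B\<^sup>2 * (?h + norm (incr ?s t \<omega>))\<^sup>2" by (rule power_mult_distrib)
      also have "\<dots> \<le> B\<^sup>2 * (2 * (T * ?h + (norm (incr ?s t \<omega>))\<^sup>2))"
      proof (rule mult_left_mono)
        have sq2: "(a + b)\<^sup>2 \<le> 2 * (a\<^sup>2 + b\<^sup>2)" for a b :: real
          using sum_squares_bound[of a b] by (simp add: power2_sum)
        show "(?h + norm (incr ?s t \<omega>))\<^sup>2 \<le> 2 * (T * ?h + (norm (incr ?s t \<omega>))\<^sup>2)"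
          by (rule order_trans[OF sq2 mult_left_mono[OF add_right_mono[OF hh]]]) simp
      qed simp
      finally show "\<epsilon>\<^sup>2 < ?f \<omega>" by (simp only: mult_ac)
    qed
    ultimately show ?thesis by blast
  qed
  show thesis by (rule that[OF C main])
qed

text \<open>The order of the choices matters: tails of \<open>X\<close> and of the scheme fix
  \<open>R\<close>, which determines the constants \<open>K\<close> and \<open>C\<close>; then
  \<delta> and \<open>\<eta>'\<close> are made small, \<open>N\<close> large, and finally
  \<open>m\<close> is chosen for that \<open>N\<close>. No bound depends on the cell of
  \<open>t\<close>, hence uniformity in time.\<close>

lemma Y_converges_in_probability:
  assumes e: "0 < \<epsilon>" "0 < \<eta>"
  shows "\<forall>\<^sub>F N in sequentially. \<forall>t\<in>{0..T}. prob {\<omega> \<in> space M. \<epsilon> < norm (X t \<omega> - Y N t \<omega>)} \<le> \<eta>"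
proof -
  obtain R1 where R1: "1 \<le> R1" "prob (space M - {\<omega> \<in> space M. \<forall>s\<in>{0..T}. norm (X s \<omega>) \<le> R1}) \<le> \<eta> / 8"
    using bounded_paths_event[OF less_imp_le[OF T_pos] X_adapted X_continuous, of "\<eta> / 8"] e by auto
  obtain R2 where R2: "1 \<le> R2" "\<And>N. N \<ge> 1 \<Longrightarrow> emeasure M {\<omega> \<in> space M. \<exists>k\<le>N. R2 < norm (Y N (grid N k) \<omega>)} \<le> ennreal (\<eta> / 8)"
    using Y_uniform_tail[of "\<eta> / 8"] e by auto
  define R where "R = max R1 R2"
  have R: "1 \<le> R" "0 \<le> R" "R1 \<le> R" "R2 \<le> R" using R1(1) by (auto simp: R_def)
  obtain K where K: "0 \<le> K"
    "\<And>N m \<delta> \<eta> G A j. N \<ge> 1 \<Longrightarrow> m \<ge> 1 \<Longrightarrow> R \<le> cutoff N \<Longrightarrow> 0 \<le> \<delta> \<Longrightarrow> 0 \<le> \<eta> \<Longrightarrow> G \<in> sets M \<Longrightarrow> prob (space M - G) \<le> \<eta> \<Longrightarrow>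
      osc_bounded N \<delta> G \<Longrightarrow> fine_sum_close N m \<delta> \<eta> A \<Longrightarrow> j \<le> N \<Longrightarrow>
      \<exists>D. D \<in> borel_measurable M \<and> integrable M (\<lambda>\<omega>. (norm (D \<omega> :: real^'d))\<^sup>2) \<and> expectation (\<lambda>\<omega>. (norm (D \<omega>))\<^sup>2) \<le> K * (\<delta>\<^sup>2 + \<eta> + T / real N) \<and>
        (\<forall>\<omega>\<in>good N R j. X 0 \<omega> + fine_sum N m j \<omega> - Y N (grid N j) \<omega> = D \<omega>)"
    by (rule grid_error_bound[OF R(1)], rule that)
  obtain C where C: "0 \<le> C"
    "\<And>N k t \<epsilon>. N \<ge> 1 \<Longrightarrow> k < N \<Longrightarrow> grid N k \<le> t \<Longrightarrow> t \<le> grid N (Suc k) \<Longrightarrow> 0 < \<epsilon> \<Longrightarrow>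
      \<exists>E\<in>sets M. {\<omega> \<in> good N R k. \<epsilon> < norm (Y N t \<omega> - Y N (grid N k) \<omega>)} \<subseteq> E \<and> prob E \<le> C * (T / real N) / \<epsilon>\<^sup>2"
    by (rule Y_increment_prob[OF R(2)], rule that)
  let ?e = "\<epsilon> / 4"
  \<comment> \<open>\<open>q\<close> bounds each of \<open>\<delta>\<^sup>2\<close>,
    \<open>\<eta>'\<close> and \<open>T / real N\<close>. The number 24 is three such terms times
    the desired fraction one eighth of \<eta>; the summand \<open>1\<close> avoids division by
    zero.\<close>
  define q where "q = \<eta> * ?e\<^sup>2 / (24 * (K + C + 1))"
  have den: "0 < K + C + 1" using K(1) C(1) by linarith
  have q: "0 < q" using e den by (simp add: q_def)
  have Kq: "K * (q + q + q) / ?e\<^sup>2 \<le> \<eta> / 8" and Cq: "C * q / ?e\<^sup>2 \<le> \<eta> / 8"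
  proof -
    have e2: "0 < ?e\<^sup>2" using e by simp
    have "q * (24 * (K + C + 1)) = \<eta> * ?e\<^sup>2" using den by (simp add: q_def)
    then have "24 * (K * q) + 24 * (C * q) + 24 * q = \<eta> * ?e\<^sup>2" by (simp add: algebra_simps)
    moreover have "0 \<le> K * q" "0 \<le> C * q" using K(1) C(1) q by auto
    ultimately have "K * (q + q + q) \<le> \<eta> / 8 * ?e\<^sup>2" "C * q \<le> \<eta> / 8 * ?e\<^sup>2" using q by (simp_all add: algebra_simps)
    then show "K * (q + q + q) / ?e\<^sup>2 \<le> \<eta> / 8" "C * q / ?e\<^sup>2 \<le> \<eta> / 8" using e2 by (simp_all only: pos_divide_le_eq)
  qed
  define \<delta> where "\<delta> = min ?e (sqrt q)"
  have \<delta>: "0 < \<delta>" "\<delta> \<le> ?e" using e q by (auto simp: \<delta>_def)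
  have \<delta>q: "\<delta>\<^sup>2 \<le> q"
  proof -
    have "\<delta>\<^sup>2 \<le> (sqrt q)\<^sup>2" using \<delta> by (intro power_mono) (auto simp: \<delta>_def)
    then show ?thesis using q by simp
  qed
  define \<eta>' where "\<eta>' = min (\<eta> / 8) q"
  have \<eta>': "0 < \<eta>'" "\<eta>' \<le> \<eta> / 8" "\<eta>' \<le> q" using e q by (auto simp: \<eta>'_def)
  obtain r G where rG: "0 < r" "G \<in> sets M" "prob (space M - G) \<le> \<eta>'"
    "\<And>\<omega> s t. \<omega> \<in> G \<Longrightarrow> s \<in> {0..T} \<Longrightarrow> t \<in> {0..T} \<Longrightarrow> \<bar>s - t\<bar> < r \<Longrightarrow> norm (X s \<omega> - X t \<omega>) \<le> \<delta>"
    by (rule modulus_event[OF T_pos X_adapted X_continuous \<eta>'(1) \<delta>(1)], assumption, assumption, rule that)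
  have "\<forall>\<^sub>F N in sequentially. T / real N < min r q"
    using order_tendstoD(2)[OF step_tendsto_0, of "min r q"] rG(1) q by simp
  from this cutoff_ge_eventually[of R] eventually_ge_at_top[of 1] show ?thesis
  proof eventually_elim
    case (elim N)
    then have N: "N \<ge> 1" and cut: "R \<le> cutoff N" and hr: "T / real N < r" "T / real N < q" by auto
    obtain m A where mA: "m \<ge> 1" "\<And>k. k \<le> N \<Longrightarrow> A k \<in> sets M"
      "\<And>k. k \<le> N \<Longrightarrow> {\<omega> \<in> space M. \<delta> < norm (X (grid N k) \<omega> - X 0 \<omega> - fine_sum N m k \<omega>)} \<subseteq> A k"
      "\<And>k. k \<le> N \<Longrightarrow> prob (A k) \<le> \<eta>'"
      by (rule fine_sum_converges[OF N \<delta>(1) \<eta>'(1)], rule that)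
    show ?case
    proof
      fix t assume t: "t \<in> {0..T}"
      obtain k where k: "k < N" "grid N k \<le> t" "t \<le> grid N (Suc k)" by (rule grid_cell[OF N t])
      have kN: "k \<le> N" using k by simp
      have osc: "norm (X s \<omega> - X t \<omega>) \<le> \<delta>" if "\<omega> \<in> G" "s \<in> {0..T}" "t \<in> {0..T}" "\<bar>s - t\<bar> \<le> T / real N" for \<omega> s t
        using rG(4)[OF that(1-3)] that(4) hr by linarith
      have ob: "osc_bounded N \<delta> G" using osc by (simp add: osc_bounded_def)
      have close: "fine_sum_close N m \<delta> \<eta>' A" using mA(2,3,4) by (simp add: fine_sum_close_def)
      obtain D where D: "D \<in> borel_measurable M" "integrable M (\<lambda>\<omega>. (norm (D \<omega> :: real^'d))\<^sup>2)"
        "expectation (\<lambda>\<omega>. (norm (D \<omega>))\<^sup>2) \<le> K * (\<delta>\<^sup>2 + \<eta>' + T / real N)"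
        "\<And>\<omega>. \<omega> \<in> good N R k \<Longrightarrow> X 0 \<omega> + fine_sum N m k \<omega> - Y N (grid N k) \<omega> = D \<omega>"
        using K(2)[OF N mA(1) cut less_imp_le[OF \<delta>(1)] less_imp_le[OF \<eta>'(1)] rG(2,3) ob close kN] by blast
      obtain E where E: "E \<in> sets M" "{\<omega> \<in> good N R k. ?e < norm (Y N t \<omega> - Y N (grid N k) \<omega>)} \<subseteq> E" "prob E \<le> C * (T / real N) / ?e\<^sup>2"
        using C(2)[OF N k, of ?e] e by auto
      let ?B1 = "space M - {\<omega> \<in> space M. \<forall>s\<in>{0..T}. norm (X s \<omega>) \<le> R1}"
      let ?B2 = "{\<omega> \<in> space M. \<exists>k\<le>N. R2 < norm (Y N (grid N k) \<omega>)}"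
      let ?B3 = "{\<omega> \<in> space M. ?e\<^sup>2 < (norm (D \<omega>))\<^sup>2}"
      have B1: "?B1 \<in> sets M"
        using sup_event_measurable[OF _ X_adapted X_continuous, of T R1] sets_F_subset[of T] T_pos by auto
      have B2: "?B2 \<in> sets M"
      proof -
        have "{\<omega> \<in> space M. \<exists>k\<in>{..N}. R2 < norm (Y N (grid N k) \<omega>)} \<in> sets M"
          by (intro sets.sets_Collect_finite_Ex borel_measurable_less borel_measurable_const
              measurable_compose[OF Y_measurable_M[OF N grid_mem[OF N]] borel_measurable_norm]) auto
        then show ?thesis by (simp only: Bex_def atMost_iff)
      qed
      have B3: "?B3 \<in> sets M"
        by (rule borel_measurable_less[OF borel_measurable_const borel_measurable_integrable[OF D(2)]])
      have "prob ?B3 \<le> K * (\<delta>\<^sup>2 + \<eta>' + T / real N) / ?e\<^sup>2"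
        by (rule measure_gt_le_integral[OF D(2) _ _ finite_measure_axioms D(3)]) (use e in auto)
      also have "\<dots> \<le> K * (q + q + q) / ?e\<^sup>2"
        using K(1) \<delta>q \<eta>'(3) hr(2) by (intro divide_right_mono mult_left_mono add_mono) auto
      finally have p3: "prob ?B3 \<le> \<eta> / 8" using Kq by linarith
      have pE: "prob E \<le> \<eta> / 8"
      proof -
        have "C * (T / real N) / ?e\<^sup>2 \<le> C * q / ?e\<^sup>2" using C(1) hr(2) by (intro divide_right_mono mult_left_mono) auto
        then show ?thesis using E(3) Cq by linarith
      qed
      have p2: "prob ?B2 \<le> \<eta> / 8" using R2(2)[OF N] e by (simp add: emeasure_eq_measure)
      have G': "space M - G \<in> sets M" using rG(2) by auto
      \<comment> \<open>Six exceptional events, each of probability at most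
        \<open>\<eta> / 8\<close>. Outside them the error is a sum of four parts of norm at most
        \<open>\<epsilon> / 4\<close>: movement of \<open>X\<close> in the cell, defect of the
        Riemann sum, \<open>D\<close>, and movement of the scheme in the cell.\<close>
      have sub: "{\<omega> \<in> space M. \<epsilon> < norm (X t \<omega> - Y N t \<omega>)} \<subseteq> ((?B1 \<union> ?B2) \<union> (?B3 \<union> E)) \<union> ((space M - G) \<union> A k)"
      proof (rule subsetI, rule ccontr)
        fix \<omega> assume "\<omega> \<in> {\<omega> \<in> space M. \<epsilon> < norm (X t \<omega> - Y N t \<omega>)}"
          and "\<omega> \<notin> ((?B1 \<union> ?B2) \<union> (?B3 \<union> E)) \<union> ((space M - G) \<union> A k)"
        then have w: "\<omega> \<in> space M" "\<epsilon> < norm (X t \<omega> - Y N t \<omega>)" "\<omega> \<notin> ?B1" "\<omega> \<notin> ?B2" "\<omega> \<notin> ?B3" "\<omega> \<notin> E" "\<omega> \<in> G" "\<omega> \<notin> A k" by blast+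
        have Tk: "grid N k \<in> {0..T}" by (rule grid_mem[OF N kN])
        have X1: "norm (X s \<omega>) \<le> R" if "s \<in> {0..grid N k}" for s
        proof -
          have "norm (X s \<omega>) \<le> R1" using w(1,3) that Tk by auto
          then show ?thesis using R(3) by simp
        qed
        have Y1: "norm (Y N (grid N i) \<omega>) \<le> R" if "i \<le> k" for i
        proof -
          have "norm (Y N (grid N i) \<omega>) \<le> R2" using w(1,4) that kN by (auto simp: not_less)
          then show ?thesis using R(4) by simp
        qed
        have good: "\<omega> \<in> good N R k" unfolding good_def using w(1) X1 Y1 by blast
        have 1: "norm (X t \<omega> - X (grid N k) \<omega>) \<le> ?e"
          using osc[OF w(7) t Tk] k grid_Suc[of N k] \<delta>(2) by simp
        have 2: "norm (X (grid N k) \<omega> - X 0 \<omega> - fine_sum N m k \<omega>) \<le> ?e"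
          using mA(3)[OF kN] w(1,8) \<delta>(2) by (force simp: not_less)
        have "(norm (D \<omega>))\<^sup>2 \<le> ?e\<^sup>2" using w(1,5) by (simp add: not_less)
        then have 3: "norm (D \<omega>) \<le> ?e" by (rule power2_le_imp_le) (use e in simp)
        have 4: "norm (Y N (grid N k) \<omega> - Y N t \<omega>) \<le> ?e"
          using E(2) w(6) good by (auto simp: not_less norm_minus_commute)
        have eq: "X t \<omega> - Y N t \<omega> = (X t \<omega> - X (grid N k) \<omega>) + (X (grid N k) \<omega> - X 0 \<omega> - fine_sum N m k \<omega>) + D \<omega> + (Y N (grid N k) \<omega> - Y N t \<omega>)"
          unfolding D(4)[OF good, symmetric] by simp
        have "norm (X t \<omega> - Y N t \<omega>) \<le> ?e + ?e + ?e + ?e"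
          unfolding eq by (intro order_trans[OF norm_triangle_ineq] add_mono 1 2 3 4)
        then show False using w(2) by simp
      qed
      have un: "prob (S \<union> S') \<le> a + a'" if "prob S \<le> a" "prob S' \<le> a'" "S \<in> sets M" "S' \<in> sets M" for S S' a a'
        using measure_Un_le[OF that(3,4)] that(1,2) by linarith
      have "prob {\<omega> \<in> space M. \<epsilon> < norm (X t \<omega> - Y N t \<omega>)} \<le> prob (((?B1 \<union> ?B2) \<union> (?B3 \<union> E)) \<union> ((space M - G) \<union> A k))"
        by (rule finite_measure_mono[OF sub]) (intro sets.Un B1 B2 B3 E(1) G' mA(2)[OF kN])
      also have "\<dots> \<le> ((prob ?B1 + prob ?B2) + (prob ?B3 + prob E)) + (prob (space M - G) + prob (A k))"
        by (intro un order_refl sets.Un B1 B2 B3 E(1) G' mA(2)[OF kN])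
      also have "\<dots> \<le> ((\<eta> / 8 + \<eta> / 8) + (\<eta> / 8 + \<eta> / 8)) + (\<eta> / 8 + \<eta> / 8)"
        using rG(3) mA(4)[OF kN] \<eta>'(2) by (intro add_mono R1(2) p2 p3 pE) auto
      also have "\<dots> \<le> \<eta>" using e by simp
      finally show "prob {\<omega> \<in> space M. \<epsilon> < norm (X t \<omega> - Y N t \<omega>)} \<le> \<eta>" .
    qed
  qed
qed

end

section \<open>Strong convergence\<close>

lemma powr_add_le:
  fixes a b q :: real
  assumes "0 \<le> a" "0 \<le> b" "0 \<le> q"
  shows "(a + b) powr q \<le> 2 powr q * (a powr q + b powr q)"
proof -
  have "(a + b) powr q \<le> (2 * max a b) powr q" using assms by (intro powr_mono2) auto
  also have "\<dots> = 2 powr q * max a b powr q" using assms by (simp add: powr_mult)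
  also have "\<dots> \<le> 2 powr q * (a powr q + b powr q)" by (intro mult_left_mono) (auto simp: max_def)
  finally show ?thesis .
qed

section \<open>Moments of the solution and uniform integrability\<close>

context tamed_euler_sde
begin

lemma error_event_sets:
  assumes "N \<ge> 1" "t \<in> {0..T}"
  shows "{\<omega> \<in> space M. \<epsilon> < norm (X t \<omega> - Y N t \<omega>)} \<in> sets M"
proof -
  note [measurable] = X_measurable[OF assms(2)] Y_measurable_M[OF assms]
  show ?thesis by measurable
qed

text \<open>Fatou's lemma along convergence in probability. The norm of \<open>X\<close> is first
  truncated at \<open>n\<close>, so that the event of a large error contributes at most
  \<open>real n powr q\<close> times its probability; elsewhere \<open>X\<close> is within distance
  1 of the scheme, whose moments are bounded uniformly.\<close>

lemma X_moment_bound: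
  assumes q: "0 \<le> q"
  obtains C where "0 \<le> C" "\<And>t. t \<in> {0..T} \<Longrightarrow> (\<integral>\<^sup>+\<omega>. ennreal (norm (X t \<omega>) powr q) \<partial>M) \<le> ennreal C"
proof -
  obtain CY where CY: "0 \<le> CY"
    "\<And>N t. N \<ge> 1 \<Longrightarrow> t \<in> {0..T} \<Longrightarrow> (\<integral>\<^sup>+\<omega>. ennreal (norm (Y N t \<omega>) powr q) \<partial>M) \<le> ennreal CY"
    by (rule Y_moment_bound[OF q], rule that)
  define C where "C = 2 powr q * (CY + 1) + 1"
  have C: "0 \<le> C" using CY(1) by (simp add: C_def)
  have "(\<integral>\<^sup>+\<omega>. ennreal (norm (X t \<omega>) powr q) \<partial>M) \<le> ennreal C" if t: "t \<in> {0..T}" for t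
  proof -
    note [measurable] = X_measurable[OF t]
    have trunc: "(\<integral>\<^sup>+\<omega>. ennreal (min (norm (X t \<omega>)) (real n) powr q) \<partial>M) \<le> ennreal C" for n :: nat
    proof -
      \<comment> \<open>The admissible probability depends on the truncation level, so that the
        contribution of the bad event stays below 1 for every \<open>n\<close>.\<close>
      define \<eta> where "\<eta> = 1 / (1 + real n powr q)"
      have \<eta>: "0 < \<eta>" "real n powr q * \<eta> \<le> 1" by (auto simp: \<eta>_def divide_simps add_pos_nonneg)
      have "\<forall>\<^sub>F N in sequentially. N \<ge> 1 \<and> (\<forall>t\<in>{0..T}. prob {\<omega> \<in> space M. 1 < norm (X t \<omega> - Y N t \<omega>)} \<le> \<eta>)"
        by (intro eventually_conj eventually_ge_at_top Y_converges_in_probability \<eta>(1)) simp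
      then obtain N where N: "N \<ge> 1" "prob {\<omega> \<in> space M. 1 < norm (X t \<omega> - Y N t \<omega>)} \<le> \<eta>"
        using t by (auto dest!: eventually_happens)
      let ?E = "{\<omega> \<in> space M. 1 < norm (X t \<omega> - Y N t \<omega>)}"
      have E: "?E \<in> sets M" by (rule error_event_sets[OF N(1) t])
      note [measurable] = Y_measurable_M[OF N(1) t]
      have "(\<integral>\<^sup>+\<omega>. ennreal (min (norm (X t \<omega>)) (real n) powr q) \<partial>M)
        \<le> (\<integral>\<^sup>+\<omega>. ennreal (2 powr q) * (ennreal (norm (Y N t \<omega>) powr q) + 1) + ennreal (real n powr q) * indicator ?E \<omega> \<partial>M)"
      proof (rule nn_integral_mono)
        fix \<omega> assume w: "\<omega> \<in> space M"
        have "min (norm (X t \<omega>)) (real n) powr q \<le> 2 powr q * (norm (Y N t \<omega>) powr q + 1) + real n powr q * indicat_real ?E \<omega>"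
        proof (cases "\<omega> \<in> ?E")
          case True
          have "min (norm (X t \<omega>)) (real n) powr q \<le> real n powr q" using q by (intro powr_mono2) auto
          then show ?thesis using True by (simp add: add_increasing)
        next
          case False
          then have "norm (X t \<omega> - Y N t \<omega>) \<le> 1" using w by simp
          then have "norm (X t \<omega>) \<le> norm (Y N t \<omega>) + 1" using norm_triangle_ineq2[of "X t \<omega>" "Y N t \<omega>"] by linarith
          then have "min (norm (X t \<omega>)) (real n) powr q \<le> (norm (Y N t \<omega>) + 1) powr q" using q by (intro powr_mono2) auto
          also have "\<dots> \<le> 2 powr q * (norm (Y N t \<omega>) powr q + 1)" using powr_add_le[of "norm (Y N t \<omega>)" 1 q] q by simp
          finally show ?thesis using False by simp
        qed
        then have "ennreal (min (norm (X t \<omega>)) (real n) powr q) \<le> ennreal (2 powr q * (norm (Y N t \<omega>) powr q + 1) + real n powr q * indicat_real ?E \<omega>)"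
          by (rule ennreal_leI)
        also have "\<dots> = ennreal (2 powr q) * (ennreal (norm (Y N t \<omega>) powr q) + 1) + ennreal (real n powr q) * indicator ?E \<omega>"
          by (simp add: ennreal_mult ennreal_indicator)
        finally show "ennreal (min (norm (X t \<omega>)) (real n) powr q) \<le> ennreal (2 powr q) * (ennreal (norm (Y N t \<omega>) powr q) + 1) + ennreal (real n powr q) * indicator ?E \<omega>" .
      qed
      also have "\<dots> = ennreal (2 powr q) * ((\<integral>\<^sup>+\<omega>. ennreal (norm (Y N t \<omega>) powr q) \<partial>M) + 1) + ennreal (real n powr q) * emeasure M ?E"
        using E by (simp add: nn_integral_add nn_integral_cmult emeasure_space_1)
      also have "\<dots> \<le> ennreal (2 powr q) * (ennreal CY + 1) + ennreal (real n powr q) * ennreal \<eta>"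
        using CY(2)[OF N(1) t] N(2) by (intro add_mono mult_left_mono order_refl) (auto simp: emeasure_eq_measure ennreal_leI)
      also have "\<dots> = ennreal (2 powr q * (CY + 1) + real n powr q * \<eta>)"
        using CY(1) \<eta>(1) by (simp add: ennreal_mult)
      also have "\<dots> \<le> ennreal C" using \<eta>(2) by (intro ennreal_leI) (simp add: C_def)
      finally show ?thesis .
    qed
    have "(\<integral>\<^sup>+\<omega>. ennreal (norm (X t \<omega>) powr q) \<partial>M) \<le> (\<integral>\<^sup>+\<omega>. liminf (\<lambda>n. ennreal (min (norm (X t \<omega>)) (real n) powr q)) \<partial>M)"
    proof (rule nn_integral_mono)
      fix \<omega>
      obtain n0 :: nat where "norm (X t \<omega>) \<le> real n0" using real_arch_simple by blast
      then have "\<forall>\<^sub>F n in sequentially. ennreal (norm (X t \<omega>) powr q) \<le> ennreal (min (norm (X t \<omega>)) (real n) powr q)"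
        by (intro eventually_sequentiallyI[of n0]) (auto simp: min_def)
      then show "ennreal (norm (X t \<omega>) powr q) \<le> liminf (\<lambda>n. ennreal (min (norm (X t \<omega>)) (real n) powr q))"
        by (rule Liminf_bounded)
    qed
    also have "\<dots> \<le> liminf (\<lambda>n. \<integral>\<^sup>+\<omega>. ennreal (min (norm (X t \<omega>)) (real n) powr q) \<partial>M)"
      by (rule nn_integral_liminf) measurable
    also have "\<dots> \<le> liminf (\<lambda>n. ennreal C)" using trunc by (intro Liminf_mono always_eventually allI)
    finally show ?thesis by (simp add: Liminf_const)
  qed
  then show thesis by (rule that[OF C])
qed

lemma error_moment_bound:
  assumes q: "0 \<le> q"
  obtains C where "0 \<le> C"
    "\<And>N t. N \<ge> 1 \<Longrightarrow> t \<in> {0..T} \<Longrightarrow> (\<integral>\<^sup>+\<omega>. ennreal (norm (X t \<omega> - Y N t \<omega>) powr q) \<partial>M) \<le> ennreal C"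
proof -
  obtain CY where CY: "0 \<le> CY"
    "\<And>N t. N \<ge> 1 \<Longrightarrow> t \<in> {0..T} \<Longrightarrow> (\<integral>\<^sup>+\<omega>. ennreal (norm (Y N t \<omega>) powr q) \<partial>M) \<le> ennreal CY"
    by (rule Y_moment_bound[OF q], rule that)
  obtain CX where CX: "0 \<le> CX" "\<And>t. t \<in> {0..T} \<Longrightarrow> (\<integral>\<^sup>+\<omega>. ennreal (norm (X t \<omega>) powr q) \<partial>M) \<le> ennreal CX"
    by (rule X_moment_bound[OF q], rule that)
  have "(\<integral>\<^sup>+\<omega>. ennreal (norm (X t \<omega> - Y N t \<omega>) powr q) \<partial>M) \<le> ennreal (2 powr q * (CX + CY))"
    if N: "N \<ge> 1" and t: "t \<in> {0..T}" for N t
  proof -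
    note [measurable] = X_measurable[OF t] Y_measurable_M[OF N t]
    have "(\<integral>\<^sup>+\<omega>. ennreal (norm (X t \<omega> - Y N t \<omega>) powr q) \<partial>M)
      \<le> (\<integral>\<^sup>+\<omega>. ennreal (2 powr q) * (ennreal (norm (X t \<omega>) powr q) + ennreal (norm (Y N t \<omega>) powr q)) \<partial>M)"
    proof (rule nn_integral_mono)
      fix \<omega>
      have "norm (X t \<omega> - Y N t \<omega>) powr q \<le> (norm (X t \<omega>) + norm (Y N t \<omega>)) powr q"
        using q by (intro powr_mono2 norm_triangle_ineq4) auto
      also have "\<dots> \<le> 2 powr q * (norm (X t \<omega>) powr q + norm (Y N t \<omega>) powr q)" using q by (intro powr_add_le) auto
      finally have "ennreal (norm (X t \<omega> - Y N t \<omega>) powr q) \<le> ennreal (2 powr q * (norm (X t \<omega>) powr q + norm (Y N t \<omega>) powr q))"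
        by (rule ennreal_leI)
      then show "ennreal (norm (X t \<omega> - Y N t \<omega>) powr q) \<le> ennreal (2 powr q) * (ennreal (norm (X t \<omega>) powr q) + ennreal (norm (Y N t \<omega>) powr q))"
        by (simp add: ennreal_mult)
    qed
    also have "\<dots> = ennreal (2 powr q) * ((\<integral>\<^sup>+\<omega>. ennreal (norm (X t \<omega>) powr q) \<partial>M) + (\<integral>\<^sup>+\<omega>. ennreal (norm (Y N t \<omega>) powr q) \<partial>M))"
      by (simp add: nn_integral_add nn_integral_cmult)
    also have "\<dots> \<le> ennreal (2 powr q) * (ennreal CX + ennreal CY)"
      by (intro mult_left_mono add_mono CX(2)[OF t] CY(2)[OF N t]) simp
    also have "\<dots> = ennreal (2 powr q * (CX + CY))" using CX(1) CY(1) by (simp add: ennreal_mult)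
    finally show ?thesis .
  qed
  moreover have "0 \<le> 2 powr q * (CX + CY)" using CX(1) CY(1) by simp
  ultimately show thesis using that by blast
qed

text \<open>Moments of order \<open>2 * r\<close>, bounded uniformly in \<open>N\<close> and
  \<open>t\<close>, give uniform integrability of the \<open>r\<close>-th power of the error;
  together with convergence in probability, uniform in time, this yields convergence of the
  supremum.\<close>

lemma strong_convergence:
  assumes r: "0 < r"
  shows "(\<lambda>N. SUP t\<in>{0..T}. \<integral>\<^sup>+\<omega>. ennreal (norm (X t \<omega> - Y N t \<omega>) powr r) \<partial>M) \<longlonglongrightarrow> 0"
proof -
  obtain C where C: "0 \<le> C"
    "\<And>N t. N \<ge> 1 \<Longrightarrow> t \<in> {0..T} \<Longrightarrow> (\<integral>\<^sup>+\<omega>. ennreal (norm (X t \<omega> - Y N t \<omega>) powr (2 * r)) \<partial>M) \<le> ennreal C"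
    by (rule error_moment_bound[of "2 * r"], use r in simp, rule that)
  have small: "\<forall>\<^sub>F N in sequentially. (SUP t\<in>{0..T}. \<integral>\<^sup>+\<omega>. ennreal (norm (X t \<omega> - Y N t \<omega>) powr r) \<partial>M) \<le> ennreal e"
    if e: "0 < e" for e
  proof -
    define \<epsilon> where "\<epsilon> = (e / 3) powr (1 / r)"
    \<comment> \<open>First \<theta> makes the contribution of the higher moment at most
      \<open>e / 3\<close>; then \<eta> is chosen so small that the bad event, whose weight is
      \<open>1 / \<theta>\<close>, contributes another third.\<close>
    define \<theta> where "\<theta> = e / (3 * (C + 1))"
    define \<eta> where "\<eta> = \<theta> * e / 3"
    have \<epsilon>: "0 < \<epsilon>" "\<epsilon> powr r = e / 3" using e r by (auto simp: \<epsilon>_def powr_powr)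
    have \<theta>: "0 < \<theta>" using e C(1) by (simp add: \<theta>_def)
    have \<theta>C: "\<theta> * C \<le> e / 3"
    proof -
      have "\<theta> * C \<le> \<theta> * (C + 1)" using \<theta> by simp
      also have "\<dots> = e / 3" using C(1) by (simp add: \<theta>_def divide_simps)
      finally show ?thesis .
    qed
    have \<eta>: "0 < \<eta>" "\<eta> / \<theta> = e / 3" using \<theta> e by (auto simp: \<eta>_def)
    from Y_converges_in_probability[OF \<epsilon>(1) \<eta>(1)] eventually_ge_at_top[of 1] show ?thesis
    proof eventually_elim
      case (elim N)
      show ?case
      proof (rule SUP_least)
        fix t assume t: "t \<in> {0..T}"
        let ?E = "{\<omega> \<in> space M. \<epsilon> < norm (X t \<omega> - Y N t \<omega>)}"
        let ?Z = "\<lambda>\<omega>. norm (X t \<omega> - Y N t \<omega>)"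
        have E: "?E \<in> sets M" by (rule error_event_sets[OF elim(2) t])
        note [measurable] = X_measurable[OF t] Y_measurable_M[OF elim(2) t]
        have "(\<integral>\<^sup>+\<omega>. ennreal (?Z \<omega> powr r) \<partial>M)
          \<le> (\<integral>\<^sup>+\<omega>. ennreal (e / 3) + (ennreal \<theta> * ennreal (?Z \<omega> powr (2 * r)) + ennreal (1 / \<theta>) * indicator ?E \<omega>) \<partial>M)"
        proof (rule nn_integral_mono)
          fix \<omega> assume w: "\<omega> \<in> space M"
          have "?Z \<omega> powr r \<le> e / 3 + (\<theta> * ?Z \<omega> powr (2 * r) + 1 / \<theta> * indicat_real ?E \<omega>)"
          proof (cases "\<omega> \<in> ?E")
            case False
            then have "?Z \<omega> powr r \<le> \<epsilon> powr r" using w r by (intro powr_mono2) auto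
            then show ?thesis using False \<epsilon>(2) \<theta> by (simp add: add_increasing2)
          next
            case True
            let ?z = "?Z \<omega> powr r"
            have sq: "?Z \<omega> powr (2 * r) = ?z\<^sup>2" by (simp add: power2_eq_square powr_add[symmetric])
            \<comment> \<open>On the bad event Young's inequality bounds \<open>?z\<close> by
              \<open>\<theta> * ?z\<^sup>2 + 1 / \<theta>\<close>, trading the unbounded error for a
              small multiple of the higher moment and a constant.\<close>
            have "?z * (2 * \<theta>) \<le> (\<theta> * ?z)\<^sup>2 + 1"
              using sum_squares_bound[of "\<theta> * ?z" 1] by (simp add: mult_ac)
            moreover have "0 \<le> ?z * \<theta>" using \<theta> by simp
            moreover have "(\<theta> * ?z\<^sup>2 + 1 / \<theta>) * \<theta> = (\<theta> * ?z)\<^sup>2 + 1"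
              using \<theta> by (simp add: field_simps power2_eq_square)
            moreover have "?z * (2 * \<theta>) = ?z * \<theta> + ?z * \<theta>" by (simp add: algebra_simps)
            ultimately have "?z * \<theta> \<le> (\<theta> * ?z\<^sup>2 + 1 / \<theta>) * \<theta>" by linarith
            then have "?z \<le> \<theta> * ?z\<^sup>2 + 1 / \<theta>" using \<theta> by (simp only: mult_le_cancel_right_pos)
            then show ?thesis using True e sq by (simp add: add_increasing)
          qed
          then have "ennreal (?Z \<omega> powr r) \<le> ennreal (e / 3 + (\<theta> * ?Z \<omega> powr (2 * r) + 1 / \<theta> * indicat_real ?E \<omega>))"
            by (rule ennreal_leI)
          also have "\<dots> = ennreal (e / 3) + (ennreal \<theta> * ennreal (?Z \<omega> powr (2 * r)) + ennreal (1 / \<theta>) * indicator ?E \<omega>)"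
          proof -
            have "0 \<le> e / 3" "0 \<le> \<theta>" "0 \<le> 1 / \<theta>" "0 \<le> indicat_real ?E \<omega>" using e \<theta> by auto
            then show ?thesis
              by (simp only: ennreal_plus ennreal_mult ennreal_indicator mult_nonneg_nonneg powr_ge_zero add_nonneg_nonneg)
          qed
          finally show "ennreal (?Z \<omega> powr r) \<le> ennreal (e / 3) + (ennreal \<theta> * ennreal (?Z \<omega> powr (2 * r)) + ennreal (1 / \<theta>) * indicator ?E \<omega>)" .
        qed
        also have "\<dots> = ennreal (e / 3) + (ennreal \<theta> * (\<integral>\<^sup>+\<omega>. ennreal (?Z \<omega> powr (2 * r)) \<partial>M) + ennreal (1 / \<theta>) * emeasure M ?E)"
          using E by (simp add: nn_integral_add nn_integral_cmult emeasure_space_1)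
        also have "\<dots> \<le> ennreal (e / 3) + (ennreal \<theta> * ennreal C + ennreal (1 / \<theta>) * ennreal \<eta>)"
          using C(2)[OF elim(2) t] elim(1) t
          by (intro add_mono mult_left_mono order_refl) (auto simp: emeasure_eq_measure intro!: ennreal_leI)
        also have "\<dots> = ennreal (e / 3 + (\<theta> * C + 1 / \<theta> * \<eta>))"
        proof -
          have "0 \<le> e / 3" "0 \<le> \<theta>" "0 \<le> 1 / \<theta>" "0 \<le> \<eta>" using e \<theta> \<eta> by auto
          then show ?thesis using C(1)
            by (simp only: ennreal_plus ennreal_mult mult_nonneg_nonneg add_nonneg_nonneg)
        qed
        also have "\<dots> \<le> ennreal e" using \<theta>C \<eta>(2) by (intro ennreal_leI) simp
        finally show "(\<integral>\<^sup>+\<omega>. ennreal (?Z \<omega> powr r) \<partial>M) \<le> ennreal e" .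
      qed
    qed
  qed
  show ?thesis
  proof (rule order_tendstoI)
    fix a :: ennreal assume "0 < a"
    \<comment> \<open>The bound \<open>a\<close> may be infinite; density of the order supplies a
      finite positive value strictly below it.\<close>
    then obtain b where b: "0 < b" "b < a" using dense by blast
    then obtain e where e: "b = ennreal e" "0 \<le> e" by (cases b) auto
    then have "0 < e" using b(1) by (simp add: ennreal_less_zero_iff)
    from small[OF this] show "\<forall>\<^sub>F N in sequentially. (SUP t\<in>{0..T}. \<integral>\<^sup>+\<omega>. ennreal (norm (X t \<omega> - Y N t \<omega>) powr r) \<partial>M) < a"
      by eventually_elim (rule le_less_trans[OF _ b(2)[unfolded e(1)]])
  qed simp
qed

end

theorem theorem1p1:
  fixes T :: real and M :: "'a measure" and F :: "real \<Rightarrow> 'a measure"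
    and \<mu> :: "real^'d \<Rightarrow> real^'d" and \<sigma> :: "real^'d \<Rightarrow> real^'m^'d"
    and W :: "real \<Rightarrow> 'a \<Rightarrow> real^'m" and X :: "real \<Rightarrow> 'a \<Rightarrow> real^'d"
    and \<rho> :: real and U Ubar :: "real^'d \<Rightarrow> real"
    and U1 :: "real^'d \<Rightarrow> ((real^'d) \<Rightarrow>\<^sub>L real)"
    and U2 :: "real^'d \<Rightarrow> ((real^'d) \<Rightarrow>\<^sub>L ((real^'d) \<Rightarrow>\<^sub>L real))"
    and U3 :: "real^'d \<Rightarrow> ((real^'d) \<Rightarrow>\<^sub>L ((real^'d) \<Rightarrow>\<^sub>L ((real^'d) \<Rightarrow>\<^sub>L real)))"
    and Y :: "nat \<Rightarrow> real \<Rightarrow> 'a \<Rightarrow> real^'d" and \<tau> :: "nat \<Rightarrow> 'a \<Rightarrow> real"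
    and p c :: real
  assumes T_pos: "0 < T"
    and mu_loclip: "locally_lipschitz \<mu>" and sigma_loclip: "locally_lipschitz \<sigma>"
    and basis: "stochastic_basis M F T"
    and BM: "std_brownian_motion M F T W"
    and SDE: "sde_solution M F T \<mu> \<sigma> W X"
    and rho: "0 \<le> \<rho>"
    and U_nonneg: "\<And>x. 0 \<le> U x"
    and U1_deriv: "\<And>x. (U has_derivative blinfun_apply (U1 x)) (at x)"
    and U2_deriv: "\<And>x. (U1 has_derivative blinfun_apply (U2 x)) (at x)"
    and U3_deriv: "\<And>x. (U2 has_derivative blinfun_apply (U3 x)) (at x)"
    and U3_cont: "continuous_on UNIV U3"
    and Ubar_cont: "continuous_on UNIV Ubar"
    and exp_U_X0: "(\<integral>\<^sup>+ \<omega>. ennreal (exp (U (X 0 \<omega>))) \<partial>M) < \<infinity>"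
    and Ubar_bdd: "bdd_below (range Ubar)"
    and Lyap: "\<And>x. blinfun_apply (U1 x) (\<mu> x)
                 + (1/2) * trace (\<sigma> x ** transpose (\<sigma> x) ** hess_of (U2 x))
                 + (1/2) * (norm (transpose (\<sigma> x) *v grad_of (U1 x)))\<^sup>2
                 + Ubar x \<le> \<rho> * U x"
    and Y_init: "\<And>N \<omega>. N \<ge> 1 \<Longrightarrow> \<omega> \<in> space M \<Longrightarrow> Y N 0 \<omega> = X 0 \<omega>"
    and Y_step: "\<And>N n t \<omega>. N \<ge> 1 \<Longrightarrow> n < N \<Longrightarrow> \<omega> \<in> space M \<Longrightarrow>
        real n * T / real N < t \<Longrightarrow> t \<le> real (Suc n) * T / real N \<Longrightarrow>
        Y N t \<omega> = Y N (real n * T / real N) \<omega> +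
          (if norm (Y N (real n * T / real N) \<omega>) \<le> exp (sqrt \<bar>ln (real N / T)\<bar>)
           then (1 / (1 + (norm ((t - real n * T / real N) *\<^sub>R \<mu> (Y N (real n * T / real N) \<omega>)
                    + \<sigma> (Y N (real n * T / real N) \<omega>) *v (W t \<omega> - W (real n * T / real N) \<omega>)))\<^sup>2))
                *\<^sub>R ((t - real n * T / real N) *\<^sub>R \<mu> (Y N (real n * T / real N) \<omega>)
                    + \<sigma> (Y N (real n * T / real N) \<omega>) *v (W t \<omega> - W (real n * T / real N) \<omega>))
           else 0)"
    and p_ge: "1 \<le> p" and c_ge: "1 \<le> c"
    and tau_def: "\<And>N \<omega>. N \<ge> 1 \<Longrightarrow> \<omega> \<in> space M \<Longrightarrow>
        \<tau> N \<omega> = Inf ({t \<in> (\<lambda>k. real k * T / real N) ` {0..N}.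
                         exp (sqrt \<bar>ln (real N / T)\<bar>) < norm (Y N t \<omega>)} \<union> {T})"
    and growth: "\<And>x. norm (\<mu> x) + norm (\<sigma> x) \<le> c * (1 + norm x powr c)"
    and Ubar_lip: "\<And>x y. \<bar>Ubar x - Ubar y\<bar> \<le> c * (1 + norm x powr c + norm y powr c) * norm (x - y)"
    and U_coerc: "\<And>x. norm x powr (1 / c) \<le> c * (1 + U x)"
    and U1_bd: "\<And>x. norm (U1 x) \<le> c * (1 + U x) powr max (1 - 1 / p) 0"
    and U2_bd: "\<And>x. norm (U2 x) \<le> c * (1 + U x) powr max (1 - 2 / p) 0"
    and U3_bd: "\<And>x. norm (U3 x) \<le> c * (1 + U x) powr max (1 - 3 / p) 0"
  shows "(\<forall>r>0. ((\<lambda>N. SUP t\<in>{0..T}. \<integral>\<^sup>+ \<omega>. ennreal (norm (X t \<omega> - Y N t \<omega>) powr r) \<partial>M)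
                    \<longlonglongrightarrow> 0))
       \<and> limsup (\<lambda>N. SUP t\<in>{0..T}. \<integral>\<^sup>+ \<omega>. ennreal (exp (U (Y N t \<omega>) / exp (\<rho> * t)
              + integral {0..min t (\<tau> N \<omega>)} (\<lambda>s. Ubar (Y N s \<omega>) / exp (\<rho> * s)))) \<partial>M)
           \<le> (\<integral>\<^sup>+ \<omega>. ennreal (exp (U (X 0 \<omega>))) \<partial>M)
       \<and> (\<integral>\<^sup>+ \<omega>. ennreal (exp (U (X 0 \<omega>))) \<partial>M) < \<infinity>
       \<and> (SUP N\<in>{1..}. SUP t\<in>{0..T}. \<integral>\<^sup>+ \<omega>. ennreal (exp (U (Y N t \<omega>) / exp (\<rho> * t)
              + integral {0..min t (\<tau> N \<omega>)} (\<lambda>s. Ubar (Y N s \<omega>) / exp (\<rho> * s)))) \<partial>M) < \<infinity>"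
  proof -
  interpret tamed_euler_sde M F T W \<mu> \<sigma> \<rho> U Ubar U1 U2 U3 Y \<tau> p c X
  proof (intro tamed_euler_sde.intro tamed_euler_scheme.intro filtered_brownian_motion.intro)
    show "prob_space M" using basis by (simp add: stochastic_basis_def)
    show "filtered_brownian_motion_axioms M F T W" by (rule filtered_brownian_motion_axioms.intro; fact)
    have "X 0 \<in> borel_measurable (F 0)" using SDE T_pos by (auto simp: sde_solution_def)
    show "tamed_euler_scheme_axioms M F T W \<mu> \<sigma> \<rho> U Ubar U1 U2 U3 Y \<tau> p c (X 0)"
      by (rule tamed_euler_scheme_axioms.intro; fact)
    show "tamed_euler_sde_axioms M F T W \<mu> \<sigma> X" by (rule tamed_euler_sde_axioms.intro; fact)
  qed
  show ?thesis
    using strong_convergence limsup_exp_lyap_exponent exp_U_X0 SUP_exp_lyap_exponent_finite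
    unfolding lyap_exponent_def by blast
qed

end
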